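(* Any pure S-ring over a CG-ring of odd characteristic is the tensor product of a pure cyclotomic ring and S-rings of rank $2$ over non-fields.
   Context: All rings are finite, commutative, with identity; the one-element ring is allowed. For a ring $R$, $R^+$ is the additive group, $R^\times$ the group of units, $\mathcal P(R)$ the set of primes dividing $|R|$; $R_p$ is the $p$-component of $R$ (the subring whose additive group is the Sylow $p$-subgroup of $R^+$), and $R_Q=\prod_{p\in Q}R_p$ for $Q\subset\mathcal P(R)$. $R$ is a CG-ring if for every $p\in\mathcal P(R)$ the ring $R_p$ is a Galois ring, i.e. a local ring with radical $pR_p$. S-ring over a finite group $G$: a subring $\mathcal A$ of $\mathbb Z G$ having a $\mathbb Z$-basis consisting of the elements $\sum_{x\in X}x$, where $X$ runs over a partition $\mathcal S(\mathcal A)$ of $G$ into non-empty sets (basic sets) such that $\{1\}\in\mathcal S(\mathcal A)$ and $X\in\mathcal S(\mathcal A)\Rightarrow X^{-1}\in\mathcal S(\mathcal A)$. Its rank is $|\mathcal S(\mathcal A)|$. S-ring over the ring $R$: an S-ring $\mathcal A$ over $R^+$ such that $uX\in\mathcal S(\mathcal A)$ for all $X\in\mathcal S(\mathcal A)$, $u\in R^\times$. For $X\subset R$, $I_{\rm L}(X)$ is the largest ideal $I$ of $R$ with $X+I=X$. The S-ring $\mathcal A$ is pure if $I_{\rm L}(X)=0$ for some (equivalently, every) $X\in\mathcal S(\mathcal A)$ with $X\cap R^\times\ne\emptyset$. $\mathcal A$ is cyclotomic if there is a subgroup $K\le R^\times$ such that $\mathcal S(\mathcal A)$ is the set of orbits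 of $K$ acting on $R$ by multiplication. The tensor product of S-rings $\mathcal A_i$ over groups $G_i$ is the S-ring over $\prod_iG_i$ with basic sets $\prod_iX_i$, $X_i\in\mathcal S(\mathcal A_i)$. The assertion means: there is a partition $\mathcal P(R)=Q_0\sqcup Q_1\sqcup\dots\sqcup Q_k$ ($k\ge 0$, $Q_0$ possibly empty) such that $\mathcal A=\mathcal A_0\otimes\mathcal A_1\otimes\dots\otimes\mathcal A_k$, where $\mathcal A_0$ is a pure cyclotomic S-ring over $R_{Q_0}$ and, for $i\ge1$, $R_{Q_i}$ is not a field and $\mathcal A_i$ is the S-ring of rank $2$ over $R_{Q_i}$. *)

theory Defs
  imports "HOL-Algebra.Subrings" "HOL-Algebra.Group_Action" "HOL-Algebra.Product_Groups"
    "HOL-Algebra.Sylow" "HOL-Library.Disjoint_Sets" "HOL-Library.Indicator_Function"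
    "HOL-Computational_Algebra.Primes"
begin

section \<open>Integral group rings\<close>

text \<open>
  For a finite group \<open>G\<close>, an element of the group ring is represented by its coefficient
  function, which vanishes outside the carrier of \<open>G\<close>; multiplication is convolution.
\<close>

definition group_ring :: "('g, 'm) monoid_scheme \<Rightarrow> ('g \<Rightarrow> int) ring"
  where "group_ring G =
    \<lparr>carrier = {a. \<forall>x. x \<notin> carrier G \<longrightarrow> a x = 0},
     monoid.mult = (\<lambda>a b x. if x \<in> carrier G
        then \<Sum>y\<in>carrier G. a y * b (inv\<^bsub>G\<^esub> y \<otimes>\<^bsub>G\<^esub> x) else 0),
     one = indicator {\<one>\<^bsub>G\<^esub>},
     ring.zero = (\<lambda>x. 0),
     ring.add = (\<lambda>a b x. a x + b x)\<rparr>"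

text \<open>
  The element \<open>\<Sum>\<^sub>x\<^sub>\<in>\<^sub>X x\<close> of the group ring is the indicator function of \<open>X\<close>.
\<close>

abbreviation simple_quantity :: "'g set \<Rightarrow> 'g \<Rightarrow> int"
  where "simple_quantity X \<equiv> indicator X"

definition int_comb :: "('g \<Rightarrow> int) set \<Rightarrow> (('g \<Rightarrow> int) \<Rightarrow> int) \<Rightarrow> 'g \<Rightarrow> int"
  where "int_comb B c = (\<lambda>x. \<Sum>b\<in>B. c b * b x)"

definition int_span :: "('g \<Rightarrow> int) set \<Rightarrow> ('g \<Rightarrow> int) set"
  where "int_span B = range (int_comb B)"

text \<open>
  A finite set \<open>B\<close> is a \<open>\<int>\<close>-basis of \<open>A\<close> if the elements of \<open>A\<close> are exactly the integral
  linear combinations of \<open>B\<close>, each with unique coefficients.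
\<close>

definition int_basis :: "('g \<Rightarrow> int) set \<Rightarrow> ('g \<Rightarrow> int) set \<Rightarrow> bool"
  where "int_basis B A \<longleftrightarrow> finite B \<and> bij_betw (int_comb B) (B \<rightarrow>\<^sub>E UNIV) A"

text \<open>The homomorphism of group rings induced by a map from the group \<open>G\<close> to another group.\<close>

definition group_ring_map ::
    "('g, 'm) monoid_scheme \<Rightarrow> ('g \<Rightarrow> 'h) \<Rightarrow> ('g \<Rightarrow> int) \<Rightarrow> 'h \<Rightarrow> int"
  where "group_ring_map G \<phi> a = (\<lambda>y. \<Sum>x\<in>{x \<in> carrier G. \<phi> x = y}. a x)"


section \<open>S-rings over finite groups\<close>

definition S_ring_partition ::
    "('g, 'm) monoid_scheme \<Rightarrow> ('g \<Rightarrow> int) set \<Rightarrow> 'g set set \<Rightarrow> bool"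
  where "S_ring_partition G \<A> S \<longleftrightarrow>
    partition_on (carrier G) S \<and>
    int_basis (simple_quantity ` S) \<A> \<and>
    {\<one>\<^bsub>G\<^esub>} \<in> S \<and>
    (\<forall>X\<in>S. set_inv\<^bsub>G\<^esub> X \<in> S)"

definition S_ring :: "('g, 'm) monoid_scheme \<Rightarrow> ('g \<Rightarrow> int) set \<Rightarrow> bool"
  where "S_ring G \<A> \<longleftrightarrow>
    group G \<and> finite (carrier G) \<and> subring \<A> (group_ring G) \<and> (\<exists>S. S_ring_partition G \<A> S)"

text \<open>The partition is determined by the S-ring, see \<open>basic_sets_eq\<close> below.\<close>

definition basic_sets :: "('g, 'm) monoid_scheme \<Rightarrow> ('g \<Rightarrow> int) set \<Rightarrow> 'g set set"
  where "basic_sets G \<A> = (THE S. S_ring_partition G \<A> S)"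

definition S_ring_rank :: "('g, 'm) monoid_scheme \<Rightarrow> ('g \<Rightarrow> int) set \<Rightarrow> nat"
  where "S_ring_rank G \<A> = card (basic_sets G \<A>)"

text \<open>The tensor product is an S-ring over the external direct product \<^const>\<open>product_group\<close>.\<close>

definition tensor_S_ring ::
    "'i set \<Rightarrow> ('i \<Rightarrow> ('g, 'm) monoid_scheme) \<Rightarrow> ('i \<Rightarrow> ('g \<Rightarrow> int) set) \<Rightarrow> (('i \<Rightarrow> 'g) \<Rightarrow> int) set"
  where "tensor_S_ring I G \<A> =
    int_span (simple_quantity ` {Pi\<^sub>E I X | X. \<forall>i\<in>I. X i \<in> basic_sets (G i) (\<A> i)})"


section \<open>Finite commutative rings and their components\<close>

definition ring_characteristic :: "('a, 'm) ring_scheme \<Rightarrow> nat"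
  where "ring_characteristic R = group.ord (add_monoid R) \<one>\<^bsub>R\<^esub>"

definition ring_primes :: "('a, 'm) ring_scheme \<Rightarrow> nat set"
  where "ring_primes R = {p. prime p \<and> p dvd order R}"

text \<open>
  The components of a ring \<open>R\<close> are ideals of \<open>R\<close>, regarded as rings with an identity of their
  own, which in general differs from that of \<open>R\<close>.
\<close>

definition ring_on :: "('a, 'm) ring_scheme \<Rightarrow> 'a set \<Rightarrow> ('a, 'm) ring_scheme"
  where "ring_on R C =
    R\<lparr>carrier := C, one := (THE e. e \<in> C \<and> (\<forall>x\<in>C. e \<otimes>\<^bsub>R\<^esub> x = x \<and> x \<otimes>\<^bsub>R\<^esub> e = x))\<rparr>"

definition sylow_carrier :: "('a, 'm) ring_scheme \<Rightarrow> nat \<Rightarrow> 'a set"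
  where "sylow_carrier R p =
    (THE H. subgroup H (add_monoid R) \<and> card H = p ^ multiplicity p (order R))"

definition p_component :: "('a, 'm) ring_scheme \<Rightarrow> nat \<Rightarrow> ('a, 'm) ring_scheme"
  where "p_component R p = ring_on R (sylow_carrier R p)"

text \<open>
  The product of the \<open>p\<close>-components, \<open>p \<in> Q\<close>, is taken as an internal direct product inside
  \<open>R\<close>; it is the zero ring if \<open>Q\<close> is empty.
\<close>

definition Q_component :: "('a, 'm) ring_scheme \<Rightarrow> nat set \<Rightarrow> ('a, 'm) ring_scheme"
  where "Q_component R Q =
    ring_on R {finsum R f Q | f. f \<in> (\<Pi> p\<in>Q. carrier (p_component R p))}"

definition local_ring :: "('a, 'm) ring_scheme \<Rightarrow> bool"
  where "local_ring R \<longleftrightarrow> cring R \<and> (\<exists>!M. maximalideal M R)"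

definition ring_radical :: "('a, 'm) ring_scheme \<Rightarrow> 'a set"
  where "ring_radical R = carrier R \<inter> \<Inter>{M. maximalideal M R}"

definition CG_ring :: "('a, 'm) ring_scheme \<Rightarrow> bool"
  where "CG_ring R \<longleftrightarrow>
    cring R \<and> finite (carrier R) \<and>
    (\<forall>p\<in>ring_primes R. local_ring (p_component R p) \<and>
       ring_radical (p_component R p) =
         {[p] \<cdot>\<^bsub>p_component R p\<^esub> x | x. x \<in> carrier (p_component R p)})"


section \<open>S-rings over rings\<close>

definition S_ring_over_ring :: "('a, 'm) ring_scheme \<Rightarrow> ('a \<Rightarrow> int) set \<Rightarrow> bool"
  where "S_ring_over_ring R \<A> \<longleftrightarrow>
    S_ring (add_monoid R) \<A> \<and>
    (\<forall>X\<in>basic_sets (add_monoid R) \<A>. \<forall>u\<in>Units R.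
       (\<lambda>x. u \<otimes>\<^bsub>R\<^esub> x) ` X \<in> basic_sets (add_monoid R) \<A>)"

text \<open>\<^const>\<open>Greatest\<close> refers here to the inclusion order on sets.\<close>

definition I_L :: "('a, 'm) ring_scheme \<Rightarrow> 'a set \<Rightarrow> 'a set"
  where "I_L R X = (GREATEST I. ideal I R \<and> X <+>\<^bsub>R\<^esub> I = X)"

definition pure_S_ring :: "('a, 'm) ring_scheme \<Rightarrow> ('a \<Rightarrow> int) set \<Rightarrow> bool"
  where "pure_S_ring R \<A> \<longleftrightarrow>
    S_ring_over_ring R \<A> \<and>
    (\<exists>X\<in>basic_sets (add_monoid R) \<A>. X \<inter> Units R \<noteq> {} \<and> I_L R X = {\<zero>\<^bsub>R\<^esub>})"

definition cyclotomic_S_ring :: "('a, 'm) ring_scheme \<Rightarrow> ('a \<Rightarrow> int) set \<Rightarrow> bool"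
  where "cyclotomic_S_ring R \<A> \<longleftrightarrow>
    S_ring_over_ring R \<A> \<and>
    (\<exists>K. subgroup K (units_of R) \<and>
       basic_sets (add_monoid R) \<A> =
         orbits ((units_of R)\<lparr>carrier := K\<rparr>) (carrier R) (\<lambda>u x. u \<otimes>\<^bsub>R\<^esub> x))"


section \<open>Well-definedness\<close>

lemma simple_quantity_in_basis_span:
  assumes "int_basis (simple_quantity ` S) \<A>" "X \<in> S"
  shows "simple_quantity X \<in> \<A>"
proof -
  let ?B = "simple_quantity ` S"
  let ?c = "restrict (\<lambda>b. if b = simple_quantity X then 1 else 0) ?B"
  have fin: "finite ?B" and bij: "bij_betw (int_comb ?B) (?B \<rightarrow>\<^sub>E UNIV) \<A>"
    using assms(1) by (auto simp: int_basis_def)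
  have "int_comb ?B ?c = simple_quantity X"
  proof
    fix x
    have "int_comb ?B ?c x = (\<Sum>b\<in>?B. if b = simple_quantity X then b x else 0)"
      unfolding int_comb_def by (intro sum.cong) auto
    also have "\<dots> = simple_quantity X x"
      using fin assms(2) by (subst sum.delta) auto
    finally show "int_comb ?B ?c x = simple_quantity X x" .
  qed
  moreover have "?c \<in> ?B \<rightarrow>\<^sub>E UNIV" by auto
  ultimately show ?thesis using bij by (metis bij_betwE)
qed

lemma int_basis_constant:
  assumes "int_basis (simple_quantity ` S) \<A>" "partition_on C S"
    and "a \<in> \<A>" "Y \<in> S" "x \<in> Y" "y \<in> Y"
  shows "a x = a y"
proof -
  let ?B = "simple_quantity ` S"
  obtain c where c: "a = int_comb ?B c"
    using assms(1,3) unfolding int_basis_def bij_betw_def by blast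
  have "simple_quantity X x = simple_quantity X y" if "X \<in> S" for X
  proof -
    have "X = Y \<or> X \<inter> Y = {}"
      using assms(2,4) that unfolding partition_on_def disjoint_def by blast
    then show ?thesis using assms(5,6) by (auto simp: indicator_def)
  qed
  then show ?thesis unfolding c int_comb_def by (intro sum.cong) auto
qed

lemma S_ring_partition_subset:
  assumes "S_ring_partition G \<A> S" "S_ring_partition G \<A> T"
  shows "S \<subseteq> T"
proof
  fix X assume X: "X \<in> S"
  have pS: "partition_on (carrier G) S" "int_basis (simple_quantity ` S) \<A>"
    and pT: "partition_on (carrier G) T" "int_basis (simple_quantity ` T) \<A>"
    using assms by (auto simp: S_ring_partition_def)
  obtain x where x: "x \<in> X" using X pS(1) by (metis all_not_in_conv partition_on_def)
  then have "x \<in> \<Union>T" using X pS(1) pT(1) unfolding partition_on_def by blast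
  then obtain Y where Y: "Y \<in> T" "x \<in> Y" by blast
  have "y \<in> X" if "y \<in> Y" for y
    using int_basis_constant[OF pT(2,1) simple_quantity_in_basis_span[OF pS(2) X] Y that] x
    by (auto simp: indicator_def split: if_splits)
  moreover have "y \<in> Y" if "y \<in> X" for y
    using int_basis_constant[OF pS(2,1) simple_quantity_in_basis_span[OF pT(2) Y(1)] X x that] Y(2)
    by (auto simp: indicator_def split: if_splits)
  ultimately have "X = Y" by blast
  with Y show "X \<in> T" by simp
qed

lemma basic_sets_eq:
  assumes "S_ring_partition G \<A> S"
  shows "basic_sets G \<A> = S"
  unfolding basic_sets_def
  using assms S_ring_partition_subset by (metis (mono_tags, lifting) subset_antisym the_equality)

lemma (in comm_group) sylow_subgroup_eq:
  assumes "subgroup H G" "finite (carrier G)" "card H = n" "order G = n * m" "coprime n m"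
  shows "H = {x \<in> carrier G. x [^] n = \<one>}"
proof
  have n0: "n \<noteq> 0" using assms order_gt_0_iff_finite by (metis mult_is_0 not_gr0)
  interpret H: subgroup H G by fact
  show "H \<subseteq> {x \<in> carrier G. x [^] n = \<one>}"
  proof safe
    fix x assume x: "x \<in> H"
    then show "x \<in> carrier G" by simp
    interpret GH: group "G\<lparr>carrier := H\<rparr>" by (rule subgroup_imp_group) fact
    have "x [^]\<^bsub>G\<lparr>carrier := H\<rparr>\<^esub> order (G\<lparr>carrier := H\<rparr>) = \<one>"
      using GH.pow_order_eq_1[of x] x by simp
    then show "x [^] n = \<one>"
      using assms(3) by (simp add: order_def flip: nat_pow_consistent)
  qed
  have N: "H \<lhd> G" using assms(1) by (simp add: normal_iff_subgroup)
  interpret N: normal H G by (fact N)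
  interpret Q: group "G Mod H" by (rule N.factorgroup_is_group)
  have "card (rcosets H) * n = n * m"
    using lagrange[OF assms(1)] assms(3,4) by simp
  then have om: "order (G Mod H) = m"
    using n0 by (simp add: order_def FactGroup_def mult.commute)
  have mH: "y [^] m \<in> H" if y: "y \<in> carrier G" for y
  proof -
    have hom: "group_hom G (G Mod H) (\<lambda>a. H #> a)"
      using N.r_coset_hom_Mod by (intro group_hom.intro group_hom_axioms.intro is_group Q.is_group) auto
    have "H #> (y [^] m) = (H #> y) [^]\<^bsub>G Mod H\<^esub> m"
      using group_hom.hom_nat_pow[OF hom y] by simp
    also have "\<dots> = \<one>\<^bsub>G Mod H\<^esub>"
      using Q.pow_order_eq_1[of "H #> y"] y om by (simp add: FactGroup_def RCOSETS_def) blast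
    also have "\<dots> = H" by (simp add: FactGroup_def)
    finally show ?thesis using y coset_join1[OF _ _ assms(1)] by simp
  qed
  show "{x \<in> carrier G. x [^] n = \<one>} \<subseteq> H"
  proof safe
    fix x assume x: "x \<in> carrier G" "x [^] n = \<one>"
    obtain u v where uv: "u * int n + v * int m = 1"
      using assms(5) bezout_int[of "int n" "int m"] by auto
    have "x = x [^] (int n * u + int m * v)"
      using uv x(1) by (simp add: mult.commute)
    also have "\<dots> = x [^] (int n * u) \<otimes> x [^] (int m * v)"
      using x(1) by (simp add: int_pow_mult)
    also have "\<dots> = (x [^] n) [^] u \<otimes> (x [^] m) [^] v"
      using x(1) by (simp flip: int_pow_int int_pow_pow)
    also have "\<dots> = (x [^] m) [^] v" using x by (simp add: int_pow_one)
    also have "\<dots> \<in> H" using mH[OF x(1)] subgroup_int_pow_closed[OF assms(1)] by blast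
    finally show "x \<in> H" .
  qed
qed

lemma sylow_carrier_props:
  assumes "cring R" "finite (carrier R)" "prime p"
  shows "subgroup (sylow_carrier R p) (add_monoid R)"
    and "card (sylow_carrier R p) = p ^ multiplicity p (order R)"
    and "sylow_carrier R p =
      {x \<in> carrier R. [(p ^ multiplicity p (order R))] \<cdot>\<^bsub>R\<^esub> x = \<zero>\<^bsub>R\<^esub>}"
proof -
  interpret cring R by fact
  let ?A = "add_monoid R" and ?n = "p ^ multiplicity p (order R)"
  have ordA: "order ?A = order R" by (simp add: order_def)
  have "order R \<noteq> 0" using assms(2) by (auto simp: order_def)
  then obtain m where m: "order R = ?n * m" "\<not> p dvd m"
    using assms(3) multiplicity_decompose'[of "order R" p] by (metis not_prime_unit)
  have cop: "coprime ?n m"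
    using m(2) assms(3) by (simp add: prime_imp_coprime)
  have char: "H = {x \<in> carrier R. [?n] \<cdot>\<^bsub>R\<^esub> x = \<zero>\<^bsub>R\<^esub>}"
    if "subgroup H ?A \<and> card H = ?n" for H
    using add.sylow_subgroup_eq[of H ?n m] that assms(2) m(1) ordA cop
    by (simp add: add_pow_def)
  obtain H where H: "subgroup H ?A \<and> card H = ?n"
    using sylow_thm[OF assms(3) add.is_group, of "multiplicity p (order R)" m] m(1) ordA assms(2)
    by auto
  have "subgroup (sylow_carrier R p) ?A \<and> card (sylow_carrier R p) = ?n"
    unfolding sylow_carrier_def
  proof (rule theI)
    show "subgroup H ?A \<and> card H = ?n" by (fact H)
    show "K = H" if "subgroup K ?A \<and> card K = ?n" for K
      using char[OF that] char[OF H] by simp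
  qed
  then show "subgroup (sylow_carrier R p) ?A" "card (sylow_carrier R p) = ?n"
    "sylow_carrier R p = {x \<in> carrier R. [?n] \<cdot>\<^bsub>R\<^esub> x = \<zero>\<^bsub>R\<^esub>}"
    using char by blast+
qed

end

theory Submission
  imports Defs "HOL-Algebra.QuotRing" "HOL-Number_Theory.Cong"
begin

text \<open>
 Call an ideal an \<open>\<A>\<close>-ideal if it is a union of basic sets. Up to multiplication by units, a basic
 set is determined by the \<open>\<A>\<close>-ideal it generates; this follows by induction over quotients by
 \<open>\<A>\<close>-ideals. Let \<open>X\<close> be the basic set of 1. Schur's theorem on \<open>p\<close>-th multiples, purity and a
 count of the sets \<open>X \<inter> (X + t)\<close> show that, for each prime \<open>p\<close>, either \<open>p R\<close> is an \<open>\<A>\<close>-ideal or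
 some maximal \<open>\<A>\<close>-ideal has trivial \<open>p\<close>-component. In the second case that \<open>\<A>\<close>-ideal is a
 direct summand of \<open>R\<close>, and the same counting shows that the complementary summand splits off as a
 tensor factor of rank 2.

 Once all \<open>p R\<close> are \<open>\<A>\<close>-ideals, \<open>X\<close> is a group \<open>K\<close> of units. The functions counting
 \<open>k \<in> K\<close> with \<open>z = v + w k\<close>, for units \<open>v\<close> and \<open>w\<close>, are constant on basic sets as well as on
 \<open>K\<close>-orbits, and signed combinations of them isolate any given \<open>z\<close> up to \<open>K\<close>. These combinations are
 products over the primes; for one prime they are constructed along the powers of \<open>p\<close>, where purity
 enters through the fact that \<open>K\<close> does not contain \<open>1 + Ann(p)\<close>.
\<close>

section \<open>Component idempotents\<close>

text \<open>The obstacle is that the basic set X of 1 need not consist of units: in rank 2 it is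
  everything except 0. Units are therefore controlled only through \<A>-ideals and through
  proportions: a unit-stable set occupies the same share of X as of the union of all unit multiples
  of X. Odd order supplies the thresholds: a proper ideal has index at least three in a larger one,
  h and -h differ for non-zero h, and every element is a sum of two units. Rank 2 arises because a
  class with non-zero component in the summand fills more than two thirds of each coset of the
  summand that it meets, which leaves no room for a second such class. In the cyclotomic part only
  the basic sets of units are known, namely as cosets of K. Points are seen through the lines with
  unit coefficients, and the weights may not use points on the coordinate axes; hence signed
  weights. Separation is used in dual form: a function whose sums over all these lines vanish is
  zero at z. Applied once it makes the basic sets invariant under K, applied again it makes K
  transitive on them.\<close>

context cring
begin

abbreviation overlap :: "'a set \<Rightarrow> 'a \<Rightarrow> nat"
 where "overlap X t \<equiv> card {a \<in> X. a \<oplus> t \<in> X}"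

abbreviation hits :: "'a set \<Rightarrow> 'a \<Rightarrow> 'a set \<Rightarrow> nat"
 where "hits J x X \<equiv> card {t \<in> J. x \<oplus> t \<in> X}"

definition num :: "nat \<Rightarrow> 'a"
 where "num m = [m] \<cdot> \<one>"

lemma num_closed [simp, intro]: "num m \<in> carrier R" by (simp add: num_def)

lemma num_0 [simp]: "num 0 = \<zero>" and num_1 [simp]: "num (Suc 0) = \<one>" by (simp_all add: num_def)

lemma num_add: "num (m + n) = num m \<oplus> num n" by (simp add: num_def add.nat_pow_mult)

lemma num_mult: "num (m * n) = num m \<otimes> num n"
 by (simp add: num_def add_pow_ldistr add.nat_pow_pow mult.commute)

lemma add_pow_num: "x \<in> carrier R ==> [(m::nat)] \<cdot> x = num m \<otimes> x"
 by (simp add: num_def add_pow_ldistr)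

lemma num_power: "num (m ^ n) = num m [^] n"
proof (induction n)
 case (Suc n)
 then show ?case using num_mult[of "m ^ n" m] by (simp add: mult.commute)
qed (simp add: num_def)

end

section \<open>The Chinese remainder theorem and the component idempotents\<close>

locale fin_cring = cring +
 assumes fin [simp, intro]: "finite (carrier R)"
begin

lemma order_pos: "order R > 0" by (auto simp: order_def card_gt_0_iff)

lemma num_order: "num (order R) = \<zero>" using add.pow_order_eq_1[of \<one>] by (simp add: num_def order_def)

lemma num_mod: "num (m mod order R) = num m"
proof -
 have "num m = num (order R * (m div order R) + m mod order R)" by simp
 also have "\<dots> = num (m mod order R)" by (subst num_add, subst num_mult) (simp add: num_order)
 finally show ?thesis by simp
qed

lemma num_cong: "[a = b] (mod order R) ==> num a = num b"
 by (metis num_mod unique_euclidean_semiring_class.cong_def)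

abbreviation "P \<equiv> ring_primes R"

abbreviation "ppart p \<equiv> p ^ multiplicity p (order R)"

lemma P_prime: "p \<in> P ==> prime p" by (simp add: ring_primes_def)

lemma P_finite [simp, intro]: "finite P"
proof -
 have "P \<subseteq> {..order R}" using order_pos by (auto simp: ring_primes_def dvd_imp_le)
 then show ?thesis by (meson finite_atMost finite_subset)
qed

lemma order_prod: "order R = (\<Prod>p\<in>P. ppart p)"
proof -
 have "P = prime_factors (order R)"
  using order_pos by (auto simp: ring_primes_def prime_factors_dvd)
 then show ?thesis using order_pos by (simp add: prime_factorization_nat)
qed

lemma coprime_parts: "Q \<subseteq> P ==> Q' \<subseteq> P ==> Q \<inter> Q' = {} ==>
  coprime (\<Prod>p\<in>Q. ppart p) (\<Prod>p\<in>Q'. ppart p)" by (intro prod_coprime_left prod_coprime_right)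
   (metis P_prime coprime_power_left_iff coprime_power_right_iff disjoint_iff primes_coprime subsetD)

lemma cong_parts:
 assumes "\<And>p. p \<in> Q ==> [a = b] (mod ppart p)" "Q \<subseteq> P"
 shows "[a = b :: nat] (mod (\<Prod>p\<in>Q. ppart p))"
proof -
 have "finite Q" using assms(2) finite_subset by blast
 then show ?thesis using assms
 proof (induction Q rule: finite_induct)
  case (insert p F)
  then have "coprime (ppart p) (\<Prod>p\<in>F. ppart p)" using coprime_parts[of "{p}" F] by simp
  then show ?case using insert by (auto intro: coprime_cong_mult_nat)
 qed auto
qed

lemma num_eqI: "(\<And>p. p \<in> P ==> [a = b] (mod ppart p)) ==> num a = num b"
 using cong_parts[of P a b] num_cong order_prod by simp

definition idx :: "nat set \<Rightarrow> nat"
 where "idx Q = (SOME m. \<forall>p\<in>P. [m = (if p \<in> Q then 1 else 0)] (mod ppart p))"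

lemma idx: "p \<in> P ==> [idx Q = (if p \<in> Q then 1 else 0)] (mod ppart p)"
proof -
 let ?a = "\<Prod>p\<in>P \<inter> Q. ppart p" and ?b = "\<Prod>p\<in>P - Q. ppart p"
 have "coprime ?a ?b" by (intro coprime_parts) auto
 then obtain m where m: "[m = 1] (mod ?a)" "[m = 0] (mod ?b)"
  using binary_chinese_remainder_nat by blast
 have "[m = (if p \<in> Q then 1 else 0)] (mod ppart p)" if "p \<in> P" for p
 proof (cases "p \<in> Q")
  case True
  then have "ppart p dvd ?a" using that by (intro dvd_prodI) auto
  then show ?thesis using True cong_dvd_modulus_nat[OF m(1)] by simp
 next
  case False
  then have "ppart p dvd ?b" using that by (intro dvd_prodI) auto
  then show ?thesis using False cong_dvd_modulus_nat[OF m(2)] by simp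
 qed
 then have "\<exists>m. \<forall>p\<in>P. [m = (if p \<in> Q then 1 else 0)] (mod ppart p)" by blast
 from someI_ex[OF this] show "p \<in> P ==> ?thesis" unfolding idx_def by blast
qed

text \<open>The identity of R_Q, written as an integer multiple of 1, so that equations between such
  elements reduce to congruences modulo the prime power parts of the order. \<open>Q\<close> may be
  any set of naturals, which lets the complementary component be written \<open>- Q\<close>.\<close>

definition \<epsilon> :: "nat set \<Rightarrow> 'a"
 where "\<epsilon> Q = num (idx Q)"

lemma \<epsilon>_closed [simp, intro]: "\<epsilon> Q \<in> carrier R" by (simp add: \<epsilon>_def)

abbreviation \<pi> :: "nat set \<Rightarrow> 'a \<Rightarrow> 'a"
 where "\<pi> Q x \<equiv> \<epsilon> Q \<otimes> x"

lemma \<epsilon>_eq_numI: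
 "(\<And>p. p \<in> P ==> [m = (if p \<in> Q then 1 else 0)] (mod ppart p)) ==> \<epsilon> Q = num m"
 unfolding \<epsilon>_def by (rule num_eqI) (meson cong_sym cong_trans idx)

lemma \<epsilon>_UNIV [simp]: "\<epsilon> UNIV = \<one>" using \<epsilon>_eq_numI[of "Suc 0" UNIV] by simp

lemma \<epsilon>_P: "P \<subseteq> Q ==> \<epsilon> Q = \<one>" using \<epsilon>_eq_numI[of "Suc 0" Q] by (auto simp: subset_iff)

lemma \<epsilon>_empty [simp]: "\<epsilon> {} = \<zero>" using \<epsilon>_eq_numI[of 0 "{}"] by simp

lemma \<epsilon>_mult [simp]: "\<epsilon> Q \<otimes> \<epsilon> Q' = \<epsilon> (Q \<inter> Q')"
proof -
 have "\<epsilon> (Q \<inter> Q') = num (idx Q * idx Q')"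
 proof (rule \<epsilon>_eq_numI)
  fix p assume "p \<in> P"
  from cong_mult[OF idx[OF this, of Q] idx[OF this, of Q']]
  show "[idx Q * idx Q' = (if p \<in> Q \<inter> Q' then 1 else 0)] (mod ppart p)" by (auto split: if_splits)
 qed
 then show ?thesis by (simp add: num_mult \<epsilon>_def)
qed

lemma \<epsilon>_add: "Q \<inter> Q' = {} ==> \<epsilon> Q \<oplus> \<epsilon> Q' = \<epsilon> (Q \<union> Q')"
proof -
 assume d: "Q \<inter> Q' = {}"
 have "\<epsilon> (Q \<union> Q') = num (idx Q + idx Q')"
 proof (rule \<epsilon>_eq_numI)
  fix p assume "p \<in> P"
  from cong_add[OF idx[OF this, of Q] idx[OF this, of Q']] d
  show "[idx Q + idx Q' = (if p \<in> Q \<union> Q' then 1 else 0)] (mod ppart p)" by (auto split: if_splits)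
 qed
 then show ?thesis by (simp add: num_add \<epsilon>_def)
qed

lemma \<epsilon>_compl: "\<epsilon> (- Q) = \<one> \<ominus> \<epsilon> Q"
using \<epsilon>_add[of "- Q" Q] add.inv_solve_right[of "\<epsilon> (- Q)" \<one> "\<epsilon> Q"] by (simp add: a_minus_def)

lemma \<epsilon>_split: "x \<in> carrier R ==> x = \<pi> Q x \<oplus> \<pi> (- Q) x"
proof -
 assume x: "x \<in> carrier R"
 have "\<pi> Q x \<oplus> \<pi> (- Q) x = (\<epsilon> Q \<oplus> \<epsilon> (- Q)) \<otimes> x" using x by (simp add: l_distr)
 then show ?thesis using x by (simp add: \<epsilon>_add)
qed

lemma \<epsilon>_idem: "x \<in> carrier R ==> \<pi> Q (\<pi> Q' x) = \<epsilon> (Q \<inter> Q') \<otimes> x" by (simp flip: m_assoc)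

lemma \<epsilon>_disj: "x \<in> carrier R ==> Q \<inter> Q' = {} ==> \<pi> Q (\<pi> Q' x) = \<zero>" by (simp add: \<epsilon>_idem)

lemma \<epsilon>_eqI:
 assumes "x \<in> carrier R" "y \<in> carrier R"
  and "\<And>p. p \<in> P ==> p \<in> Q ==> \<pi> {p} x = \<pi> {p} y"
 shows "\<pi> Q x = \<pi> Q y"
proof -
 have *: "\<pi> F x = \<pi> F y" if "finite F" "F \<subseteq> P \<inter> Q" for F using that
 proof (induction F rule: finite_induct)
  case (insert p F)
  then have "\<epsilon> (insert p F) = \<epsilon> {p} \<oplus> \<epsilon> F" using \<epsilon>_add[of "{p}" F] by simp
  then show ?case using insert assms by (simp add: l_distr)
 qed (use assms in simp)
 have "\<epsilon> Q = \<epsilon> (P \<inter> Q)"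
  unfolding \<epsilon>_def[of "P \<inter> Q"] using idx[of _ "P \<inter> Q"] by (intro \<epsilon>_eq_numI) auto
 then show ?thesis using *[of "P \<inter> Q"] by auto
qed

lemma eqI_primes:
 assumes "x \<in> carrier R" "y \<in> carrier R"
  and "\<And>p. p \<in> P ==> \<pi> {p} x = \<pi> {p} y"
 shows "x = y" using \<epsilon>_eqI[of x y UNIV] assms by simp

lemma num_inverse:
 assumes "\<And>p. p \<in> P ==> p \<in> Q ==> coprime a p"
 shows "\<exists>b. num a \<otimes> num b \<otimes> \<epsilon> Q = \<epsilon> Q"
proof -
 have "coprime a (\<Prod>p\<in>P \<inter> Q. ppart p)" using assms by (intro prod_coprime_right) auto
 then obtain b where b: "[a * b = 1] (mod (\<Prod>p\<in>P \<inter> Q. ppart p))"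
  using cong_solve_coprime_nat unfolding One_nat_def by blast
 have "\<epsilon> Q = num (a * b * idx Q)"
 proof (rule \<epsilon>_eq_numI)
  fix p assume p: "p \<in> P"
  show "[a * b * idx Q = (if p \<in> Q then 1 else 0)] (mod ppart p)"
  proof (cases "p \<in> Q")
   case True
   then have "ppart p dvd (\<Prod>p\<in>P \<inter> Q. ppart p)" using p by (intro dvd_prodI) auto
   then have "[a * b = 1] (mod ppart p)" using b cong_dvd_modulus_nat by blast
   from cong_mult[OF this idx[OF p, of Q]] True show ?thesis by simp
  next
   case False
   from cong_mult[OF cong_refl[of "a * b"] idx[OF p, of Q]] False show ?thesis by simp
  qed
 qed
 then show ?thesis by (metis num_mult \<epsilon>_def)
qed

lemma num_inverse_off: "prime p ==> \<exists>b. num p \<otimes> num b \<otimes> \<epsilon> (- {p}) = \<epsilon> (- {p})"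
 by (rule num_inverse) (metis ComplD P_prime insertI1 primes_coprime)

lemma ppart_kill: "p \<in> P ==> num (ppart p) \<otimes> \<epsilon> {p} = \<zero>"
proof -
 assume p: "p \<in> P"
 have "num (ppart p * idx {p}) = num 0"
 proof (rule num_eqI)
  fix q assume q: "q \<in> P"
  show "[ppart p * idx {p} = 0] (mod ppart q)"
  proof (cases "q = p")
   case True then show ?thesis by (simp add: cong_0_iff)
  next
   case False
   with cong_mult[OF cong_refl[of "ppart p"] idx[OF q, of "{p}"]] show ?thesis by simp
  qed
 qed
 then show ?thesis by (simp add: num_mult \<epsilon>_def)
qed

end

lemma (in cring) idealI':
 assumes "I \<subseteq> carrier R" "\<zero> \<in> I"
  and "\<And>x y. x \<in> I ==> y \<in> I ==> x \<oplus> y \<in> I"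
  and "\<And>r x. r \<in> carrier R ==> x \<in> I ==> r \<otimes> x \<in> I"
 shows "ideal I R"
proof (rule idealI)
 show "ring R" by (rule ring_axioms)
 have minus: "\<ominus> x \<in> I" if "x \<in> I" for x
  using assms(4)[of "\<ominus> \<one>" x] that assms(1) by (auto simp: l_minus)
 show "subgroup I (add_monoid R)" by (rule add.subgroupI) (use assms minus in auto)
 show "x \<otimes> a \<in> I" if "a \<in> I" "x \<in> carrier R" for a x using assms(4) that by simp
 show "a \<otimes> x \<in> I" if "a \<in> I" "x \<in> carrier R" for a x
  using assms(4)[OF that(2,1)] that assms(1) by (simp add: m_comm subsetD)
qed

lemma (in cring) unit_rightI: "a \<in> carrier R ==> b \<in> carrier R ==> a \<otimes> b = \<one> ==> a \<in> Units R"
 unfolding Units_def using m_comm[of a b] by auto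

lemma (in cring) add_minus: "a \<in> carrier R ==> b \<in> carrier R ==> a \<oplus> (b \<ominus> a) = b"
 using a_lcomm[of a b "\<ominus> a"] by (simp add: a_minus_def r_neg)

lemma (in cring) ideal_sub: "ideal I R ==> I \<subseteq> carrier R"
 and ideal_in: "ideal I R ==> x \<in> I ==> x \<in> carrier R"
 and ideal_zero: "ideal I R ==> \<zero> \<in> I"
 and ideal_add: "ideal I R ==> x \<in> I ==> y \<in> I ==> x \<oplus> y \<in> I"
 and ideal_mult: "ideal I R ==> x \<in> I ==> r \<in> carrier R ==> r \<otimes> x \<in> I"
 and ideal_mult': "ideal I R ==> x \<in> I ==> r \<in> carrier R ==> x \<otimes> r \<in> I"
 and ideal_neg: "ideal I R ==> x \<in> I ==> \<ominus> x \<in> I"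
 and ideal_minus: "ideal I R ==> x \<in> I ==> y \<in> I ==> x \<ominus> y \<in> I"
proof -
 assume I: "ideal I R"
 then interpret ideal I R .
 show "I \<subseteq> carrier R" by (rule a_subset)
 show "x \<in> I ==> x \<in> carrier R" by (rule a_Hcarr)
 show "\<zero> \<in> I" by (rule additive_subgroup.zero_closed) (rule is_additive_subgroup)
 show "x \<in> I ==> y \<in> I ==> x \<oplus> y \<in> I" by (rule additive_subgroup.a_closed) (rule is_additive_subgroup)
 show "x \<in> I ==> r \<in> carrier R ==> r \<otimes> x \<in> I" by (rule I_l_closed)
 show "x \<in> I ==> r \<in> carrier R ==> x \<otimes> r \<in> I" by (rule I_r_closed)
 show "x \<in> I ==> \<ominus> x \<in> I" by (rule a_inv_closed)
 then show "x \<in> I ==> y \<in> I ==> x \<ominus> y \<in> I"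
  by (metis I a_minus_def additive_subgroup.a_closed additive_subgroup.a_inv_closed ideal.axioms(1))
qed

lemma (in cring) ideal_add_cancel:
 assumes "ideal I R" "y \<in> I" "x \<in> carrier R" "x \<oplus> y \<in> I"
 shows "x \<in> I"
proof -
 have "x = (x \<oplus> y) \<ominus> y" using assms ideal_in[OF assms(1)] by (simp add: a_minus_def a_assoc r_neg)
 then show ?thesis using assms ideal_minus by metis
qed

section \<open>Multiples of p, the annihilator of p, and units supported at one prime\<close>

context fin_cring
begin

definition patch :: "nat set \<Rightarrow> 'a \<Rightarrow> 'a \<Rightarrow> 'a"
 where "patch Q a b = \<pi> Q a \<oplus> \<pi> (- Q) b"

lemma patch_closed [simp, intro]: "a \<in> carrier R ==> b \<in> carrier R ==> patch Q a b \<in> carrier R"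
 by (simp add: patch_def)

lemma patch_in: "a \<in> carrier R ==> b \<in> carrier R ==> Q' \<subseteq> Q ==> \<epsilon> Q' \<otimes> patch Q a b = \<pi> Q' a"
 by (simp add: patch_def r_distr \<epsilon>_idem Int_absorb2)      (metis Compl_disjoint2 Int_assoc Int_absorb2 \<epsilon>_empty add.r_one inf_bot_right inf_commute l_null         m_closed \<epsilon>_closed)

lemma patch_out: "a \<in> carrier R ==> b \<in> carrier R ==> Q' \<inter> Q = {} ==> \<epsilon> Q' \<otimes> patch Q a b = \<pi> Q' b"
 by (simp add: patch_def r_distr \<epsilon>_idem) (simp add: Int_absorb2 disjoint_eq_subset_Compl)

lemma patch_eqI:
 assumes "x \<in> carrier R" "a \<in> carrier R" "b \<in> carrier R"
  "\<pi> Q x = \<pi> Q a" "\<pi> (- Q) x = \<pi> (- Q) b"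
 shows "x = patch Q a b" using \<epsilon>_split[OF assms(1), of Q] assms by (simp add: patch_def)

lemma patch_unit:
 assumes "a \<in> carrier R" "b \<in> carrier R" "c \<in> carrier R" "d \<in> carrier R"
  and "\<pi> Q (a \<otimes> c) = \<epsilon> Q" "\<pi> (- Q) (b \<otimes> d) = \<epsilon> (- Q)"
 shows "patch Q a b \<in> Units R"
proof -
 have "\<pi> Q (patch Q a b \<otimes> patch Q c d) = \<pi> Q a \<otimes> patch Q c d"
  using assms patch_in[of a b Q Q] by (simp flip: m_assoc)
 also have "\<dots> = a \<otimes> (\<epsilon> Q \<otimes> patch Q c d)" using assms by (simp add: m_ac)
 also have "\<dots> = \<pi> Q \<one>" using assms patch_in[of c d Q Q] by (simp add: m_ac)
 finally have 1: "\<pi> Q (patch Q a b \<otimes> patch Q c d) = \<pi> Q \<one>" .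
 have "\<pi> (- Q) (patch Q a b \<otimes> patch Q c d) = \<pi> (- Q) b \<otimes> patch Q c d"
  using assms patch_out[of a b "- Q" Q] by (simp flip: m_assoc)
 also have "\<dots> = b \<otimes> (\<epsilon> (- Q) \<otimes> patch Q c d)" using assms by (simp add: m_ac)
 also have "\<dots> = \<pi> (- Q) \<one>" using assms patch_out[of c d "- Q" Q] by (simp add: m_ac)
 finally have "\<pi> (- Q) (patch Q a b \<otimes> patch Q c d) = \<pi> (- Q) \<one>" .
 from patch_eqI[OF _ _ _ 1 this] have "patch Q a b \<otimes> patch Q c d = \<one>"
  using assms patch_eqI[of \<one> \<one> \<one> Q] by simp
 then show ?thesis using assms by (intro unit_rightI[of _ "patch Q c d"]) auto
qed

lemma patch_Units: "a \<in> Units R ==> b \<in> Units R ==> patch Q a b \<in> Units R"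
 by (rule patch_unit[of a b "inv a" "inv b"]) auto

definition mul :: "nat \<Rightarrow> 'a set"
 where "mul p = (\<lambda>x. num p \<otimes> x) ` carrier R"

text \<open>For a prime p this annihilator lies in R_p. In a \<open>cg_ring\<close> with p in
  \<open>P\<close> it is contained in every ideal with non-zero p-component
  (\<open>tor_sub_ideal\<close>), and its non-zero elements form one orbit of
  \<open>\<Gamma> p\<close> (\<open>tor_trans\<close>).\<close>

definition tor :: "nat \<Rightarrow> 'a set"
 where "tor p = {x \<in> carrier R. num p \<otimes> x = \<zero>}"

text \<open>The unit group of R_p, embedded in the units of R by the value 1 at the other
  primes.\<close>

definition \<Gamma> :: "nat \<Rightarrow> 'a set"
 where "\<Gamma> p = {u \<in> Units R. \<pi> (- {p}) u = \<epsilon> (- {p})}"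

lemma mul_sub: "mul p \<subseteq> carrier R" by (auto simp: mul_def)

lemma mul_ideal: "ideal (mul p) R"
proof (rule idealI')
 show "\<zero> \<in> mul p" unfolding mul_def by (rule image_eqI[of _ _ \<zero>]) auto
 show "x \<oplus> y \<in> mul p" if "x \<in> mul p" "y \<in> mul p" for x y
  using that by (auto simp: mul_def image_iff simp flip: r_distr)
 show "r \<otimes> x \<in> mul p" if "r \<in> carrier R" "x \<in> mul p" for r x
  using that by (auto simp: mul_def) (metis imageI m_closed m_lcomm num_closed)
qed (rule mul_sub)

lemma tor_ideal: "ideal (tor p) R" by (rule idealI') (auto simp: tor_def r_distr m_lcomm)

lemma tor_carrier: "h \<in> tor p ==> h \<in> carrier R" by (simp add: tor_def)

text \<open>Otherwise p would be a unit, and the Sylow p-subgroup, being the annihilator of a power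
  of p, would be zero.\<close>

lemma one_notin_mul: "p \<in> P ==> \<one> \<notin> mul p"
proof
 assume p: "p \<in> P" and "\<one> \<in> mul p"
 then obtain y where y: "y \<in> carrier R" "\<one> = num p \<otimes> y" by (auto simp: mul_def)
 then have u: "num p \<in> Units R" by (intro unit_rightI[of _ y]) auto
 note pp = P_prime[OF p]
 have "sylow_carrier R p = {x \<in> carrier R. num (ppart p) \<otimes> x = \<zero>}"
  using sylow_carrier_props(3)[OF is_cring fin pp] add_pow_num[of _ "ppart p"] by (simp cong: conj_cong)
 also have "\<dots> = {\<zero>}"
 proof -
  have "num (ppart p) \<in> Units R" using u by (simp add: num_power Units_pow_closed)
  then have "x = \<zero>" if "x \<in> carrier R" "num (ppart p) \<otimes> x = \<zero>" for x
   using that by (metis Units_l_cancel num_closed r_null zero_closed)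
  then show ?thesis by auto
 qed
 finally have "ppart p = 1" using sylow_carrier_props(2)[OF is_cring fin pp] by simp
 moreover have "multiplicity p (order R) > 0"
  using p order_pos by (intro multiplicity_gt_zero_iff[THEN iffD2]) (auto simp: ring_primes_def)
 ultimately show False using pp by simp
qed

lemma mul_off: "prime p ==> x \<in> carrier R ==> \<pi> (- {p}) x \<in> mul p"
proof -
 assume p: "prime p" and x: "x \<in> carrier R"
 obtain b where "num p \<otimes> num b \<otimes> \<epsilon> (- {p}) = \<epsilon> (- {p})" using num_inverse_off[OF p] by blast
 then have "\<pi> (- {p}) x = num p \<otimes> (num b \<otimes> \<epsilon> (- {p}) \<otimes> x)" using x by (simp flip: m_assoc)
 then show ?thesis using x by (auto simp: mul_def)
qed

lemma mul_iff: "prime p ==> x \<in> carrier R ==> x \<in> mul p \<longleftrightarrow> \<pi> {p} x \<in> mul p"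
 using \<epsilon>_split[of x "{p}"] mul_off[of p x] mul_ideal[of p] by (metis \<epsilon>_closed ideal_add ideal_mult)

lemma mul_\<epsilon>: "prime p ==> x \<in> carrier R ==> p \<notin> Q ==> \<pi> Q x \<in> mul p"
 using mul_iff[of p "\<pi> Q x"] ideal_zero[OF mul_ideal[of p]] by (simp add: \<epsilon>_disj)

lemma ideal_off:
 assumes "prime p" "ideal I R" "x \<in> carrier R" "num p \<otimes> x \<in> I"
 shows "\<pi> (- {p}) x \<in> I"
proof -
 obtain b where "num p \<otimes> num b \<otimes> \<epsilon> (- {p}) = \<epsilon> (- {p})" using num_inverse_off[OF assms(1)] by blast
 then have "\<pi> (- {p}) x = (num b \<otimes> \<epsilon> (- {p})) \<otimes> (num p \<otimes> x)"
  using assms(3) by (metis \<epsilon>_closed m_assoc m_comm m_closed num_closed)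
 then show ?thesis using ideal_mult[OF assms(2,4)] by simp
qed

lemma tor_\<epsilon>: "prime p ==> h \<in> tor p ==> \<pi> {p} h = h"
 using ideal_off[OF _ zeroideal, of p h] \<epsilon>_split[of h "{p}"] by (simp add: tor_def)

lemma tor_\<epsilon>_off: "prime p ==> h \<in> tor p ==> p \<notin> Q ==> \<pi> Q h = \<zero>"
 using tor_\<epsilon>[of p h] \<epsilon>_disj[of h Q "{p}"] by (simp add: tor_carrier)

lemma tor_nontrivial: "p \<in> P ==> \<exists>h\<in>tor p. h \<noteq> \<zero>"
proof (rule ccontr)
 assume p: "p \<in> P" and "\<not> ?thesis"
 then have t: "x = \<zero>" if "x \<in> carrier R" "num p \<otimes> x = \<zero>" for x using that by (auto simp: tor_def)
 have "inj_on (\<lambda>x. num p \<otimes> x) (carrier R)"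
 proof (rule inj_onI)
  fix x y assume xy: "x \<in> carrier R" "y \<in> carrier R" "num p \<otimes> x = num p \<otimes> y"
  then have "num p \<otimes> (x \<ominus> y) = \<zero>" by (simp add: a_minus_def r_distr r_minus r_neg)
  then show "x = y" using t[of "x \<ominus> y"] xy by simp
 qed
 then have "mul p = carrier R" unfolding mul_def by (intro endo_inj_surj) auto
 then show False using one_notin_mul[OF p] by simp
qed

text \<open>Lagrange's theorem for an element of additive order p. The purpose is that
  \<open>card (tor p) - 1\<close> is then prime to p, as needed in
  \<open>schur_\<Gamma>\<close>.\<close>

lemma card_tor: "p \<in> P ==> p dvd card (tor p)"
proof -
 assume p: "p \<in> P"
 then obtain h where h: "h \<in> tor p" "h \<noteq> \<zero>" using tor_nontrivial by blast
 let ?G = "(add_monoid R)\<lparr>carrier := tor p\<rparr>"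
 have sg: "subgroup (tor p) (add_monoid R)"
  using tor_ideal additive_subgroup.a_subgroup ideal.axioms(1) by blast
 interpret G: group ?G using add.subgroup_imp_group[OF sg] .
 have "finite (tor p)" by (simp add: tor_def)
 then have fG: "finite (carrier ?G)" by simp
 have pw: "h [^]\<^bsub>?G\<^esub> n = [n] \<cdot> h" for n :: nat by (metis add.nat_pow_consistent)
 have "[p] \<cdot> h = \<zero>" using h by (simp add: add_pow_num tor_def)
 then have "h [^]\<^bsub>?G\<^esub> p = \<one>\<^bsub>?G\<^esub>" unfolding pw by simp
 then have "G.ord h dvd p" using G.pow_eq_id h(1) by simp
 moreover have "G.ord h \<noteq> 1" using G.ord_eq_1 h by simp
 ultimately have "G.ord h = p" using P_prime[OF p] by (metis prime_nat_iff)
 then show ?thesis using G.ord_dvd_group_order[of h] h by (simp add: order_def)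
qed

lemma card_ideal_dvd: "ideal I R ==> card I dvd order R"
proof -
 assume "ideal I R"
 then have "subgroup I (add_monoid R)" using additive_subgroup.a_subgroup ideal.axioms(1) by blast
 from add.lagrange[OF this] show ?thesis by (metis dvd_triv_right order_def partial_object.select_convs(1) partial_object.simps(1))
qed

text \<open>The elements 1 + j form a group of units of order \<open>card J\<close>; the counted
  ones are its intersection with K, and Lagrange's theorem applies.\<close>

lemma one_plus_unit_dvd:
 assumes J: "ideal J R" and Ju: "\<And>j. j \<in> J ==> \<one> \<oplus> j \<in> Units R"
  and K: "subgroup K (units_of R)"
 shows "hits J \<one> K dvd card J"
proof -
 interpret U: group "units_of R" by (rule units_group)
 let ?L = "(\<lambda>j. \<one> \<oplus> j) ` J"
 note J' = ideal_in[OF J]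
 have closed: "x \<otimes> y \<in> ?L" if xy: "x \<in> ?L" "y \<in> ?L" for x y
 proof -
  obtain i j where ij: "i \<in> J" "j \<in> J" "x = \<one> \<oplus> i" "y = \<one> \<oplus> j" using xy by blast
  then have c: "i \<in> carrier R" "j \<in> carrier R" using J' by auto
  have "x \<otimes> y = \<one> \<oplus> (i \<oplus> (j \<oplus> i \<otimes> j))" unfolding ij using c by algebra
  moreover have "i \<oplus> (j \<oplus> i \<otimes> j) \<in> J" using ij c ideal_mult[OF J] ideal_add[OF J] by simp
  ultimately show ?thesis by blast
 qed
 have invs: "inv x \<in> ?L" if x: "x \<in> ?L" for x
 proof -
  obtain i where i: "i \<in> J" "x = \<one> \<oplus> i" using x by blast
  then have u: "x \<in> Units R" and c: "i \<in> carrier R" using Ju J' by auto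
  have "inv x = \<one> \<oplus> (\<ominus> (i \<otimes> inv x))"
  proof -
   have "inv x \<oplus> i \<otimes> inv x = (\<one> \<oplus> i) \<otimes> inv x" using u c by (simp add: l_distr)
   also have "\<dots> = x \<otimes> inv x" by (simp add: i(2))
   also have "\<dots> = \<one>" using u by simp
   finally show ?thesis using u c
    by (metis Units_inv_closed a_minus_def add.inv_solve_right m_closed one_closed)
  qed
  moreover have "\<ominus> (i \<otimes> inv x) \<in> J" using i u ideal_mult'[OF J] ideal_neg[OF J] by simp
  ultimately show ?thesis by blast
 qed
 have L: "subgroup ?L (units_of R)"
 proof (rule U.subgroupI)
  show "?L \<subseteq> carrier (units_of R)" using Ju by (auto simp: units_of_def)
  show "?L \<noteq> {}" using ideal_zero[OF J] by blast
  show "inv\<^bsub>units_of R\<^esub> a \<in> ?L" if "a \<in> ?L" for a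
   using invs[OF that] Ju that by (auto simp: units_of_inv)
  show "a \<otimes>\<^bsub>units_of R\<^esub> b \<in> ?L" if "a \<in> ?L" "b \<in> ?L" for a b
   using closed[OF that] by (simp add: units_of_mult)
 qed
 interpret L: group "(units_of R)\<lparr>carrier := ?L\<rparr>" by (rule U.subgroup_imp_group[OF L])
 have KL: "subgroup (K \<inter> ?L) ((units_of R)\<lparr>carrier := ?L\<rparr>)"
  by (intro U.subgroup_incl U.subgroups_Inter_pair K L) auto
 have "card (K \<inter> ?L) dvd card ?L"
  using L.lagrange[OF KL] by (metis dvd_triv_right order_def partial_object.select_convs(1) partial_object.update_convs(1) partial_object.surjective partial_object.simps(1))
 moreover have inj: "inj_on (\<lambda>j. \<one> \<oplus> j) J" using J' by (auto intro!: inj_onI)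
 moreover have "K \<inter> ?L = (\<lambda>j. \<one> \<oplus> j) ` {j \<in> J. \<one> \<oplus> j \<in> K}" by auto
 moreover have "card ((\<lambda>j. \<one> \<oplus> j) ` {j \<in> J. \<one> \<oplus> j \<in> K}) = hits J \<one> K"
  by (rule card_image) (use inj in \<open>auto intro: inj_on_subset\<close>)
 ultimately show ?thesis by (simp add: card_image)
qed

end

text \<open>The hypothesis on the components in a form that passes easily to quotients and to the
  rings R_Q: every element is an integer times a unit. It is derived from the Galois property in
  \<open>CG_ring_cg_ring\<close>.\<close>

locale cg_ring = fin_cring +
 assumes odd_order: "odd (order R)"
  and assoc_num: "x \<in> carrier R ==> \<exists>d. \<exists>u\<in>Units R. x = num d \<otimes> u"
begin

lemma P_odd: "p \<in> P ==> p \<ge> 3"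
proof -
 assume p: "p \<in> P"
 then have "p \<noteq> 2" using odd_order by (auto simp: ring_primes_def)
 then show ?thesis using prime_ge_2_nat[OF P_prime[OF p]] by simp
qed

lemma unit_iff: "x \<in> carrier R ==> x \<in> Units R \<longleftrightarrow> (\<forall>p\<in>P. x \<notin> mul p)"
proof safe
 fix p assume p: "x \<in> Units R" "p \<in> P" "x \<in> mul p"
 then have "inv x \<otimes> x \<in> mul p" using ideal_mult[OF mul_ideal] by blast
 then show False using p one_notin_mul by simp
next
 assume x: "x \<in> carrier R" "\<forall>p\<in>P. x \<notin> mul p"
 obtain d u where u: "u \<in> Units R" "x = num d \<otimes> u" using assoc_num[OF x(1)] by blast
 have "coprime d p" if p: "p \<in> P" for p
 proof (rule ccontr)
  assume "\<not> coprime d p"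
  then have "p dvd d" using P_prime[OF p] by (metis coprime_commute prime_imp_coprime)
  then obtain c where "d = p * c" by blast
  then have "x = num p \<otimes> (num c \<otimes> u)" using u by (simp add: num_mult m_assoc Units_closed)
  then show False using x(2) p u by (auto simp: mul_def)
 qed
 then obtain b where "num d \<otimes> num b \<otimes> \<epsilon> UNIV = \<epsilon> UNIV" using num_inverse[of UNIV d] by blast
 then have "num d \<in> Units R" by (intro unit_rightI[of _ "num b"]) auto
 then show "x \<in> Units R" using u by simp
qed

text \<open>Write x = d u and split the power of p off d. The remaining integer is prime to p, hence
  invertible at p; completed by 1 at the other primes it becomes a unit of R.\<close>

lemma local_form:
 assumes "x \<in> carrier R" "p \<in> P"
 obtains i u where "u \<in> Units R" "\<pi> {p} x = num (p ^ i) \<otimes> (u \<otimes> \<epsilon> {p})"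
proof -
 obtain d u where u: "u \<in> Units R" "x = num d \<otimes> u" using assoc_num[OF assms(1)] by blast
 note uc = Units_closed[OF u(1)]
 show ?thesis
 proof (cases "d = 0")
  case True
  \<comment> \<open>Zero has the required form too, since the p-part of the order annihilates
    R_p.\<close>
  have "num (ppart p) \<otimes> (\<one> \<otimes> \<epsilon> {p}) = \<pi> {p} x" using ppart_kill[OF assms(2)] True u uc by simp
  then show ?thesis using that[of \<one>] by (metis Units_one_closed)
 next
  case False
  then obtain e where e: "d = p ^ multiplicity p d * e" "\<not> p dvd e"
   using multiplicity_decompose'[of d p] P_prime[OF assms(2)] by (metis not_prime_unit)
  have "coprime e q" if "q \<in> P" "q \<in> {p}" for q
   using that e(2) P_prime by (metis coprime_commute prime_imp_coprime singletonD)
  then obtain b where b: "num e \<otimes> num b \<otimes> \<epsilon> {p} = \<epsilon> {p}" using num_inverse[of "{p}" e] by blast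
  let ?w = "patch {p} (num e) \<one>"
  have w: "?w \<in> Units R" by (rule patch_unit[of _ _ "num b" \<one>]) (use b in \<open>simp_all add: m_comm\<close>)
  have "(u \<otimes> ?w) \<otimes> \<epsilon> {p} = u \<otimes> (\<epsilon> {p} \<otimes> num e)"
   using uc patch_in[of "num e" \<one> "{p}" "{p}"] by (simp add: m_ac)
  moreover have "num d = num (p ^ multiplicity p d) \<otimes> num e" using e(1) num_mult by metis
  ultimately have "num (p ^ multiplicity p d) \<otimes> ((u \<otimes> ?w) \<otimes> \<epsilon> {p}) = \<pi> {p} x"
   using uc by (simp only: u(2) m_ac num_closed \<epsilon>_closed m_closed)
  then show ?thesis using that[of "u \<otimes> ?w"] u w by (metis Units_m_closed)
 qed
qed

lemma num_pow_kill: "num (p ^ i) \<otimes> x = \<zero> ==> i \<le> j ==> x \<in> carrier R ==> num (p ^ j) \<otimes> x = \<zero>"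
proof -
 assume a: "num (p ^ i) \<otimes> x = \<zero>" "i \<le> j" "x \<in> carrier R"
 have "num (p ^ j) = num (p ^ (j - i)) \<otimes> num (p ^ i)" using a(2) by (simp flip: num_mult power_add)
 then show ?thesis using a by (simp add: m_assoc)
qed

text \<open>R_p is a chain ring: both elements are powers of p times units, and the smaller exponent
  divides the larger one.\<close>

lemma local_dvd:
 assumes "x \<in> carrier R" "y \<in> carrier R" "p \<in> P"
 shows "(\<exists>t\<in>carrier R. \<pi> {p} t = t \<and> \<pi> {p} x = y \<otimes> t) \<or>
  (\<exists>t\<in>carrier R. \<pi> {p} t = t \<and> \<pi> {p} y = x \<otimes> t)"
proof -
 have *: "\<exists>t\<in>carrier R. \<pi> {p} t = t \<and> \<pi> {p} y = x \<otimes> t"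
  if "x \<in> carrier R" "y \<in> carrier R" "u \<in> Units R" "v \<in> Units R" "i \<le> j"
   "\<pi> {p} x = num (p ^ i) \<otimes> (u \<otimes> \<epsilon> {p})" "\<pi> {p} y = num (p ^ j) \<otimes> (v \<otimes> \<epsilon> {p})"
  for x y u v i j
 proof -
  let ?t = "num (p ^ (j - i)) \<otimes> (inv u \<otimes> (v \<otimes> \<epsilon> {p}))"
  have c: "u \<in> carrier R" "inv u \<in> carrier R" "v \<in> carrier R" using that by auto
  have n: "num (p ^ j) = num (p ^ i) \<otimes> num (p ^ (j - i))"
   using \<open>i \<le> j\<close> by (simp flip: num_mult power_add)
  have "x \<otimes> ?t = \<pi> {p} x \<otimes> ?t"
  proof -
   have "\<pi> {p} x \<otimes> ?t = x \<otimes> (num (p ^ (j - i)) \<otimes> (inv u \<otimes> (v \<otimes> (\<epsilon> {p} \<otimes> \<epsilon> {p}))))"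
    using c that(1) by (simp only: m_ac \<epsilon>_closed num_closed m_closed)
   then show ?thesis by simp
  qed
  also have "\<dots> = num (p ^ i) \<otimes> num (p ^ (j - i)) \<otimes> ((u \<otimes> inv u) \<otimes> (v \<otimes> (\<epsilon> {p} \<otimes> \<epsilon> {p})))"
   unfolding that(6) using c by (simp only: m_ac \<epsilon>_closed num_closed m_closed)
  also have "\<dots> = \<pi> {p} y" unfolding that(7) n using that(3) c by simp
  finally have 1: "\<pi> {p} y = x \<otimes> ?t" by simp
  have "\<pi> {p} ?t = num (p ^ (j - i)) \<otimes> (inv u \<otimes> (v \<otimes> (\<epsilon> {p} \<otimes> \<epsilon> {p})))"
   using c by (simp only: m_ac \<epsilon>_closed num_closed m_closed)
  then have "\<pi> {p} ?t = ?t" by simp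
  then show ?thesis using 1 c by (intro bexI[of _ ?t]) auto
 qed
 obtain i u where u: "u \<in> Units R" "\<pi> {p} x = num (p ^ i) \<otimes> (u \<otimes> \<epsilon> {p})"
  using local_form[OF assms(1,3)] by blast
 obtain j v where v: "v \<in> Units R" "\<pi> {p} y = num (p ^ j) \<otimes> (v \<otimes> \<epsilon> {p})"
  using local_form[OF assms(2,3)] by blast
 show ?thesis using *[OF assms(1,2) u(1) v(1) _ u(2) v(2)] *[OF assms(2,1) v(1) u(1) _ v(2) u(2)]
  by (cases "i \<le> j") auto
qed

text \<open>Outside p R the exponent in \<open>local_form\<close> is 0, so t is a unit of R_p and
  can be cancelled.\<close>

lemma nonunit_local:
 assumes "t \<in> carrier R" "\<pi> {p} t = t" "t \<notin> mul p" "z \<in> carrier R" "p \<in> P" "t \<otimes> z = \<zero>"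
 shows "\<pi> {p} z = \<zero>"
proof -
 obtain i u where u: "u \<in> Units R" "\<pi> {p} t = num (p ^ i) \<otimes> (u \<otimes> \<epsilon> {p})"
  using local_form[OF assms(1,5)] by blast
 note uc = Units_closed[OF u(1)]
 have "i = 0"
 proof (rule ccontr)
  assume "i \<noteq> 0"
  then obtain j where "i = Suc j" by (cases i) auto
  then have "t = num p \<otimes> (num (p ^ j) \<otimes> (u \<otimes> \<epsilon> {p}))"
   using u assms(2) uc by (simp add: num_mult m_assoc)
  then show False using assms(3) uc by (auto simp: mul_def)
 qed
 then have t: "t = u \<otimes> \<epsilon> {p}" using u assms(2) uc by simp
 have "u \<otimes> \<pi> {p} z = u \<otimes> \<zero>" using assms(4,6) uc unfolding t by (simp add: m_assoc)
 then show ?thesis using u(1) assms(4) by (metis Units_l_cancel \<epsilon>_closed m_closed zero_closed)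
qed

text \<open>If divisibility in the chain ring goes the wrong way, so that the p-component of y is h
  t, then t is outside p R because p h = 0 and that component is non-zero. So t is a unit at p and
  can be inverted.\<close>

lemma tor_dvd:
 assumes "y \<in> carrier R" "\<pi> {p} y \<noteq> \<zero>" "p \<in> P" "h \<in> tor p"
 obtains t where "t \<in> carrier R" "\<pi> {p} t = t" "h = y \<otimes> t"
proof -
 note hc = tor_carrier[OF assms(4)] and he = tor_\<epsilon>[OF P_prime[OF assms(3)] assms(4)]
 consider t where "t \<in> carrier R" "\<pi> {p} t = t" "\<pi> {p} h = y \<otimes> t"
  | t where "t \<in> carrier R" "\<pi> {p} t = t" "\<pi> {p} y = h \<otimes> t"
  using local_dvd[OF hc assms(1,3)] by blast
 then show ?thesis
 proof cases
  case 1 then show ?thesis using that he by simp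
 next
  case (2 t)
  have "t \<notin> mul p"
  proof
   assume "t \<in> mul p"
   then obtain s where s: "s \<in> carrier R" "t = num p \<otimes> s" by (auto simp: mul_def)
   have "h \<otimes> t = (num p \<otimes> h) \<otimes> s" using s hc by (simp add: m_ac)
   then show False using 2 assms s by (simp add: tor_def)
  qed
  obtain i u where u: "u \<in> Units R" "\<pi> {p} t = num (p ^ i) \<otimes> (u \<otimes> \<epsilon> {p})"
   using local_form[OF 2(1) assms(3)] by blast
  note uc = Units_closed[OF u(1)]
  have "i = 0"
  proof (rule ccontr)
   assume "i \<noteq> 0"
   then obtain j where "i = Suc j" by (cases i) auto
   then have "t = num p \<otimes> (num (p ^ j) \<otimes> (u \<otimes> \<epsilon> {p}))"
    using u 2(2) uc by (simp add: num_mult m_assoc)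
   then show False using \<open>t \<notin> mul p\<close> uc by (auto simp: mul_def)
  qed
  then have t: "t = u \<otimes> \<epsilon> {p}" using u 2(2) uc by simp
  let ?s = "inv u \<otimes> \<epsilon> {p}"
  have "y \<otimes> ?s = \<pi> {p} y \<otimes> inv u" using u assms(1) by (simp add: m_ac)
  also have "\<dots> = \<pi> {p} h \<otimes> (u \<otimes> inv u)"
   unfolding 2(3) t using u uc hc by (simp add: m_ac Units_inv_closed del: Units_r_inv)
  also have "\<dots> = h" using he hc u by simp
  finally have "h = y \<otimes> ?s" by simp
  moreover have "\<pi> {p} ?s = inv u \<otimes> (\<epsilon> {p} \<otimes> \<epsilon> {p})" using u by (simp only: m_ac \<epsilon>_closed Units_inv_closed m_closed)
  ultimately show ?thesis using that[of ?s] u by simp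
 qed
qed

lemma tor_sub_ideal:
 assumes "ideal I R" "x \<in> I" "\<pi> {p} x \<noteq> \<zero>" "p \<in> P"
 shows "tor p \<subseteq> I"
using tor_dvd[OF ideal_in[OF assms(1,2)] assms(3,4)] ideal_mult'[OF assms(1,2)] by auto

lemma one_plus_unit:
 "t \<in> carrier R ==> (\<And>p. p \<in> P ==> t \<in> mul p) ==> \<one> \<oplus> t \<in> Units R"
 using one_notin_mul ideal_add_cancel[OF mul_ideal, of t _ \<one>] by (subst unit_iff) (auto)

lemma one_plus_\<Gamma>:
 assumes "t \<in> carrier R" "\<pi> {p} t = t" "t \<in> mul p" "prime p"
 shows "\<one> \<oplus> t \<in> \<Gamma> p"
proof -
 have "t \<in> mul q" if "q \<in> P" for q
  using mul_\<epsilon>[of q t "{p}"] assms P_prime[OF that] by (cases "q = p") auto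
 then have "\<one> \<oplus> t \<in> Units R" using one_plus_unit assms(1) by blast
 moreover have "\<pi> (- {p}) t = \<zero>" using \<epsilon>_disj[of t "- {p}" "{p}"] assms by simp
 ultimately show ?thesis using assms(1) by (simp add: \<Gamma>_def r_distr)
qed

text \<open>The link between translations and units. With h = y t the factor t lies in p R: a unit t
  at p would turn p h = 0 into p y = 0 at p. Hence 1 + t is a unit, and adding h to y is
  multiplication by it. A set stable under \<open>\<Gamma> p\<close> can thus fail to be stable
  under translation by \<open>tor p\<close> only at elements whose p-component lies in
  \<open>tor p\<close>.\<close>

lemma add_tor:
 assumes "y \<in> carrier R" "\<pi> {p} y \<notin> tor p" "p \<in> P" "h \<in> tor p"
 obtains t where "t \<in> carrier R" "\<pi> {p} t = t" "t \<in> mul p" "h = y \<otimes> t"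
  "\<one> \<oplus> t \<in> \<Gamma> p" "y \<oplus> h = (\<one> \<oplus> t) \<otimes> y"
proof -
 have "\<pi> {p} y \<noteq> \<zero>" using assms(2) by (auto simp: tor_def)
 then obtain t where t: "t \<in> carrier R" "\<pi> {p} t = t" "h = y \<otimes> t"
  using tor_dvd[OF assms(1) _ assms(3,4)] by metis
 have m: "t \<in> mul p"
 proof (rule ccontr)
  assume n: "t \<notin> mul p"
  have "t \<otimes> (num p \<otimes> y) = num p \<otimes> h" using t assms(1) by (simp add: m_ac)
  also have "\<dots> = \<zero>" using assms(4) by (simp add: tor_def)
  finally have "\<pi> {p} (num p \<otimes> y) = \<zero>"
   using nonunit_local[OF t(1,2) n _ assms(3)] assms(1) by simp
  then show False using assms(1,2) by (simp add: tor_def m_ac)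
 qed
 have "y \<oplus> h = (\<one> \<oplus> t) \<otimes> y" using t assms(1) m_comm[of t y] by (simp add: l_distr)
 then show ?thesis using that t m one_plus_\<Gamma>[OF t(1,2) m P_prime[OF assms(3)]] by blast
qed

lemma \<Gamma>_Units: "g \<in> \<Gamma> p ==> g \<in> Units R" by (simp add: \<Gamma>_def)

text \<open>\<open>tor_dvd\<close> gives k = h t. As p h = 0 and k is non-zero, t is outside p R, so
  it is a unit at p, to be completed by 1 elsewhere.\<close>

lemma tor_trans:
 assumes "p \<in> P" "h \<in> tor p" "k \<in> tor p" "h \<noteq> \<zero>" "k \<noteq> \<zero>"
 shows "\<exists>g\<in>\<Gamma> p. k = g \<otimes> h"
proof -
 note hc = tor_carrier[OF assms(2)] and he = tor_\<epsilon>[OF P_prime[OF assms(1)] assms(2)]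
 obtain t where t: "t \<in> carrier R" "\<pi> {p} t = t" "k = h \<otimes> t"
  using tor_dvd[OF hc _ assms(1,3)] assms(4) he by metis
 have nt: "t \<notin> mul p"
 proof
  assume "t \<in> mul p"
  then obtain s where s: "s \<in> carrier R" "t = num p \<otimes> s" by (auto simp: mul_def)
  have "k = (num p \<otimes> h) \<otimes> s" using s hc t by (simp add: m_ac)
  then show False using assms s by (simp add: tor_def)
 qed
 let ?g = "patch {p} t \<one>"
 have "?g \<in> Units R"
 proof (subst unit_iff)
  show "\<forall>q\<in>P. ?g \<notin> mul q"
  proof safe
   fix q assume q: "q \<in> P" "?g \<in> mul q"
   then have "\<pi> {q} ?g \<in> mul q" using ideal_mult[OF mul_ideal] by simp
   then show False
    using t nt patch_in[of t \<one> "{q}" "{p}"] patch_out[of t \<one> "{q}" "{p}"] one_notin_mul[OF q(1)] mul_iff[OF P_prime[OF q(1)], of \<one>]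
     by (cases "q = p") auto
  qed
 qed (use t in auto)
 moreover have "\<pi> (- {p}) ?g = \<epsilon> (- {p})" using t patch_out[of t \<one> "- {p}" "{p}"] by simp
 moreover have "?g \<otimes> \<pi> {p} h = \<pi> {p} ?g \<otimes> h"
  using hc t by (simp only: m_ac patch_closed one_closed \<epsilon>_closed m_closed)
 then have "?g \<otimes> h = \<pi> {p} ?g \<otimes> h" unfolding he .
 then have "?g \<otimes> h = k" using t hc patch_in[of t \<one> "{p}" "{p}"] by (simp add: m_comm)
 ultimately show ?thesis by (intro bexI[of _ ?g]) (simp_all add: \<Gamma>_def)
qed

text \<open>With this, a set containing 0 that is closed under sums and under multiplication by
  units is an ideal; for basic sets only the action of units is available. At p take u = 2 if r is 1
  modulo p R and u = 1 otherwise; since p is odd, u and r - u are units at p.\<close>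

lemma sum_of_units:
 assumes "r \<in> carrier R"
 obtains u v where "u \<in> Units R" "v \<in> Units R" "r = u \<oplus> v"
proof -
 let ?Q = "{p \<in> P. r \<ominus> \<one> \<in> mul p}"
 let ?u = "\<one> \<oplus> \<epsilon> ?Q"
 have rc: "r \<ominus> \<one> \<in> carrier R" using assms by simp
 have e: "\<pi> {p} ?u = (if p \<in> ?Q then \<epsilon> {p} \<otimes> num 2 else \<epsilon> {p})" if "p \<in> P" for p
  by (auto simp: r_distr numeral_2_eq_2 num_add[of 1 1, simplified] num_def[of 1])
 have two: "num 2 \<notin> mul p" if p: "p \<in> P" for p
 proof
  assume "num 2 \<in> mul p"
  obtain c where "p = 2 * c + 1" using odd_order p
   by (metis dvd_trans mem_Collect_eq oddE ring_primes_def)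
  then have "num p = num c \<otimes> num 2 \<oplus> \<one>" using num_add[of "c * 2" 1] by (simp add: num_mult mult.commute)
  moreover have "num p \<in> mul p" unfolding mul_def by (rule image_eqI[of _ _ \<one>]) auto
  ultimately have "\<one> \<oplus> num c \<otimes> num 2 \<in> mul p" by (simp add: a_comm)
  then have "\<one> \<in> mul p"
   using ideal_add_cancel[OF mul_ideal, of "num c \<otimes> num 2" p \<one>] ideal_mult[OF mul_ideal \<open>num 2 \<in> mul p\<close>] by simp
  then show False using one_notin_mul[OF p] by simp
 qed
 have "?u \<in> Units R"
 proof (subst unit_iff)
  show "\<forall>p\<in>P. ?u \<notin> mul p"
  proof safe
   fix p assume p: "p \<in> P" "?u \<in> mul p"
   then have m: "\<pi> {p} ?u \<in> mul p" using ideal_mult[OF mul_ideal] by simp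
   show False
   proof (cases "p \<in> ?Q")
    case True
    then have "\<epsilon> {p} \<otimes> num 2 \<in> mul p" using m e[OF p(1)] by simp
    then show False using two[OF p(1)] mul_iff[OF P_prime[OF p(1)], of "num 2"] by simp
   next
    case False
    then have "\<epsilon> {p} \<in> mul p" using m e[OF p(1)] by (simp split: if_splits)
    then show False using one_notin_mul[OF p(1)] mul_iff[OF P_prime[OF p(1)], of \<one>] by simp
   qed
  qed
 qed simp
 moreover have "r \<ominus> ?u \<in> Units R"
 proof (subst unit_iff)
  show "\<forall>p\<in>P. r \<ominus> ?u \<notin> mul p"
  proof safe
   fix p assume p: "p \<in> P" "r \<ominus> ?u \<in> mul p"
   have ru: "r \<ominus> ?u = (r \<ominus> \<one>) \<oplus> \<ominus> \<epsilon> ?Q" using assms by (simp add: a_minus_def minus_add a_assoc)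
   have m: "\<pi> {p} (r \<ominus> ?u) \<in> mul p" using p ideal_mult[OF mul_ideal] by simp
   show False
   proof (cases "p \<in> ?Q")
    case True
    then have "\<ominus> \<epsilon> ?Q \<oplus> (r \<ominus> \<one>) \<in> mul p" using p(2) rc unfolding ru by (simp add: a_comm)
    then have "\<ominus> \<epsilon> ?Q \<in> mul p"
     using ideal_add_cancel[OF mul_ideal, of "r \<ominus> \<one>" p "\<ominus> \<epsilon> ?Q"] True by simp
    then have "\<ominus> (\<ominus> \<epsilon> ?Q) \<in> mul p" using ideal_neg[OF mul_ideal] by blast
    then have "\<epsilon> ?Q \<in> mul p" by simp
    from ideal_mult[OF mul_ideal this \<epsilon>_closed]
    have "\<epsilon> {p} \<otimes> \<epsilon> ?Q \<in> mul p" .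
    moreover have "\<epsilon> {p} \<otimes> \<epsilon> ?Q = \<epsilon> {p}" using True by simp
    ultimately show False using one_notin_mul[OF p(1)] mul_iff[OF P_prime[OF p(1)], of \<one>] by simp
   next
    case False
    then have "\<epsilon> {p} \<otimes> \<epsilon> ?Q = \<zero>" by auto
    then have "\<pi> {p} (r \<ominus> ?u) = \<pi> {p} (r \<ominus> \<one>)"
     unfolding ru using rc by (simp add: r_distr r_minus)
    then have "r \<ominus> \<one> \<in> mul p" using m mul_iff[OF P_prime[OF p(1)] rc] by simp
    then show False using False p(1) by simp
   qed
  qed
 qed (use assms in simp)
 moreover have "r = ?u \<oplus> (r \<ominus> ?u)" using assms by (simp add: add_minus)
 ultimately show ?thesis using that by blast
qed

end

section \<open>S-rings as partitions of the ring\<close>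

lemma funpow_period_fixed:
 assumes "(f ^^ m) x = x" "(f ^^ p) x = x" "coprime m p" "p > 0"
 shows "f x = x"
proof -
 have it: "(f ^^ (k * n)) x = x" if "(f ^^ n) x = x" for k n
  using that by (induction k) (simp_all add: funpow_add)
 show ?thesis
 proof (cases "m = 0")
  case True
  then have "p = 1" using assms by simp
  then show ?thesis using assms(2) by simp
 next
  case False
  then obtain a b where ab: "a * m = b * p + gcd m p" using bezout_nat[of m p] by (metis mult.commute)
  then have "a * m = Suc (b * p)" using assms(3) by simp
  then have "(f ^^ (a * m)) x = f ((f ^^ (b * p)) x)" by simp
  then show ?thesis using it[OF assms(1)] it[OF assms(2)] by simp
 qed
qed

text \<open>The points moved by \<open>f\<close> fall into orbits of exactly p elements: a shorter
  period is prime to p and would make the point fixed.\<close>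

lemma card_fixed_mod_prime:
 assumes S: "finite S" and f: "\<And>x. x \<in> S ==> f x \<in> S" and fp: "\<And>x. x \<in> S ==> (f ^^ p) x = x"
  and p: "prime p"
 shows "[card S = card {x \<in> S. f x = x}] (mod p)"
proof -
 define Or where "Or x = (\<lambda>i. (f ^^ i) x) ` {..<p}" for x
 let ?N = "{x \<in> S. f x \<noteq> x}"
 have p0: "p > 0" using p prime_gt_0_nat by blast
 have fi: "(f ^^ i) x \<in> S" if "x \<in> S" for i x using that by (induction i) (auto intro: f)
 have red: "(f ^^ i) x = (f ^^ (i mod p)) x" if "x \<in> S" for i x
 proof -
  have "(f ^^ (k * p)) x = x" for k using fp[OF that] by (induction k) (simp_all add: funpow_add)
  then have "(f ^^ (i mod p + (i div p) * p)) x = (f ^^ (i mod p)) x" by (simp only: funpow_add o_apply)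
  then show ?thesis by simp
 qed
 have Or_range: "Or x = range (\<lambda>i. (f ^^ i) x)" if "x \<in> S" for x
 proof
  show "range (\<lambda>i. (f ^^ i) x) \<subseteq> Or x"
  proof
   fix y assume "y \<in> range (\<lambda>i. (f ^^ i) x)"
   then obtain i where "y = (f ^^ i) x" by blast
   then have "y = (f ^^ (i mod p)) x" using red[OF that] by simp
   then show "y \<in> Or x" unfolding Or_def using p0 by (intro image_eqI[of _ _ "i mod p"]) auto
  qed
 qed (auto simp: Or_def)
 have bk: "(f ^^ (p - i mod p)) ((f ^^ i) x) = x" if "x \<in> S" for x i
 proof -
  have "i mod p < p" using p0 by simp
  then have "p - i mod p + i = p + p * (i div p)" using mult_div_mod_eq[of p i] by linarith
  then have "(p - i mod p + i) mod p = 0" by simp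
  then have "(f ^^ (p - i mod p + i)) x = x" using red[OF that, of "p - i mod p + i"] by simp
  then show ?thesis by (simp add: funpow_add)
 qed
 have Or_eq: "Or y = Or x" if x: "x \<in> S" and y: "y \<in> Or x" for x y
 proof -
  obtain i where i: "y = (f ^^ i) x" using y by (auto simp: Or_def)
  have ys: "y \<in> S" using i fi[OF x] by simp
  have "x = (f ^^ (p - i mod p)) y" using bk[OF x] i by simp
  have sub: "range (\<lambda>i. (f ^^ i) b) \<subseteq> range (\<lambda>i. (f ^^ i) a)" if "b = (f ^^ j) a" for a b j
  proof
   fix c assume "c \<in> range (\<lambda>i. (f ^^ i) b)"
   then obtain k where "c = (f ^^ k) b" by blast
   then have "c = (f ^^ (k + j)) a" using that by (simp add: funpow_add)
   then show "c \<in> range (\<lambda>i. (f ^^ i) a)" by blast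
  qed
  show ?thesis unfolding Or_range[OF x] Or_range[OF ys]
   using sub[OF i] sub[OF \<open>x = (f ^^ (p - i mod p)) y\<close>] by blast
 qed
 have inj: "inj_on (\<lambda>i. (f ^^ i) x) {..<p}" if x: "x \<in> ?N" for x
 proof -
  have False if ij: "i < j" "j < p" "(f ^^ i) x = (f ^^ j) x" for i j
  proof -
   have xS: "x \<in> S" using x by simp
   have "x = (f ^^ (p - i)) ((f ^^ i) x)" using bk[OF xS, of i] ij by simp
   also have "\<dots> = (f ^^ (p - i + j)) x" using ij(3) by (simp add: funpow_add)
   also have "p - i + j = (j - i) + p" using ij by simp
   also have "(f ^^ (j - i + p)) x = (f ^^ (j - i)) x" using fp[OF xS] by (simp add: funpow_add)
   finally have "(f ^^ (j - i)) x = x" by simp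
   moreover have "\<not> p dvd j - i" using ij by (simp add: nat_dvd_not_less)
   then have "coprime (j - i) p" using p by (metis coprime_commute prime_imp_coprime)
   ultimately have "f x = x" using funpow_period_fixed[of "j - i" f x p] fp[OF xS] p0 by simp
   then show False using x by simp
  qed
  then show ?thesis by (intro inj_onI) (metis lessThan_iff linorder_neqE_nat)
 qed
 have sub: "Or x \<subseteq> ?N" if x: "x \<in> ?N" for x
 proof
  fix y assume y: "y \<in> Or x"
  then obtain i where i: "y = (f ^^ i) x" by (auto simp: Or_def)
  have xS: "x \<in> S" using x by simp
  have "f y \<noteq> y"
  proof
   assume fy: "f y = y"
   have fk: "(f ^^ k) y = y" for k by (induction k) (simp_all add: fy)
   have "x = (f ^^ (p - i mod p)) y" using bk[OF xS] i by simp
   then have "x = y" using fk by simp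
   then show False using fy x by simp
  qed
  then show "y \<in> ?N" using i fi[OF xS] by simp
 qed
 have "p * card (Or ` ?N) = card (\<Union> (Or ` ?N))"
 proof (rule card_partition)
  show "card c = p" if "c \<in> Or ` ?N" for c using that inj by (auto simp: Or_def card_image)
  show "c1 \<inter> c2 = {}" if "c1 \<in> Or ` ?N" "c2 \<in> Or ` ?N" "c1 \<noteq> c2" for c1 c2
  using \<open>c1 \<in> _\<close> \<open>c2 \<in> _\<close> Or_eq \<open>c1 \<noteq> c2\<close> by blast
  show "finite (\<Union> (Or ` ?N))" using sub S by (auto intro!: finite_subset[of _ S])
 qed (use S in auto)
 moreover have "\<Union> (Or ` ?N) = ?N"
 proof
  show "?N \<subseteq> \<Union> (Or ` ?N)"
  proof
   fix x assume "x \<in> ?N"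
   moreover have "x \<in> Or x" unfolding Or_def by (rule image_eqI[of _ _ 0]) (use p0 in auto)
   ultimately show "x \<in> \<Union> (Or ` ?N)" by blast
  qed
 qed (use sub in auto)
 ultimately have N: "card ?N = p * card (Or ` ?N)" by simp
 have "S = {x \<in> S. f x = x} \<union> ?N" by auto
 then have "card S = card {x \<in> S. f x = x} + card ?N"
  using S by (subst card_Un_disjoint[symmetric]) auto
 then show ?thesis unfolding N by (simp add: cong_def)
qed

context cring
begin

lemma unit_cancel [simp]:
 "u \<in> Units R ==> y \<in> carrier R ==> inv u \<otimes> (u \<otimes> y) = y"
 "u \<in> Units R ==> y \<in> carrier R ==> u \<otimes> (inv u \<otimes> y) = y" by (simp_all add: Units_closed flip: m_assoc)

lemma add_minus_cancel: "a \<in> carrier R ==> b \<in> carrier R ==> (a \<oplus> b) \<ominus> a = b"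
 using a_comm[of a b] by (simp add: a_minus_def a_assoc r_neg)

abbreviation "lsum xs \<equiv> foldr (\<oplus>) xs \<zero>"

lemma lsum_closed: "set xs \<subseteq> carrier R ==> lsum xs \<in> carrier R" by (induction xs) auto

lemma lsum_append: "set xs \<subseteq> carrier R ==> x \<in> carrier R ==> lsum (xs @ [x]) = x \<oplus> lsum xs"
 by (induction xs) (auto simp: a_lcomm lsum_closed)

lemma lsum_rotate1: "set xs \<subseteq> carrier R ==> lsum (rotate1 xs) = lsum xs"
 by (cases xs) (auto simp: lsum_append simp del: foldr_append)

lemma lsum_replicate: "x \<in> carrier R ==> lsum (replicate n x) = num n \<otimes> x"
proof (induction n)
 case (Suc n)
 then show ?case using num_add[of 1 n] by (simp add: l_distr)
qed simp

lemma set_add_iff: "X \<subseteq> carrier R ==> Y \<subseteq> carrier R ==>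
  s \<in> X <+>\<^bsub>R\<^esub> Y \<longleftrightarrow> s \<in> carrier R \<and> (\<exists>a\<in>X. s \<ominus> a \<in> Y)"
proof safe
 assume c: "X \<subseteq> carrier R" "Y \<subseteq> carrier R"
 { assume "s \<in> X <+>\<^bsub>R\<^esub> Y"
  then obtain a b where ab: "a \<in> X" "b \<in> Y" "s = a \<oplus> b" by (auto simp: set_add_def')
  then have "s \<ominus> a = b" using c by (simp add: subsetD a_minus_def a_comm[of a b] a_assoc r_neg)
  then show "\<exists>a\<in>X. s \<ominus> a \<in> Y" using ab by (intro bexI[of _ a]) simp_all
  show "s \<in> carrier R" using ab c by auto }
 fix a assume a: "s \<in> carrier R" "a \<in> X" "s \<ominus> a \<in> Y"
 then have "s = a \<oplus> (s \<ominus> a)" using c by (simp add: add_minus subsetD)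
 then show "s \<in> X <+>\<^bsub>R\<^esub> Y" using a by (auto simp: set_add_def')
qed

end

text \<open>
 An S-ring over \<open>R\<close> is represented by the map sending an element to its basic set; \<open>cls_conv\<close> states
 that the functions which are constant on basic sets are closed under convolution.
\<close>

locale cg_sring = cg_ring R for R (structure) +
 fixes cls :: "'a \<Rightarrow> 'a set"
 assumes cls_self: "x \<in> carrier R ==> x \<in> cls x"
  and cls_carrier: "x \<in> carrier R ==> cls x \<subseteq> carrier R"
  and cls_eq: "x \<in> carrier R ==> y \<in> cls x ==> cls y = cls x"
  and cls_zero: "cls \<zero> = {\<zero>}"
  and cls_mult: "u \<in> Units R ==> x \<in> carrier R ==> cls (u \<otimes> x) = (\<lambda>y. u \<otimes> y) ` cls x"
  and cls_conv: "\<lbrakk>\<And>x y. x \<in> carrier R ==> y \<in> cls x ==> f y = (f x :: int);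
   \<And>x y. x \<in> carrier R ==> y \<in> cls x ==> g y = g x; x \<in> carrier R; y \<in> cls x\<rbrakk> \<Longrightarrow>
   (\<Sum>a\<in>carrier R. f a * g (y \<ominus> a)) = (\<Sum>a\<in>carrier R. f a * g (x \<ominus> a))"
begin

section \<open>Unions of basic sets, \<A>-ideals, and unit multiples of basic sets\<close>

definition aset :: "'a set \<Rightarrow> bool"
 where "aset X \<longleftrightarrow> X \<subseteq> carrier R \<and> (\<forall>x\<in>X. cls x \<subseteq> X)"

definition aideal :: "'a set \<Rightarrow> bool"
 where "aideal J \<longleftrightarrow> ideal J R \<and> aset J"

text \<open>The least unit-stable union of basic sets containing x (\<open>W_least\<close>). It is
  the basic set of x taken up to units, and \<open>W_eqI\<close> shows that it is determined by the
  \<A>-ideals that contain x.\<close>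

definition W :: "'a \<Rightarrow> 'a set"
 where "W x = {u \<otimes> y |u y. u \<in> Units R \<and> y \<in> cls x}"

definition gen :: "'a \<Rightarrow> 'a set"
 where "gen x = \<Inter> {J. aideal J \<and> x \<in> J}"

lemma cls_in: "x \<in> carrier R ==> y \<in> cls x ==> y \<in> carrier R" using cls_carrier by blast

lemma aset_carrier: "aset X ==> X \<subseteq> carrier R" by (simp add: aset_def)

lemma aset_in: "aset X ==> x \<in> X ==> x \<in> carrier R" by (auto simp: aset_def)

lemma aset_finite: "aset X ==> finite X" using aset_carrier finite_subset by blast

lemma asetD: "aset X ==> x \<in> X ==> y \<in> cls x ==> y \<in> X" by (auto simp: aset_def)

lemma aset_cong: "aset X ==> x \<in> carrier R ==> y \<in> cls x ==> y \<in> X \<longleftrightarrow> x \<in> X"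
 by (metis asetD cls_eq cls_in cls_self)

lemma asetI: "X \<subseteq> carrier R ==> (\<And>x y. x \<in> X ==> y \<in> cls x ==> y \<in> X) ==> aset X" by (auto simp: aset_def)

lemma aset_cls: "x \<in> carrier R ==> aset (cls x)" by (rule asetI) (use cls_carrier cls_eq in blast)+

lemma aset_Int: "aset X ==> aset Y ==> aset (X \<inter> Y)" by (auto simp: aset_def)

lemma aset_univ: "aset (carrier R)" using cls_carrier by (auto simp: aset_def)

lemma aset_mult: "aset X ==> u \<in> Units R ==> aset ((\<lambda>x. u \<otimes> x) ` X)"
 using cls_mult aset_in unfolding aset_def by (auto simp: subset_iff image_iff)

lemma cls_neg: "x \<in> carrier R ==> cls (\<ominus> x) = (\<lambda>y. \<ominus> y) ` cls x"
proof -
 assume x: "x \<in> carrier R"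
 have "cls (\<ominus> \<one> \<otimes> x) = (\<lambda>y. \<ominus> \<one> \<otimes> y) ` cls x"
  using x by (intro cls_mult) (simp_all add: Units_minus_one_closed)
 also have "\<dots> = (\<lambda>y. \<ominus> y) ` cls x" using cls_in[OF x] by (intro image_cong) (auto simp: l_minus)
 finally show ?thesis using x by (simp add: l_minus)
qed

lemma aset_neg: "aset X ==> aset ((\<lambda>x. \<ominus> x) ` X)"
 using cls_neg aset_in unfolding aset_def by (auto simp: subset_iff image_iff)

lemma int_card_conv:
 assumes "X \<subseteq> carrier R"
 shows "(\<Sum>a\<in>carrier R. of_bool (a \<in> X) * of_bool (y \<ominus> a \<in> Y)) = int (card {a \<in> X. y \<ominus> a \<in> Y})"
proof -
 have "(\<Sum>a\<in>carrier R. of_bool (a \<in> X) * of_bool (y \<ominus> a \<in> Y)) =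
   (\<Sum>a\<in>carrier R. of_bool (a \<in> X \<and> y \<ominus> a \<in> Y) :: int)" by (intro sum.cong) auto
 also have "\<dots> = int (card (carrier R \<inter> {a. a \<in> X \<and> y \<ominus> a \<in> Y}))" by (subst sum_of_bool_eq) auto
 also have "carrier R \<inter> {a. a \<in> X \<and> y \<ominus> a \<in> Y} = {a \<in> X. y \<ominus> a \<in> Y}" using assms by blast
 finally show ?thesis .
qed

text \<open>The number is the coefficient of y in the product of the simple quantities of X and
  Y.\<close>

lemma card_conv:
 assumes "aset X" "aset Y" "x \<in> carrier R" "y \<in> cls x"
 shows "card {a \<in> X. y \<ominus> a \<in> Y} = card {a \<in> X. x \<ominus> a \<in> Y}"
proof -
 have "int (card {a \<in> X. y \<ominus> a \<in> Y}) = int (card {a \<in> X. x \<ominus> a \<in> Y})"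
  unfolding int_card_conv[OF aset_carrier[OF assms(1)], symmetric]
  by (rule cls_conv) (use assms aset_cong in auto)
 then show ?thesis by simp
qed

text \<open>X + Y is the support of the product of two simple quantities, whose coefficients are
  counts and do not cancel.\<close>

lemma aset_add: "aset X ==> aset Y ==> aset (X <+>\<^bsub>R\<^esub> Y)"
proof (rule asetI)
 assume X: "aset X" and Y: "aset Y"
 note iff = set_add_iff[OF aset_carrier[OF X] aset_carrier[OF Y]]
 show "X <+>\<^bsub>R\<^esub> Y \<subseteq> carrier R" using iff by blast
 fix s t assume s: "s \<in> X <+>\<^bsub>R\<^esub> Y" and t: "t \<in> cls s"
 then have sc: "s \<in> carrier R" using iff by blast
 have "{a \<in> X. s \<ominus> a \<in> Y} \<noteq> {}" using s iff by blast
 then have "card {a \<in> X. s \<ominus> a \<in> Y} > 0" using aset_finite[OF X] by (simp add: card_gt_0_iff)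
 then have "card {a \<in> X. t \<ominus> a \<in> Y} > 0" using card_conv[OF X Y sc t] by simp
 then have "{a \<in> X. t \<ominus> a \<in> Y} \<noteq> {}" by (metis card.empty less_irrefl)
 then show "t \<in> X <+>\<^bsub>R\<^esub> Y" using iff cls_in[OF sc t] by blast
qed

text \<open>The overlap is a coefficient of the product of the simple quantities of -X and
  X.\<close>

lemma card_shift:
 assumes "aset X" "x \<in> carrier R" "y \<in> cls x"
 shows "overlap X y = overlap X x"
proof -
 have *: "overlap X z = card {b \<in> (\<lambda>x. \<ominus> x) ` X. z \<ominus> b \<in> X}" if "z \<in> carrier R" for z
 proof (rule bij_betw_same_card[of "\<lambda>a. \<ominus> a"], rule bij_betw_imageI)
  show "inj_on (\<lambda>a. \<ominus> a) {a \<in> X. a \<oplus> z \<in> X}"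
   using aset_in[OF assms(1)] by (auto intro!: inj_onI dest!: a_inv_inj[THEN inj_onD])
  show "(\<lambda>a. \<ominus> a) ` {a \<in> X. a \<oplus> z \<in> X} = {b \<in> (\<lambda>x. \<ominus> x) ` X. z \<ominus> b \<in> X}"
   using aset_in[OF assms(1)] that by (auto simp: image_iff a_minus_def a_comm)
 qed
 show ?thesis using *[OF assms(2)] *[OF cls_in[OF assms(2,3)]]
   card_conv[OF aset_neg[OF assms(1)] assms(1,2,3)] by simp
qed

lemma aideal_ideal: "aideal J ==> ideal J R" and aideal_aset: "aideal J ==> aset J"
 by (auto simp: aideal_def)

lemma aideal_zero: "aideal {\<zero>}" by (simp add: aideal_def zeroideal aset_def cls_zero)

lemma aideal_univ: "aideal (carrier R)" by (simp add: aideal_def oneideal aset_univ)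

lemma aideal_Int: "aideal I ==> aideal J ==> aideal (I \<inter> J)"
 by (simp add: aideal_def aset_Int i_intersect)

lemma aideal_add: "aideal I ==> aideal J ==> aideal (I <+>\<^bsub>R\<^esub> J)"
 by (simp add: aideal_def aset_add add_ideals)

lemma aideal_finite: "finite {J. aideal J}"
 by (rule finite_subset[of _ "Pow (carrier R)"]) (auto simp: aideal_def aset_def)

lemma gen_aideal: "x \<in> carrier R ==> aideal (gen x)"
proof -
 assume x: "x \<in> carrier R"
 have "carrier R \<in> {J. aideal J \<and> x \<in> J}" using aideal_univ x by simp
 then have ne: "{J. aideal J \<and> x \<in> J} \<noteq> {}" by blast
 have "ideal (\<Inter> {J. aideal J \<and> x \<in> J}) R" by (rule i_Intersect) (use ne aideal_ideal in auto)
 moreover have "aset (\<Inter> {J. aideal J \<and> x \<in> J})"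
 proof (rule asetI)
  show "\<Inter> {J. aideal J \<and> x \<in> J} \<subseteq> carrier R" using aideal_univ x by blast
  fix y z assume y: "y \<in> \<Inter> {J. aideal J \<and> x \<in> J}" and z: "z \<in> cls y"
  show "z \<in> \<Inter> {J. aideal J \<and> x \<in> J}"
  proof
   fix J assume "J \<in> {J. aideal J \<and> x \<in> J}"
   then have "aideal J" "y \<in> J" using y by auto
   then show "z \<in> J" using asetD[of J y z] z by (simp add: aideal_def)
  qed
 qed
 ultimately show ?thesis by (simp add: aideal_def gen_def)
qed

lemma gen_self: "x \<in> gen x" by (simp add: gen_def)

lemma gen_sub: "aideal J ==> x \<in> J ==> gen x \<subseteq> J" by (auto simp: gen_def)

text \<open>The largest \<A>-ideal inside I. Sums are handled by \<open>aset_add\<close>, and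
  general multiples by writing the factor as a sum of two units.\<close>

lemma aideal_core: "ideal I R ==> aideal {x \<in> I. cls x \<subseteq> I}"
proof -
 assume I: "ideal I R"
 note Ic = ideal_in[OF I]
 have add: "cls (x \<oplus> y) \<subseteq> I" if xy: "x \<in> I" "cls x \<subseteq> I" "y \<in> I" "cls y \<subseteq> I" for x y
 proof -
  have c: "x \<in> carrier R" "y \<in> carrier R" using xy Ic by auto
  have "aset (cls x <+>\<^bsub>R\<^esub> cls y)" using aset_add aset_cls c by blast
  moreover have "x \<oplus> y \<in> cls x <+>\<^bsub>R\<^esub> cls y" using cls_self c by (auto simp: set_add_def')
  ultimately have "cls (x \<oplus> y) \<subseteq> cls x <+>\<^bsub>R\<^esub> cls y" by (auto simp: aset_def)
  also have "\<dots> \<subseteq> I" using xy ideal_add[OF I] by (auto simp: set_add_def')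
  finally show ?thesis .
 qed
 have unit: "cls (u \<otimes> x) \<subseteq> I" if "u \<in> Units R" "x \<in> I" "cls x \<subseteq> I" for u x
  using that cls_mult[of u x] Ic ideal_mult[OF I] by (auto simp: Units_closed)
 have "ideal {x \<in> I. cls x \<subseteq> I} R"
 proof (rule idealI')
  show "r \<otimes> x \<in> {x \<in> I. cls x \<subseteq> I}" if rx: "r \<in> carrier R" "x \<in> {x \<in> I. cls x \<subseteq> I}" for r x
  proof -
   obtain u v where uv: "u \<in> Units R" "v \<in> Units R" "r = u \<oplus> v" using sum_of_units[OF rx(1)] by blast
   have x: "x \<in> I" "cls x \<subseteq> I" "x \<in> carrier R" using rx Ic by auto
   have "r \<otimes> x = u \<otimes> x \<oplus> v \<otimes> x" using uv x by (simp add: l_distr Units_closed)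
   then show ?thesis
    using add[of "u \<otimes> x" "v \<otimes> x"] unit uv x ideal_mult[OF I] ideal_add[OF I] by (simp add: Units_closed)
  qed
 qed (use Ic ideal_zero[OF I] cls_zero ideal_add[OF I] add in auto)
 moreover have "aset {x \<in> I. cls x \<subseteq> I}" using Ic cls_eq by (intro asetI) (auto, blast)
 ultimately show ?thesis by (simp add: aideal_def)
qed

text \<open>It suffices that a single basic set lies in I. This is how the inclusion in Schur's
  theorem produces a proper \<A>-ideal.\<close>

lemma gen_sub_ideal: "ideal I R ==> x \<in> carrier R ==> cls x \<subseteq> I ==> gen x \<subseteq> I"
 using gen_sub[OF aideal_core, of I x] cls_self[of x] by blast

definition stable :: "'a set \<Rightarrow> bool"
 where "stable X \<longleftrightarrow> (\<forall>u\<in>Units R. \<forall>x\<in>X. u \<otimes> x \<in> X)"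

lemma stableD: "stable X ==> u \<in> Units R ==> x \<in> X ==> u \<otimes> x \<in> X" by (simp add: stable_def)

lemma ideal_stable: "ideal I R ==> stable I" using ideal_mult by (auto simp: stable_def Units_closed)

lemma W_carrier: "x \<in> carrier R ==> W x \<subseteq> carrier R" using cls_in by (auto simp: W_def Units_closed)

lemma W_self: "x \<in> carrier R ==> x \<in> W x"
proof -
 assume x: "x \<in> carrier R"
 then have "\<one> \<otimes> x \<in> W x" unfolding W_def using cls_self by blast
 then show ?thesis using x by simp
qed

lemma cls_sub_W: "x \<in> carrier R ==> cls x \<subseteq> W x"
proof
 fix y assume x: "x \<in> carrier R" and y: "y \<in> cls x"
 then have "\<one> \<otimes> y \<in> W x" unfolding W_def by blast
 then show "y \<in> W x" using cls_in[OF x y] by simp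
qed

lemma W_aset: "x \<in> carrier R ==> aset (W x)"
proof (rule asetI)
 assume x: "x \<in> carrier R"
 fix y z assume "y \<in> W x" "z \<in> cls y"
 then obtain u y' where u: "u \<in> Units R" "y' \<in> cls x" "y = u \<otimes> y'" by (auto simp: W_def)
 then have "z \<in> (\<lambda>a. u \<otimes> a) ` cls x"
  using \<open>z \<in> cls y\<close> cls_mult[OF u(1) cls_in[OF x u(2)]] cls_eq[OF x u(2)] by simp
 then show "z \<in> W x" using u(1) by (auto simp: W_def)
qed (rule W_carrier)

lemma W_stable: "x \<in> carrier R ==> stable (W x)" unfolding stable_def W_def using cls_in
 by (auto simp: Units_closed) (metis Units_closed Units_m_closed m_assoc)

lemma W_least: "aset X ==> stable X ==> x \<in> X ==> W x \<subseteq> X" unfolding W_def stable_def using asetD by blast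

lemma W_cls:
 assumes "x \<in> carrier R" "y \<in> W x"
 obtains u where "u \<in> Units R" "cls y = (\<lambda>a. u \<otimes> a) ` cls x"
proof -
 obtain u y' where u: "u \<in> Units R" "y' \<in> cls x" "y = u \<otimes> y'" using assms(2) by (auto simp: W_def)
 then show ?thesis using that[of u] cls_mult[OF u(1) cls_in[OF assms(1) u(2)]] cls_eq[OF assms(1) u(2)] by simp
qed

lemma W_sym:
 assumes "x \<in> carrier R" "y \<in> W x"
 shows "x \<in> W y"
proof -
 obtain u y' where u: "u \<in> Units R" "y' \<in> cls x" "y = u \<otimes> y'" using assms(2) by (auto simp: W_def)
 have c: "y' \<in> carrier R" "y \<in> carrier R" using u cls_in[OF assms(1)] by auto
 have "y' = inv u \<otimes> y" using u c by simp
 then have "y' \<in> W y"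
  using stableD[OF W_stable[OF c(2)] Units_inv_Units[OF u(1)] W_self[OF c(2)]] by simp
 moreover have "x \<in> cls y'" using cls_eq[OF assms(1) u(2)] cls_self[OF assms(1)] by simp
 ultimately show ?thesis using W_aset[OF c(2)] asetD by blast
qed

lemma W_eq: "x \<in> carrier R ==> y \<in> W x ==> W y = W x"
 using W_sym W_least W_aset W_stable W_carrier by (meson subsetD subset_antisym)

lemma aideal_W: "aideal J ==> x \<in> carrier R ==> y \<in> W x ==> y \<in> J \<longleftrightarrow> x \<in> J"
 by (metis W_carrier W_least W_sym aideal_aset aideal_ideal ideal_stable subsetD)

definition rad :: "'a set \<Rightarrow> 'a set"
 where "rad X = {t \<in> carrier R. \<forall>x\<in>X. x \<oplus> t \<in> X}"

text \<open>An element belongs to \<open>rad X\<close> exactly if its overlap has the greatest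
  possible value \<open>card X\<close>, and overlaps are constant on basic sets.\<close>

lemma aset_rad: "aset X ==> aset (rad X)"
proof (rule asetI)
 assume X: "aset X"
 have *: "t \<in> rad X \<longleftrightarrow> overlap X t = card X" if "t \<in> carrier R" for t
 proof
  assume "overlap X t = card X"
  then have "{a \<in> X. a \<oplus> t \<in> X} = X" using aset_finite[OF X] by (intro card_subset_eq) auto
  then show "t \<in> rad X" using that by (auto simp: rad_def)
 next
  assume "t \<in> rad X"
  then have "{a \<in> X. a \<oplus> t \<in> X} = X" by (auto simp: rad_def)
  then show "overlap X t = card X" by simp
 qed
 fix s t assume s: "s \<in> rad X" "t \<in> cls s"
 then have sc: "s \<in> carrier R" by (simp add: rad_def)
 then have "overlap X t = card X" using *[OF sc] s(1) card_shift[OF X sc s(2)] by simp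
 then show "t \<in> rad X" using *[OF cls_in[OF sc s(2)]] by simp
qed (auto simp: rad_def)

lemma aideal_rad: "aset X ==> stable X ==> aideal (rad X)"
proof -
 assume X: "aset X" and st: "stable X"
 note Xc = aset_in[OF X]
 have add: "s \<oplus> t \<in> rad X" if "s \<in> rad X" "t \<in> rad X" for s t
  using that Xc by (auto simp: rad_def simp flip: a_assoc)
 have unit: "u \<otimes> t \<in> rad X" if ut: "u \<in> Units R" "t \<in> rad X" for u t
 proof -
  have "x \<oplus> u \<otimes> t \<in> X" if x: "x \<in> X" for x
  proof -
   have "inv u \<otimes> x \<oplus> t \<in> X" using ut st x stableD by (simp add: rad_def)
   then have "u \<otimes> (inv u \<otimes> x \<oplus> t) \<in> X" using st ut stableD by blast
   then show ?thesis using ut x Xc by (simp add: r_distr Units_closed rad_def)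
  qed
  then show ?thesis using ut by (simp add: rad_def Units_closed)
 qed
 have "ideal (rad X) R"
 proof (rule idealI')
  show "r \<otimes> x \<in> rad X" if rx: "r \<in> carrier R" "x \<in> rad X" for r x
  proof -
   obtain u v where uv: "u \<in> Units R" "v \<in> Units R" "r = u \<oplus> v" using sum_of_units[OF rx(1)] by blast
   have "x \<in> carrier R" using rx by (simp add: rad_def)
   then have "r \<otimes> x = u \<otimes> x \<oplus> v \<otimes> x" using uv by (simp add: l_distr Units_closed)
   then show ?thesis using add unit uv rx by simp
  qed
 qed (use add Xc in \<open>auto simp: rad_def\<close>)
 then show ?thesis using aset_rad[OF X] by (simp add: aideal_def)
qed

text \<open>The number of these lists is the coefficient of g in the m-th power of the simple
  quantity of Z. Lists are chosen so that \<open>rotate1\<close> can act on them.\<close>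

definition tuples :: "'a set \<Rightarrow> nat \<Rightarrow> 'a \<Rightarrow> 'a list set"
 where "tuples Z m g = {xs. length xs = m \<and> set xs \<subseteq> Z \<and> lsum xs = g}"

lemma finite_tuples: "finite Z ==> finite (tuples Z m g)"
 by (rule finite_subset[OF _ finite_lists_length_eq[of Z m]]) (auto simp: tuples_def)

lemma card_tuples_Suc:
 assumes "Z \<subseteq> carrier R" "g \<in> carrier R"
 shows "card (tuples Z (Suc m) g) = (\<Sum>a\<in>Z. card (tuples Z m (g \<ominus> a)))"
proof -
 have fZ: "finite Z" using assms(1) finite_subset by blast
 have iff: "lsum xs = g \<ominus> a \<longleftrightarrow> a \<oplus> lsum xs = g" if "a \<in> Z" "set xs \<subseteq> Z" for a xs
 proof -
  have "a \<in> carrier R" "lsum xs \<in> carrier R" using that assms(1) lsum_closed by blast+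
  then show ?thesis using assms(2) add_minus[of a g] add_minus_cancel[of a "lsum xs"] by metis
 qed
 have "tuples Z (Suc m) g = (\<Union>a\<in>Z. (\<lambda>xs. a # xs) ` tuples Z m (g \<ominus> a))"
 proof safe
  fix xs assume xs: "xs \<in> tuples Z (Suc m) g"
  then obtain a ys where "xs = a # ys" by (cases xs) (auto simp: tuples_def)
  then show "xs \<in> (\<Union>a\<in>Z. (\<lambda>xs. a # xs) ` tuples Z m (g \<ominus> a))"
   using xs iff by (auto simp: tuples_def)
 next
  fix a xs assume "a \<in> Z" "xs \<in> tuples Z m (g \<ominus> a)"
  then show "a # xs \<in> tuples Z (Suc m) g" using iff[of a xs] by (simp add: tuples_def)
 qed
 moreover have "card (\<Union>a\<in>Z. (\<lambda>xs. a # xs) ` tuples Z m (g \<ominus> a)) =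
   (\<Sum>a\<in>Z. card ((\<lambda>xs. a # xs) ` tuples Z m (g \<ominus> a)))"
  by (rule card_UN_disjoint) (use fZ finite_tuples in auto)
 ultimately show ?thesis by (simp add: card_image)
qed

lemma card_tuples_cls:
 assumes Z: "aset Z"
 shows "x \<in> carrier R ==> y \<in> cls x ==> card (tuples Z m y) = card (tuples Z m x)"
proof (induction m arbitrary: x y)
 case 0
 have "y = \<zero> \<longleftrightarrow> x = \<zero>" using 0 cls_zero cls_eq cls_self by (metis singletonD zero_closed)
 then have "tuples Z 0 y = tuples Z 0 x" by (auto simp: tuples_def)
 then show ?case by simp
next
 case (Suc m)
 have *: "int (card (tuples Z (Suc m) z)) =
   (\<Sum>a\<in>carrier R. of_bool (a \<in> Z) * int (card (tuples Z m (z \<ominus> a))))" if "z \<in> carrier R" for z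
 proof -
  have "(\<Sum>a\<in>carrier R. of_bool (a \<in> Z) * int (card (tuples Z m (z \<ominus> a)))) =
    (\<Sum>a\<in>Z. int (card (tuples Z m (z \<ominus> a))))"
   using aset_carrier[OF Z] by (intro sum.mono_neutral_cong_right) auto
  then show ?thesis using card_tuples_Suc[OF aset_carrier[OF Z] that] by simp
 qed
 have "int (card (tuples Z (Suc m) y)) = int (card (tuples Z (Suc m) x))"
  unfolding *[OF Suc.prems(1)] *[OF cls_in[OF Suc.prems]]
  by (rule cls_conv) (use Suc aset_cong[OF Z] in auto)
 then show ?case by simp
qed

lemma card_tuples_prime:
 assumes "Z \<subseteq> carrier R" "prime p"
 shows "[card (tuples Z p g) = card {z \<in> Z. num p \<otimes> z = g}] (mod p)"
proof -
 have fZ: "finite Z" using assms(1) finite_subset by blast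
 have p0: "p > 0" using assms(2) prime_gt_0_nat by blast
 have "[card (tuples Z p g) = card {xs \<in> tuples Z p g. rotate1 xs = xs}] (mod p)"
 proof (rule card_fixed_mod_prime)
  show "rotate1 xs \<in> tuples Z p g" if "xs \<in> tuples Z p g" for xs
   using that lsum_rotate1[of xs] assms(1) by (auto simp: tuples_def)
  show "(rotate1 ^^ p) xs = xs" if "xs \<in> tuples Z p g" for xs
   using that rotate_id[of p xs] by (simp add: tuples_def rotate_def)
 qed (use fZ finite_tuples assms in auto)
 also have "{xs \<in> tuples Z p g. rotate1 xs = xs} = replicate p ` {z \<in> Z. num p \<otimes> z = g}"
 proof safe
  fix xs assume xs: "xs \<in> tuples Z p g" "rotate1 xs = xs"
  then have ne: "xs \<noteq> []" using p0 by (auto simp: tuples_def)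
  then have "card (set xs) = 1" using rotate1_fixpoint_card[OF xs(2)] by blast
  then obtain z where z: "set xs = {z}" by (metis card_1_singletonE)
  then have "xs = replicate p z" using xs(1) replicate_eqI[of xs p z] by (simp add: tuples_def)
  moreover have "z \<in> Z" "num p \<otimes> z = g"
   using xs(1) z lsum_replicate[of z p] assms(1) \<open>xs = replicate p z\<close> by (auto simp: tuples_def)
  ultimately show "xs \<in> replicate p ` {z \<in> Z. num p \<otimes> z = g}" by blast
 next
  fix z assume z: "z \<in> Z" "g = num p \<otimes> z"
  then show "replicate p z \<in> tuples Z p (num p \<otimes> z)"
   using lsum_replicate[of z p] assms(1) by (auto simp: tuples_def)
  show "rotate1 (replicate p z) = replicate p z"
   by (cases p) (simp_all add: replicate_append_same)
 qed
 also have "card (replicate p ` {z \<in> Z. num p \<otimes> z = g}) = card {z \<in> Z. num p \<otimes> z = g}"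
  by (rule card_image, rule inj_onI) (use p0 in simp)
 finally show ?thesis .
qed

text \<open>
 Schur's theorem on multiples: modulo \<open>p\<close>, only the constant \<open>p\<close>-tuples contribute to the number of
 \<open>p\<close>-tuples in \<open>Z\<close> with a given sum, because rotation permutes the others in orbits of length \<open>p\<close>.
\<close>

lemma schur_prime:
 assumes Z: "aset Z" and p: "prime p" and x: "x \<in> Z"
  and nd: "\<not> p dvd card {z \<in> Z. num p \<otimes> z = num p \<otimes> x}"
 shows "cls (num p \<otimes> x) \<subseteq> (\<lambda>z. num p \<otimes> z) ` Z"
proof
 fix y assume y: "y \<in> cls (num p \<otimes> x)"
 have c: "num p \<otimes> x \<in> carrier R" using aset_in[OF Z x] by simp
 note tp = card_tuples_prime[OF aset_carrier[OF Z] p]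
 have "[card {z \<in> Z. num p \<otimes> z = y} = card {z \<in> Z. num p \<otimes> z = num p \<otimes> x}] (mod p)"
  using cong_trans[OF cong_sym[OF tp[of y]]] tp[of "num p \<otimes> x"] card_tuples_cls[OF Z c y, of p] by simp
 then have "\<not> p dvd card {z \<in> Z. num p \<otimes> z = y}" using nd cong_dvd_iff by blast
 then have "{z \<in> Z. num p \<otimes> z = y} \<noteq> {}" by (metis card.empty dvd_0_right)
 then show "y \<in> (\<lambda>z. num p \<otimes> z) ` Z" by blast
qed

text \<open>By \<open>add_tor\<close>, x + h can leave Z only if the p-component of x lies in
  \<open>tor p\<close>. The elements of Z with the same p-th multiple as x are then a translate of a
  subset T of \<open>tor p\<close>. This T is non-empty, not all of \<open>tor p\<close>, and stable
  under \<open>\<Gamma> p\<close>, which is transitive on the non-zero elements. So T is {0} or its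
  complement in \<open>tor p\<close>, and p divides neither cardinality.\<close>

lemma schur_\<Gamma>:
 assumes Z: "aset Z" and p: "p \<in> P" and inv: "\<And>g z. g \<in> \<Gamma> p ==> z \<in> Z ==> g \<otimes> z \<in> Z"
  and x: "x \<in> Z" and h: "h \<in> tor p" and xh: "x \<oplus> h \<notin> Z"
 shows "\<pi> {p} x \<in> tor p" "cls (num p \<otimes> x) \<subseteq> (\<lambda>z. num p \<otimes> z) ` Z"
proof -
 note xc = aset_in[OF Z x] and pp = P_prime[OF p]
 show xt: "\<pi> {p} x \<in> tor p" using add_tor[OF xc _ p h] inv x xh by metis
 let ?x0 = "\<pi> (- {p}) x"
 define T where "T = {k \<in> tor p. ?x0 \<oplus> k \<in> Z}"
 have T_iff: "k \<in> T \<longleftrightarrow> k \<in> tor p \<and> ?x0 \<oplus> k \<in> Z" for k by (simp add: T_def)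
 have x0: "?x0 \<oplus> \<pi> {p} x = x" using \<epsilon>_split[OF xc, of "{p}"] xc by (simp add: a_comm)
 have "?x0 \<oplus> (\<pi> {p} x \<oplus> h) = x \<oplus> h"
  using x0 xc tor_carrier[OF h] by (metis a_assoc \<epsilon>_closed m_closed)
 then have nfull: "\<pi> {p} x \<oplus> h \<in> tor p - T"
  using xh ideal_add[OF tor_ideal xt h] by (simp add: T_iff)
 have T1: "\<pi> {p} x \<in> T" using xt x x0 by (simp add: T_iff)
 have all: "k' \<in> T" if k: "k \<in> T" "k \<noteq> \<zero>" "k' \<in> tor p" "k' \<noteq> \<zero>" for k k'
 proof -
  obtain g where g: "g \<in> \<Gamma> p" "k' = g \<otimes> k" using tor_trans[OF p _ k(3,2,4)] k(1) by (auto simp: T_iff)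
  have kc: "k \<in> carrier R" using k(1) tor_carrier[of k p] by (simp add: T_iff)
  have gc: "g \<in> carrier R" using g(1) \<Gamma>_Units by blast
  have "g \<otimes> ?x0 = ?x0"
  proof -
   have "g \<otimes> ?x0 = \<pi> (- {p}) g \<otimes> x" using gc xc by (simp add: m_ac)
   then show ?thesis using g(1) by (simp add: \<Gamma>_def)
  qed
  then have "g \<otimes> (?x0 \<oplus> k) = ?x0 \<oplus> k'" using g gc kc xc by (simp add: r_distr)
  then show ?thesis using inv[OF g(1), of "?x0 \<oplus> k"] k by (simp add: T_iff)
 qed
 have fT: "finite (tor p)" by (simp add: tor_def)
 have "T = {\<zero>} \<or> T = tor p - {\<zero>}"
 proof (cases "\<exists>k\<in>T. k \<noteq> \<zero>")
  case True
  then obtain k where k: "k \<in> T" "k \<noteq> \<zero>" by blast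
  have "T \<subseteq> tor p" by (auto simp: T_iff)
  moreover have "tor p - {\<zero>} \<subseteq> T" using all[OF k] by auto
  moreover from this have "\<zero> \<notin> T" using nfull by auto
  ultimately have "T = tor p - {\<zero>}" by auto
  then show ?thesis ..
 next
  case False
  then have "T \<subseteq> {\<zero>}" by auto
  then show ?thesis using T1 by (metis empty_iff subset_singletonD)
 qed
 \<comment> \<open>Here p divides the order of \<open>tor p\<close>, hence not that number minus
   one.\<close>
 then have nd: "\<not> p dvd card T"
 proof
  assume "T = tor p - {\<zero>}"
  then have c: "card T + 1 = card (tor p)"
   using fT ideal_zero[OF tor_ideal, of p] card.remove[of "tor p" \<zero>] by simp
  show ?thesis
  proof
   assume "p dvd card T"
   then have "p dvd 1" using card_tor[OF p] c by (metis dvd_add_right_iff)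
   then show False using pp by simp
  qed
 qed (use pp in auto)
 have "card {z \<in> Z. num p \<otimes> z = num p \<otimes> x} = card T"
 proof (rule bij_betw_same_card[of "\<lambda>z. z \<ominus> ?x0"], rule bij_betw_imageI)
  show "inj_on (\<lambda>z. z \<ominus> ?x0) {z \<in> Z. num p \<otimes> z = num p \<otimes> x}"
   using aset_in[OF Z] xc by (auto intro!: inj_onI simp: a_minus_def)
  have px: "num p \<otimes> x = num p \<otimes> ?x0"
  proof -
   have "num p \<otimes> x = num p \<otimes> (?x0 \<oplus> \<pi> {p} x)" using x0 by simp
   then show ?thesis using xt xc by (simp add: r_distr tor_def)
  qed
  show "(\<lambda>z. z \<ominus> ?x0) ` {z \<in> Z. num p \<otimes> z = num p \<otimes> x} = T"
  proof safe
   fix z assume z: "z \<in> Z" "num p \<otimes> z = num p \<otimes> x"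
   have zc: "z \<in> carrier R" using aset_in[OF Z z(1)] .
   have "z \<ominus> ?x0 \<in> tor p" using z px zc xc
    by (simp add: tor_def a_minus_def r_distr r_minus r_neg)
   moreover have "?x0 \<oplus> (z \<ominus> ?x0) \<in> Z" using z zc xc by (simp add: add_minus)
   ultimately show "z \<ominus> ?x0 \<in> T" by (simp add: T_iff)
  next
   fix k assume "k \<in> T"
   then have k: "k \<in> tor p" "?x0 \<oplus> k \<in> Z" by (auto simp: T_iff)
   have kc: "k \<in> carrier R" using k tor_carrier by blast
   have "k = (?x0 \<oplus> k) \<ominus> ?x0" using kc xc by (simp add: add_minus_cancel)
   moreover have "num p \<otimes> (?x0 \<oplus> k) = num p \<otimes> x" using k xc px by (simp add: r_distr tor_def)
   ultimately show "k \<in> (\<lambda>z. z \<ominus> ?x0) ` {z \<in> Z. num p \<otimes> z = num p \<otimes> x}" using k by blast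
  qed
 qed
 then show "cls (num p \<otimes> x) \<subseteq> (\<lambda>z. num p \<otimes> z) ` Z" using schur_prime[OF Z pp x] nd by simp
qed

end

text \<open>The bound for \<open>W_eq_min\<close>: w is the size of W x, n that of U, c the number
  of points of W x in a coset of U, l the overlap for a non-zero element of U, and b the number of
  points lost by that translation. From b c \<le> w one gets l c \<ge> w (c - 1) = (n - 1) l, and l
  is non-zero because c \<ge> 2.\<close>

lemma count_arith:
 fixes w n l c b :: nat
 assumes "w + (n - 1) * l = w * c" "l + b = w" "b * c \<le> w" "c \<ge> 2" "w > 0" "n \<ge> 1"
 shows "c \<ge> n - 1"
proof -
 obtain m where n: "n = Suc m" using assms(6) by (cases n) auto
 obtain d where c: "c = Suc d" "d > 0" using assms(4) by (cases c) auto
 have 1: "m * l = w * d" using assms(1) by (simp add: n c)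
 have "l * c + b * c = w * c" using assms(2) by (simp flip: add_mult_distrib)
 then have "l * c \<ge> w * d" using assms(3) by (simp add: c)
 then have "m * (w * d) \<le> m * (l * c)" by (rule mult_le_mono2)
 also have "\<dots> = (w * d) * c" using 1 by (metis mult.assoc)
 finally have "(w * d) * m \<le> (w * d) * c" by simp
 then show ?thesis using assms(5) c(2) by (simp add: n)
qed

lemma set_addI: "a \<in> X ==> b \<in> Y ==> a \<oplus>\<^bsub>R\<^esub> b \<in> X <+>\<^bsub>R\<^esub> Y" by (auto simp: set_add_def')

context cg_ring
begin

lemma double_zero: "x \<in> carrier R ==> x \<oplus> x = \<zero> ==> x = \<zero>"
proof -
 assume x: "x \<in> carrier R" "x \<oplus> x = \<zero>"
 obtain c where c: "order R = 2 * c + 1" using odd_order by (metis oddE)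
 have two: "num 2 \<otimes> x = \<zero>" using x num_add[of 1 1] by (simp add: l_distr numeral_2_eq_2)
 have "\<zero> = num (order R) \<otimes> x" using x by (simp add: num_order)
 also have "\<dots> = num c \<otimes> (num 2 \<otimes> x) \<oplus> x" unfolding c using x num_add[of "c * 2" 1]
  by (simp add: num_mult[of c 2] l_distr m_assoc mult.commute[of 2 c])
 finally show ?thesis using x two by simp
qed

lemma ideal_num_mult: "ideal J R ==> ideal ((\<lambda>x. num p \<otimes> x) ` J) R"
proof (rule idealI')
 assume J: "ideal J R"
 note Jc = ideal_in[OF J]
 show "(\<lambda>x. num p \<otimes> x) ` J \<subseteq> carrier R" using Jc by auto
 show "\<zero> \<in> (\<lambda>x. num p \<otimes> x) ` J" by (rule image_eqI[of _ _ \<zero>]) (use ideal_zero[OF J] in auto)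
 show "x \<oplus> y \<in> (\<lambda>x. num p \<otimes> x) ` J"
  if xy: "x \<in> (\<lambda>x. num p \<otimes> x) ` J" "y \<in> (\<lambda>x. num p \<otimes> x) ` J" for x y
 proof -
  obtain a b where "a \<in> J" "b \<in> J" "x = num p \<otimes> a" "y = num p \<otimes> b" using xy by blast
  then show ?thesis using Jc ideal_add[OF J] by (intro image_eqI[of _ _ "a \<oplus> b"]) (auto simp: r_distr)
 qed
 show "r \<otimes> x \<in> (\<lambda>x. num p \<otimes> x) ` J" if rx: "r \<in> carrier R" "x \<in> (\<lambda>x. num p \<otimes> x) ` J" for r x
 proof -
  obtain a where "a \<in> J" "x = num p \<otimes> a" using rx by blast
  then show ?thesis using rx(1) Jc ideal_mult[OF J] by (intro image_eqI[of _ _ "r \<otimes> a"]) (auto simp: m_lcomm)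
 qed
qed

text \<open>Multiplication by p has a non-trivial kernel on the finite set J, so it is not
  onto.\<close>

lemma num_mult_proper:
 assumes J: "ideal J R" and p: "p \<in> P" and t: "tor p \<subseteq> J"
 shows "(\<lambda>x. num p \<otimes> x) ` J \<subset> J"
proof -
 have fJ: "finite J" using ideal_sub[OF J] finite_subset by blast
 have "(\<lambda>x. num p \<otimes> x) ` J \<noteq> J"
 proof
  assume e: "(\<lambda>x. num p \<otimes> x) ` J = J"
  then have inj: "inj_on (\<lambda>x. num p \<otimes> x) J" using fJ by (simp add: eq_card_imp_inj_on)
  obtain h where h: "h \<in> tor p" "h \<noteq> \<zero>" using tor_nontrivial[OF p] by blast
  then have "num p \<otimes> h = num p \<otimes> \<zero>" by (simp add: tor_def)
  then show False using inj_onD[OF inj, of h \<zero>] h t ideal_zero[OF J] by auto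
 qed
 then show ?thesis using ideal_mult[OF J] by auto
qed

lemma nonzero_prime:
 assumes "x \<in> carrier R" "x \<noteq> \<zero>"
 obtains p where "p \<in> P" "\<pi> {p} x \<noteq> \<zero>" using eqI_primes[of x \<zero>] assms by auto

lemma \<Gamma>_fix:
 assumes "g \<in> \<Gamma> p" "m \<in> carrier R" "\<pi> {p} m = \<zero>"
 shows "g \<otimes> m = m"
proof -
 have gc: "g \<in> carrier R" using assms(1) \<Gamma>_Units by blast
 have m: "m = \<pi> (- {p}) m" using \<epsilon>_split[OF assms(2), of "{p}"] assms by simp
 have "g \<otimes> \<pi> (- {p}) m = \<pi> (- {p}) g \<otimes> m" using gc assms(2) by (simp add: m_ac)
 then show ?thesis using assms(1) m by (simp add: \<Gamma>_def)
qed

end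

section \<open>Minimal and maximal \<A>-ideals, and the counting step of the induction\<close>

context cg_sring
begin

definition min_aideal :: "'a set \<Rightarrow> bool"
 where "min_aideal U \<longleftrightarrow> aideal U \<and> U \<noteq> {\<zero>} \<and> (\<forall>J. aideal J \<and> J \<subseteq> U \<longrightarrow> J = {\<zero>} \<or> J = U)"

definition max_aideal :: "'a set \<Rightarrow> 'a set \<Rightarrow> bool"
 where "max_aideal J M \<longleftrightarrow> aideal M \<and> M \<subset> J \<and> (\<forall>I. aideal I \<and> M \<subseteq> I \<and> I \<subseteq> J \<longrightarrow> I = M \<or> I = J)"

lemma max_aideal_exists:
 assumes "aideal I" "I \<subset> J"
 obtains M where "max_aideal J M" "I \<subseteq> M"
proof -
 let ?S = "{M. aideal M \<and> M \<subset> J}"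
 have "finite ?S" using aideal_finite by (rule rev_finite_subset) auto
 moreover have "I \<in> ?S" using assms by simp
 ultimately have "\<exists>M\<in>?S. I \<subseteq> M \<and> (\<forall>N\<in>?S. M \<subseteq> N \<longrightarrow> M = N)" by (rule finite_has_maximal2)
 then obtain M where M: "aideal M" "M \<subset> J" "I \<subseteq> M" "\<forall>N\<in>?S. M \<subseteq> N \<longrightarrow> M = N" by blast
 have "max_aideal J M" unfolding max_aideal_def
 proof (intro conjI allI impI M)
  fix N assume N: "aideal N \<and> M \<subseteq> N \<and> N \<subseteq> J"
  show "N = M \<or> N = J" using N M(4) by auto
 qed
 then show ?thesis using that M(3) by blast
qed

lemma min_aideal_sub: "min_aideal U ==> aideal J ==> x \<in> J ==> x \<in> U ==> x \<noteq> \<zero> ==> U \<subseteq> J"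
 unfolding min_aideal_def using aideal_Int[of U J] by blast

text \<open>The non-zero elements of a minimal \<A>-ideal form a single W. Otherwise W x avoids
  \<open>tor p\<close>. If a translation by \<open>tor p\<close> moved z out of W x, then p z would
  generate an \<A>-ideal inside p U, hence zero, and z would lie in \<open>tor p\<close>. So U would
  be contained in \<open>rad (W x)\<close>, and x - x would lie in W x.\<close>

lemma prim_W:
 assumes U: "min_aideal U" and p: "p \<in> P" and pU: "tor p \<subseteq> U"
  and x: "x \<in> U" "x \<noteq> \<zero>" and h: "h \<in> tor p" "h \<noteq> \<zero>"
 shows "x \<in> W h"
proof (rule ccontr)
 assume n: "x \<notin> W h"
 have aU: "aideal U" using U by (simp add: min_aideal_def)
 note iU = aideal_ideal[OF aU] and hc = tor_carrier[OF h(1)]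
 have xc: "x \<in> carrier R" using ideal_in[OF iU x(1)] .
 let ?Z = "W x"
 have ZU: "?Z \<subseteq> U" using W_least[OF aideal_aset[OF aU] ideal_stable[OF iU] x(1)] .
 have Z0: "\<zero> \<notin> ?Z" using aideal_W[OF aideal_zero xc, of \<zero>] x by auto
 have Zt: "k \<notin> tor p" if k: "k \<in> ?Z" for k
 proof
  assume kt: "k \<in> tor p"
  have "k \<noteq> \<zero>" using k Z0 by auto
  then obtain g where g: "g \<in> \<Gamma> p" "k = g \<otimes> h" using tor_trans[OF p h(1) kt h(2)] by blast
  then have "k \<in> W h" using stableD[OF W_stable[OF hc] \<Gamma>_Units[OF g(1)] W_self[OF hc]] by simp
  then have "W h = W x" using W_eq[OF hc] W_eq[OF xc k] by simp
  then show False using n W_self[OF xc] by simp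
 qed
 have "tor p \<subseteq> rad ?Z"
 proof
  fix k assume k: "k \<in> tor p"
  have "z \<oplus> k \<in> ?Z" if z: "z \<in> ?Z" for z
  proof (rule ccontr)
   assume "z \<oplus> k \<notin> ?Z"
   then have c: "cls (num p \<otimes> z) \<subseteq> (\<lambda>z. num p \<otimes> z) ` ?Z"
    using schur_\<Gamma>(2)[OF W_aset[OF xc] p _ z k] stableD[OF W_stable[OF xc]] \<Gamma>_Units by blast
   have zc: "z \<in> carrier R" using z W_carrier[OF xc] by blast
   have "gen (num p \<otimes> z) \<subseteq> (\<lambda>z. num p \<otimes> z) ` U"
    by (rule gen_sub_ideal[OF ideal_num_mult[OF iU]]) (use c ZU zc in auto)
   then have "gen (num p \<otimes> z) \<subset> U" using num_mult_proper[OF iU p pU] by blast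
   then have "gen (num p \<otimes> z) = {\<zero>}"
    using U gen_aideal[of "num p \<otimes> z"] zc unfolding min_aideal_def by auto
   then have "num p \<otimes> z = \<zero>" using gen_self[of "num p \<otimes> z"] by blast
   then show False using Zt[OF z] zc by (simp add: tor_def)
  qed
  then show "k \<in> rad ?Z" using tor_carrier[OF k] by (simp add: rad_def)
 qed
 then have "U \<subseteq> rad ?Z"
  using min_aideal_sub[OF U aideal_rad[OF W_aset[OF xc] W_stable[OF xc]], of h] h pU by blast
 then have "x \<oplus> \<ominus> x \<in> ?Z" using ideal_neg[OF iU x(1)] W_self[OF xc] by (auto simp: rad_def)
 then show False using Z0 xc by (simp add: r_neg)
qed

lemma card_shift_unit:
 assumes X: "aset X" and u: "u \<in> Units R" and t: "t \<in> carrier R"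
 shows "overlap X t =
  card {a \<in> (\<lambda>x. u \<otimes> x) ` X. a \<oplus> u \<otimes> t \<in> (\<lambda>x. u \<otimes> x) ` X}"
proof (rule bij_betw_same_card[of "\<lambda>a. u \<otimes> a"], rule bij_betw_imageI)
 note Xc = aset_in[OF X] and uc = Units_closed[OF u]
 have inj: "inj_on (\<lambda>a. u \<otimes> a) (carrier R)" using u by (intro inj_onI) simp
 show "inj_on (\<lambda>a. u \<otimes> a) {a \<in> X. a \<oplus> t \<in> X}" using Xc by (intro inj_on_subset[OF inj]) auto
 have *: "u \<otimes> a \<oplus> u \<otimes> t \<in> (\<lambda>x. u \<otimes> x) ` X \<longleftrightarrow> a \<oplus> t \<in> X" if "a \<in> X" for a
 proof -
  have "u \<otimes> a \<oplus> u \<otimes> t = u \<otimes> (a \<oplus> t)" using that Xc uc t by (simp add: r_distr)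
  then show ?thesis using inj_on_image_mem_iff[OF inj, of "a \<oplus> t" X] that Xc t aset_carrier[OF X] by simp
 qed
 show "(\<lambda>a. u \<otimes> a) ` {a \<in> X. a \<oplus> t \<in> X} = {a \<in> (\<lambda>x. u \<otimes> x) ` X. a \<oplus> u \<otimes> t \<in> (\<lambda>x. u \<otimes> x) ` X}"
  using * by auto
qed

lemma stable_image: "aset X ==> stable X ==> u \<in> Units R ==> (\<lambda>x. u \<otimes> x) ` X = X"
proof
 assume X: "aset X" "stable X" "u \<in> Units R"
 show "X \<subseteq> (\<lambda>x. u \<otimes> x) ` X"
 proof
  fix x assume x: "x \<in> X"
  then show "x \<in> (\<lambda>x. u \<otimes> x) ` X"
   using stableD[OF X(2) _ x, of "inv u"] X aset_in[OF X(1) x] by (intro image_eqI[of _ _ "inv u \<otimes> x"]) auto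
 qed
qed (auto simp: stable_def)

lemma card_shift_W:
 assumes X: "aset X" and st: "stable X" and t: "t \<in> carrier R" and s: "s \<in> W t"
 shows "overlap X s = overlap X t"
proof -
 obtain u y where u: "u \<in> Units R" "y \<in> cls t" "s = u \<otimes> y" using s by (auto simp: W_def)
 have "overlap X s = overlap X y"
  using card_shift_unit[OF X u(1) cls_in[OF t u(2)]] stable_image[OF X st u(1)] u(3) by simp
 then show ?thesis using card_shift[OF X t u(2)] by simp
qed

lemma card_coset_cls:
 assumes X: "aset X" and J: "aideal J" and x: "x \<in> carrier R" and y: "y \<in> cls x"
 shows "hits J y X = hits J x X"
proof -
 note iJ = aideal_ideal[OF J]
 have *: "hits J z X = card {a \<in> X. z \<ominus> a \<in> J}" if z: "z \<in> carrier R" for z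
 proof (rule bij_betw_same_card[of "\<lambda>t. z \<oplus> t"], rule bij_betw_imageI)
  show "inj_on (\<lambda>t. z \<oplus> t) {t \<in> J. z \<oplus> t \<in> X}" using z ideal_in[OF iJ] by (auto intro!: inj_onI)
  show "(\<lambda>t. z \<oplus> t) ` {t \<in> J. z \<oplus> t \<in> X} = {a \<in> X. z \<ominus> a \<in> J}"
  proof safe
   fix t assume t: "t \<in> J"
   have "z \<ominus> (z \<oplus> t) = \<ominus> t"
    using z ideal_in[OF iJ t] by (simp add: a_minus_def minus_add r_neg1 r_neg flip: a_assoc)
   then show "z \<ominus> (z \<oplus> t) \<in> J" using ideal_neg[OF iJ t] by simp
  next
   fix a assume a: "a \<in> X" "z \<ominus> a \<in> J"
   have ac: "a \<in> carrier R" using aset_in[OF X a(1)] .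
   have "a \<ominus> z = \<ominus> (z \<ominus> a)" using z ac by (simp add: a_minus_def minus_add a_comm)
   then have "a \<ominus> z \<in> J" using ideal_neg[OF iJ a(2)] by simp
   then show "a \<in> (\<lambda>t. z \<oplus> t) ` {t \<in> J. z \<oplus> t \<in> X}"
    using z ac a(1) add_minus[of z a] by (intro image_eqI[of _ _ "a \<ominus> z"]) auto
  qed
 qed
 show ?thesis using *[OF x] *[OF cls_in[OF x y]] card_conv[OF X aideal_aset[OF J] x y] by simp
qed

lemma card_coset_unit:
 assumes X: "X \<subseteq> carrier R" and J: "ideal J R" and u: "u \<in> Units R" and x: "x \<in> carrier R"
 shows "hits J (u \<otimes> x) ((\<lambda>a. u \<otimes> a) ` X) = hits J x X"
proof (rule bij_betw_same_card[symmetric, of "\<lambda>t. u \<otimes> t"], rule bij_betw_imageI)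
 note Jc = ideal_in[OF J] and uc = Units_closed[OF u]
 have inj: "inj_on (\<lambda>a. u \<otimes> a) (carrier R)" using u by (intro inj_onI) simp
 show "inj_on (\<lambda>a. u \<otimes> a) {t \<in> J. x \<oplus> t \<in> X}" using Jc by (intro inj_on_subset[OF inj]) auto
 have *: "u \<otimes> x \<oplus> u \<otimes> t \<in> (\<lambda>x. u \<otimes> x) ` X \<longleftrightarrow> x \<oplus> t \<in> X" if "t \<in> J" for t
 proof -
  have "u \<otimes> x \<oplus> u \<otimes> t = u \<otimes> (x \<oplus> t)" using that Jc uc x by (simp add: r_distr)
  then show ?thesis using inj_on_image_mem_iff[OF inj, of "x \<oplus> t" X] that Jc x X by simp
 qed
 show "(\<lambda>t. u \<otimes> t) ` {t \<in> J. x \<oplus> t \<in> X} = {t \<in> J. u \<otimes> x \<oplus> t \<in> (\<lambda>a. u \<otimes> a) ` X}"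
 proof safe
  fix t assume t: "t \<in> J" "x \<oplus> t \<in> X"
  then show "u \<otimes> t \<in> J" "u \<otimes> x \<oplus> u \<otimes> t \<in> (\<lambda>x. u \<otimes> x) ` X" using * ideal_mult[OF J] uc by auto
 next
  fix t a assume t: "t \<in> J" "u \<otimes> x \<oplus> t = u \<otimes> a" "a \<in> X"
  have i: "inv u \<otimes> t \<in> J" "u \<otimes> (inv u \<otimes> t) = t" using t u ideal_mult[OF J] Jc by auto
  then have "x \<oplus> inv u \<otimes> t \<in> X" using *[of "inv u \<otimes> t"] t by auto
  then show "t \<in> (\<lambda>t. u \<otimes> t) ` {t \<in> J. x \<oplus> t \<in> X}" using i by (intro image_eqI[of _ _ "inv u \<otimes> t"]) auto
 qed
qed

lemma card_coset_W:
 assumes X: "aset X" and st: "stable X" and J: "aideal J" and x: "x \<in> carrier R" and y: "y \<in> W x"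
 shows "hits J y X = hits J x X"
proof -
 obtain u z where u: "u \<in> Units R" "z \<in> cls x" "y = u \<otimes> z" using y by (auto simp: W_def)
 have "hits J y X = hits J z X"
  using card_coset_unit[OF aset_carrier[OF X] aideal_ideal[OF J] u(1) cls_in[OF x u(2)]]
   stable_image[OF X st u(1)] u(3) by simp
 then show ?thesis using card_coset_cls[OF X J x u(2)] by simp
qed

lemma sum_shift_coset:
 assumes "finite X" "finite J"
 shows "(\<Sum>t\<in>J. overlap X t) = (\<Sum>a\<in>X. hits J a X)"
proof -
 have "(\<Sum>t\<in>J. overlap X t) = (\<Sum>t\<in>J. \<Sum>a\<in>X. of_bool (a \<oplus> t \<in> X))"
  using assms by (intro sum.cong refl) (simp add: Int_def)
 also have "\<dots> = (\<Sum>a\<in>X. \<Sum>t\<in>J. of_bool (a \<oplus> t \<in> X))" by (rule sum.swap)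
 also have "\<dots> = (\<Sum>a\<in>X. hits J a X)" using assms by (intro sum.cong refl) (simp add: Int_def)
 finally show ?thesis .
qed

text \<open>Schur's theorem puts p a into an \<A>-ideal inside p times \<open>gen x\<close>, a
  proper part of \<open>gen x\<close>; M is maximal above it. If M had an element with non-zero
  p-component, it would contain \<open>tor p\<close> and so the p-component of a. The other
  components of a are in M because p a is and p is invertible there. But W x does not meet
  M.\<close>

lemma W_max_aideal:
 assumes x: "x \<in> carrier R" and p: "p \<in> P" and pJ: "tor p \<subseteq> gen x"
  and a: "a \<in> W x" and k: "k \<in> tor p" and ak: "a \<oplus> k \<notin> W x"
 obtains M where "max_aideal (gen x) M" "num p \<otimes> a \<in> M" "\<And>m. m \<in> M ==> \<pi> {p} m = \<zero>"
  "\<pi> {p} a \<in> tor p"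
proof -
 note iJ = aideal_ideal[OF gen_aideal[OF x]] and Z = W_aset[OF x] W_stable[OF x]
 have ac: "a \<in> carrier R" using a W_carrier[OF x] by blast
 have inv: "g \<otimes> z \<in> W x" if "g \<in> \<Gamma> p" "z \<in> W x" for g z
  using stableD[OF Z(2) \<Gamma>_Units[OF that(1)] that(2)] .
 have ZJ: "W x \<subseteq> gen x"
  using W_least[OF aideal_aset[OF gen_aideal[OF x]] ideal_stable[OF iJ] gen_self] .
 have ea: "\<pi> {p} a \<in> tor p" and c: "cls (num p \<otimes> a) \<subseteq> (\<lambda>z. num p \<otimes> z) ` W x"
  using schur_\<Gamma>[OF Z(1) p inv a k ak] by auto
 have pa: "num p \<otimes> a \<in> carrier R" using ac by simp
 have "gen (num p \<otimes> a) \<subseteq> (\<lambda>z. num p \<otimes> z) ` gen x"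
  by (rule gen_sub_ideal[OF ideal_num_mult[OF iJ] pa]) (use c ZJ in blast)
 then have "gen (num p \<otimes> a) \<subset> gen x" using num_mult_proper[OF iJ p pJ] by blast
 then obtain M where M: "max_aideal (gen x) M" "gen (num p \<otimes> a) \<subseteq> M"
  using max_aideal_exists[OF gen_aideal[OF pa]] by blast
 have aM: "aideal M" "M \<subset> gen x" using M(1) by (auto simp: max_aideal_def)
 note iM = aideal_ideal[OF aM(1)]
 have pM: "num p \<otimes> a \<in> M" using M(2) gen_self by blast
 have "a \<notin> M" using aideal_W[OF aM(1) x a] gen_sub[OF aM(1), of x] aM(2) by blast
 moreover have "a \<in> M" if m: "m \<in> M" "\<pi> {p} m \<noteq> \<zero>" for m
 using tor_sub_ideal[OF iM m p] ea ideal_off[OF P_prime[OF p] iM ac pM] \<epsilon>_split[OF ac, of "{p}"] ideal_add[OF iM]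
  by fastforce
 ultimately show ?thesis using that[OF M(1) pM _ ea] by blast
qed

text \<open>The induction step for a minimal \<A>-ideal U. If y is not in W x, translations by U do
  not preserve W x, and J = \<open>gen x\<close> is the direct sum of U and a maximal \<A>-ideal M
  with zero p-component. Points of W x lost under translation by h land in M, so each coset of U
  contains at most one of them, and counting gives at least \<open>card U - 1\<close> points of W x
  in each coset that it meets. But w + U misses two points: its point in M, and y.\<close>

lemma W_eq_min:
 assumes U: "min_aideal U" and x: "x \<in> carrier R" and y: "y \<in> carrier R"
  and same: "\<And>J. aideal J ==> x \<in> J \<longleftrightarrow> y \<in> J" and yin: "y \<in> W x <+>\<^bsub>R\<^esub> U"
 shows "y \<in> W x"
proof (rule ccontr)
 assume n: "y \<notin> W x"
 have aU: "aideal U" using U by (simp add: min_aideal_def)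
 note iU = aideal_ideal[OF aU]
 note Uc = ideal_in[OF iU]
 define J where "J = gen x"
 have aJ: "aideal J" unfolding J_def by (rule gen_aideal[OF x])
 note iJ = aideal_ideal[OF aJ] and Z = W_aset[OF x] W_stable[OF x]
 have Zc: "a \<in> carrier R" if "a \<in> W x" for a using that W_carrier[OF x] by blast
 have xJ: "x \<in> J" unfolding J_def by (rule gen_self)
 have WJ: "W x \<subseteq> J" using W_least[OF aideal_aset[OF aJ] ideal_stable[OF iJ] xJ] .
 obtain w where w: "w \<in> W x" "y \<ominus> w \<in> U"
  using yin set_add_iff[OF W_carrier[OF x] ideal_sub[OF iU]] by blast
 note wc = Zc[OF w(1)]
 have yJ: "y \<in> J" using same[OF aJ] xJ by simp
 have nz: "y \<ominus> w \<noteq> \<zero>" using n w(1) y wc by auto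
 have yw: "w \<oplus> (y \<ominus> w) = y" using y wc by (rule add_minus[rotated])
 have UJ: "U \<subseteq> J"
  by (rule min_aideal_sub[OF U aJ _ w(2) nz]) (use ideal_minus[OF iJ yJ] w(1) WJ in blast)
 have nrad: "t = \<zero>" if t: "t \<in> rad (W x)" "t \<in> U" for t
 proof (rule ccontr)
  assume "t \<noteq> \<zero>"
  then have "U \<subseteq> rad (W x)" using min_aideal_sub[OF U aideal_rad[OF Z]] t by blast
  then have "y \<ominus> w \<in> rad (W x)" using w(2) by blast
  then have "w \<oplus> (y \<ominus> w) \<in> W x" using w(1) unfolding rad_def by blast
  then show False using n yw by simp
 qed
 obtain p where p: "p \<in> P" "\<pi> {p} (y \<ominus> w) \<noteq> \<zero>" using nonzero_prime[OF _ nz] y wc by auto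
 have pU: "tor p \<subseteq> U" using tor_sub_ideal[OF iU w(2) p(2,1)] .
 obtain h where h: "h \<in> tor p" "h \<noteq> \<zero>" using tor_nontrivial[OF p(1)] by blast
 note hc = tor_carrier[OF h(1)] and pp = P_prime[OF p(1)]
 have pJ: "tor p \<subseteq> gen x" using pU UJ by (simp add: J_def)
 have hU: "h \<in> U" using h pU by blast
 obtain x1 where x1: "x1 \<in> W x" "x1 \<oplus> h \<notin> W x" using nrad[of h] h hU hc by (auto simp: rad_def)
 obtain M where M: "max_aideal J M" and Mp: "\<And>m. m \<in> M ==> \<pi> {p} m = \<zero>"
  using W_max_aideal[OF x p(1) pJ x1(1) h(1) x1(2)] unfolding J_def by metis
 have aM: "aideal M" "M \<subset> J" using M by (auto simp: max_aideal_def)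
 note iM = aideal_ideal[OF aM(1)]
 note Mc = ideal_in[OF iM]
 have hM: "h \<notin> M" using Mp[of h] tor_\<epsilon>[OF pp h(1)] h by auto
 have UM: "t = \<zero>" if "t \<in> U" "t \<in> M" for t
 proof (rule ccontr)
  assume "t \<noteq> \<zero>"
  then have "U \<subseteq> M" using min_aideal_sub[OF U aM(1)] that by blast
  then show False using hU hM by blast
 qed
 have sumJ: "I <+>\<^bsub>R\<^esub> M = J" if I: "aideal I" "I \<subseteq> J" "t \<in> I" "t \<notin> M" for I t
 proof -
  note iI = aideal_ideal[OF I(1)]
  have "aideal (I <+>\<^bsub>R\<^esub> M)" using aideal_add I aM by blast
  moreover have "m \<in> I <+>\<^bsub>R\<^esub> M" if "m \<in> M" for m
   using set_addI[OF ideal_zero[OF iI] that, of R] Mc[OF that] by simp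
  moreover have "t \<in> I <+>\<^bsub>R\<^esub> M"
   using set_addI[OF I(3) ideal_zero[OF iM], of R] ideal_in[OF iI I(3)] by simp
  moreover have "I <+>\<^bsub>R\<^esub> M \<subseteq> J" using I(2) aM(2) ideal_add[OF iJ] unfolding set_add_def' by auto
  ultimately show ?thesis using M I(4) unfolding max_aideal_def by blast
 qed
 \<comment> \<open>\<open>W_max_aideal\<close> may give different ideals at different points. Two of
   them would have sum J, whose element h has a non-zero p-component.\<close>
 have uniq: "M' = M" if M': "max_aideal J M'" "\<And>m. m \<in> M' ==> \<pi> {p} m = \<zero>" for M'
 proof (rule ccontr)
  assume ne: "M' \<noteq> M"
  have aM': "aideal M'" "M' \<subset> J" using M'(1) by (auto simp: max_aideal_def)
  have "\<not> M' \<subseteq> M" using M'(1) aM ne unfolding max_aideal_def by blast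
  then obtain t where "t \<in> M'" "t \<notin> M" by blast
  then have "M' <+>\<^bsub>R\<^esub> M = J" using sumJ aM' by blast
  moreover have "h \<in> J" using hU UJ by blast
  ultimately obtain a b where ab: "a \<in> M'" "b \<in> M" "h = a \<oplus> b" by (auto simp: set_add_def')
  then have "\<pi> {p} h = \<pi> {p} a \<oplus> \<pi> {p} b"
   using Mc ideal_in[OF aideal_ideal[OF aM'(1)]] by (simp add: r_distr)
  then show False using ab Mp M'(2) tor_\<epsilon>[OF pp h(1)] h by simp
 qed
 have notM: "a \<notin> M" if a: "a \<in> W x" for a
  using aideal_W[OF aM(1) x a] gen_sub[OF aM(1), of x] aM(2) by (auto simp: J_def)
 \<comment> \<open>Write a = u + m along J = U + M; then p u = 0. If u + k were non-zero, some unit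
   in \<open>\<Gamma> p\<close> would carry u to u + k and fix m, so a + k would stay in W x. Hence
   u + k = 0 and a + k = m.\<close>
 have bad: "a \<oplus> k \<in> M" if a: "a \<in> W x" and k: "k \<in> tor p" and ak: "a \<oplus> k \<notin> W x" for a k
 proof -
  obtain M' where M': "max_aideal J M'" "num p \<otimes> a \<in> M'" "\<And>m. m \<in> M' ==> \<pi> {p} m = \<zero>"
   using W_max_aideal[OF x p(1) pJ a k ak] unfolding J_def by metis
  then have paM: "num p \<otimes> a \<in> M" using uniq by blast
  have "a \<in> J" using a WJ by blast
  then have "a \<in> U <+>\<^bsub>R\<^esub> M" using sumJ[OF aU UJ hU hM] by simp
  then obtain u m where um: "u \<in> U" "m \<in> M" "a = u \<oplus> m" by (auto simp: set_add_def')
  have c: "u \<in> carrier R" "m \<in> carrier R" "k \<in> carrier R" using um Uc Mc tor_carrier[OF k] by auto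
  have "num p \<otimes> u \<oplus> num p \<otimes> m \<in> M" using paM um c by (simp add: r_distr)
  then have "num p \<otimes> u \<in> M" using ideal_add_cancel[OF iM ideal_mult[OF iM um(2), of "num p"]] c by simp
  then have "num p \<otimes> u = \<zero>" using UM ideal_mult[OF iU um(1)] by simp
  then have ut: "u \<in> tor p" using c by (simp add: tor_def)
  have u0: "u \<noteq> \<zero>" using um notM[OF a] c by auto
  have "u \<oplus> k = \<zero>"
  proof (rule ccontr)
   assume "u \<oplus> k \<noteq> \<zero>"
   then obtain g where g: "g \<in> \<Gamma> p" "u \<oplus> k = g \<otimes> u"
    using tor_trans[OF p(1) ut ideal_add[OF tor_ideal ut k] u0] by blast
   have "g \<otimes> a = g \<otimes> u \<oplus> g \<otimes> m" using um c \<Gamma>_Units[OF g(1)] by (simp add: r_distr Units_closed)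
   also have "\<dots> = u \<oplus> k \<oplus> m" using g \<Gamma>_fix[OF g(1) c(2) Mp[OF um(2)]] by simp
   also have "\<dots> = a \<oplus> k" using um c by (simp add: a_ac)
   finally show False using ak stableD[OF Z(2) \<Gamma>_Units[OF g(1)] a] by simp
  qed
  then have "a \<oplus> k = m" using um c by (metis a_assoc a_comm l_zero)
  then show ?thesis using um by simp
 qed
 define c where "c = hits U x (W x)"
 have c_eq: "hits U a (W x) = c" if "a \<in> W x" for a
  unfolding c_def by (rule card_coset_W[OF Z aU x that])
 have fZ: "finite (W x)" by (rule aset_finite[OF Z(1)])
 have fU: "finite U" by (rule aset_finite[OF aideal_aset[OF aU]])
 define l where "l = overlap (W x) h"
 have l_eq: "overlap (W x) t = l" if t: "t \<in> U - {\<zero>}" for t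
  unfolding l_def using card_shift_W[OF Z hc] prim_W[OF U p(1) pU _ _ h] t by blast
 have total: "card (W x) + (card U - 1) * l = card (W x) * c"
 proof -
  have "card (W x) * c = (\<Sum>a\<in>W x. hits U a (W x))" using c_eq by simp
  also have "\<dots> = (\<Sum>t\<in>U. overlap (W x) t)" by (rule sum_shift_coset[OF fZ fU, symmetric])
  also have "\<dots> = overlap (W x) \<zero> + (\<Sum>t\<in>U - {\<zero>}. overlap (W x) t)"
   by (rule sum.remove[OF fU ideal_zero[OF iU]])
  also have "{a \<in> W x. a \<oplus> \<zero> \<in> W x} = W x" using Zc by auto
  also have "(\<Sum>t\<in>U - {\<zero>}. overlap (W x) t) = (card U - 1) * l"
   using l_eq ideal_zero[OF iU] by simp
  finally show ?thesis by simp
 qed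
 define B where "B = {a \<in> W x. a \<oplus> h \<notin> W x}"
 have fB: "finite B" "B \<subseteq> W x" using fZ by (auto simp: B_def)
 have lB: "l + card B = card (W x)"
 proof -
  have "W x = {a \<in> W x. a \<oplus> h \<in> W x} \<union> B" by (auto simp: B_def)
  then show ?thesis unfolding l_def using fZ
   by (metis (no_types, lifting) B_def card_Un_disjoint disjoint_iff finite_Un mem_Collect_eq)
 qed
 \<comment> \<open>Different points of B lie in different cosets of U: a difference inside U is also
   the difference of two elements of M, hence zero. Each of these cosets contains c points of W
   x.\<close>
 have cB: "card B * c \<le> card (W x)"
 proof -
  let ?F = "\<lambda>b. (\<lambda>t. b \<oplus> t) ` {t \<in> U. b \<oplus> t \<in> W x}"
  have cF: "card (?F b) = c" if b: "b \<in> B" for b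
  proof -
   have "inj_on (\<lambda>t. b \<oplus> t) {t \<in> U. b \<oplus> t \<in> W x}" using b fB Zc Uc by (intro inj_onI) auto
   then show ?thesis using c_eq[of b] b fB by (simp add: card_image subset_iff)
  qed
  have disj: "?F a \<inter> ?F b = {}" if ab: "a \<in> B" "b \<in> B" "a \<noteq> b" for a b
  proof (rule ccontr)
   assume "?F a \<inter> ?F b \<noteq> {}"
   then obtain s t where st: "s \<in> U" "t \<in> U" "a \<oplus> s = b \<oplus> t" by auto
   have abc: "a \<in> carrier R" "b \<in> carrier R" "s \<in> carrier R" "t \<in> carrier R"
    using ab fB Zc st Uc by auto
   have "a \<ominus> b = (a \<oplus> s) \<ominus> (b \<oplus> s)" using abc by algebra
   also have "\<dots> = (b \<oplus> t) \<ominus> (b \<oplus> s)" by (simp only: st(3))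
   also have "\<dots> = t \<ominus> s" using abc by algebra
   finally have d: "a \<ominus> b = t \<ominus> s" .
   have "a \<oplus> h \<in> M" "b \<oplus> h \<in> M" using bad ab h by (auto simp: B_def)
   then have "(a \<oplus> h) \<ominus> (b \<oplus> h) \<in> M" using ideal_minus[OF iM] by blast
   moreover have "(a \<oplus> h) \<ominus> (b \<oplus> h) = a \<ominus> b" using abc hc
    by (simp add: a_minus_def minus_add a_ac r_neg)
   ultimately have "a \<ominus> b = \<zero>" using UM[of "a \<ominus> b"] d ideal_minus[OF iU st(2,1)] by simp
   then show False using ab abc by simp
  qed
  have "card B * c = (\<Sum>b\<in>B. card (?F b))" using cF by simp
  also have "\<dots> = card (\<Union>b\<in>B. ?F b)" by (rule card_UN_disjoint[symmetric]) (use fB fU disj in auto)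
  also have "\<dots> \<le> card (W x)" by (rule card_mono[OF fZ]) auto
  finally show ?thesis .
 qed
 \<comment> \<open>Otherwise x + h and x - h both lie in M, so h + h lies in both U and M, although
   it is non-zero for odd order.\<close>
 have c2: "c \<ge> 2"
 proof -
  have "\<exists>t\<in>tor p. t \<noteq> \<zero> \<and> x \<oplus> t \<in> W x"
  proof (rule ccontr)
   assume no: "\<not> ?thesis"
   have h': "\<ominus> h \<in> tor p" "\<ominus> h \<noteq> \<zero>" using ideal_neg[OF tor_ideal h(1)] h hc by auto
   have "x \<oplus> h \<in> M" "x \<oplus> \<ominus> h \<in> M" using bad[OF W_self[OF x]] no h h' by auto
   then have "(x \<oplus> h) \<ominus> (x \<oplus> \<ominus> h) \<in> M" using ideal_minus[OF iM] by blast
   moreover have "(x \<oplus> h) \<ominus> (x \<oplus> \<ominus> h) = h \<oplus> h" using x hc by algebra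
   ultimately have "h \<oplus> h = \<zero>" using UM[of "h \<oplus> h"] ideal_add[OF iU hU hU] by simp
   then show False using double_zero[OF hc] h by simp
  qed
  then obtain t where t: "t \<in> tor p" "t \<noteq> \<zero>" "x \<oplus> t \<in> W x" by blast
  have "{\<zero>, t} \<subseteq> {t \<in> U. x \<oplus> t \<in> W x}" using t pU ideal_zero[OF iU] W_self[OF x] x by auto
  then have "card {\<zero>, t} \<le> c" unfolding c_def using fU by (intro card_mono) auto
  then show ?thesis using t by simp
 qed
 have "card (W x) > 0" using fZ W_self[OF x] by (auto simp: card_gt_0_iff)
 then have cU: "c \<ge> card U - 1" using count_arith[OF total lB cB c2] by fastforce
 have yM: "y \<notin> M" using same[OF aM(1)] notM[OF W_self[OF x]] by simp
 \<comment> \<open>The two missing points of w + U are w - u = m, which lies in M, and y, which does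
   not lie in M and is therefore a different one.\<close>
 let ?S = "{t \<in> U. w \<oplus> t \<in> W x}"
 have "w \<in> U <+>\<^bsub>R\<^esub> M" using sumJ[OF aU UJ hU hM] w(1) WJ by blast
 then obtain u m where um: "u \<in> U" "m \<in> M" "w = u \<oplus> m" by (auto simp: set_add_def')
 have umc: "u \<in> carrier R" "m \<in> carrier R" using um Uc Mc by auto
 have "w \<oplus> \<ominus> u = m" using um umc by (simp add: a_comm[of u m] a_assoc r_neg)
 then have "\<ominus> u \<notin> ?S" using notM um by auto
 moreover have yS: "y \<ominus> w \<notin> ?S" using yw n by simp
 moreover have "y \<ominus> w \<noteq> \<ominus> u" using yw yM \<open>w \<oplus> \<ominus> u = m\<close> um by auto
 moreover have "\<ominus> u \<in> U" using ideal_neg[OF iU um(1)] .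
 ultimately have "?S \<subseteq> U - {\<ominus> u, y \<ominus> w}" "card {\<ominus> u, y \<ominus> w} = 2" "{\<ominus> u, y \<ominus> w} \<subseteq> U" using w(2) by auto
 then have "card ?S \<le> card U - 2"
  using card_mono[of "U - {\<ominus> u, y \<ominus> w}" ?S] card_Diff_subset[of "{\<ominus> u, y \<ominus> w}" U] fU by simp
 moreover have "card U \<ge> 2"
  using card_mono[OF fU \<open>{\<ominus> u, y \<ominus> w} \<subseteq> U\<close>] \<open>card {\<ominus> u, y \<ominus> w} = 2\<close> by simp
 ultimately show False using c_eq[OF w(1)] cU by linarith
qed

end

section \<open>Quotients by \<A>-ideals and basic sets up to units\<close>

context cg_ring
begin

lemma local_unit:
 assumes "t \<in> carrier R" "\<pi> {p} t = t" "t \<notin> mul p" "p \<in> P"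
 shows "patch {p} t \<one> \<in> Units R"
proof (subst unit_iff)
 show "\<forall>q\<in>P. patch {p} t \<one> \<notin> mul q"
 proof safe
  fix q assume q: "q \<in> P" "patch {p} t \<one> \<in> mul q"
  then have "\<epsilon> {q} \<otimes> patch {p} t \<one> \<in> mul q" using ideal_mult[OF mul_ideal] by simp
  then show False
   using assms patch_in[of t \<one> "{q}" "{p}"] patch_out[of t \<one> "{q}" "{p}"] one_notin_mul[OF q(1)] mul_iff[OF P_prime[OF q(1)], of \<one>]
    by (cases "q = p") auto
 qed
qed (use assms in auto)

text \<open>At p the element t is a unit. Completed by 1 at the other primes it is a unit w of R
  with the p-component of t, and multiplying by the inverse of w yields
  \<open>\<epsilon> {p}\<close>.\<close>

lemma ideal_\<epsilon>_unit:
 assumes I: "ideal I R" and t: "t \<in> I" "t \<notin> mul p" and p: "p \<in> P"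
 shows "\<epsilon> {p} \<in> I"
proof -
 note tc = ideal_in[OF I t(1)]
 let ?t = "\<pi> {p} t"
 have t': "?t \<in> I" "\<pi> {p} ?t = ?t" "?t \<notin> mul p" "?t \<in> carrier R"
  using ideal_mult[OF I t(1)] tc t mul_iff[OF P_prime[OF p] tc] by (auto simp: \<epsilon>_idem)
 let ?w = "patch {p} ?t \<one>"
 have w: "?w \<in> Units R" using local_unit[OF t'(4,2,3) p] .
 have "\<epsilon> {p} = \<pi> {p} ?w \<otimes> inv ?w" using w t' by (simp add: m_assoc)
 also have "\<dots> = ?t \<otimes> inv ?w" using t' patch_in[of ?t \<one> "{p}" "{p}"] by simp
 finally show ?thesis using ideal_mult'[OF I t'(1), of "inv ?w"] w by simp
qed

lemma ideal_\<epsilon>_set: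
 assumes I: "ideal I R" and "\<And>p. p \<in> P ==> p \<in> Q ==> \<epsilon> {p} \<in> I"
 shows "\<epsilon> Q \<in> I"
proof -
 have *: "\<epsilon> F \<in> I" if "finite F" "F \<subseteq> P \<inter> Q" for F using that
 proof (induction F rule: finite_induct)
  case (insert p F)
  then have "\<epsilon> (insert p F) = \<epsilon> {p} \<oplus> \<epsilon> F" using \<epsilon>_add[of "{p}" F] by simp
  then show ?case using insert assms ideal_add[OF I] by simp
 qed (use ideal_zero[OF I] in simp)
 have "\<epsilon> Q = \<epsilon> (P \<inter> Q)"
  unfolding \<epsilon>_def[of "P \<inter> Q"] using idx[of _ "P \<inter> Q"] by (intro \<epsilon>_eq_numI) auto
 then show ?thesis using *[of "P \<inter> Q"] by simp
qed

text \<open>Replace x by 1 at the primes p for which x lies in p R. At these primes x y - 1 is a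
  unit, so the component lies in I and the change is invisible modulo I.\<close>

lemma unit_lift:
 assumes I: "ideal I R" and x: "x \<in> carrier R" and y: "y \<in> carrier R" and xy: "x \<otimes> y \<ominus> \<one> \<in> I"
 obtains v where "v \<in> Units R" "v \<ominus> x \<in> I"
proof -
 let ?Q = "{p \<in> P. x \<in> mul p}"
 let ?v = "patch ?Q \<one> x"
 have "\<epsilon> {p} \<in> I" if p: "p \<in> P" "p \<in> ?Q" for p
 proof (rule ideal_\<epsilon>_unit[OF I xy _ p(1)])
  show "x \<otimes> y \<ominus> \<one> \<notin> mul p"
  proof
   assume a: "x \<otimes> y \<ominus> \<one> \<in> mul p"
   have "x \<otimes> y \<in> mul p" using ideal_mult'[OF mul_ideal _ y] p(2) by simp
   then have "x \<otimes> y \<ominus> (x \<otimes> y \<ominus> \<one>) \<in> mul p" using ideal_minus[OF mul_ideal] a by blast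
   moreover have "x \<otimes> y \<ominus> (x \<otimes> y \<ominus> \<one>) = \<one>" using x y by algebra
   ultimately show False using one_notin_mul[OF p(1)] by simp
  qed
 qed
 then have e: "\<epsilon> ?Q \<in> I" using ideal_\<epsilon>_set[OF I] by blast
 have "?v = x \<oplus> \<epsilon> ?Q \<otimes> (\<one> \<ominus> x)"
 proof -
  have "a \<otimes> \<one> \<oplus> (\<one> \<ominus> a) \<otimes> x = x \<oplus> a \<otimes> (\<one> \<ominus> x)" if "a \<in> carrier R" for a using that x by algebra
  then show ?thesis unfolding patch_def \<epsilon>_compl by blast
 qed
 then have "?v \<ominus> x = \<epsilon> ?Q \<otimes> (\<one> \<ominus> x)" using x add_minus_cancel by simp
 then have "?v \<ominus> x \<in> I" using ideal_mult'[OF I e, of "\<one> \<ominus> x"] x by simp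
 moreover have "?v \<in> Units R"
 proof (subst unit_iff)
  show "\<forall>p\<in>P. ?v \<notin> mul p"
  proof safe
   fix p assume p: "p \<in> P" "?v \<in> mul p"
   then have "\<pi> {p} ?v \<in> mul p" using ideal_mult[OF mul_ideal] by simp
   then show False using x p patch_in[of \<one> x "{p}" ?Q] patch_out[of \<one> x "{p}" ?Q]
     one_notin_mul[OF p(1)] mul_iff[OF P_prime[OF p(1)], of \<one>] mul_iff[OF P_prime[OF p(1)], of x]
    by (cases "p \<in> ?Q") auto
  qed
 qed (use x in simp)
 ultimately show ?thesis using that by blast
qed

end

lemma (in ring_hom_cring) hom_num: "h (R.num d) = S.num d"
proof (induction d)
 case (Suc d)
 then show ?case using R.num_add[of 1 d] S.num_add[of 1 d] by simp
qed simp

context cg_sring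
begin

text \<open>All representatives of the coset are used, which avoids a choice; for an \<A>-ideal one
  representative suffices (\<open>qcls_eq\<close>).\<close>

definition qcls :: "'a set \<Rightarrow> 'a set \<Rightarrow> 'a set set"
 where "qcls I C = (\<lambda>y. I +> y) ` (\<Union>x\<in>C. cls x)"

lemma quot_eq_iff:
 "ideal I R ==> x \<in> carrier R ==> y \<in> carrier R ==> I +> x = I +> y \<longleftrightarrow> x \<ominus> y \<in> I"
 using quotient_eq_iff_same_a_r_cos by blast

lemma quot_carrier: "carrier (R Quot I) = (\<lambda>x. I +> x) ` carrier R"
 by (auto simp: FactRing_def A_RCOSETS_def')

lemma quot_fiber: "ideal I R ==> x \<in> carrier R ==> {a \<in> carrier R. I +> a = I +> x} = (\<lambda>i. x \<oplus> i) ` I"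
proof (intro Set.set_eqI iffI)
 assume I: "ideal I R" and x: "x \<in> carrier R"
 fix a
 { assume a: "a \<in> {a \<in> carrier R. I +> a = I +> x}"
  then have ac: "a \<in> carrier R" "I +> a = I +> x" by auto
  then have "a \<ominus> x \<in> I" using quot_eq_iff[OF I _ x] by blast
  then show "a \<in> (\<lambda>i. x \<oplus> i) ` I"
   using add_minus[OF x ac(1)] by (intro image_eqI[of _ _ "a \<ominus> x"]) auto }
 assume "a \<in> (\<lambda>i. x \<oplus> i) ` I"
 then obtain i where i: "i \<in> I" "a = x \<oplus> i" by blast
 then have ic: "i \<in> carrier R" using ideal_in[OF I] by blast
 then have "I +> a = I +> x" using quot_eq_iff[OF I, of a x] x i add_minus_cancel by simp
 then show "a \<in> {a \<in> carrier R. I +> a = I +> x}" using i x ic by simp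
qed

lemma quot_sum:
 fixes f :: "'a set \<Rightarrow> int"
 assumes I: "ideal I R"
 shows "(\<Sum>a\<in>carrier R. f (I +> a)) = int (card I) * (\<Sum>C\<in>carrier (R Quot I). f C)"
proof -
 have "(\<Sum>a\<in>carrier R. f (I +> a)) =
   (\<Sum>C\<in>(\<lambda>x. I +> x) ` carrier R. \<Sum>a\<in>{a \<in> carrier R. I +> a = C}. f (I +> a))"
  by (rule sum.image_gen[OF fin])
 also have "\<dots> = (\<Sum>C\<in>(\<lambda>x. I +> x) ` carrier R. int (card I) * f C)"
 proof (rule sum.cong[OF refl])
  fix C assume "C \<in> (\<lambda>x. I +> x) ` carrier R"
  then obtain x where x: "x \<in> carrier R" "C = I +> x" by blast
  have "card {a \<in> carrier R. I +> a = C} = card I"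
   unfolding x(2) quot_fiber[OF I x(1)] using x(1) ideal_in[OF I] by (intro card_image inj_onI) auto
  then show "(\<Sum>a\<in>{a \<in> carrier R. I +> a = C}. f (I +> a)) = int (card I) * f C" by simp
 qed
 finally show ?thesis by (simp add: quot_carrier sum_distrib_left)
qed

lemma qcls_eq:
 assumes I: "aideal I" and x: "x \<in> carrier R"
 shows "qcls I (I +> x) = (\<lambda>y. I +> y) ` cls x"
proof
 note iI = aideal_ideal[OF I]
 have xin: "x \<in> I +> x" using x ideal_zero[OF iI] by (force simp: a_r_coset_def')
 then show "(\<lambda>y. I +> y) ` cls x \<subseteq> qcls I (I +> x)" by (auto simp: qcls_def)
 show "qcls I (I +> x) \<subseteq> (\<lambda>y. I +> y) ` cls x"
 proof
  fix D assume "D \<in> qcls I (I +> x)"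
  then obtain i z where z: "i \<in> I" "z \<in> cls (i \<oplus> x)" "D = I +> z"
   by (auto simp: qcls_def a_r_coset_def')
  have ic: "i \<in> carrier R" using ideal_in[OF iI z(1)] .
  have "aset (cls x <+>\<^bsub>R\<^esub> I)" using aset_add[OF aset_cls[OF x] aideal_aset[OF I]] .
  moreover have "i \<oplus> x \<in> cls x <+>\<^bsub>R\<^esub> I"
   using set_addI[OF cls_self[OF x] z(1), of R] x ic by (simp add: a_comm)
  ultimately have "z \<in> cls x <+>\<^bsub>R\<^esub> I" using z(2) asetD by blast
  then obtain y j where y: "y \<in> cls x" "j \<in> I" "z = y \<oplus> j" by (auto simp: set_add_def')
  then have "I +> z = I +> y"
   using quot_eq_iff[OF iI, of z y] cls_in[OF x y(1)] ideal_in[OF iI y(2)] add_minus_cancel by simp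
  then show "D \<in> (\<lambda>y. I +> y) ` cls x" using y z by blast
 qed
qed

lemma quot_unit_lift:
 assumes I: "ideal I R" and C: "C \<in> Units (R Quot I)"
 obtains v where "v \<in> Units R" "C = I +> v"
proof -
 interpret h: ring_hom_cring R "R Quot I" "(+>) I"
  using ideal.rcos_ring_hom_cring[OF I] is_cring by blast
 obtain D where D: "D \<in> carrier (R Quot I)" "C \<otimes>\<^bsub>R Quot I\<^esub> D = \<one>\<^bsub>R Quot I\<^esub>" "C \<in> carrier (R Quot I)"
  using C unfolding Units_def by blast
 then obtain x y where xy: "x \<in> carrier R" "C = I +> x" "y \<in> carrier R" "D = I +> y"
  unfolding quot_carrier by blast
 then have "I +> (x \<otimes> y) = I +> \<one>" using D by simp
 then have "x \<otimes> y \<ominus> \<one> \<in> I" using quot_eq_iff[OF I m_closed[OF xy(1,3)] one_closed] by blast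
 then obtain v where v: "v \<in> Units R" "v \<ominus> x \<in> I" using unit_lift[OF I xy(1,3)] by blast
 then have "C = I +> v" using quot_eq_iff[OF I, of v x] xy by (simp add: Units_closed)
 then show ?thesis using that v by blast
qed

lemma quotient_cg_sring:
 assumes I: "aideal I"
 shows "cg_sring (R Quot I) (qcls I)"
proof -
 note iI = aideal_ideal[OF I]
 let ?Q = "R Quot I"
 interpret Q: cring ?Q using ideal.quotient_is_cring[OF iI] is_cring by blast
 interpret h: ring_hom_cring R ?Q "(+>) I" using ideal.rcos_ring_hom_cring[OF iI] is_cring by blast
 have fQ: "finite (carrier ?Q)" by (simp add: quot_carrier)
 have "order ?Q dvd order R"
 proof -
  have "subgroup I (add_monoid R)" using additive_subgroup.a_subgroup ideal.axioms(1) iI by blast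
  from add.lagrange[OF this]
  have "card (rcosets\<^bsub>add_monoid R\<^esub> I) * card I = order R" by (simp add: order_def)
  moreover have "order ?Q = card (rcosets\<^bsub>add_monoid R\<^esub> I)"
   by (simp only: order_def FactRing_def A_RCOSETS_def partial_object.simps)
  ultimately show ?thesis by (metis dvd_triv_left)
 qed
 then have oQ: "odd (order ?Q)" using odd_order by (metis dvd_trans)
 have units: "I +> u \<in> Units ?Q" if u: "u \<in> Units R" for u
 proof (rule Q.unit_rightI[of _ "I +> inv u"])
  have "(I +> u) \<otimes>\<^bsub>?Q\<^esub> (I +> inv u) = I +> (u \<otimes> inv u)" using u by (simp add: Units_closed del: Units_r_inv)
  then show "(I +> u) \<otimes>\<^bsub>?Q\<^esub> (I +> inv u) = \<one>\<^bsub>?Q\<^esub>" using u by simp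
 qed (use u in \<open>auto simp: Units_closed\<close>)
 have hm: "I +> (x \<ominus> y) = (I +> x) \<ominus>\<^bsub>?Q\<^esub> (I +> y)" if "x \<in> carrier R" "y \<in> carrier R" for x y
  using that by simp
 show ?thesis
 proof
  show "finite (carrier ?Q)" by (rule fQ)
  show "odd (order ?Q)" by (rule oQ)
  fix C assume "C \<in> carrier ?Q"
  then obtain x where x: "x \<in> carrier R" "C = I +> x" unfolding quot_carrier by blast
  obtain d u where u: "u \<in> Units R" "x = num d \<otimes> u" using assoc_num[OF x(1)] by blast
  then have "C = Q.num d \<otimes>\<^bsub>?Q\<^esub> (I +> u)" using x by (simp add: Units_closed h.hom_num)
  then show "\<exists>d. \<exists>u\<in>Units ?Q. C = Q.num d \<otimes>\<^bsub>?Q\<^esub> u" using units[OF u(1)] by blast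
  show "C \<in> qcls I C" unfolding x(2) qcls_eq[OF I x(1)] using cls_self[OF x(1)] by blast
  show "qcls I C \<subseteq> carrier ?Q"
   unfolding x(2) qcls_eq[OF I x(1)] quot_carrier using cls_carrier[OF x(1)] by blast
  { fix D assume "D \<in> qcls I C"
   then obtain y where y: "y \<in> cls x" "D = I +> y" unfolding x(2) qcls_eq[OF I x(1)] by blast
   then show "qcls I D = qcls I C"
    using qcls_eq[OF I x(1)] qcls_eq[OF I cls_in[OF x(1) y(1)]] cls_eq[OF x(1) y(1)] x(2) by simp }
  { fix U assume "U \<in> Units ?Q"
   then obtain v where v: "v \<in> Units R" "U = I +> v" using quot_unit_lift[OF iI] by blast
   have "qcls I (U \<otimes>\<^bsub>?Q\<^esub> C) = qcls I (I +> (v \<otimes> x))" using v x by (simp add: Units_closed)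
   also have "\<dots> = (\<lambda>y. I +> y) ` ((\<lambda>y. v \<otimes> y) ` cls x)"
    using qcls_eq[OF I, of "v \<otimes> x"] cls_mult[OF v(1) x(1)] v x by (simp add: Units_closed)
   also have "\<dots> = (\<lambda>D. U \<otimes>\<^bsub>?Q\<^esub> D) ` ((\<lambda>y. I +> y) ` cls x)"
    unfolding image_image using v cls_in[OF x(1)] by (intro image_cong refl) (simp add: Units_closed)
   finally show "qcls I (U \<otimes>\<^bsub>?Q\<^esub> C) = (\<lambda>D. U \<otimes>\<^bsub>?Q\<^esub> D) ` qcls I C"
    unfolding x(2) qcls_eq[OF I x(1)] . }
  { fix f g :: "'a set \<Rightarrow> int" and D
   assume f: "\<And>x y. x \<in> carrier ?Q ==> y \<in> qcls I x ==> f y = f x"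
    and g: "\<And>x y. x \<in> carrier ?Q ==> y \<in> qcls I x ==> g y = g x"
    and D: "D \<in> qcls I C"
   obtain y where y: "y \<in> cls x" "D = I +> y" using D unfolding x(2) qcls_eq[OF I x(1)] by blast
   have cc: "k (I +> b) = (k (I +> a) :: int)"
    if "\<And>x y. x \<in> carrier ?Q ==> y \<in> qcls I x ==> k y = k x" "a \<in> carrier R" "b \<in> cls a" for k a b
    using that(1)[of "I +> a" "I +> b"] that(2,3) qcls_eq[OF I that(2)] by (auto simp: quot_carrier)
   \<comment> \<open>For functions lifted from the quotient, the convolution over R is
     \<open>card I\<close> times the convolution over the quotient, and this factor cancels.\<close>
   have s: "(\<Sum>a\<in>carrier R. f (I +> a) * g (I +> (z \<ominus> a))) =
     int (card I) * (\<Sum>C\<in>carrier ?Q. f C * g ((I +> z) \<ominus>\<^bsub>?Q\<^esub> C))" if z: "z \<in> carrier R" for z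
    using quot_sum[OF iI, of "\<lambda>C. f C * g ((I +> z) \<ominus>\<^bsub>?Q\<^esub> C)"] z by simp
   have "(\<Sum>a\<in>carrier R. f (I +> a) * g (I +> (y \<ominus> a))) = (\<Sum>a\<in>carrier R. f (I +> a) * g (I +> (x \<ominus> a)))"
    by (rule cls_conv[OF _ _ x(1) y(1), of "\<lambda>a. f (I +> a)" "\<lambda>a. g (I +> a)"]) (use cc f g in blast)+
   moreover have "card I > 0"
    using ideal_zero[OF iI] aset_finite[OF aideal_aset[OF I]] by (auto simp: card_gt_0_iff)
   ultimately show "(\<Sum>a\<in>carrier ?Q. f a * g (D \<ominus>\<^bsub>?Q\<^esub> a)) = (\<Sum>a\<in>carrier ?Q. f a * g (C \<ominus>\<^bsub>?Q\<^esub> a))"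
    unfolding s[OF x(1)] s[OF cls_in[OF x(1) y(1)]] x(2) y(2) by simp }
 next
  have "qcls I (I +> \<zero>) = {I +> \<zero>}" unfolding qcls_eq[OF I zero_closed] by (simp add: cls_zero)
  then show "qcls I \<zero>\<^bsub>?Q\<^esub> = {\<zero>\<^bsub>?Q\<^esub>}" by simp
 qed
qed

text \<open>Let I be minimal among the \<A>-ideals with y in W x + I. If I is non-zero and K is
  maximal among the \<A>-ideals properly inside it, then I becomes minimal modulo K, and
  \<open>W_eq_min\<close> in the quotient puts y into W x + K, contradicting the choice of I. The
  hypothesis on membership is inherited since \<A>-ideals of the quotient pull back.\<close>

theorem W_eqI:
 assumes x: "x \<in> carrier R" and y: "y \<in> carrier R"
  and same: "\<And>J. aideal J ==> x \<in> J \<longleftrightarrow> y \<in> J"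
 shows "y \<in> W x"
proof -
 let ?S = "{I. aideal I \<and> y \<in> W x <+>\<^bsub>R\<^esub> I}"
 have "finite ?S" using aideal_finite by (rule rev_finite_subset) auto
 moreover have "carrier R \<in> ?S"
  using aideal_univ W_self[OF x] x y set_add_iff[OF W_carrier[OF x], of "carrier R" y] by auto
 ultimately have "\<exists>I\<in>?S. I \<subseteq> carrier R \<and> (\<forall>N\<in>?S. N \<subseteq> I \<longrightarrow> I = N)" by (rule finite_has_minimal2)
 then obtain I where I: "aideal I" "y \<in> W x <+>\<^bsub>R\<^esub> I" and mn: "\<And>N. N \<in> ?S ==> N \<subseteq> I ==> I = N" by blast
 note iI = aideal_ideal[OF I(1)]
 show ?thesis
 proof (cases "I = {\<zero>}")
  case True
  then obtain w where "w \<in> W x" "y = w \<oplus> \<zero>" using I(2) by (auto simp: set_add_def')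
  then show ?thesis using W_carrier[OF x] by auto
 next
  case False
  then have "{\<zero>} \<subset> I" using ideal_zero[OF iI] by auto
  then obtain K where K: "max_aideal I K" by (rule max_aideal_exists[OF aideal_zero])
  have aK: "aideal K" "K \<subset> I" using K by (auto simp: max_aideal_def)
  note iK = aideal_ideal[OF aK(1)]
  let ?Q = "R Quot K"
  interpret Q: cg_sring ?Q "qcls K" by (rule quotient_cg_sring[OF aK(1)])
  interpret h: ring_hom_cring R ?Q "(+>) K"
   using ideal.rcos_ring_hom_cring[OF iK] is_cring by blast
  let ?h = "\<lambda>x. K +> x"
  have Qin: "?h a \<in> ?h ` J \<longleftrightarrow> a \<in> J" if "ideal J R" "K \<subseteq> J" "a \<in> carrier R" for J a
  proof
   assume "?h a \<in> ?h ` J"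
   then obtain b where b: "b \<in> J" "?h a = ?h b" by blast
   then have "a \<ominus> b \<in> J" using quot_eq_iff[OF iK, of a b] that ideal_in[OF that(1)] by blast
   then show "a \<in> J" using ideal_add[OF that(1) b(1)] add_minus[of b a] that ideal_in[OF that(1) b(1)] by metis
  qed simp
  have push: "Q.aideal (?h ` J)" if J: "aideal J" "K \<subseteq> J" for J
  proof -
   note iJ = aideal_ideal[OF J(1)]
   note Jc = ideal_in[OF iJ]
   have "ideal (?h ` J) ?Q"
   proof (rule Q.idealI')
    show "?h ` J \<subseteq> carrier ?Q" using Jc by (auto simp: quot_carrier)
    show "\<zero>\<^bsub>?Q\<^esub> \<in> ?h ` J" by (rule image_eqI[of _ _ \<zero>]) (use ideal_zero[OF iJ] in auto)
    show "a \<oplus>\<^bsub>?Q\<^esub> b \<in> ?h ` J" if ab: "a \<in> ?h ` J" "b \<in> ?h ` J" for a b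
    proof -
     obtain c d where "c \<in> J" "d \<in> J" "a = ?h c" "b = ?h d" using ab by blast
     then show ?thesis using Jc ideal_add[OF iJ] by (intro image_eqI[of _ _ "c \<oplus> d"]) auto
    qed
    show "r \<otimes>\<^bsub>?Q\<^esub> b \<in> ?h ` J" if ab: "r \<in> carrier ?Q" "b \<in> ?h ` J" for r b
    proof -
     obtain c d where "c \<in> carrier R" "d \<in> J" "r = ?h c" "b = ?h d" using ab unfolding quot_carrier by blast
     then show ?thesis using Jc ideal_mult[OF iJ] by (intro image_eqI[of _ _ "c \<otimes> d"]) auto
    qed
   qed
   moreover have "Q.aset (?h ` J)"
   proof (rule Q.asetI)
    fix C D assume "C \<in> ?h ` J" "D \<in> qcls K C"
    then obtain a where a: "a \<in> J" "D \<in> qcls K (?h a)" by auto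
    then have "D \<in> ?h ` cls a" using qcls_eq[OF aK(1) Jc[OF a(1)]] by simp
    then show "D \<in> ?h ` J" using asetD[OF aideal_aset[OF J(1)] a(1)] by auto
   qed (use Jc in \<open>auto simp: quot_carrier\<close>)
   ultimately show ?thesis by (simp add: Q.aideal_def)
  qed
  have pull: "aideal {a \<in> carrier R. ?h a \<in> J}" if J: "Q.aideal J" for J
  proof -
   note iJ = Q.aideal_ideal[OF J]
   have "ideal {a \<in> carrier R. ?h a \<in> J} R"
    by (rule idealI') (use Q.ideal_zero[OF iJ] Q.ideal_add[OF iJ] Q.ideal_mult[OF iJ] in auto)
   moreover have "aset {a \<in> carrier R. ?h a \<in> J}"
   proof (rule asetI)
    fix a b assume a: "a \<in> {a \<in> carrier R. ?h a \<in> J}" "b \<in> cls a"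
    then have "?h b \<in> qcls K (?h a)" using qcls_eq[OF aK(1)] by auto
    then have "?h b \<in> J" using Q.asetD[OF Q.aideal_aset[OF J]] a by blast
    then show "b \<in> {a \<in> carrier R. ?h a \<in> J}" using a cls_in by blast
   qed auto
   ultimately show ?thesis by (simp add: aideal_def)
  qed
  have kerK: "?h a = \<zero>\<^bsub>?Q\<^esub> \<longleftrightarrow> a \<in> K" if "a \<in> carrier R" for a
   using quot_eq_iff[OF iK that zero_closed] that by (simp add: a_minus_def)
  have U: "Q.min_aideal (?h ` I)" unfolding Q.min_aideal_def
  proof (intro conjI allI impI)
   show "Q.aideal (?h ` I)" using push I(1) aK(2) by blast
   obtain a where a: "a \<in> I" "a \<notin> K" using aK(2) by blast
   then have "?h a \<noteq> \<zero>\<^bsub>?Q\<^esub>" using kerK ideal_in[OF iI] by blast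
   then show "?h ` I \<noteq> {\<zero>\<^bsub>?Q\<^esub>}" using a(1) by blast
  next
   fix J assume J: "Q.aideal J \<and> J \<subseteq> ?h ` I"
   let ?J = "{a \<in> carrier R. ?h a \<in> J}"
   have 1: "aideal ?J" using pull J by blast
   have 2: "K \<subseteq> ?J"
   proof
    fix a assume a: "a \<in> K"
    have "?h a = \<zero>\<^bsub>?Q\<^esub>" using kerK[OF ideal_in[OF iK a]] a by blast
    moreover have "\<zero>\<^bsub>?Q\<^esub> \<in> J" using Q.ideal_zero[OF Q.aideal_ideal] J by blast
    ultimately show "a \<in> ?J" using ideal_in[OF iK a] by simp
   qed
   have 3: "?J \<subseteq> I" using Qin[OF iI] aK(2) J by blast
   have im: "J = ?h ` ?J" using J Q.ideal_sub[OF Q.aideal_ideal] unfolding quot_carrier by blast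
   from 1 2 3 K have "?J = K \<or> ?J = I" unfolding max_aideal_def by blast
   then show "J = {\<zero>\<^bsub>?Q\<^esub>} \<or> J = ?h ` I"
   proof
    assume "?J = K"
    then have "J = ?h ` K" using im by simp
    moreover have "?h ` K = {\<zero>\<^bsub>?Q\<^esub>}" using kerK ideal_in[OF iK] ideal_zero[OF iK] by (auto simp: image_iff) 
    ultimately show ?thesis by simp
   qed (use im in simp)
  qed
  have WQ: "?h a \<in> Q.W (?h x)" if a: "a \<in> W x" for a
  proof -
   obtain u b where u: "u \<in> Units R" "b \<in> cls x" "a = u \<otimes> b" using a by (auto simp: W_def)
   have bc: "b \<in> carrier R" using cls_in[OF x u(2)] .
   have "?h b \<in> qcls K (?h x)" using u qcls_eq[OF aK(1) x] by blast
   then have "?h b \<in> Q.W (?h x)" using Q.cls_sub_W[of "?h x"] x by auto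
   moreover have "?h u \<in> Units ?Q"
   proof (rule Q.unit_rightI[of _ "?h (inv u)"])
    have "?h u \<otimes>\<^bsub>?Q\<^esub> ?h (inv u) = ?h (u \<otimes> inv u)" using u by (simp add: Units_closed del: Units_r_inv)
    then show "?h u \<otimes>\<^bsub>?Q\<^esub> ?h (inv u) = \<one>\<^bsub>?Q\<^esub>" using u by simp
   qed (use u in \<open>auto simp: Units_closed\<close>)
   ultimately have "?h u \<otimes>\<^bsub>?Q\<^esub> ?h b \<in> Q.W (?h x)" using Q.stableD[OF Q.W_stable[of "?h x"]] x by simp
   then show ?thesis using u bc by (simp add: Units_closed)
  qed
  have "?h y \<in> Q.W (?h x)"
  proof (rule Q.W_eq_min[OF U])
   fix J assume J: "Q.aideal J"
   show "(?h x \<in> J) = (?h y \<in> J)" using same[OF pull[OF J]] x y by simp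
  next
   obtain w i where wi: "w \<in> W x" "i \<in> I" "y = w \<oplus> i" using I(2) by (auto simp: set_add_def')
   then have "?h y = ?h w \<oplus>\<^bsub>?Q\<^esub> ?h i" using W_carrier[OF x] ideal_in[OF iI] by auto
   then show "?h y \<in> Q.W (?h x) <+>\<^bsub>?Q\<^esub> ?h ` I" using set_addI[OF WQ[OF wi(1)], of "?h i" "?h ` I" ?Q] wi by simp
  qed (use x y in auto)
  then obtain V C where V: "V \<in> Units ?Q" "C \<in> qcls K (?h x)" "?h y = V \<otimes>\<^bsub>?Q\<^esub> C"
   unfolding Q.W_def by blast
  obtain v where v: "v \<in> Units R" "V = ?h v" using quot_unit_lift[OF iK V(1)] by blast
  obtain b where b: "b \<in> cls x" "C = ?h b" using V(2) qcls_eq[OF aK(1) x] by blast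
  have bc: "b \<in> carrier R" using cls_in[OF x b(1)] .
  have "?h y = ?h (v \<otimes> b)" using V v b bc by (simp add: Units_closed)
  then have "y \<ominus> v \<otimes> b \<in> K" using quot_eq_iff[OF iK y m_closed[OF Units_closed[OF v(1)] bc]] by blast
  moreover have "v \<otimes> b \<in> W x" using v b by (auto simp: W_def)
  ultimately have "y \<in> W x <+>\<^bsub>R\<^esub> K" using set_add_iff[OF W_carrier[OF x] ideal_sub[OF iK]] y by blast
  then have "I = K" using mn[of K] aK by blast
  then show ?thesis using aK(2) by blast
 qed
qed

lemma W_eq_gen: "x \<in> carrier R ==> y \<in> carrier R ==> gen x = gen y ==> W x = W y"
proof -
 assume x: "x \<in> carrier R" and y: "y \<in> carrier R" and g: "gen x = gen y"
 have "y \<in> W x"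
 proof (rule W_eqI[OF x y])
  fix J assume J: "aideal J"
  show "x \<in> J \<longleftrightarrow> y \<in> J" using gen_sub[OF J] gen_self g by blast
 qed
 then show ?thesis using W_eq[OF x] by simp
qed

end

section \<open>Pure S-rings\<close>

context cg_ring
begin

text \<open>All indices divide the odd order, so an index different from 1 is at least 3.\<close>

lemma ideal_index3:
 assumes I: "ideal I R" and J: "ideal J R" and sub: "I \<subset> J"
 shows "3 * card I \<le> card J"
proof -
 have sg: "subgroup I (add_monoid R)" "subgroup J (add_monoid R)"
  using I J additive_subgroup.a_subgroup ideal.axioms(1) by blast+
 have fJ: "finite J" using ideal_sub[OF J] finite_subset by blast
 interpret J: group "(add_monoid R)\<lparr>carrier := J\<rparr>" using add.subgroup_imp_group[OF sg(2)] .
 have "subgroup I ((add_monoid R)\<lparr>carrier := J\<rparr>)" using add.subgroup_incl[OF sg] sub by blast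
 from J.lagrange[OF this] obtain m where m: "card J = card I * m"
  by (simp add: order_def) (metis mult.commute)
 have "odd m" using card_ideal_dvd[OF J] odd_order m by (metis dvd_trans dvd_triv_right even_mult_iff)
 moreover have "m \<noteq> 1" using psubset_card_mono[OF fJ sub] m by auto
 ultimately have "m \<ge> 3" by presburger
 then show ?thesis using m by simp
qed

lemma num_notin_mul: "p \<in> P ==> coprime d p ==> num d \<notin> mul p"
proof
 assume p: "p \<in> P" and d: "coprime d p" and m: "num d \<in> mul p"
 obtain b where b: "num d \<otimes> num b \<otimes> \<epsilon> {p} = \<epsilon> {p}" using num_inverse[of "{p}" d] d by auto
 have "num d \<otimes> (num b \<otimes> \<epsilon> {p}) \<in> mul p" using ideal_mult'[OF mul_ideal m] by simp
 then show False using b one_notin_mul[OF p] mul_iff[OF P_prime[OF p], of \<one>] by (simp add: m_assoc)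
qed

lemma \<epsilon>_notin_mul: "p \<in> P ==> \<epsilon> {p} \<notin> mul p" using one_notin_mul mul_iff[OF P_prime, of p \<one>] by simp

lemma \<epsilon>_nonzero: "p \<in> P ==> \<epsilon> {p} \<noteq> \<zero>" using \<epsilon>_notin_mul ideal_zero[OF mul_ideal] by metis

end

section \<open>Maximal \<A>-ideals and the basic set of 1\<close>

context cg_sring
begin

lemma cls_stab:
 assumes "x \<in> carrier R" "z \<in> cls x" "u \<in> Units R" "u \<otimes> z \<in> cls x" "y \<in> cls x"
 shows "u \<otimes> y \<in> cls x"
using cls_mult[OF assms(3) cls_in[OF assms(1,2)]] cls_eq[OF assms(1,2)] cls_eq[OF assms(1,4)] assms(5)
 by auto

text \<open>A unit-stable set occupies the same proportion of \<open>cls x\<close> as of W x,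
  because the unit multiples of \<open>cls x\<close> cover every point of W x equally often.
  Proportions can be bounded in W x, where membership is a matter of \<A>-ideals, and are then
  carried over to \<open>cls x\<close>.\<close>

lemma card_cls_W:
 assumes x: "x \<in> carrier R" and B: "stable B"
 shows "card (cls x \<inter> B) * card (W x) = card (W x \<inter> B) * card (cls x)"
proof -
 have fW: "finite (W x)" using W_carrier[OF x] finite_subset by blast
 have fU: "finite (Units R)" using fin by (rule rev_finite_subset) (auto simp: Units_def)
 have Cc: "a \<in> carrier R" if "a \<in> cls x" for a using cls_in[OF x that] .
 let ?s = "card {u \<in> Units R. (\<lambda>y. u \<otimes> y) ` cls x = cls x}"
 have s: "card {u \<in> Units R. y \<in> (\<lambda>y. u \<otimes> y) ` cls x} = ?s" if y: "y \<in> W x" for y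
 proof -
  obtain v where v: "v \<in> Units R" "cls y = (\<lambda>a. v \<otimes> a) ` cls x" using W_cls[OF x y] by blast
  have yc: "y \<in> carrier R" using y W_carrier[OF x] by blast
  have iff: "y \<in> (\<lambda>y. u \<otimes> y) ` cls x \<longleftrightarrow> (\<lambda>y. u \<otimes> y) ` cls x = (\<lambda>a. v \<otimes> a) ` cls x" if u: "u \<in> Units R" for u
  using cls_mult[OF u x] cls_eq[of "u \<otimes> x" y] u x v(2) cls_self[OF yc] by fastforce
  have img: "(\<lambda>a. (v \<otimes> u) \<otimes> a) ` cls x = (\<lambda>a. v \<otimes> a) ` ((\<lambda>a. u \<otimes> a) ` cls x)"
   if "u \<in> Units R" for u
   unfolding image_image using v(1) that Cc by (intro image_cong refl) (simp add: m_assoc Units_closed)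
  have "bij_betw (\<lambda>u. v \<otimes> u) {u \<in> Units R. (\<lambda>y. u \<otimes> y) ` cls x = cls x}
    {u \<in> Units R. y \<in> (\<lambda>y. u \<otimes> y) ` cls x}"
  proof (rule bij_betw_imageI)
   show "inj_on (\<lambda>u. v \<otimes> u) {u \<in> Units R. (\<lambda>y. u \<otimes> y) ` cls x = cls x}"
    using v(1) by (intro inj_onI) (auto simp: Units_closed)
   show "(\<lambda>u. v \<otimes> u) ` {u \<in> Units R. (\<lambda>y. u \<otimes> y) ` cls x = cls x} =
     {u \<in> Units R. y \<in> (\<lambda>y. u \<otimes> y) ` cls x}"
   proof (intro Set.set_eqI iffI)
    fix w assume "w \<in> (\<lambda>u. v \<otimes> u) ` {u \<in> Units R. (\<lambda>y. u \<otimes> y) ` cls x = cls x}"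
    then obtain u where u: "u \<in> Units R" "(\<lambda>y. u \<otimes> y) ` cls x = cls x" "w = v \<otimes> u" by blast
    then show "w \<in> {u \<in> Units R. y \<in> (\<lambda>y. u \<otimes> y) ` cls x}"
     using v img[OF u(1)] iff[of w] by simp
   next
    fix w assume "w \<in> {u \<in> Units R. y \<in> (\<lambda>y. u \<otimes> y) ` cls x}"
    then have w: "w \<in> Units R" "(\<lambda>y. w \<otimes> y) ` cls x = (\<lambda>a. v \<otimes> a) ` cls x" using iff[of w] by blast+
    have "(\<lambda>a. (inv v \<otimes> w) \<otimes> a) ` cls x = (\<lambda>a. inv v \<otimes> a) ` ((\<lambda>a. w \<otimes> a) ` cls x)"
     unfolding image_image using v(1) w(1) Cc by (intro image_cong refl) (simp add: m_assoc Units_closed)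
    also have "\<dots> = (\<lambda>a. a) ` cls x"
     unfolding w(2) image_image using v(1) Cc by (intro image_cong refl) simp
    finally have "(\<lambda>a. (inv v \<otimes> w) \<otimes> a) ` cls x = cls x" by simp
    moreover have "w = v \<otimes> (inv v \<otimes> w)" using v w by (simp add: Units_closed)
    ultimately show "w \<in> (\<lambda>u. v \<otimes> u) ` {u \<in> Units R. (\<lambda>y. u \<otimes> y) ` cls x = cls x}"
     using v w by blast
   qed
  qed
  then show ?thesis using bij_betw_same_card by fastforce
 qed
 \<comment> \<open>The pairs (u, y) with y in both D and u times \<open>cls x\<close> are counted in
   both orders.\<close>
 have count: "card (Units R) * card (cls x \<inter> D) = ?s * card (W x \<inter> D)" if D: "stable D" for D
 proof -
  have "card (Units R) * card (cls x \<inter> D) = (\<Sum>u\<in>Units R. card ((\<lambda>y. u \<otimes> y) ` cls x \<inter> D))"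
  proof -
   have "card ((\<lambda>y. u \<otimes> y) ` cls x \<inter> D) = card (cls x \<inter> D)" if u: "u \<in> Units R" for u
   proof -
    have "(\<lambda>y. u \<otimes> y) ` cls x \<inter> D = (\<lambda>y. u \<otimes> y) ` (cls x \<inter> D)"
    proof safe
     fix a assume a: "a \<in> cls x" "u \<otimes> a \<in> D"
     then have "inv u \<otimes> (u \<otimes> a) \<in> D" using stableD[OF D _ a(2)] u by blast
     then show "u \<otimes> a \<in> (\<lambda>y. u \<otimes> y) ` (cls x \<inter> D)" using a u Cc by simp
    qed (use stableD[OF D u] in auto)
    then show ?thesis using u Cc by (simp add: card_image inj_on_def)
   qed
   then show ?thesis by simp
  qed
  also have "\<dots> = (\<Sum>u\<in>Units R. \<Sum>y\<in>W x \<inter> D. of_bool (y \<in> (\<lambda>y. u \<otimes> y) ` cls x))"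
  proof (rule sum.cong[OF refl])
   fix u assume u: "u \<in> Units R"
   have "(\<lambda>y. u \<otimes> y) ` cls x \<subseteq> W x" using u by (auto simp: W_def)
   then have "(\<lambda>y. u \<otimes> y) ` cls x \<inter> D = (W x \<inter> D) \<inter> {y. y \<in> (\<lambda>y. u \<otimes> y) ` cls x}" by blast
   then show "card ((\<lambda>y. u \<otimes> y) ` cls x \<inter> D) = (\<Sum>y\<in>W x \<inter> D. of_bool (y \<in> (\<lambda>y. u \<otimes> y) ` cls x))"
    using fW by simp
  qed
  also have "\<dots> = (\<Sum>y\<in>W x \<inter> D. \<Sum>u\<in>Units R. of_bool (y \<in> (\<lambda>y. u \<otimes> y) ` cls x))" by (rule sum.swap)
  also have "\<dots> = (\<Sum>y\<in>W x \<inter> D. ?s)"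
  proof (rule sum.cong[OF refl])
   fix y assume "y \<in> W x \<inter> D"
   then show "(\<Sum>u\<in>Units R. of_bool (y \<in> (\<lambda>y. u \<otimes> y) ` cls x)) = ?s"
    using s[of y] fU by (simp add: Int_def)
  qed
  finally show ?thesis by simp
 qed
 have c1: "card (Units R) * card (cls x \<inter> B) = ?s * card (W x \<inter> B)" by (rule count[OF B])
 have "stable UNIV" by (simp add: stable_def)
 from count[OF this] have c2: "card (Units R) * card (cls x) = ?s * card (W x)" by simp
 have "card (Units R) > 0" by (auto simp: card_gt_0_iff)
 moreover have "card (Units R) * (card (cls x \<inter> B) * card (W x)) =
   card (Units R) * (card (W x \<inter> B) * card (cls x))"
 proof -
  have "card (Units R) * (card (cls x \<inter> B) * card (W x)) = ?s * card (W x \<inter> B) * card (W x)"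
   using c1 by (simp only: mult.assoc[symmetric])
  also have "\<dots> = card (W x \<inter> B) * (card (Units R) * card (cls x))" unfolding c2 by simp
  finally show ?thesis by (simp only: mult.left_commute)
 qed
 ultimately show ?thesis by (metis less_not_refl mult_left_cancel)
qed

text \<open>Here t = u k with k in \<open>cls h\<close>. Rescaling X by the inverse of u gives
  another union of basic sets, whose overlap does not distinguish k from h.\<close>

lemma shift_W:
 assumes X: "aset X" and t: "t \<in> W h" and h: "h \<in> carrier R"
 obtains u where "u \<in> Units R" "overlap X t = overlap X (u \<otimes> h)"
proof -
 obtain u k where u: "u \<in> Units R" "k \<in> cls h" "t = u \<otimes> k" using t by (auto simp: W_def)
 let ?Y = "(\<lambda>x. inv u \<otimes> x) ` X"
 have Y: "aset ?Y" using aset_mult[OF X] u by simp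
 have im: "(\<lambda>x. u \<otimes> x) ` ?Y = X"
  unfolding image_image using u aset_in[OF X] by (simp cong: image_cong_simp)
 have "overlap X t = overlap ?Y k"
  using card_shift_unit[OF Y u(1) cls_in[OF h u(2)]] unfolding im u(3) by simp
 also have "\<dots> = overlap ?Y h" by (rule card_shift[OF Y h u(2)])
 also have "\<dots> = overlap X (u \<otimes> h)" using card_shift_unit[OF Y u(1) h] unfolding im by simp
 finally show ?thesis using that u(1) by blast
qed

abbreviation "K \<equiv> cls \<one>"

abbreviation "mx \<equiv> max_aideal (carrier R)"

lemma mx_aideal: "mx M ==> aideal M" and mx_ideal: "mx M ==> ideal M R"
 by (auto simp: max_aideal_def aideal_def)

lemma mx_one: "mx M ==> \<one> \<notin> M" using ideal.one_imp_carrier mx_ideal unfolding max_aideal_def by blast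

lemma mx_sum:
 assumes M: "mx M" and J: "aideal J" and x: "x \<in> J" "x \<notin> M"
 obtains j m where "j \<in> J" "m \<in> M" "\<one> = j \<oplus> m"
proof -
 note iM = mx_ideal[OF M] and iJ = aideal_ideal[OF J]
 have "aideal (J <+>\<^bsub>R\<^esub> M)" using aideal_add[OF J mx_aideal[OF M]] .
 moreover have "M \<subseteq> J <+>\<^bsub>R\<^esub> M"
  using set_addI[OF ideal_zero[OF iJ], of _ M R] ideal_in[OF iM] by fastforce
 moreover have "x \<in> J <+>\<^bsub>R\<^esub> M" using set_addI[OF x(1) ideal_zero[OF iM], of R] ideal_in[OF iJ x(1)] by simp
 ultimately have "J <+>\<^bsub>R\<^esub> M = carrier R"
  using M x(2) aset_carrier[OF aideal_aset] unfolding max_aideal_def by blast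
 then have "\<one> \<in> J <+>\<^bsub>R\<^esub> M" by simp
 then show ?thesis using that by (auto simp: set_add_def')
qed

text \<open>Two different maximal \<A>-ideals have elements with sum 1. At p one of the two is a
  unit, and its ideal contains the whole component R_p.\<close>

lemma mx_\<epsilon>:
 assumes M: "mx M" and M': "mx M'" and ne: "M \<noteq> M'" and p: "p \<in> P"
 shows "\<epsilon> {p} \<in> M \<or> \<epsilon> {p} \<in> M'"
proof -
 have "\<not> M' \<subseteq> M" using M M' ne unfolding max_aideal_def by blast
 then obtain x where "x \<in> M'" "x \<notin> M" by blast
 then obtain a b where ab: "a \<in> M'" "b \<in> M" "\<one> = a \<oplus> b" using mx_sum[OF M mx_aideal[OF M']] by blast
 then have "a \<notin> mul p \<or> b \<notin> mul p" using ideal_add[OF mul_ideal] one_notin_mul[OF p] by metis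
 then show ?thesis
  using ab ideal_\<epsilon>_unit[OF mx_ideal[OF M] _ _ p] ideal_\<epsilon>_unit[OF mx_ideal[OF M'] _ _ p] by blast
qed

lemma mx_exists:
 assumes "ideal I R" "I \<noteq> carrier R" "x \<in> carrier R" "cls x \<subseteq> I"
 obtains M where "mx M" "x \<in> M"
proof -
 have "gen x \<subset> carrier R"
  using gen_sub_ideal[OF assms(1,3,4)] assms(2) ideal_sub[OF assms(1)] by blast
 then obtain M where "mx M" "gen x \<subseteq> M" by (rule max_aideal_exists[OF gen_aideal[OF assms(3)]])
 then show ?thesis using that gen_self by blast
qed

lemma gen_one: "gen \<one> = carrier R"
 using ideal.one_imp_carrier[OF aideal_ideal[OF gen_aideal[OF one_closed]] gen_self] .

text \<open>An element outside every maximal \<A>-ideal generates R as an \<A>-ideal, just as 1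
  does, so \<open>W_eq_gen\<close> applies.\<close>

lemma W_one_iff: "y \<in> carrier R ==> y \<in> W \<one> \<longleftrightarrow> (\<forall>M. mx M \<longrightarrow> y \<notin> M)"
proof safe
 fix M assume "y \<in> W \<one>" "mx M" "y \<in> M"
 then show False using aideal_W[OF mx_aideal one_closed, of M y] mx_one by blast
next
 assume y: "y \<in> carrier R" and n: "\<forall>M. mx M \<longrightarrow> y \<notin> M"
 have "gen y = carrier R"
 proof (rule ccontr)
  assume "gen y \<noteq> carrier R"
  then have "gen y \<subset> carrier R" using aset_carrier[OF aideal_aset[OF gen_aideal[OF y]]] by blast
  then obtain M where "mx M" "gen y \<subseteq> M" by (rule max_aideal_exists[OF gen_aideal[OF y]])
  then show False using n gen_self by blast
 qed
 then have "W \<one> = W y" using W_eq_gen[OF one_closed y] gen_one by simp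
 then show "y \<in> W \<one>" using W_self[OF y] by simp
qed

lemma W_one_cls: "y \<in> W \<one> ==> \<exists>u\<in>Units R. u \<otimes> y \<in> K"
proof -
 assume "y \<in> W \<one>"
 then obtain u x where u: "u \<in> Units R" "x \<in> K" "y = u \<otimes> x" by (auto simp: W_def)
 then have "inv u \<otimes> y \<in> K" using cls_in[OF one_closed u(2)] by simp
 then show ?thesis using u(1) by blast
qed

text \<open>A unit in K sends 1 back into the basic set of 1 and therefore stabilises it
  (\<open>cls_stab\<close>). At this stage K may also contain non-units.\<close>

lemma K_subgroup: "subgroup {u \<in> Units R. u \<in> K} (units_of R)"
proof -
 interpret U: group "units_of R" by (rule units_group)
 have st: "u \<otimes> y \<in> K" if "u \<in> Units R" "u \<in> K" "y \<in> K" for u y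
  using cls_stab[OF one_closed cls_self[OF one_closed] that(1) _ that(3)] that by (simp add: Units_closed)
 show ?thesis
 proof (rule U.subgroupI)
  show "{u \<in> Units R. u \<in> K} \<subseteq> carrier (units_of R)" by (auto simp: units_of_def)
  show "{u \<in> Units R. u \<in> K} \<noteq> {}" using cls_self[OF one_closed] by blast
  show "a \<otimes>\<^bsub>units_of R\<^esub> b \<in> {u \<in> Units R. u \<in> K}"
   if "a \<in> {u \<in> Units R. u \<in> K}" "b \<in> {u \<in> Units R. u \<in> K}" for a b
   using that st by (simp add: units_of_mult)
  show "inv\<^bsub>units_of R\<^esub> a \<in> {u \<in> Units R. u \<in> K}" if "a \<in> {u \<in> Units R. u \<in> K}" for a
  proof -
   have a: "a \<in> Units R" "a \<in> K" using that by auto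
   have "cls (inv a \<otimes> a) = (\<lambda>y. inv a \<otimes> y) ` cls a" using a by (intro cls_mult) auto
   then have "K = (\<lambda>y. inv a \<otimes> y) ` K" using cls_eq[OF one_closed a(2)] a(1) by simp
   moreover have "inv a \<otimes> \<one> \<in> (\<lambda>y. inv a \<otimes> y) ` K" using cls_self[OF one_closed] by blast
   ultimately show ?thesis using a by (simp add: units_of_inv)
  qed
 qed
qed

end

text \<open>Purity is stated at the basic set of 1; \<open>pure_sringI\<close> obtains it from an
  arbitrary basic set that contains a unit.\<close>

locale pure_sring = cg_sring R cls for R (structure) and cls +
 assumes pure: "ideal J R ==> (\<And>x j. x \<in> K ==> j \<in> J ==> x \<oplus> j \<in> K) ==> J = {\<zero>}"
begin

lemma one_aset: "aset K" by (rule aset_cls[OF one_closed])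

lemma one_finite: "finite K" by (rule aset_finite[OF one_aset])

lemma pure_tor:
 assumes "p \<in> P"
 obtains x h where "x \<in> K" "h \<in> tor p" "x \<oplus> h \<notin> K"
 using pure[OF tor_ideal[of p]] tor_nontrivial[OF assms] by blast

text \<open>The order of \<open>1 + J\<close> is odd, so a subgroup of index less than three is everything.\<close>

lemma pure_arith:
 assumes J: "aideal J" and Ju: "\<And>j. j \<in> J ==> \<one> \<oplus> j \<in> Units R"
  and c: "3 * hits J \<one> K > card J"
 shows "J = {\<zero>}"
proof -
 note iJ = aideal_ideal[OF J]
 have fJ: "finite J" by (rule aset_finite[OF aideal_aset[OF J]])
 have "{j \<in> J. \<one> \<oplus> j \<in> {u \<in> Units R. u \<in> K}} = {t \<in> J. \<one> \<oplus> t \<in> K}" using Ju by blast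
 then have "hits J \<one> K dvd card J" using one_plus_unit_dvd[OF iJ Ju K_subgroup] by simp
 then obtain m where m: "card J = hits J \<one> K * m" by blast
 have "odd (card J)" using card_ideal_dvd[OF iJ] odd_order by (metis dvd_trans)
 then have "odd m" using m by simp
 moreover have "hits J \<one> K * m < hits J \<one> K * 3" using c m by simp
 then have "m < 3" by simp
 ultimately have "m = 1" by presburger
 then have "hits J \<one> K = card J" using m by simp
 then have eq: "hits J x K = card J" if "x \<in> K" for x
  using card_coset_cls[OF one_aset J one_closed that] by simp
 show ?thesis
 proof (rule pure[OF iJ])
  fix x j assume x: "x \<in> K" and j: "j \<in> J"
  have "{t \<in> J. x \<oplus> t \<in> K} = J" using eq[OF x] fJ by (intro card_subset_eq) auto
  then show "x \<oplus> j \<in> K" using j by blast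
 qed
qed

lemma sum_shift_one:
 assumes "aideal J"
 shows "(\<Sum>t\<in>J. overlap K t) = card K * hits J \<one> K"
 using sum_shift_coset[OF one_finite aset_finite[OF aideal_aset[OF assms]]]
  card_coset_cls[OF one_aset assms one_closed] by simp

text \<open>\<open>\<Gamma> p\<close> fixes x and hence stabilises K, so
  \<open>schur_\<Gamma>\<close> applies to K at a point z that some translation by
  \<open>tor p\<close> moves out of K; purity provides z. It puts p z into an \<A>-ideal inside p R.
  A maximal \<A>-ideal containing p z does not contain z, which forces its p-component to vanish as
  in \<open>W_max_aideal\<close>.\<close>

lemma mx_split:
 assumes p: "p \<in> P" and x: "x \<in> K" "\<pi> {p} x = \<zero>"
 obtains M where "mx M" "\<And>m. m \<in> M ==> \<pi> {p} m = \<zero>"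
proof -
 have xc: "x \<in> carrier R" using cls_in[OF one_closed x(1)] .
 have st: "g \<otimes> y \<in> K" if g: "g \<in> \<Gamma> p" and y: "y \<in> K" for g y
  using cls_stab[OF one_closed x(1) \<Gamma>_Units[OF g] _ y] \<Gamma>_fix[OF g xc x(2)] x(1) by simp
 obtain z h where z: "z \<in> K" "h \<in> tor p" "z \<oplus> h \<notin> K" using pure_tor[OF p] by blast
 have zc: "z \<in> carrier R" using cls_in[OF one_closed z(1)] .
 have s: "\<pi> {p} z \<in> tor p" "cls (num p \<otimes> z) \<subseteq> (\<lambda>z. num p \<otimes> z) ` K"
  using schur_\<Gamma>[OF one_aset p st z] by auto
 have "cls (num p \<otimes> z) \<subseteq> mul p" using s(2) cls_carrier[OF one_closed] by (auto simp: mul_def)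
 moreover have "mul p \<noteq> carrier R" using one_notin_mul[OF p] by blast
 ultimately obtain M where M: "mx M" "num p \<otimes> z \<in> M" using mx_exists[OF mul_ideal, of p "num p \<otimes> z"] zc by auto
 have zM: "z \<notin> M" using W_one_iff[OF zc] M(1) cls_sub_W[OF one_closed] z(1) by blast
 have "\<pi> {p} m = \<zero>" if m: "m \<in> M" for m
 using tor_sub_ideal[OF mx_ideal[OF M(1)] m _ p] s(1) ideal_off[OF P_prime[OF p] mx_ideal[OF M(1)] zc M(2)] zM \<epsilon>_split[OF zc, of "{p}"] ideal_add[OF mx_ideal[OF M(1)]]
  by fastforce
 then show ?thesis using that M(1) by blast
qed

text \<open>If no element of K has zero p-component, then \<open>\<epsilon> (- {p})\<close> is not
  in W 1, since every element of W 1 has a unit multiple in K. So it lies in a maximal \<A>-ideal,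
  which cannot contain \<open>\<epsilon> {p}\<close> as well.\<close>

lemma mx_cover:
 assumes p: "p \<in> P"
 obtains M where "mx M" "\<epsilon> {p} \<notin> M" "(\<forall>m\<in>M. \<pi> {p} m = \<zero>) \<or> \<epsilon> (- {p}) \<in> M"
proof (cases "\<exists>x\<in>K. \<pi> {p} x = \<zero>")
 case True
 then obtain M where M: "mx M" "\<And>m. m \<in> M ==> \<pi> {p} m = \<zero>" using mx_split[OF p] by blast
 then have "\<epsilon> {p} \<notin> M" using \<epsilon>_nonzero[OF p] by fastforce
 then show ?thesis using that M by blast
next
 case False
 have "\<epsilon> (- {p}) \<notin> W \<one>"
 proof
  assume "\<epsilon> (- {p}) \<in> W \<one>"
  then obtain u where u: "u \<in> Units R" "u \<otimes> \<epsilon> (- {p}) \<in> K" using W_one_cls by blast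
  have "\<pi> {p} (u \<otimes> \<epsilon> (- {p})) = u \<otimes> (\<epsilon> {p} \<otimes> \<epsilon> (- {p}))"
   using u by (simp only: m_ac Units_closed \<epsilon>_closed m_closed)
  then have "\<pi> {p} (u \<otimes> \<epsilon> (- {p})) = \<zero>" using u(1) by (simp add: Units_closed)
  then show False using u False by blast
 qed
 then obtain M where M: "mx M" "\<epsilon> (- {p}) \<in> M" using W_one_iff by blast
 have "\<epsilon> {p} \<notin> M"
 using ideal_add[OF mx_ideal[OF M(1)]] M(2) mx_one[OF M(1)] \<epsilon>_add[of "{p}" "- {p}"] by fastforce
 then show ?thesis using that M by blast
qed

lemma rad_mul:
 assumes "j \<in> carrier R" "\<And>M. mx M ==> j \<in> M" "q \<in> P"
 shows "j \<in> mul q"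
proof -
 obtain M where "mx M" "\<epsilon> {q} \<notin> M" using mx_cover[OF assms(3)] by blast
 then show ?thesis using ideal_\<epsilon>_unit[OF mx_ideal, of M j q] assms by blast
qed

text \<open>Suppose that M from \<open>mx_cover\<close> has a non-zero p-component. As p R is not an
  \<A>-ideal, M is strictly smaller than p R, and then K contains a unit multiple of some power p^i
  with i \<ge> 1. So K is stable under the units 1 + t with p^i t = 0, and translation by
  \<open>tor p\<close> keeps every point of K whose p-component is not divisible by p^i. These
  points make up at least half of K, which is enough to contradict purity through
  \<open>pure_arith\<close>.\<close>

lemma mul_or_split:
 assumes p: "p \<in> P" and na: "\<not> aideal (mul p)"
 obtains M where "mx M" "\<And>m. m \<in> M ==> \<pi> {p} m = \<zero>"
proof -
 note pp = P_prime[OF p]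
 obtain M where M: "mx M" "\<epsilon> {p} \<notin> M" "(\<forall>m\<in>M. \<pi> {p} m = \<zero>) \<or> \<epsilon> (- {p}) \<in> M"
  using mx_cover[OF p] by blast
 note iM = mx_ideal[OF M(1)]
 show ?thesis
 proof (cases "\<forall>m\<in>M. \<pi> {p} m = \<zero>")
  case True then show ?thesis using that M(1) by blast
 next
  case False
  then have eM: "\<epsilon> (- {p}) \<in> M" using M(3) by blast
  have torM: "tor p \<subseteq> M" using tor_sub_ideal[OF iM _ _ p] False by blast
  have Mmul: "M \<subseteq> mul p" using ideal_\<epsilon>_unit[OF iM _ _ p] M(2) by blast
  have pM: "num p \<otimes> \<epsilon> {p} \<notin> M"
  proof
   assume a: "num p \<otimes> \<epsilon> {p} \<in> M"
   have "mul p \<subseteq> M"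
   proof
    fix y assume "y \<in> mul p"
    then obtain x where x: "x \<in> carrier R" "y = num p \<otimes> x" by (auto simp: mul_def)
    have "\<pi> {p} y = x \<otimes> (num p \<otimes> \<epsilon> {p})" unfolding x(2) using x(1) by (simp add: m_ac)
    then have "\<pi> {p} y \<in> M" using ideal_mult[OF iM a x(1)] by simp
    moreover have "\<pi> (- {p}) y \<in> M" using ideal_mult'[OF iM eM, of y] x by simp
    ultimately show "y \<in> M" using \<epsilon>_split[of y "{p}"] ideal_add[OF iM] x by (metis m_closed num_closed)
   qed
   then have "mul p = M" using Mmul by blast
   then show False using na mx_aideal[OF M(1)] by simp
  qed
  \<comment> \<open>The exponent is at least 2: for 0 the identity of R_p would lie in M, and for 1
    all of p R would. Hence it has the form i + 1 with i \<ge> 1, and p^i is still outside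
    M.\<close>
  let ?k = "LEAST k. num (p ^ k) \<otimes> \<epsilon> {p} \<in> M"
  have "num (ppart p) \<otimes> \<epsilon> {p} \<in> M" using ppart_kill[OF p] ideal_zero[OF iM] by simp
  then have kM: "num (p ^ ?k) \<otimes> \<epsilon> {p} \<in> M" by (rule LeastI)
  have k_least: "num (p ^ j) \<otimes> \<epsilon> {p} \<notin> M" if "j < ?k" for j using not_less_Least[OF that] .
  have "?k \<noteq> 0" using kM M(2) by (metis \<epsilon>_closed l_one num_1 power_0 One_nat_def)
  moreover have "?k \<noteq> 1" using kM pM by (metis power_one_right)
  ultimately obtain i where i: "?k = Suc i" "i \<ge> 1" by (cases ?k) auto
  let ?y = "num (p ^ i)"
  have yM: "?y \<otimes> \<epsilon> {p} \<notin> M" using k_least[of i] i by simp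
  have other: "\<epsilon> {p} \<in> M'" if "mx M'" "M' \<noteq> M" for M' using mx_\<epsilon>[OF M(1) that(1) _ p] that(2) M(2) by blast
  \<comment> \<open>The choice of i keeps p^i out of M. Any other maximal \<A>-ideal contains
    \<open>\<epsilon> {p}\<close>; if it contained p^i, which is invertible off p, it would contain
    1.\<close>
  have yW: "?y \<in> W \<one>" unfolding W_one_iff[OF num_closed]
  proof (intro allI impI notI)
   fix M' assume M': "mx M'" "?y \<in> M'"
   show False
   proof (cases "M' = M")
    case True then show False using M'(2) yM ideal_mult'[OF iM] by simp
   next
    case False
    have "coprime (p ^ i) q" if "q \<in> P" "q \<in> - {p}" for q
     using that P_prime[OF that(1)] pp by (simp add: primes_coprime)
    then obtain b where "?y \<otimes> num b \<otimes> \<epsilon> (- {p}) = \<epsilon> (- {p})" using num_inverse[of "- {p}" "p ^ i"] by blast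
    then have "\<epsilon> (- {p}) \<in> M'" using ideal_mult'[OF mx_ideal[OF M'(1)] M'(2), of "num b \<otimes> \<epsilon> (- {p})"] by (simp add: m_assoc)
    then have "\<epsilon> {p} \<oplus> \<epsilon> (- {p}) \<in> M'" using ideal_add[OF mx_ideal[OF M'(1)]] other[OF M'(1) False] by blast
    then show False using mx_one[OF M'(1)] \<epsilon>_add[of "{p}" "- {p}"] by simp
   qed
  qed
  then obtain u where u: "u \<in> Units R" "u \<otimes> ?y \<in> K" using W_one_cls by blast
  \<comment> \<open>The unit 1 + t fixes the element u p^i of K and therefore stabilises K.\<close>
  have stab: "(\<one> \<oplus> t) \<otimes> x \<in> K"
   if t: "t \<in> carrier R" "?y \<otimes> t = \<zero>" "\<one> \<oplus> t \<in> Units R" and x: "x \<in> K" for t x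
  proof (rule cls_stab[OF one_closed u(2) t(3) _ x])
   have "(\<one> \<oplus> t) \<otimes> (u \<otimes> ?y) = u \<otimes> ?y \<oplus> u \<otimes> (?y \<otimes> t)"
    using t u by (simp add: l_distr m_ac Units_closed)
   then show "(\<one> \<oplus> t) \<otimes> (u \<otimes> ?y) \<in> K" using t u by (simp add: Units_closed)
  qed
  define B where "B = {x \<in> carrier R. \<exists>y\<in>carrier R. \<pi> {p} x = ?y \<otimes> y}"
  have Bmul: "x \<in> mul p" if x: "x \<in> B" for x
  proof -
   obtain y where y: "y \<in> carrier R" "\<pi> {p} x = ?y \<otimes> y" "x \<in> carrier R" using x by (auto simp: B_def)
   obtain j where "i = Suc j" using i(2) by (cases i) auto
   then have "\<pi> {p} x = num p \<otimes> (num (p ^ j) \<otimes> y)" using y by (simp add: num_mult m_assoc)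
   then show ?thesis using mul_iff[OF pp y(3)] y(1) by (auto simp: mul_def)
  qed
  have near: "x \<oplus> h \<in> K" if x: "x \<in> K" "x \<notin> B" and h: "h \<in> tor p" for x h
  proof -
   have xc: "x \<in> carrier R" using cls_in[OF one_closed x(1)] .
   obtain j v where v: "v \<in> Units R" "\<pi> {p} x = num (p ^ j) \<otimes> (v \<otimes> \<epsilon> {p})" using local_form[OF xc p] by blast
   have "j < i"
   proof (rule ccontr)
    assume "\<not> j < i"
    then have "num (p ^ j) = ?y \<otimes> num (p ^ (j - i))" by (simp flip: num_mult power_add)
    then have "\<pi> {p} x = ?y \<otimes> (num (p ^ (j - i)) \<otimes> (v \<otimes> \<epsilon> {p}))" using v by (simp add: m_assoc Units_closed)
    then show False using x xc v(1) unfolding B_def by (auto simp: Units_closed)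
   qed
   have "\<pi> {p} x \<noteq> \<zero>"
   proof
    assume "\<pi> {p} x = \<zero>"
    then have "\<pi> {p} x = ?y \<otimes> \<zero>" by simp
    then show False using x xc unfolding B_def by blast
   qed
   then obtain t where t: "t \<in> carrier R" "\<pi> {p} t = t" "h = x \<otimes> t" using tor_dvd[OF xc _ p h] by blast
   \<comment> \<open>At p the element x is p^j times the unit v with j < i. So p h = 0 gives p^(j+1)
     t = 0, hence p^i t = 0, and \<open>stab\<close> applies to 1 + t.\<close>
   have "num p \<otimes> h = v \<otimes> (num (p ^ Suc j) \<otimes> \<pi> {p} t)"
   proof -
    have "num p \<otimes> h = num p \<otimes> (\<pi> {p} x \<otimes> t)" using t xc by (metis m_assoc m_comm \<epsilon>_closed)
    also have "\<dots> = num p \<otimes> (num (p ^ j) \<otimes> (v \<otimes> \<epsilon> {p}) \<otimes> t)" using v by simp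
    also have "\<dots> = v \<otimes> ((num p \<otimes> num (p ^ j)) \<otimes> \<pi> {p} t)"
     using v(1) t(1) by (simp only: m_ac Units_closed \<epsilon>_closed num_closed m_closed)
    finally show ?thesis by (simp add: num_mult)
   qed
   then have "v \<otimes> (num (p ^ Suc j) \<otimes> t) = v \<otimes> \<zero>" using h t v by (simp add: tor_def Units_closed)
   then have "num (p ^ Suc j) \<otimes> t = \<zero>" by (subst (asm) Units_l_cancel) (use v t in auto)
   then have yt: "?y \<otimes> t = \<zero>" using num_pow_kill[of p "Suc j" t i] \<open>j < i\<close> t by simp
   have "t \<in> mul p"
   proof (rule ccontr)
    assume "t \<notin> mul p"
    then have "\<pi> {p} ?y = \<zero>" using nonunit_local[OF t(1,2) _ _ p, of ?y] yt t(1) by (simp add: m_comm)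
    then show False using yM ideal_zero[OF iM] by (simp add: m_comm)
   qed
   then have "\<one> \<oplus> t \<in> Units R" using one_plus_\<Gamma>[OF t(1,2) _ pp] \<Gamma>_Units by blast
   then have "(\<one> \<oplus> t) \<otimes> x \<in> K" using stab t(1) yt x(1) by blast
   moreover have "(\<one> \<oplus> t) \<otimes> x = x \<oplus> h" using t xc m_comm[of t x] by (simp add: l_distr)
   ultimately show ?thesis by simp
  qed
  have fW: "finite (W \<one>)" using W_carrier[OF one_closed] finite_subset by blast
  \<comment> \<open>Adding \<open>\<epsilon> {p}\<close> carries B out of B, since B lies in p R. It
    does not leave W 1, since M lies in p R and the other maximal \<A>-ideals contain
    \<open>\<epsilon> {p}\<close>.\<close>
  have BW: "2 * card (W \<one> \<inter> B) \<le> card (W \<one>)"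
  proof -
   let ?f = "\<lambda>b. b \<oplus> \<epsilon> {p}"
   have nm: "?f b \<notin> mul p" if b: "b \<in> B" for b
   proof
    assume "?f b \<in> mul p"
    then have "\<epsilon> {p} \<oplus> b \<in> mul p" using b by (simp add: B_def a_comm)
    then show False using ideal_add_cancel[OF mul_ideal Bmul[OF b]] \<epsilon>_notin_mul[OF p] by simp
   qed
   have "?f b \<in> W \<one>" if b: "b \<in> W \<one>" "b \<in> B" for b
   proof -
    have bc: "b \<in> carrier R" using b by (simp add: B_def)
    have "\<not> (mx M' \<and> ?f b \<in> M')" for M'
    proof
     assume a: "mx M' \<and> ?f b \<in> M'"
     then have M': "mx M'" "?f b \<in> M'" by auto
     show False
     using Mmul M'(2) nm[OF b(2)] ideal_add_cancel[OF mx_ideal[OF M'(1)] other[OF M'(1)] bc M'(2)] b(1) W_one_iff[OF bc] M'(1)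
      by auto
    qed
    then show ?thesis using W_one_iff[of "?f b"] bc by simp
   qed
   then have "?f ` (W \<one> \<inter> B) \<subseteq> W \<one> - B" using nm Bmul by blast
   moreover have "inj_on ?f (W \<one> \<inter> B)" by (auto intro!: inj_onI simp: B_def)
   ultimately have "card (W \<one> \<inter> B) \<le> card (W \<one> - B)" using fW by (metis card_inj_on_le finite_Diff)
   moreover have "card (W \<one>) = card (W \<one> \<inter> B) + card (W \<one> - B)" using fW card_Int_Diff by blast
   ultimately show ?thesis by simp
  qed
  have "stable B" unfolding stable_def B_def
  proof safe
   fix v x y assume v: "v \<in> Units R" "x \<in> carrier R" "y \<in> carrier R" "\<pi> {p} x = ?y \<otimes> y"
   have "\<pi> {p} (v \<otimes> x) = v \<otimes> \<pi> {p} x" using v by (simp add: m_ac Units_closed)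
   also have "\<dots> = ?y \<otimes> (v \<otimes> y)" unfolding v(4) using v by (simp add: m_ac Units_closed)
   finally show "\<exists>y\<in>carrier R. \<pi> {p} (v \<otimes> x) = ?y \<otimes> y" using v by (auto simp: Units_closed)
   show "v \<otimes> x \<in> carrier R" using v by (simp add: Units_closed)
  qed
  from card_cls_W[OF one_closed this]
  have BX: "2 * card (K \<inter> B) \<le> card K"
  proof -
   assume e: "card (K \<inter> B) * card (W \<one>) = card (W \<one> \<inter> B) * card K"
   have "(2 * card (K \<inter> B)) * card (W \<one>) = (2 * card (W \<one> \<inter> B)) * card K" using e by simp
   also have "\<dots> \<le> card (W \<one>) * card K" using BW by (rule mult_le_mono1)
   finally have "(2 * card (K \<inter> B)) * card (W \<one>) \<le> card K * card (W \<one>)" by simp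
   moreover have "card (W \<one>) > 0" using fW W_self[OF one_closed] by (auto simp: card_gt_0_iff)
   ultimately show ?thesis by simp
  qed
  have lower: "2 * overlap K h \<ge> card K" if h: "h \<in> tor p" for h
  proof -
   have "K - B \<subseteq> {a \<in> K. a \<oplus> h \<in> K}" using near h by blast
   then have "card (K - B) \<le> overlap K h" using one_finite by (intro card_mono) auto
   moreover have "card K = card (K \<inter> B) + card (K - B)" using one_finite card_Int_Diff by blast
   ultimately show ?thesis using BX by simp
  qed
  obtain h where h: "h \<in> tor p" "h \<noteq> \<zero>" using tor_nontrivial[OF p] by blast
  note hc = tor_carrier[OF h(1)]
  let ?J = "gen h"
  have aJ: "aideal ?J" by (rule gen_aideal[OF hc])
  note iJ = aideal_ideal[OF aJ]
  have fJ: "finite ?J" by (rule aset_finite[OF aideal_aset[OF aJ]])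
  have hM': "h \<in> M'" if M': "mx M'" for M'
  using h torM ideal_mult'[OF mx_ideal[OF M'] other[OF M'] hc] tor_\<epsilon>[OF pp h(1)] by auto
  have unit: "\<one> \<oplus> j \<in> Units R" if j: "j \<in> ?J" for j
  proof (rule one_plus_unit)
   show jc: "j \<in> carrier R" using ideal_in[OF iJ j] .
   show "j \<in> mul q" if "q \<in> P" for q
    using rad_mul[OF jc _ that] gen_sub[OF mx_aideal hM'] j by blast
  qed
  \<comment> \<open>Elements of J with non-zero p-component generate the same \<A>-ideal as h and so
    obey the bound \<open>lower\<close>; the others form an ideal of index at least 3. Thus two
    thirds of J contribute at least half of \<open>card K\<close> each, and the full term for 0
    lifts the count strictly above a third of \<open>card J\<close>.\<close>
  let ?Jn = "{t \<in> ?J. \<pi> {p} t \<noteq> \<zero>}" and ?Jz = "{t \<in> ?J. \<pi> {p} t = \<zero>}"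
  have low1: "2 * overlap K t \<ge> card K" if t: "t \<in> ?Jn" for t
  proof -
   have tc: "t \<in> carrier R" using t ideal_in[OF iJ] by blast
   have "tor p \<subseteq> gen t" using tor_sub_ideal[OF aideal_ideal[OF gen_aideal[OF tc]] gen_self _ p] t by blast
   then have "gen h \<subseteq> gen t" using gen_sub[OF gen_aideal[OF tc]] h by blast
   moreover have "gen t \<subseteq> gen h" using gen_sub[OF aJ] t by blast
   ultimately have "t \<in> W h" using W_eq_gen[OF hc tc] W_self[OF tc] by simp
   then obtain v where "v \<in> Units R" "overlap K t = overlap K (v \<otimes> h)"
    using shift_W[OF one_aset _ hc] by blast
   then show ?thesis using lower[of "v \<otimes> h"] ideal_mult[OF tor_ideal h(1)] by (simp add: Units_closed)
  qed
  have "ideal ?Jz R"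
   by (rule idealI') (use ideal_in[OF iJ] ideal_zero[OF iJ] ideal_add[OF iJ] ideal_mult[OF iJ] in
     \<open>auto simp: r_distr m_lcomm\<close>)
  moreover have "?Jz \<subset> ?J" using gen_self[of h] tor_\<epsilon>[OF pp h(1)] h(2) by force
  ultimately have J0: "3 * card ?Jz \<le> card ?J" using ideal_index3[OF _ iJ] by blast
  have e: "?J \<inter> {t. \<pi> {p} t = \<zero>} = ?Jz" "?J - {t. \<pi> {p} t = \<zero>} = ?Jn" by auto
  have "card ?J = card ?Jz + card ?Jn"
   using card_Int_Diff[OF fJ, of "{t. \<pi> {p} t = \<zero>}"] unfolding e .
  then have J1: "3 * card ?Jn \<ge> 2 * card ?J" using J0 by simp
  let ?c = "hits ?J \<one> K" and ?x = "card K"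
  have "2 * (?x * ?c) = (\<Sum>t\<in>?J. 2 * overlap K t)"
   using sum_shift_one[OF aJ] by (simp flip: sum_distrib_left)
  also have "\<dots> \<ge> (\<Sum>t\<in>insert \<zero> ?Jn. 2 * overlap K t)"
   using fJ ideal_zero[OF iJ] by (intro sum_mono2) auto
  also have "(\<Sum>t\<in>insert \<zero> ?Jn. 2 * overlap K t) =
    2 * ?x + (\<Sum>t\<in>?Jn. 2 * overlap K t)"
  proof -
   have "{a \<in> K. a \<oplus> \<zero> \<in> K} = K" using cls_in[OF one_closed] by auto
   then show ?thesis using fJ by (subst sum.insert) auto
  qed
  finally have "2 * (?x * ?c) \<ge> 2 * ?x + (\<Sum>t\<in>?Jn. 2 * overlap K t)" .
  moreover have "(\<Sum>t\<in>?Jn. 2 * overlap K t) \<ge> (\<Sum>t\<in>?Jn. ?x)" by (rule sum_mono) (rule low1)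
  ultimately have "2 * (?x * ?c) \<ge> 2 * ?x + card ?Jn * ?x" by simp
  then have "?x * (2 + card ?Jn) \<le> ?x * (2 * ?c)" by (simp add: algebra_simps)
  moreover have "?x > 0" using one_finite cls_self[OF one_closed] by (auto simp: card_gt_0_iff)
  ultimately have "2 + card ?Jn \<le> 2 * ?c" using mult_le_cancel1[of ?x "2 + card ?Jn" "2 * ?c"] by blast
  then have "3 * ?c > card ?J" using J1 by linarith
  from pure_arith[OF aJ unit this] have "?J = {\<zero>}" by simp
  then show ?thesis using gen_self[of h] h(2) by blast
 qed
qed

end

section \<open>Splitting off factors of rank 2\<close>

context fin_cring
begin

definition comp :: "nat set \<Rightarrow> 'a set"
 where "comp S = {x \<in> carrier R. \<pi> S x = x}"

lemma comp_ideal: "ideal (comp S) R"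
 unfolding comp_def by (rule idealI') (auto simp: r_distr m_lcomm)

lemma comp_in: "x \<in> comp S ==> x \<in> carrier R" by (simp add: comp_def)

lemma comp_out: "x \<in> comp S ==> \<pi> (- S) x = \<zero>" unfolding comp_def using \<epsilon>_disj[of x "- S" S] by auto

lemma comp_proj: "x \<in> carrier R ==> \<pi> S x \<in> comp S" by (simp add: comp_def \<epsilon>_idem)

end

context pure_sring
begin

definition cocomp :: "nat set \<Rightarrow> 'a set"
 where "cocomp S = {x \<in> carrier R. \<pi> S x = \<zero>}"

text \<open>
 The prime sets of the tensor factors of rank 2: those of the maximal \<open>\<A>\<close>-ideals which are
 ring direct summands, apart from the ideals \<open>p R\<close>.
\<close>

definition block :: "nat set \<Rightarrow> bool"
 where "block S \<longleftrightarrow> S \<subseteq> P \<and> S \<noteq> {} \<and> mx (cocomp S) \<and> (\<forall>p\<in>S. \<not> aideal (mul p))"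

lemma cocomp_in: "x \<in> cocomp S ==> x \<in> carrier R" by (simp add: cocomp_def)

lemma cocomp_out: "x \<in> cocomp S ==> \<pi> (- S) x = x" unfolding cocomp_def using \<epsilon>_split[of x S] by auto

lemma cocomp_proj: "x \<in> carrier R ==> \<pi> (- S) x \<in> cocomp S" by (simp add: cocomp_def \<epsilon>_idem)

text \<open>For l in the set S of primes whose component is not contained in M, the ideal M lies in
  l R. If l R were an \<A>-ideal, the two would agree by maximality, but M has zero p-component and
  p R is not an \<A>-ideal. So \<open>mul_or_split\<close> applies to l, and
  \<open>mx_\<epsilon>\<close> identifies the ideal it gives with M. Hence M vanishes at all of S
  and contains all other components.\<close>

lemma split_comp:
 assumes "p \<in> P" "\<not> aideal (mul p)" "mx M" "\<And>m. m \<in> M ==> \<pi> {p} m = \<zero>"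
 shows "block {l \<in> P. \<epsilon> {l} \<notin> M}" "p \<in> {l \<in> P. \<epsilon> {l} \<notin> M}" "M = cocomp {l \<in> P. \<epsilon> {l} \<notin> M}"
proof -
 let ?S = "{l \<in> P. \<epsilon> {l} \<notin> M}"
 note iM = mx_ideal[OF assms(3)]
 have eM: "\<epsilon> {q} \<notin> M'" if "q \<in> P" "\<And>m. m \<in> M' ==> \<pi> {q} m = \<zero>" for M' q
  using that \<epsilon>_nonzero[OF that(1)] by fastforce
 show pS: "p \<in> ?S" using assms eM by blast
 have na: "\<not> aideal (mul l)" if l: "l \<in> ?S" for l
 proof
  assume a: "aideal (mul l)"
  have "M \<subseteq> mul l" using ideal_\<epsilon>_unit[OF iM] l by blast
  moreover have "mul l \<noteq> carrier R" using one_notin_mul l by blast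
  ultimately have e: "M = mul l" using assms(3) a mul_sub unfolding max_aideal_def by blast
  then have "l \<noteq> p" using a assms(2) by auto
  then have "\<pi> {p} \<one> \<in> mul l" using mul_\<epsilon>[of l \<one> "{p}"] l P_prime by simp
  then show False using pS e by simp
 qed
 have kill: "\<pi> {l} m = \<zero>" if l: "l \<in> ?S" and m: "m \<in> M" for l m
 proof -
  obtain M' where M': "mx M'" "\<And>m. m \<in> M' ==> \<pi> {l} m = \<zero>"
   using mul_or_split[of l] na[OF l] l by blast
  have lP: "l \<in> P" and lM: "\<epsilon> {l} \<notin> M" using l by simp_all
  have "\<epsilon> {l} \<notin> M'" by (rule eM[OF lP M'(2)])
  then have "M = M'" using mx_\<epsilon>[OF assms(3) M'(1) _ lP] lM by blast
  then show ?thesis using M'(2) m by simp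
 qed
 show M: "M = cocomp ?S"
 proof
  show "M \<subseteq> cocomp ?S"
  proof
   fix m assume m: "m \<in> M"
   have "\<epsilon> ?S \<otimes> m = \<epsilon> ?S \<otimes> \<zero>" by (rule \<epsilon>_eqI) (use kill m ideal_in[OF iM m] in auto)
   then show "m \<in> cocomp ?S" using ideal_in[OF iM m] by (simp add: cocomp_def)
  qed
  show "cocomp ?S \<subseteq> M"
  proof
   fix m assume m: "m \<in> cocomp ?S"
   have "\<epsilon> (- ?S) \<in> M" by (rule ideal_\<epsilon>_set[OF iM]) auto
   then show "m \<in> M" using ideal_mult'[OF iM _ cocomp_in[OF m]] cocomp_out[OF m] by metis
  qed
 qed
 then show "block ?S" unfolding block_def using pS na assms(3) by auto
qed

lemma block_exists:
 assumes "p \<in> P" "\<not> aideal (mul p)"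
 obtains S where "block S" "p \<in> S"
proof -
 obtain M where "mx M" "\<And>m. m \<in> M ==> \<pi> {p} m = \<zero>" using mul_or_split[OF assms(1)] assms(2) by blast
 then show ?thesis using that split_comp(1,2)[OF assms, of M] by blast
qed

lemma \<epsilon>_mem: "p \<in> S ==> \<epsilon> S \<otimes> \<epsilon> {p} = \<epsilon> {p}" by simp

lemma \<epsilon>_in_cocomp: "p \<in> P ==> \<epsilon> {p} \<in> cocomp S \<longleftrightarrow> p \<notin> S"
 using \<epsilon>_nonzero[of p] by (cases "p \<in> S") (auto simp: cocomp_def Int_absorb1)

lemma block_unique: "block S ==> block S' ==> p \<in> S ==> p \<in> S' ==> S = S'"
proof -
 assume S: "block S" "block S'" and p: "p \<in> S" "p \<in> S'"
 have pP: "p \<in> P" using S(1) p by (auto simp: block_def)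
 have "cocomp S = cocomp S'"
  using mx_\<epsilon>[of "cocomp S" "cocomp S'" p] S p \<epsilon>_in_cocomp[OF pP] by (auto simp: block_def)
 then have "q \<in> S \<longleftrightarrow> q \<in> S'" if "q \<in> P" for q using \<epsilon>_in_cocomp[OF that] by blast
 then show ?thesis using S by (auto simp: block_def)
qed

lemma block_finite: "finite {S. block S}"
 by (rule finite_subset[of _ "Pow P"]) (auto simp: block_def)

context
 fixes S assumes S: "block S"
begin

lemma block_mx: "mx (cocomp S)" using S by (simp add: block_def)

lemma block_cocomp_aideal: "aideal (cocomp S)" using block_mx mx_aideal by blast

lemma block_P: "p \<in> S ==> p \<in> P" using S by (auto simp: block_def)

text \<open>\<open>gen z\<close> is not contained in the maximal \<A>-ideal \<open>cocomp S\<close>,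
  so 1 = j + m with j in \<open>gen z\<close> and m in \<open>cocomp S\<close>; projecting to R_S
  shows that \<open>gen z\<close> contains its identity.\<close>

lemma block_gen: "z \<in> carrier R ==> z \<notin> cocomp S ==> comp S \<subseteq> gen z"
proof
 fix u assume z: "z \<in> carrier R" "z \<notin> cocomp S" and u: "u \<in> comp S"
 note iG = aideal_ideal[OF gen_aideal[OF z(1)]]
 obtain j m where jm: "j \<in> gen z" "m \<in> cocomp S" "\<one> = j \<oplus> m"
  using mx_sum[OF block_mx gen_aideal[OF z(1)] gen_self z(2)] by blast
 have c: "j \<in> carrier R" "m \<in> carrier R" "u \<in> carrier R"
  using ideal_in[OF iG jm(1)] cocomp_in[OF jm(2)] comp_in[OF u] by auto
 have "\<epsilon> S = \<pi> S (j \<oplus> m)" by (simp flip: jm(3))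
 then have "\<epsilon> S = \<pi> S j" using c jm(2) by (simp add: r_distr cocomp_def)
 then have "\<epsilon> S \<in> gen z" using ideal_mult[OF iG jm(1), of "\<epsilon> S"] by simp
 then show "u \<in> gen z" using ideal_mult'[OF iG _ c(3), of "\<epsilon> S"] u by (simp add: comp_def)
qed

text \<open>By \<open>block_gen\<close> the \<A>-ideals of y and z both contain R_S, and the
  components off S agree, so both elements generate the same \<A>-ideal.\<close>

lemma block_W:
 assumes z: "z \<in> carrier R" "z \<notin> cocomp S" and y: "y \<in> carrier R" "y \<notin> cocomp S"
  and e: "\<pi> (- S) y = \<pi> (- S) z"
 shows "y \<in> W z"
proof -
 have sub: "gen y \<subseteq> gen z" if z: "z \<in> carrier R" "z \<notin> cocomp S" and y: "y \<in> carrier R"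
  "\<pi> (- S) y = \<pi> (- S) z" for y z
 proof (rule gen_sub[OF gen_aideal[OF z(1)]])
  note iG = aideal_ideal[OF gen_aideal[OF z(1)]]
  have "\<pi> S y \<in> gen z" using block_gen[OF z] comp_proj[OF y(1)] by blast
  moreover have "\<pi> (- S) y \<in> gen z" using y(2) ideal_mult[OF iG gen_self, of "\<epsilon> (- S)"] by simp
  ultimately show "y \<in> gen z" using \<epsilon>_split[OF y(1), of S] ideal_add[OF iG] by metis
 qed
 have "gen y = gen z" using sub[OF z y(1) e] sub[OF y z(1) e[symmetric]] by blast
 then show ?thesis using W_eq_gen[OF y(1) z(1)] W_self[OF y(1)] by simp
qed

text \<open>If p annihilated R_S, then S would be {p} and p R would be \<open>cocomp S\<close>, an
  \<A>-ideal, which the definition of a block excludes.\<close>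

lemma block_big:
 assumes p: "p \<in> S"
 obtains d where "d \<in> comp S" "d \<notin> tor p"
proof (rule ccontr)
 assume no: "\<not> thesis"
 note pP = block_P[OF p]
 have sub: "comp S \<subseteq> tor p" using no that by blast
 have eq: "S = {p}"
 proof (rule ccontr)
  assume "S \<noteq> {p}"
  then obtain l where l: "l \<in> S" "l \<noteq> p" using p by blast
  then have "\<epsilon> {l} \<in> tor p" using sub by (auto simp: comp_def)
  then have "\<epsilon> {l} \<otimes> \<epsilon> {l} = \<zero>" using tor_\<epsilon>_off[OF P_prime[OF pP], of "\<epsilon> {l}" "{l}"] l by simp
  then show False using \<epsilon>_nonzero[OF block_P[OF l(1)]] by simp
 qed
 have "mul p = cocomp S"
 proof
  show "mul p \<subseteq> cocomp S"
  proof
   fix y assume "y \<in> mul p"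
   then obtain x where x: "x \<in> carrier R" "y = num p \<otimes> x" by (auto simp: mul_def)
   have "\<pi> S x \<in> tor p" using sub comp_proj[OF x(1)] by blast
   then have "\<pi> S y = \<zero>" using x by (simp add: tor_def m_lcomm)
   then show "y \<in> cocomp S" using x by (simp add: cocomp_def)
  qed
  show "cocomp S \<subseteq> mul p"
   using mul_off[OF P_prime[OF pP]] cocomp_in cocomp_out eq by (metis subsetI)
 qed
 then show False using S p block_cocomp_aideal by (auto simp: block_def)
qed

text \<open>By \<open>block_W\<close>, some element of \<open>cls z\<close> is a unit multiple of z
  with its S-component replaced by any prescribed non-zero one. If S = {p}, prescribe a component in
  \<open>tor p\<close>: the unit 1 + t from \<open>add_tor\<close> fixes that element and so
  stabilises \<open>cls z\<close>. Otherwise prescribe one that is zero at p: then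
  \<open>\<Gamma> p\<close> stabilises \<open>cls z\<close>, and by Schur's theorem a failure would
  force W (p a) into p R, against \<open>block_W\<close>.\<close>

lemma block_near:
 assumes z: "z \<in> carrier R" "z \<notin> cocomp S" and p: "p \<in> S" and h: "h \<in> tor p"
  and a: "a \<in> cls z" "\<pi> S a \<notin> tor p"
 shows "a \<oplus> h \<in> cls z"
proof -
 note pP = block_P[OF p]
 note pp = P_prime[OF pP]
 have ac: "a \<in> carrier R" using cls_in[OF z(1) a(1)] .
 have W_mem: "\<exists>u\<in>Units R. u \<otimes> (k \<oplus> \<pi> (- S) z) \<in> cls z" if k: "k \<in> comp S" "k \<noteq> \<zero>" for k
 proof -
  let ?y = "k \<oplus> \<pi> (- S) z"
  have kc: "k \<in> carrier R" using comp_in[OF k(1)] .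
  have "\<pi> S ?y = k" using k z by (simp add: r_distr comp_def \<epsilon>_disj)
  moreover have "\<pi> (- S) ?y = \<pi> (- S) z" using comp_out[OF k(1)] z kc by (simp add: r_distr \<epsilon>_idem)
  ultimately have "?y \<in> W z" using block_W[OF z, of ?y] k(2) kc z by (auto simp: cocomp_def)
  then obtain u b where u: "u \<in> Units R" "b \<in> cls z" "?y = u \<otimes> b" by (auto simp: W_def)
  then have "inv u \<otimes> ?y = b" using cls_in[OF z(1)] by simp
  then show ?thesis using u by (intro bexI[of _ "inv u"]) auto
 qed
 show ?thesis
 proof (cases "S = {p}")
  case True
  obtain k where k: "k \<in> tor p" "k \<noteq> \<zero>" using tor_nontrivial[OF pP] by blast
  note kc = tor_carrier[OF k(1)]
  have kS: "k \<in> comp S" using tor_\<epsilon>[OF pp k(1)] kc True by (simp add: comp_def)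
  obtain u where u: "u \<in> Units R" "u \<otimes> (k \<oplus> \<pi> (- S) z) \<in> cls z" using W_mem[OF kS k(2)] by blast
  let ?y = "k \<oplus> \<pi> (- S) z"
  obtain t where t: "t \<in> carrier R" "\<pi> {p} t = t" "t \<in> mul p" "h = a \<otimes> t"
   "\<one> \<oplus> t \<in> \<Gamma> p" "a \<oplus> h = (\<one> \<oplus> t) \<otimes> a" using add_tor[OF ac _ pP h] a(2) True by blast
  obtain s where s: "s \<in> carrier R" "t = num p \<otimes> s" using t(3) by (auto simp: mul_def)
  \<comment> \<open>t is a multiple of p, k is annihilated by p, and the other component is zero at
    p; so 1 + t fixes the representative.\<close>
  have "t \<otimes> k = (num p \<otimes> k) \<otimes> s" using s kc by (simp add: m_ac)
  then have tk: "t \<otimes> k = \<zero>" using k(1) s by (simp add: tor_def)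
  have "t \<otimes> \<pi> (- S) z = \<pi> {p} t \<otimes> \<pi> (- S) z" using t(2) by simp
  also have "\<dots> = t \<otimes> \<pi> {p} (\<pi> (- S) z)" using t(1) z(1) by (simp only: m_ac \<epsilon>_closed m_closed)
  also have "\<dots> = \<zero>" using True t(1) z(1) by (simp add: \<epsilon>_disj)
  finally have ty: "t \<otimes> ?y = \<zero>" using tk t(1) kc z(1) by (simp add: r_distr)
  have yc: "?y \<in> carrier R" using kc z(1) by simp
  have "(\<one> \<oplus> t) \<otimes> (u \<otimes> w) = u \<otimes> w \<oplus> u \<otimes> (t \<otimes> w)" if "w \<in> carrier R" for w
   using t(1) u(1) that by (simp add: l_distr m_lcomm[of t u w] Units_closed)
  then have "(\<one> \<oplus> t) \<otimes> (u \<otimes> ?y) = u \<otimes> ?y \<oplus> u \<otimes> (t \<otimes> ?y)" using yc by blast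
  also have "\<dots> = u \<otimes> ?y" unfolding ty using u(1) kc z(1) by (simp add: Units_closed)
  finally have "(\<one> \<oplus> t) \<otimes> (u \<otimes> ?y) \<in> cls z" using u(2) by simp
  then show ?thesis using cls_stab[OF z(1) u(2) \<Gamma>_Units[OF t(5)] _ a(1)] t(6) by simp
 next
  case False
  then obtain l where l: "l \<in> S" "l \<noteq> p" using p by blast
  have el: "\<epsilon> {l} \<in> comp S" using \<epsilon>_mem[OF l(1)] by (simp add: comp_def)
  obtain u where u: "u \<in> Units R" "u \<otimes> (\<epsilon> {l} \<oplus> \<pi> (- S) z) \<in> cls z"
   using W_mem[OF el \<epsilon>_nonzero[OF block_P[OF l(1)]]] by blast
  let ?y = "\<epsilon> {l} \<oplus> \<pi> (- S) z"
  have "\<pi> {p} ?y = \<zero>" using l p z(1) by (simp add: r_distr \<epsilon>_idem)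
  then have uy: "\<pi> {p} (u \<otimes> ?y) = \<zero>" using u(1) z(1) m_lcomm[of "\<epsilon> {p}" u ?y] by (simp add: Units_closed)
  have inv: "g \<otimes> b \<in> cls z" if g: "g \<in> \<Gamma> p" and b: "b \<in> cls z" for g b
  proof (rule cls_stab[OF z(1) u(2) \<Gamma>_Units[OF g] _ b])
   have "g \<otimes> (u \<otimes> ?y) = u \<otimes> ?y" using \<Gamma>_fix[OF g _ uy] u(1) z(1) by (simp add: Units_closed)
   then show "g \<otimes> (u \<otimes> ?y) \<in> cls z" using u(2) by simp
  qed
  show ?thesis
  proof (rule ccontr)
   assume n: "a \<oplus> h \<notin> cls z"
   have "cls (num p \<otimes> a) \<subseteq> (\<lambda>b. num p \<otimes> b) ` cls z"
    by (rule schur_\<Gamma>(2)[OF aset_cls[OF z(1)] pP inv a(1) h n])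
   then have c: "cls (num p \<otimes> a) \<subseteq> mul p" using cls_carrier[OF z(1)] by (auto simp: mul_def)
   have "\<pi> S (num p \<otimes> a) \<noteq> \<zero>" using a(2) ac by (simp add: tor_def m_lcomm)
   then have pa: "num p \<otimes> a \<in> carrier R" "num p \<otimes> a \<notin> cocomp S" using ac by (auto simp: cocomp_def)
   \<comment> \<open>The element that is 1 on S and agrees with p a elsewhere: it belongs to W (p a)
     but is a unit at p.\<close>
   let ?w = "\<epsilon> S \<oplus> \<pi> (- S) (num p \<otimes> a)"
   have w: "\<pi> S ?w = \<epsilon> S" "\<pi> (- S) ?w = \<pi> (- S) (num p \<otimes> a)"
    using pa(1) by (simp_all add: r_distr \<epsilon>_idem)
   have "\<epsilon> S \<noteq> \<zero>" using \<epsilon>_mem[OF p] \<epsilon>_nonzero[OF pP] by (metis \<epsilon>_closed l_null)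
   then have "?w \<in> W (num p \<otimes> a)" using block_W[OF pa, of ?w] w pa(1) by (auto simp: cocomp_def)
   moreover have "W (num p \<otimes> a) \<subseteq> mul p"
    using c ideal_mult[OF mul_ideal] by (auto simp: W_def Units_closed)
   ultimately have "\<pi> {p} ?w \<in> mul p" using ideal_mult[OF mul_ideal] by blast
   moreover have "\<pi> {p} ?w = \<epsilon> {p}" using p pa(1) by (simp add: r_distr \<epsilon>_idem)
   ultimately show False using \<epsilon>_notin_mul[OF pP] by simp
  qed
 qed
qed

text \<open>By \<open>block_near\<close> only the points of B, whose S-component lies in
  \<open>tor p\<close>, can be lost. They form at most a third of W z: for d in R_S outside
  \<open>tor p\<close>, the shifts by d and by -d carry them to two disjoint sets outside B.
  \<open>card_cls_W\<close> transfers this proportion to \<open>cls z\<close>.\<close>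

lemma block_shift:
 assumes z: "z \<in> carrier R" "z \<notin> cocomp S" and p: "p \<in> S" and h: "h \<in> tor p"
 shows "2 * card (cls z) \<le> 3 * overlap (cls z) h"
proof -
 note pP = block_P[OF p]
 define B where "B = {x \<in> carrier R. \<pi> S x \<in> tor p}"
 have fW: "finite (W z)" using W_carrier[OF z(1)] finite_subset by blast
 have fC: "finite (cls z)" using cls_carrier[OF z(1)] finite_subset by blast
 have Wc: "w \<in> carrier R" "w \<notin> cocomp S" if "w \<in> W z" for w
  using that W_carrier[OF z(1)] aideal_W[OF block_cocomp_aideal z(1) that] z(2) by auto
 obtain d where d: "d \<in> comp S" "d \<notin> tor p" using block_big[OF p] by blast
 note dc = comp_in[OF d(1)]
 have "stable B" unfolding stable_def B_def
 proof safe
  fix v x assume v: "v \<in> Units R" "x \<in> carrier R" "\<pi> S x \<in> tor p"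
  have "\<pi> S (v \<otimes> x) = v \<otimes> \<pi> S x" using v by (simp add: m_ac Units_closed)
  then show "\<pi> S (v \<otimes> x) \<in> tor p" using ideal_mult[OF tor_ideal v(3)] v(1) by (simp add: Units_closed)
  show "v \<otimes> x \<in> carrier R" using v by (simp add: Units_closed)
 qed
 note cW = card_cls_W[OF z(1) this]
 have BW: "3 * card (W z \<inter> B) \<le> card (W z)"
 proof -
  let ?E = "W z \<inter> B"
  have Ec: "w \<in> carrier R" "\<pi> S w \<in> tor p" "w \<in> W z" if "w \<in> ?E" for w using that by (auto simp: B_def)
  have shift: "w \<oplus> e \<in> W z - B" if w: "w \<in> ?E" and e: "e \<in> comp S" "e \<notin> tor p" for w e
  proof -
   note ec = comp_in[OF e(1)]
   have s: "\<pi> S (w \<oplus> e) = e \<oplus> \<pi> S w" using e(1) Ec(1)[OF w] by (simp add: r_distr comp_def a_comm)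
   have n: "\<pi> S (w \<oplus> e) \<notin> tor p" unfolding s
    using ideal_add_cancel[OF tor_ideal Ec(2)[OF w] ec] e(2) by blast
   then have "\<pi> S (w \<oplus> e) \<noteq> \<zero>" using ideal_zero[OF tor_ideal] by metis
   moreover have "\<pi> (- S) (w \<oplus> e) = \<pi> (- S) w"
    using comp_out[OF e(1)] ec Ec(1)[OF w] by (simp add: r_distr)
   ultimately have "w \<oplus> e \<in> W w" using block_W[OF Wc[OF Ec(3)[OF w]], of "w \<oplus> e"] ec Ec(1)[OF w]
    by (auto simp: cocomp_def)
   then show ?thesis using W_eq[OF z(1) Ec(3)[OF w]] n by (auto simp: B_def)
  qed
  have md: "\<ominus> d \<in> comp S" "\<ominus> d \<notin> tor p"
   using ideal_neg[OF comp_ideal d(1)] ideal_neg[OF tor_ideal, of "\<ominus> d" p] d(2) dc by auto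
  let ?F = "(\<lambda>w. w \<oplus> d) ` ?E" and ?G = "(\<lambda>w. w \<oplus> \<ominus> d) ` ?E"
  \<comment> \<open>A common point would put d + d into \<open>tor p\<close>, and then d itself,
    since the order is odd.\<close>
  have "?F \<inter> ?G = {}"
  proof (rule ccontr)
   assume "?F \<inter> ?G \<noteq> {}"
   then obtain v w where vw: "v \<in> ?E" "w \<in> ?E" "v \<oplus> d = w \<oplus> \<ominus> d" by blast
   note c = Ec(1)[OF vw(1)] Ec(1)[OF vw(2)]
   have "d \<oplus> d = (w \<oplus> \<ominus> d \<oplus> d) \<ominus> v \<oplus> (v \<oplus> d \<ominus> (w \<oplus> \<ominus> d))" using c dc by algebra
   also have "\<dots> = w \<ominus> v"
   proof -
    have "v \<oplus> d \<ominus> (w \<oplus> \<ominus> d) = \<zero>" unfolding vw(3) using c dc by simp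
    moreover have "(w \<oplus> \<ominus> d \<oplus> d) \<ominus> v = w \<ominus> v" using c dc by algebra
    ultimately show ?thesis using c by simp
   qed
   finally have dd: "d \<oplus> d = w \<ominus> v" .
   have "\<pi> S (w \<ominus> v) = \<pi> S w \<ominus> \<pi> S v" using c by (simp add: a_minus_def r_distr r_minus)
   moreover have "\<pi> S (d \<oplus> d) = d \<oplus> d" using d(1) by (simp add: r_distr comp_def)
   ultimately have "d \<oplus> d \<in> tor p"
    using ideal_minus[OF tor_ideal Ec(2)[OF vw(2)] Ec(2)[OF vw(1)]] dd by simp
   then have "num p \<otimes> d \<oplus> num p \<otimes> d = \<zero>" using dc by (simp add: tor_def r_distr)
   then show False using double_zero[of "num p \<otimes> d"] d(2) dc by (simp add: tor_def)
  qed
  moreover have "?E \<inter> (?F \<union> ?G) = {}" using shift[OF _ d] shift[OF _ md] by blast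
  moreover have "card ?F = card ?E" "card ?G = card ?E"
   using Ec(1) dc by (auto intro!: card_image inj_onI)
  moreover have "finite ?E" "finite ?F" "finite ?G" using fW by auto
  ultimately have "card (?E \<union> (?F \<union> ?G)) = 3 * card ?E" by (simp add: card_Un_disjoint)
  moreover have "?E \<union> (?F \<union> ?G) \<subseteq> W z" using shift[OF _ d] shift[OF _ md] by blast
  ultimately show ?thesis using card_mono[OF fW] by metis
 qed
 have BC: "3 * card (cls z \<inter> B) \<le> card (cls z)"
 proof -
  have "(3 * card (cls z \<inter> B)) * card (W z) = (3 * card (W z \<inter> B)) * card (cls z)" using cW by simp
  also have "\<dots> \<le> card (W z) * card (cls z)" using BW by (rule mult_le_mono1)
  finally have "card (W z) * (3 * card (cls z \<inter> B)) \<le> card (W z) * card (cls z)" by simp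
  moreover have "card (W z) > 0" using fW W_self[OF z(1)] by (auto simp: card_gt_0_iff)
  ultimately show ?thesis using mult_le_cancel1[of "card (W z)"] by blast
 qed
 have "cls z - B \<subseteq> {a \<in> cls z. a \<oplus> h \<in> cls z}"
  using block_near[OF z p h] cls_in[OF z(1)] by (auto simp: B_def)
 then have "card (cls z - B) \<le> overlap (cls z) h" using fC by (intro card_mono) auto
 moreover have "card (cls z) = card (cls z \<inter> B) + card (cls z - B)" using fC card_Int_Diff by blast
 ultimately show ?thesis using BC by simp
qed

lemma block_shift_W:
 assumes z: "z \<in> carrier R" "z \<notin> cocomp S" and p: "p \<in> S" and h: "h \<in> tor p" and t: "t \<in> W h"
 shows "2 * card (cls z) \<le> 3 * overlap (cls z) t"
proof -
 obtain u where u: "u \<in> Units R"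
  "overlap (cls z) t = overlap (cls z) (u \<otimes> h)"
  using shift_W[OF aset_cls[OF z(1)] t tor_carrier[OF h]] by blast
 show ?thesis unfolding u(2)
  using block_shift[OF z p] ideal_mult[OF tor_ideal h] u(1) by (simp add: Units_closed)
qed

lemma block_tor:
 obtains p h where "p \<in> S" "h \<in> tor p" "h \<noteq> \<zero>" "h \<in> comp S" "h \<notin> cocomp S"
proof -
 obtain p where p: "p \<in> S" using S by (auto simp: block_def)
 note pP = block_P[OF p]
 obtain h where h: "h \<in> tor p" "h \<noteq> \<zero>" using tor_nontrivial[OF pP] by blast
 note hc = tor_carrier[OF h(1)] and eh = tor_\<epsilon>[OF P_prime[OF pP] h(1)]
 have "\<pi> S h = \<pi> S (\<pi> {p} h)" using eh by simp
 also have "\<dots> = \<pi> {p} h" using p hc by (simp only: \<epsilon>_idem) simp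
 finally have "\<pi> S h = h" using eh by simp
 then show ?thesis using that[OF p h] h hc by (auto simp: comp_def cocomp_def)
qed

text \<open>One inclusion is \<open>block_gen\<close>. For the other, let J0 be the intersection of
  \<open>gen h\<close> with \<open>cocomp S\<close>. All h + j with j in J0 lie in W h, so each has
  an overlap of at least two thirds with K, while for each a in K at most c of the sums a + h + j
  lie in K, where c counts the j with 1 + j in K. So c exceeds a third of \<open>card J0\<close>,
  and \<open>pure_arith\<close> gives J0 = {0}.\<close>

lemma block_comp_gen:
 assumes h: "h \<in> comp S" "h \<noteq> \<zero>" "\<exists>p\<in>S. h \<in> tor p"
 shows "gen h = comp S"
proof -
 note hc = comp_in[OF h(1)]
 obtain p where p: "p \<in> S" "h \<in> tor p" using h(3) by blast
 note pP = block_P[OF p(1)]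
 have hM: "h \<notin> cocomp S" using h(1,2) by (auto simp: comp_def cocomp_def)
 have UJ: "comp S \<subseteq> gen h" by (rule block_gen[OF hc hM])
 let ?J = "gen h"
 have aJ: "aideal ?J" by (rule gen_aideal[OF hc])
 note iJ = aideal_ideal[OF aJ]
 define J0 where "J0 = ?J \<inter> cocomp S"
 have aJ0: "aideal J0" unfolding J0_def by (rule aideal_Int[OF aJ block_cocomp_aideal])
 note iJ0 = aideal_ideal[OF aJ0]
 have fJ0: "finite J0" by (rule aset_finite[OF aideal_aset[OF aJ0]])
 have J0c: "j \<in> carrier R" "j \<in> ?J" "j \<in> cocomp S" if "j \<in> J0" for j
  using that ideal_in[OF iJ] by (auto simp: J0_def)
 have hj: "h \<oplus> j \<in> W h" if j: "j \<in> J0" for j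
 proof -
  have c: "h \<oplus> j \<in> carrier R" using hc J0c[OF j] by simp
  have "\<pi> S (h \<oplus> j) = h" using h(1) J0c[OF j] by (simp add: r_distr comp_def cocomp_def)
  then have "h \<oplus> j \<notin> cocomp S" using h(2) by (auto simp: cocomp_def)
  then have "h \<in> gen (h \<oplus> j)" using block_gen[OF c] h(1) by blast
  then have "gen h \<subseteq> gen (h \<oplus> j)" by (rule gen_sub[OF gen_aideal[OF c]])
  moreover have "gen (h \<oplus> j) \<subseteq> gen h"
   using gen_sub[OF aJ] ideal_add[OF iJ gen_self] J0c[OF j] by blast
  ultimately have "gen h = gen (h \<oplus> j)" by blast
  then show ?thesis using W_eq_gen[OF hc c] W_self[OF c] by simp
 qed
 have one: "\<one> \<notin> cocomp S" using mx_one[OF block_mx] .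
 let ?c = "hits J0 \<one> K" and ?x = "card K"
 have ceq: "hits J0 x K = ?c" if "x \<in> K" for x
  using card_coset_cls[OF one_aset aJ0 one_closed that] .
 \<comment> \<open>If a + h + j0 lies in K for some j0, the sums a + h + j run through the coset of
   that element of K modulo J0, which has c points in K.\<close>
 have upper: "card {j \<in> J0. a \<oplus> (h \<oplus> j) \<in> K} \<le> ?c" if a: "a \<in> K" for a
 proof (cases "{j \<in> J0. a \<oplus> (h \<oplus> j) \<in> K} = {}")
  case False
  then obtain j0 where j0: "j0 \<in> J0" "a \<oplus> (h \<oplus> j0) \<in> K" by blast
  have ac: "a \<in> carrier R" using cls_in[OF one_closed a] .
  let ?y = "a \<oplus> (h \<oplus> j0)"
  have "(\<lambda>j. j \<ominus> j0) ` {j \<in> J0. a \<oplus> (h \<oplus> j) \<in> K} \<subseteq> {t \<in> J0. ?y \<oplus> t \<in> K}"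
  proof safe
   fix j assume j: "j \<in> J0" "a \<oplus> (h \<oplus> j) \<in> K"
   show "j \<ominus> j0 \<in> J0" using ideal_minus[OF iJ0 j(1) j0(1)] .
   have "?y \<oplus> (j \<ominus> j0) = a \<oplus> (h \<oplus> j)" using ac hc J0c(1)[OF j(1)] J0c(1)[OF j0(1)] by algebra
   then show "?y \<oplus> (j \<ominus> j0) \<in> K" using j by simp
  qed
  moreover have "inj_on (\<lambda>j. j \<ominus> j0) {j \<in> J0. a \<oplus> (h \<oplus> j) \<in> K}"
   using J0c(1) j0(1) by (auto intro!: inj_onI simp: a_minus_def)
  ultimately have "card {j \<in> J0. a \<oplus> (h \<oplus> j) \<in> K} \<le> hits J0 ?y K"
   using fJ0 by (intro card_inj_on_le) auto
  then show ?thesis using ceq[OF j0(2)] by simp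
 qed (simp only: card.empty le0)
 have "(\<Sum>j\<in>J0. 2 * ?x) \<le> (\<Sum>j\<in>J0. 3 * overlap K (h \<oplus> j))"
  by (rule sum_mono) (rule block_shift_W[OF one_closed one p hj])
 also have "\<dots> = 3 * (\<Sum>j\<in>J0. \<Sum>a\<in>K. of_bool (a \<oplus> (h \<oplus> j) \<in> K))"
  using one_finite by (simp add: sum_distrib_left Int_def)
 also have "\<dots> = 3 * (\<Sum>a\<in>K. \<Sum>j\<in>J0. of_bool (a \<oplus> (h \<oplus> j) \<in> K))" by (subst sum.swap) (rule refl)
 also have "\<dots> = 3 * (\<Sum>a\<in>K. card {j \<in> J0. a \<oplus> (h \<oplus> j) \<in> K})" using fJ0 by (simp add: Int_def)
 also have "\<dots> \<le> 3 * (\<Sum>a\<in>K. ?c)" by (intro mult_le_mono2 sum_mono upper)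
 finally have "?x * (2 * card J0) \<le> ?x * (3 * ?c)" by (simp add: algebra_simps)
 moreover have "?x > 0" using one_finite cls_self[OF one_closed] by (auto simp: card_gt_0_iff)
 ultimately have "2 * card J0 \<le> 3 * ?c" using mult_le_cancel1[of ?x] by blast
 moreover have "card J0 > 0" using fJ0 ideal_zero[OF iJ0] by (auto simp: card_gt_0_iff)
 ultimately have c3: "3 * ?c > card J0" by linarith
 \<comment> \<open>At primes of S the element j vanishes. For another prime q, either q R is an
   \<A>-ideal containing h, or q belongs to another block T and h lies in \<open>cocomp T\<close>;
   either way the \<A>-ideal generated by h, and with it j, lies in q R or in
   \<open>cocomp T\<close>, which vanishes at q.\<close>
 have unit: "\<one> \<oplus> j \<in> Units R" if j: "j \<in> J0" for j
 proof (rule one_plus_unit[OF J0c(1)[OF j]])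
  fix q assume q: "q \<in> P"
  note qp = P_prime[OF q]
  show "j \<in> mul q"
  proof (cases "q \<in> S")
   case True
   then have "\<pi> (- S) j \<in> mul q" using mul_\<epsilon>[OF qp J0c(1)[OF j], of "- S"] by simp
   then show ?thesis using cocomp_out[OF J0c(3)[OF j]] by simp
  next
   case False
   then have qp': "q \<noteq> p" using p by auto
   show ?thesis
   proof (cases "aideal (mul q)")
    case True
    have "\<pi> {p} h \<in> mul q" using mul_\<epsilon>[OF qp hc, of "{p}"] qp' by simp
    then have "h \<in> mul q" using tor_\<epsilon>[OF P_prime[OF pP] p(2)] by simp
    then show ?thesis using gen_sub[OF True] J0c(2)[OF j] by blast
   next
    case nF: False
    then obtain T where T: "block T" "q \<in> T" using block_exists[OF q] by blast
    then have "p \<notin> T" using block_unique[OF S T(1) p(1)] False by blast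
    then have "\<pi> T h = \<zero>" using tor_\<epsilon>_off[OF P_prime[OF pP] p(2)] by blast
    then have "h \<in> cocomp T" using hc by (simp add: cocomp_def)
    then have jT: "j \<in> cocomp T" using gen_sub[OF mx_aideal] T(1) J0c(2)[OF j] by (auto simp: block_def)
    then have "\<pi> (- T) j \<in> mul q" using mul_\<epsilon>[OF qp J0c(1)[OF j], of "- T"] T(2) by simp
    then show ?thesis using cocomp_out[OF jT] by simp
   qed
  qed
 qed
 have J0z: "J0 = {\<zero>}" by (rule pure_arith[OF aJ0 unit c3])
 have "?J \<subseteq> comp S"
 proof
  fix j assume j: "j \<in> ?J"
  have jc: "j \<in> carrier R" using ideal_in[OF iJ j] .
  have "\<pi> (- S) j \<in> J0" using ideal_mult[OF iJ j] cocomp_proj[OF jc] by (simp add: J0_def)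
  then have "j = \<pi> S j" using J0z \<epsilon>_split[OF jc, of S] jc by simp
  then show "j \<in> comp S" using comp_proj[OF jc] by metis
 qed
 then show ?thesis using UJ by blast
qed

lemma block_comp_aideal: "aideal (comp S)"
proof -
 obtain p h where "p \<in> S" "h \<in> tor p" "h \<noteq> \<zero>" "h \<in> comp S" using block_tor by blast
 then show ?thesis using block_comp_gen[of h] gen_aideal[OF comp_in] by metis
qed

text \<open>All non-zero elements of R_S lie in W h, so each overlap is at least two thirds of the
  class. Summed over R_S, the full overlap at 0 accounts for the extra 1.\<close>

lemma block_count:
 assumes z: "z \<in> carrier R" "z \<notin> cocomp S" and b: "b \<in> cls z"
 shows "1 + 2 * card (comp S) \<le> 3 * hits (comp S) b (cls z)"
proof -
 obtain p h where p: "p \<in> S" "h \<in> tor p" "h \<noteq> \<zero>" "h \<in> comp S" using block_tor by blast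
 note hc = comp_in[OF p(4)] and aU = block_comp_aideal
 have gh: "gen h = comp S" using block_comp_gen p by blast
 have fU: "finite (comp S)" by (rule aset_finite[OF aideal_aset[OF aU]])
 have fC: "finite (cls z)" using cls_carrier[OF z(1)] finite_subset by blast
 have tW: "t \<in> W h" if t: "t \<in> comp S - {\<zero>}" for t
 proof -
  have tc: "t \<in> carrier R" using t comp_in by blast
  have "t \<notin> cocomp S" using t by (auto simp: comp_def cocomp_def)
  then have "comp S \<subseteq> gen t" by (rule block_gen[OF tc])
  moreover have "gen t \<subseteq> comp S" using gen_sub[OF aU] t by blast
  ultimately have "gen h = gen t" using gh by blast
  then show ?thesis using W_eq_gen[OF hc tc] W_self[OF tc] by simp
 qed
 let ?c = "hits (comp S) b (cls z)" and ?x = "card (cls z)"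
 have ceq: "hits (comp S) a (cls z) = ?c" if "a \<in> cls z" for a
  using card_coset_cls[OF aset_cls[OF z(1)] aU z(1) that] card_coset_cls[OF aset_cls[OF z(1)] aU z(1) b] by simp
 have "3 * (?x * ?c) = 3 * (\<Sum>a\<in>cls z. hits (comp S) a (cls z))" using ceq by simp
 also have "\<dots> = (\<Sum>t\<in>comp S. 3 * overlap (cls z) t)"
  by (simp add: sum_shift_coset[OF fC fU, symmetric] sum_distrib_left)
 also have "\<dots> = 3 * overlap (cls z) \<zero> + (\<Sum>t\<in>comp S - {\<zero>}. 3 * overlap (cls z) t)"
  by (rule sum.remove[OF fU ideal_zero[OF comp_ideal]])
 also have "{a \<in> cls z. a \<oplus> \<zero> \<in> cls z} = cls z" using cls_in[OF z(1)] by auto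
 also have "3 * ?x + (\<Sum>t\<in>comp S - {\<zero>}. 3 * overlap (cls z) t) \<ge> 3 * ?x + (\<Sum>t\<in>comp S - {\<zero>}. 2 * ?x)"
  by (intro add_left_mono sum_mono block_shift_W[OF z p(1,2)] tW)
 finally have "3 * ?x + (card (comp S) - 1) * (2 * ?x) \<le> 3 * (?x * ?c)"
  using ideal_zero[OF comp_ideal] by simp
 moreover obtain n where n: "card (comp S) = Suc n"
  using fU ideal_zero[OF comp_ideal] by (metis card_gt_0_iff empty_iff gr0_implies_Suc)
 ultimately have "?x * (3 + 2 * n) \<le> ?x * (3 * ?c)" by (simp add: algebra_simps)
 moreover have "?x > 0" using fC b by (auto simp: card_gt_0_iff)
 ultimately have "3 + 2 * n \<le> 3 * ?c" using mult_le_cancel1[of ?x] by blast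
 then show ?thesis using n by simp
qed

text \<open>Two different classes meeting the same coset of R_S outside \<open>cocomp S\<close>
  would each fill more than two thirds of that coset.\<close>

lemma block_cls:
 assumes z: "z \<in> carrier R" "z \<notin> cocomp S" and b: "b \<in> carrier R" "b \<notin> cocomp S"
  and e: "\<pi> (- S) b = \<pi> (- S) z"
 shows "b \<in> cls z"
proof (rule ccontr)
 assume n: "b \<notin> cls z"
 have fU: "finite (comp S)" by (rule aset_finite[OF aideal_aset[OF block_comp_aideal]])
 let ?t0 = "z \<ominus> b"
 have t0: "?t0 \<in> comp S"
 proof -
  have "\<pi> (- S) ?t0 = \<zero>" using z(1) b(1) e by (simp add: a_minus_def r_distr r_minus r_neg)
  then show ?thesis using \<epsilon>_split[of ?t0 S] z(1) b(1) by (simp add: comp_def)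
 qed
 let ?A = "{t \<in> comp S. z \<oplus> t \<in> cls z}" and ?B = "{t \<in> comp S. b \<oplus> t \<in> cls b}"
 let ?C = "{t \<in> comp S. z \<oplus> t \<in> cls b}"
 have "card ?B \<le> card ?C"
 proof (rule card_inj_on_le[of "\<lambda>t. t \<ominus> ?t0"])
  show "inj_on (\<lambda>t. t \<ominus> ?t0) ?B" using comp_in z(1) b(1) by (auto intro!: inj_onI simp: a_minus_def)
  show "(\<lambda>t. t \<ominus> ?t0) ` ?B \<subseteq> ?C"
  proof safe
   fix t assume t: "t \<in> comp S" "b \<oplus> t \<in> cls b"
   show "t \<ominus> ?t0 \<in> comp S" using ideal_minus[OF comp_ideal t(1) t0] .
   have "z \<oplus> (t \<ominus> ?t0) = b \<oplus> t" using z(1) b(1) comp_in[OF t(1)] by algebra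
   then show "z \<oplus> (t \<ominus> ?t0) \<in> cls b" using t(2) by simp
  qed
 qed (use fU in simp)
 moreover have "?A \<inter> ?C = {}" using cls_eq[OF z(1)] cls_eq[OF b(1)] cls_self[OF b(1)] n by blast
 then have "card ?A + card ?C = card (?A \<union> ?C)" using fU by (simp add: card_Un_disjoint)
 moreover have "card (?A \<union> ?C) \<le> card (comp S)" using fU by (intro card_mono) auto
 ultimately show False
  using block_count[OF z cls_self[OF z(1)]] block_count[OF b cls_self[OF b(1)]] by linarith
qed

text \<open>The splitting into R_S and its complement at the level of basic sets: on R_S a class
  only records whether the component is zero. One direction holds because both summands are
  \<A>-ideals, the other by \<open>block_cls\<close>.\<close>

theorem block_split:
 assumes x: "x \<in> carrier R" and y: "y \<in> carrier R"
 shows "y \<in> cls x \<longleftrightarrow> (\<pi> S y = \<zero> \<longleftrightarrow> \<pi> S x = \<zero>) \<and> \<pi> (- S) y \<in> cls (\<pi> (- S) x)"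
proof -
 note aM = block_cocomp_aideal and aU = block_comp_aideal
 have Miff: "a \<in> cocomp S \<longleftrightarrow> \<pi> S a = \<zero>" if "a \<in> carrier R" for a using that by (simp add: cocomp_def)
 have ex: "\<pi> (- S) x \<in> carrier R" using x by simp
 have xM: "\<pi> (- S) x \<in> cocomp S" using cocomp_proj[OF x] .
 show ?thesis
 proof
  assume yx: "y \<in> cls x"
  have "\<pi> S y = \<zero> \<longleftrightarrow> \<pi> S x = \<zero>" using aset_cong[OF aideal_aset[OF aM] x yx] Miff x y by simp
  moreover have "\<pi> (- S) y \<in> cls (\<pi> (- S) x)"
  proof -
   have "x = \<pi> (- S) x \<oplus> \<pi> S x" using \<epsilon>_split[OF x, of S] x by (simp add: a_comm)
   then have "x \<in> cls (\<pi> (- S) x) <+>\<^bsub>R\<^esub> comp S"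
    using set_addI[OF cls_self[OF ex] comp_proj[OF x, of S], of R] by simp
   then have "y \<in> cls (\<pi> (- S) x) <+>\<^bsub>R\<^esub> comp S"
    using asetD[OF aset_add[OF aset_cls[OF ex] aideal_aset[OF aU]] _ yx] by blast
   then obtain c u where c: "c \<in> cls (\<pi> (- S) x)" "u \<in> comp S" "y = c \<oplus> u" by (auto simp: set_add_def')
   have "c \<in> cocomp S" using asetD[OF aideal_aset[OF aM] xM c(1)] .
   then have "\<pi> (- S) y = c"
    using c(3) comp_out[OF c(2)] comp_in[OF c(2)] cocomp_in cocomp_out by (simp add: r_distr)
   then show ?thesis using c(1) by simp
  qed
  ultimately show "(\<pi> S y = \<zero> \<longleftrightarrow> \<pi> S x = \<zero>) \<and> \<pi> (- S) y \<in> cls (\<pi> (- S) x)" by blast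
 next
  assume r: "(\<pi> S y = \<zero> \<longleftrightarrow> \<pi> S x = \<zero>) \<and> \<pi> (- S) y \<in> cls (\<pi> (- S) x)"
  show "y \<in> cls x"
  proof (cases "\<pi> S x = \<zero>")
   case True
   then have "x = \<pi> (- S) x" "y = \<pi> (- S) y"
    using r \<epsilon>_split[OF x, of S] \<epsilon>_split[OF y, of S] x y by simp_all
   then show ?thesis using r by simp
  next
   case False
   have "\<pi> (- S) x = x \<oplus> \<ominus> \<pi> S x"
   proof -
    have "x \<oplus> \<ominus> \<pi> S x = (\<pi> S x \<oplus> \<pi> (- S) x) \<ominus> \<pi> S x"
     using \<epsilon>_split[OF x, of S] by (simp add: a_minus_def)
    then show ?thesis using x add_minus_cancel by simp
   qed
   then have "\<pi> (- S) x \<in> cls x <+>\<^bsub>R\<^esub> comp S"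
    using set_addI[OF cls_self[OF x] ideal_neg[OF comp_ideal comp_proj[OF x, of S]], of R] by simp
   then have "\<pi> (- S) y \<in> cls x <+>\<^bsub>R\<^esub> comp S"
    using asetD[OF aset_add[OF aset_cls[OF x] aideal_aset[OF aU]]] r by blast
   then obtain c u where c: "c \<in> cls x" "u \<in> comp S" "\<pi> (- S) y = c \<oplus> u" by (auto simp: set_add_def')
   have cc: "c \<in> carrier R" using cls_in[OF x c(1)] .
   have "c \<notin> cocomp S" using aset_cong[OF aideal_aset[OF aM] x c(1)] False Miff[OF x] by simp
   moreover have "\<pi> (- S) y = \<pi> (- S) c"
   proof -
    have "\<pi> (- S) y = \<pi> (- S) (\<pi> (- S) y)" using y by (simp add: \<epsilon>_idem)
    also have "\<dots> = \<pi> (- S) c" unfolding c(3) using cc comp_in[OF c(2)] comp_out[OF c(2)] by (simp add: r_distr)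
    finally show ?thesis .
   qed
   moreover have "y \<notin> cocomp S" using r False Miff[OF y] by blast
   ultimately have "y \<in> cls c" using block_cls[OF cc _ y] by blast
   then show ?thesis using cls_eq[OF x c(1)] by simp
  qed
 qed
qed

end

end

section \<open>The component rings R_Q\<close>

context fin_cring
begin

text \<open>R_Q as a ring with its own identity. Addition and multiplication are those of R, so
  basic sets of R contained in it can be used unchanged.\<close>

abbreviation corner :: "nat set \<Rightarrow> ('a, 'b) ring_scheme"
 where "corner Q \<equiv> R\<lparr>carrier := comp Q, one := \<epsilon> Q\<rparr>"

lemma \<epsilon>_in_comp: "\<epsilon> Q \<in> comp Q" by (simp add: comp_def)

lemma comp_mult: "x \<in> comp Q ==> \<pi> Q x = x" by (simp add: comp_def)

lemma comp_add_closed: "x \<in> comp Q ==> y \<in> comp Q ==> x \<oplus> y \<in> comp Q"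
 and comp_mult_closed: "x \<in> comp Q ==> y \<in> comp Q ==> x \<otimes> y \<in> comp Q"
 and comp_zero: "\<zero> \<in> comp Q"
 and comp_neg: "x \<in> comp Q ==> \<ominus> x \<in> comp Q"
 using ideal_add[OF comp_ideal, of x Q y] ideal_mult[OF comp_ideal, of y Q x]
  ideal_zero[OF comp_ideal, of Q] ideal_neg[OF comp_ideal, of x Q] comp_in[of x Q] by simp_all

text \<open>Stated for disjoint families because it serves both the single primes and the sets of
  the final partition. The third claim carries the induction.\<close>

lemma finsum_family:
 assumes I: "finite I" and dis: "disjoint_family_on Q I" and x: "\<And>i. i \<in> I ==> x i \<in> comp (Q i)"
 shows "finsum R x I \<in> carrier R" "j \<in> I ==> \<epsilon> (Q j) \<otimes> finsum R x I = x j"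
  "S \<inter> (\<Union>i\<in>I. Q i) = {} ==> \<epsilon> S \<otimes> finsum R x I = \<zero>"
proof -
 have "finsum R x F \<in> carrier R \<and> (\<forall>j\<in>F. \<epsilon> (Q j) \<otimes> finsum R x F = x j) \<and>
   (\<forall>S. S \<inter> (\<Union>i\<in>F. Q i) = {} \<longrightarrow> \<epsilon> S \<otimes> finsum R x F = \<zero>)" if "finite F" "F \<subseteq> I" for F using that
 proof (induction F rule: finite_induct)
  case (insert i F)
  have xc: "x \<in> F \<rightarrow> carrier R" "x i \<in> carrier R" using x insert.prems comp_in by auto
  have xi: "\<epsilon> (Q i) \<otimes> x i = x i" using x[of i] insert.prems comp_mult by simp
  have off: "\<epsilon> S \<otimes> x i = \<zero>" if "S \<inter> Q i = {}" for S using \<epsilon>_disj[OF xc(2) that] xi by simp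
  have e: "finsum R x (insert i F) = x i \<oplus> finsum R x F" using insert.hyps xc by simp
  have IH: "finsum R x F \<in> carrier R" "\<forall>j\<in>F. \<epsilon> (Q j) \<otimes> finsum R x F = x j"
   "\<And>S. S \<inter> (\<Union>i\<in>F. Q i) = {} ==> \<epsilon> S \<otimes> finsum R x F = \<zero>" using insert by auto
  have disj: "Q j \<inter> Q i = {}" if "j \<in> F" for j
   using disjoint_family_onD[OF dis, of j i] that insert.prems insert.hyps(2) by auto
  show ?case unfolding e
  proof (intro conjI ballI allI impI)
   fix j assume j: "j \<in> insert i F"
   show "\<pi> (Q j) (x i \<oplus> finsum R x F) = x j"
   proof (cases "j = i")
    case True
    have "Q i \<inter> (\<Union>i\<in>F. Q i) = {}" using disj by blast
    then show ?thesis using True IH(1,3) xi xc by (simp add: r_distr)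
   next
    case False
    then have "x j \<in> carrier R" using j xc(1) by auto
    then show ?thesis using False j IH(1,2) off[OF disj] xc by (simp add: r_distr)
   qed
  qed (use IH xc off in \<open>auto simp: r_distr Int_Un_distrib\<close>)
 qed simp
 from this[OF I order_refl] show "finsum R x I \<in> carrier R" "j \<in> I ==> \<epsilon> (Q j) \<otimes> finsum R x I = x j"
  "S \<inter> (\<Union>i\<in>I. Q i) = {} ==> \<epsilon> S \<otimes> finsum R x I = \<zero>" by blast+
qed

lemma corner_cring: "cring (corner Q)"
proof (rule cringI)
 show "abelian_group (corner Q)"
 proof (rule abelian_groupI)
  fix x assume "x \<in> carrier (corner Q)"
  then show "\<exists>y\<in>carrier (corner Q). y \<oplus>\<^bsub>corner Q\<^esub> x = \<zero>\<^bsub>corner Q\<^esub>"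
   using comp_in by (auto intro!: bexI[of _ "\<ominus> x"] comp_neg simp: l_neg)
 qed (auto simp: comp_add_closed comp_zero comp_in a_assoc intro: a_comm comp_in)
 show "comm_monoid (corner Q)" by (rule comm_monoidI)
   (auto simp: comp_mult_closed \<epsilon>_in_comp comp_in m_assoc comp_mult intro: m_comm comp_in)
qed (simp add: comp_in l_distr)

lemma corner_fin: "fin_cring (corner Q)"
 using fin_cring.intro[OF corner_cring] fin_cring_axioms.intro[of "corner Q"]
  finite_subset[OF ideal_sub[OF comp_ideal] fin] by simp

lemma corner_num: "cring.num (corner Q) d = \<epsilon> Q \<otimes> num d"
proof (induction d)
 case 0
 then show ?case using cring.num_0[OF corner_cring] by simp
next
 case (Suc d)
 have "cring.num (corner Q) (Suc d) = cring.num (corner Q) d \<oplus> \<epsilon> Q"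
  using cring.num_add[OF corner_cring, of Q d 1] cring.num_1[OF corner_cring, of Q] by simp
 then show ?case using Suc num_add[of d 1] by (simp add: r_distr)
qed

lemma corner_num_mult: "x \<in> comp Q ==> cring.num (corner Q) d \<otimes> x = num d \<otimes> x"
 using comp_mult[of x Q] comp_in[of x Q] by (simp add: corner_num m_assoc m_lcomm)

lemma corner_order: "order (corner Q) dvd order R"
 using card_ideal_dvd[OF comp_ideal[of Q]] by (simp add: order_def)

lemma corner_neg: "x \<in> comp Q ==> \<ominus>\<^bsub>corner Q\<^esub> x = \<ominus> x"
proof -
 assume x: "x \<in> comp Q"
 interpret C: cring "corner Q" by (rule corner_cring)
 show ?thesis using C.minus_equality[of "\<ominus> x" x] x comp_neg comp_in by (simp add: l_neg)
qed

lemma corner_minus: "x \<in> comp Q ==> y \<in> comp Q ==> x \<ominus>\<^bsub>corner Q\<^esub> y = x \<ominus> y"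
 using corner_neg[of y Q] by (simp add: a_minus_def)

lemma comp_minus_closed: "x \<in> comp Q ==> y \<in> comp Q ==> x \<ominus> y \<in> comp Q"
 by (simp add: a_minus_def comp_add_closed comp_neg)

lemma corner_primes: "ring_primes (corner Q) = P \<inter> Q"
proof (intro equalityI subsetI)
 interpret C: fin_cring "corner Q" by (rule corner_fin)
 fix p assume p: "p \<in> C.P"
 then have "prime p" "p dvd order (corner Q)" by (simp_all add: ring_primes_def)
 then have pp: "prime p" and pP: "p \<in> P"
  using dvd_trans[OF _ corner_order[of Q]] by (auto simp: ring_primes_def)
 obtain h where h: "h \<in> C.tor p" "h \<noteq> \<zero>" using C.tor_nontrivial[OF p] by auto
 have hc: "h \<in> comp Q" using C.tor_carrier[OF h(1)] by simp
 have ht: "h \<in> tor p" using h(1) corner_num_mult[OF hc] comp_in[OF hc] by (simp add: C.tor_def tor_def)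
 have "p \<in> Q" using tor_\<epsilon>_off[OF pp ht, of Q] comp_mult[OF hc] h(2) by auto
 then show "p \<in> P \<inter> Q" using pP by simp
next
 fix p assume p: "p \<in> P \<inter> Q"
 have t: "tor p \<subseteq> comp Q"
 proof
  fix h assume h: "h \<in> tor p"
  have "\<pi> Q (\<pi> {p} h) = \<pi> {p} h" using p by (simp add: \<epsilon>_idem[OF tor_carrier[OF h]])
  then show "h \<in> comp Q" using tor_\<epsilon>[OF _ h] P_prime p tor_carrier[OF h] by (simp add: comp_def)
 qed
 have "ideal (tor p) (corner Q)"
 proof (rule cring.idealI'[OF corner_cring])
  fix r x assume "r \<in> carrier (corner Q)" "x \<in> tor p"
  then show "r \<otimes>\<^bsub>corner Q\<^esub> x \<in> tor p" using ideal_mult[OF tor_ideal, of x p r] comp_in by simp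
 next
  show "tor p \<subseteq> carrier (corner Q)" using t by simp
  show "\<zero>\<^bsub>corner Q\<^esub> \<in> tor p" using ideal_zero[OF tor_ideal, of p] by simp
  fix x y assume "x \<in> tor p" "y \<in> tor p"
  then show "x \<oplus>\<^bsub>corner Q\<^esub> y \<in> tor p" using ideal_add[OF tor_ideal, of x p y] by simp
 qed
 then have "card (tor p) dvd order (corner Q)" using fin_cring.card_ideal_dvd[OF corner_fin] by blast
 then have "p dvd order (corner Q)" using card_tor[of p] p dvd_trans by blast
 then show "p \<in> ring_primes (corner Q)" using p by (simp add: ring_primes_def)
qed

lemma corner_Units: "Units (corner Q) = (\<lambda>u. \<pi> Q u) ` Units R"
proof (intro equalityI subsetI)
 fix x assume "x \<in> Units (corner Q)"
 then obtain y where xy: "x \<in> comp Q" "y \<in> comp Q" "x \<otimes> y = \<epsilon> Q" by (auto simp: Units_def)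
 note c = comp_in[OF xy(1)] comp_in[OF xy(2)]
 have "patch Q x \<one> \<in> Units R" by (rule patch_unit[of _ _ y \<one>]) (use c xy(3) in auto)
 moreover have "\<epsilon> Q \<otimes> patch Q x \<one> = x" using patch_in[of x \<one> Q Q] xy by (simp add: comp_def)
 ultimately show "x \<in> (\<lambda>u. \<pi> Q u) ` Units R" by force
next
 fix x assume "x \<in> (\<lambda>u. \<pi> Q u) ` Units R"
 then obtain u where u: "u \<in> Units R" "x = \<pi> Q u" by auto
 have "\<pi> Q u \<otimes> (\<epsilon> Q \<otimes> inv u) = \<epsilon> Q \<otimes> \<epsilon> Q \<otimes> (u \<otimes> inv u)"
  using u(1) by (simp only: m_ac \<epsilon>_closed Units_closed Units_inv_closed m_closed)
 then have "x \<otimes> (\<epsilon> Q \<otimes> inv u) = \<epsilon> Q" using u by simp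
 moreover have "x \<in> comp Q" "\<epsilon> Q \<otimes> inv u \<in> comp Q" using u comp_proj[of u Q] comp_proj[of "inv u" Q] by (simp_all add: Units_closed)
 ultimately show "x \<in> Units (corner Q)"
  using comp_in by (auto simp: Units_def m_comm[of x "\<epsilon> Q \<otimes> inv u"])
qed

lemma corner_mul: "prime p ==> x \<in> comp Q ==> x \<in> fin_cring.mul (corner Q) p \<longleftrightarrow> x \<in> mul p"
proof -
 assume p: "prime p" and x: "x \<in> comp Q"
 interpret C: fin_cring "corner Q" by (rule corner_fin)
 show ?thesis
 proof
  assume "x \<in> C.mul p"
  then obtain y where y: "y \<in> comp Q" "x = num p \<otimes> y" using corner_num_mult by (auto simp: C.mul_def)
  then show "x \<in> mul p" using comp_in[OF y(1)] by (auto simp: mul_def)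
 next
  assume "x \<in> mul p"
  then obtain y where y: "y \<in> carrier R" "x = num p \<otimes> y" by (auto simp: mul_def)
  have "x = num p \<otimes> \<pi> Q y" using comp_mult[OF x] y by (simp add: m_lcomm)
  then show "x \<in> C.mul p" using corner_num_mult[OF comp_proj[OF y(1), of Q]] comp_proj[OF y(1), of Q]
   by (auto simp: C.mul_def intro!: image_eqI[of _ _ "\<pi> Q y"])
 qed
qed

lemma corner_tor: "x \<in> comp Q ==> x \<in> fin_cring.tor (corner Q) p \<longleftrightarrow> x \<in> tor p"
 using fin_cring.tor_def[OF corner_fin, of Q p] corner_num_mult[of x Q p] comp_in[of x Q]
 by (simp add: tor_def)

end

lemma (in cg_ring) corner_cg_ring: "cg_ring (corner Q)"
proof -
 interpret C: fin_cring "corner Q" by (rule corner_fin)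
 show ?thesis
 proof
  show "odd (order (corner Q))" using corner_order[of Q] odd_order dvd_trans by blast
  fix x assume "x \<in> carrier (corner Q)"
  then have x: "x \<in> comp Q" by simp
  obtain d u where u: "u \<in> Units R" "x = num d \<otimes> u" using assoc_num[OF comp_in[OF x]] by blast
  have "x = num d \<otimes> \<pi> Q u"
   using comp_mult[OF x] u by (simp add: m_lcomm[of "\<epsilon> Q" "num d" u] Units_closed)
  then have "x = C.num d \<otimes> \<pi> Q u" using corner_num_mult comp_proj u(1) Units_closed by simp
  then show "\<exists>d. \<exists>u\<in>Units (corner Q). x = C.num d \<otimes>\<^bsub>corner Q\<^esub> u"
   using u(1) unfolding corner_Units by auto
 qed
qed

section \<open>The local separation lemma\<close>

lemma card_le_fibres:
 assumes "finite A" "\<And>y. y \<in> f ` A ==> card {x \<in> A. f x = y} \<le> c"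
 shows "card A \<le> card (f ` A) * c"
proof -
 have "card A = (\<Sum>y\<in>f ` A. card {x \<in> A. f x = y})"
  using sum.group[of A "f ` A" f "\<lambda>_. 1 :: nat"] assms(1) by simp
 also have "\<dots> \<le> (\<Sum>y\<in>f ` A. c)" using assms(2) by (intro sum_mono) auto
 finally show ?thesis by simp
qed

locale local_cg_ring = cg_ring +
 fixes p assumes primes: "ring_primes R = {p}"
begin

lemma pP: "p \<in> P" by (simp add: primes)
lemma pp: "prime p" using P_prime[OF pP] .
lemma p3: "p \<ge> 3" using P_odd[OF pP] .
lemma \<epsilon>_one: "\<epsilon> {p} = \<one>" by (rule \<epsilon>_P) (simp add: primes)

definition D :: "nat \<Rightarrow> 'a set"
 where "D i = (\<lambda>x. num (p ^ i) \<otimes> x) ` carrier R"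

lemma D_ideal: "ideal (D i) R" unfolding D_def by (rule ideal_num_mult) (rule oneideal)

lemma D_1: "D (Suc 0) = mul p" by (simp add: D_def mul_def)

lemma D_0: "D 0 = carrier R" by (simp add: D_def)

lemma D_in: "x \<in> D i ==> x \<in> carrier R" using ideal_in[OF D_ideal] .

lemma num_D: "x \<in> D i ==> num (p ^ j) \<otimes> x \<in> D (i + j)"
proof -
 assume "x \<in> D i"
 then obtain y where y: "y \<in> carrier R" "x = num (p ^ i) \<otimes> y" by (auto simp: D_def)
 then have "num (p ^ j) \<otimes> x = num (p ^ (i + j)) \<otimes> y"
  by (simp add: power_add num_mult m_ac del: of_nat_power)
 then show ?thesis using y by (auto simp: D_def)
qed

lemma D_mult: "x \<in> D i ==> y \<in> D j ==> x \<otimes> y \<in> D (i + j)"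
proof -
 assume x: "x \<in> D i" and y: "y \<in> D j"
 then obtain y' where y': "y' \<in> carrier R" "y = num (p ^ j) \<otimes> y'" by (auto simp: D_def)
 have "x \<otimes> y = num (p ^ j) \<otimes> (x \<otimes> y')" using y' D_in[OF x] by (simp add: m_lcomm)
 then show ?thesis using num_D ideal_mult'[OF D_ideal x y'(1)] by simp
qed

lemma D_mono: "i \<le> j ==> D j \<subseteq> D i"
proof
 fix x assume "i \<le> j" "x \<in> D j"
 then obtain y where y: "y \<in> carrier R" "x = num (p ^ j) \<otimes> y" by (auto simp: D_def)
 have "num (p ^ j) = num (p ^ i) \<otimes> num (p ^ (j - i))"
  using \<open>i \<le> j\<close> by (simp flip: num_mult power_add)
 then have "x = num (p ^ i) \<otimes> (num (p ^ (j - i)) \<otimes> y)" using y by (simp add: m_assoc)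
 then show "x \<in> D i" using y by (auto simp: D_def)
qed

lemma D_Suc: "x \<in> D (Suc i) ==> x \<in> D i" using D_mono[of i "Suc i"] by auto

lemma D_le1: "i \<ge> 1 ==> x \<in> D i ==> x \<in> D 1" using D_mono[of 1 i] by auto

lemma D_vanish: "\<exists>n. D n = {\<zero>}"
proof -
 have "num (ppart p) = \<zero>" using ppart_kill[OF pP] by (simp add: \<epsilon>_one)
 then have "D (multiplicity p (order R)) = {\<zero>}" by (auto simp: D_def image_iff)
 then show ?thesis ..
qed

lemma unit_D: "x \<in> carrier R ==> x \<in> Units R \<longleftrightarrow> x \<notin> D 1" using unit_iff[of x] by (simp add: primes D_1)

lemma unit_add: "x \<in> Units R ==> d \<in> D 1 ==> x \<oplus> d \<in> Units R"
 using unit_D[of x] unit_D[of "x \<oplus> d"] ideal_add_cancel[OF D_ideal, of d 1 x] D_in[of d] Units_closed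
 by (metis a_closed)

lemma unit_cong: "x \<in> carrier R ==> y \<in> carrier R ==> x \<ominus> y \<in> D 1 ==> x \<in> Units R \<longleftrightarrow> y \<in> Units R"
proof -
 have *: "x \<in> Units R" if "x \<in> carrier R" "y \<in> Units R" "x \<ominus> y \<in> D 1" for x y
  using unit_add[OF that(2,3)] add_minus[of y x] that by (simp add: Units_closed)
 assume a: "x \<in> carrier R" "y \<in> carrier R" "x \<ominus> y \<in> D 1"
 have "y \<ominus> x \<in> D 1" using ideal_neg[OF D_ideal a(3)] a by (simp add: a_minus_def minus_add a_comm)
 then show ?thesis using * a by blast
qed

lemma D_unit_mult: "u \<in> Units R ==> x \<in> carrier R ==> u \<otimes> x \<in> D i \<longleftrightarrow> x \<in> D i"
proof
 assume u: "u \<in> Units R" and x: "x \<in> carrier R"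
 show "x \<in> D i ==> u \<otimes> x \<in> D i" using ideal_mult[OF D_ideal] u by blast
 assume "u \<otimes> x \<in> D i"
 then have "inv u \<otimes> (u \<otimes> x) \<in> D i" using ideal_mult[OF D_ideal] u by blast
 then show "x \<in> D i" using u x by simp
qed

lemma D_sym: "x \<in> carrier R ==> y \<in> carrier R ==> x \<ominus> y \<in> D i \<longleftrightarrow> y \<ominus> x \<in> D i"
proof -
 assume "x \<in> carrier R" "y \<in> carrier R"
 then have "\<ominus> (x \<ominus> y) = y \<ominus> x" "\<ominus> (y \<ominus> x) = x \<ominus> y" by (simp_all add: a_minus_def minus_add a_comm)
 then show ?thesis using ideal_neg[OF D_ideal] by metis
qed

lemma D_trans: "x \<in> carrier R ==> y \<in> carrier R ==> z \<in> carrier R ==>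
  x \<ominus> y \<in> D i ==> y \<ominus> z \<in> D i ==> x \<ominus> z \<in> D i"
proof -
 assume c: "x \<in> carrier R" "y \<in> carrier R" "z \<in> carrier R" and d: "x \<ominus> y \<in> D i" "y \<ominus> z \<in> D i"
 have "x \<ominus> z = (x \<ominus> y) \<oplus> (y \<ominus> z)" using c by algebra
 then show ?thesis using ideal_add[OF D_ideal d] by simp
qed

lemma D_shift: "x \<in> carrier R ==> y \<in> carrier R ==> x \<ominus> y \<in> D i ==> x \<in> D i \<longleftrightarrow> y \<in> D i"
 using ideal_add_cancel[OF D_ideal, of "x \<ominus> y" i y] ideal_add[OF D_ideal, of y i "x \<ominus> y"] add_minus[of y x]
 by auto

lemma D_form:
 assumes "x \<in> D i" "x \<notin> D (Suc i)"
 obtains u where "u \<in> Units R" "x = num (p ^ i) \<otimes> u"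
proof -
 obtain y where y: "y \<in> carrier R" "x = num (p ^ i) \<otimes> y" using assms(1) by (auto simp: D_def)
 have "y \<in> Units R" using unit_D y num_D[of y 1 i] assms by auto
 then show ?thesis using that y by blast
qed

lemma D_form':
 assumes x: "x \<in> carrier R" "x \<notin> D i"
 obtains j u where "u \<in> Units R" "x = num (p ^ j) \<otimes> u" "j < i"
proof -
 obtain j u where u: "u \<in> Units R" "\<pi> {p} x = num (p ^ j) \<otimes> (u \<otimes> \<epsilon> {p})"
  using local_form[OF x(1) pP] by blast
 then have e: "x = num (p ^ j) \<otimes> u" using x by (simp add: \<epsilon>_one Units_closed)
 then have "x \<in> D j" using u by (auto simp: D_def Units_closed)
 then have "j < i" using D_mono[of i j] x(2) by (meson in_mono not_le)
 then show ?thesis using that u e by blast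
qed

lemma D_psub:
 assumes "D i \<noteq> {\<zero>}"
 shows "num (p ^ i) \<notin> D (Suc i)"
proof
 assume a: "num (p ^ i) \<in> D (Suc i)"
 obtain x where x: "x \<in> D i" "x \<noteq> \<zero>" using assms ideal_zero[OF D_ideal] by blast
 have "tor p \<subseteq> D i" by (rule tor_sub_ideal[OF D_ideal x(1) _ pP]) (use x D_in in \<open>simp add: \<epsilon>_one\<close>)
 from num_mult_proper[OF D_ideal pP this]
 have "(\<lambda>x. num p \<otimes> x) ` D i \<noteq> D i" by blast
 moreover have "(\<lambda>x. num p \<otimes> x) ` D i = D (Suc i)"
  by (simp add: D_def image_image num_mult m_assoc)
 moreover have "D i \<subseteq> D (Suc i)" using ideal_mult'[OF D_ideal a] by (auto simp: D_def)
 ultimately show False using D_mono[of i "Suc i"] by auto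
qed

lemma D_cancel:
 assumes "D i \<noteq> {\<zero>}" "x \<in> carrier R"
 shows "num (p ^ i) \<otimes> x \<in> D (Suc i) \<longleftrightarrow> x \<in> D 1"
proof
 assume a: "num (p ^ i) \<otimes> x \<in> D (Suc i)"
 show "x \<in> D 1"
 using unit_D a D_unit_mult[of x "num (p ^ i)" "Suc i"] D_psub[OF assms(1)] m_comm[of x "num (p ^ i)"] assms(2)
  by auto
qed (use num_D[of x 1 i] in simp)

lemma card_coset:
 assumes "c \<in> carrier R"
 shows "card {b \<in> carrier R. b \<ominus> c \<in> D i} = card (D i)"
proof -
 have "bij_betw (\<lambda>d. d \<oplus> c) (D i) {b \<in> carrier R. b \<ominus> c \<in> D i}"
  by (rule bij_betw_byWitness[of _ "\<lambda>b. b \<ominus> c"])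
   (use assms D_in in \<open>auto simp: a_minus_def a_assoc r_neg l_neg\<close>)
 then show ?thesis by (simp add: bij_betw_same_card)
qed

lemma sum_coset:
 fixes F :: "'a \<Rightarrow> real"
 assumes "c \<in> carrier R" "\<And>b. b \<in> carrier R ==> b \<ominus> c \<in> D i ==> F b = F c"
 shows "(\<Sum>b\<in>carrier R. of_bool (b \<ominus> c \<in> D i) * F b) = card (D i) * F c"
proof -
 have "(\<Sum>b\<in>carrier R. of_bool (b \<ominus> c \<in> D i) * F b) = (\<Sum>b\<in>carrier R. of_bool (b \<ominus> c \<in> D i) * F c)"
  using assms(2) by (intro sum.cong) auto
 also have "\<dots> = (\<Sum>b\<in>carrier R. of_bool (b \<ominus> c \<in> D i)) * F c" by simp
 also have "(\<Sum>b\<in>carrier R. of_bool (b \<ominus> c \<in> D i)) = real (card {b \<in> carrier R. b \<ominus> c \<in> D i})"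
  by (simp add: Int_def)
 finally show ?thesis by (simp add: card_coset[OF assms(1)])
qed

lemma card_units: "card (Units R) + card (D 1) = order R"
proof -
 have "carrier R = Units R \<union> D 1" "Units R \<inter> D 1 = {}" using unit_D D_in by blast+
 then show ?thesis unfolding order_def using fin by (metis card_Un_disjoint finite_Un)
qed

lemma card_D_pos: "card (D i) > 0"
 using ideal_zero[OF D_ideal] finite_subset[OF ideal_sub[OF D_ideal] fin] by (auto simp: card_gt_0_iff)

text \<open>As long as p^i R is non-zero, multiplication by p^i identifies R modulo p R with p^i R
  modulo p^(i+1) R. The pairs (x, y) with y congruent to p^i x are counted in both orders.\<close>

lemma card_index:
 assumes "D i \<noteq> {\<zero>}"
 shows "order R * card (D (Suc i)) = card (D i) * card (D 1)"
proof -
 let ?f = "\<lambda>x. num (p ^ i) \<otimes> x"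
 let ?g = "\<lambda>x. {y \<in> carrier R. ?f (y \<ominus> x) \<in> D (Suc i)}"
 have "(\<Sum>x\<in>carrier R. card {y \<in> D i. y \<ominus> ?f x \<in> D (Suc i)}) = (\<Sum>x\<in>carrier R. card (D (Suc i)))"
 proof (rule sum.cong[OF refl])
  fix x assume x: "x \<in> carrier R"
  have "y \<in> D i" if "y \<in> carrier R" "y \<ominus> ?f x \<in> D (Suc i)" for y
   using D_shift[of y "?f x" i] D_Suc[OF that(2)] that x by (auto simp: D_def)
  then have "{y \<in> D i. y \<ominus> ?f x \<in> D (Suc i)} = {y \<in> carrier R. y \<ominus> ?f x \<in> D (Suc i)}"
   using D_in by blast
  then show "card {y \<in> D i. y \<ominus> ?f x \<in> D (Suc i)} = card (D (Suc i))"
   using card_coset[of "?f x"] x by simp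
 qed
 also have "\<dots> = order R * card (D (Suc i))" by (simp add: order_def)
 finally have 1: "order R * card (D (Suc i)) = (\<Sum>x\<in>carrier R. card {y \<in> D i. y \<ominus> ?f x \<in> D (Suc i)})" ..
 have "\<dots> = (\<Sum>x\<in>carrier R. \<Sum>y\<in>D i. of_bool (y \<ominus> ?f x \<in> D (Suc i)))"
  using finite_subset[OF ideal_sub[OF D_ideal] fin]
  by (intro sum.cong) (auto simp: of_bool_def sum.If_cases Int_def)
 also have "\<dots> = (\<Sum>y\<in>D i. \<Sum>x\<in>carrier R. of_bool (y \<ominus> ?f x \<in> D (Suc i)))" by (rule sum.swap)
 also have "\<dots> = (\<Sum>y\<in>D i. card (D 1))"
 proof (rule sum.cong[OF refl])
  fix y assume "y \<in> D i"
  then obtain z where z: "z \<in> carrier R" "y = ?f z" by (auto simp: D_def)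
  have "y \<ominus> ?f x \<in> D (Suc i) \<longleftrightarrow> x \<ominus> z \<in> D 1" if x: "x \<in> carrier R" for x
  using z x D_cancel[OF assms, of "z \<ominus> x"] D_sym[of z x]
   by (simp add: a_minus_def r_distr r_minus)
  then have "(\<Sum>x\<in>carrier R. of_bool (y \<ominus> ?f x \<in> D (Suc i))) = card {x \<in> carrier R. x \<ominus> z \<in> D 1}"
   by (simp add: Int_def)
  then show "(\<Sum>x\<in>carrier R. of_bool (y \<ominus> ?f x \<in> D (Suc i))) = card (D 1)"
   using card_coset[OF z(1)] by simp
 qed
 finally show ?thesis using 1 by simp
qed

end

section \<open>Signed sums along lines with unit coefficients\<close>

context local_cg_ring
begin

abbreviation line :: "'a \<Rightarrow> 'a \<Rightarrow> 'a \<Rightarrow> 'a"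
 where "line y b k \<equiv> y \<ominus> b \<otimes> k"

lemma card_Ex_sum: "finite A ==> (\<Sum>x\<in>A. of_bool (Q x)) = (of_nat (card {x \<in> A. Q x}) :: 'c :: semiring_1)"
 by (simp add: Int_def)

lemma lin_coset:
 assumes "m \<in> Units R" "t \<in> carrier R" "b \<in> carrier R"
 shows "line t b m \<in> D i \<longleftrightarrow> b \<ominus> t \<otimes> inv m \<in> D i"
using assms D_unit_mult[of m "b \<ominus> t \<otimes> inv m" i] D_sym[of t "b \<otimes> m" i]
 by (simp add: m_lcomm[of m t "inv m"] a_minus_def r_distr r_minus m_comm[of m b] Units_closed)

lemma sum_lin:
 fixes F :: "'a \<Rightarrow> real"
 assumes m: "m \<in> Units R" and t: "t \<in> carrier R"
  and F: "\<And>b c. b \<in> carrier R ==> c \<in> carrier R ==> b \<ominus> c \<in> D i ==> F b = F c"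
 shows "(\<Sum>b\<in>carrier R. of_bool (line t b m \<in> D i) * F b) = card (D i) * F (t \<otimes> inv m)"
proof -
 have "(\<Sum>b\<in>carrier R. of_bool (line t b m \<in> D i) * F b) =
   (\<Sum>b\<in>carrier R. of_bool (b \<ominus> t \<otimes> inv m \<in> D i) * F b)"
  using lin_coset[OF m t] by (intro sum.cong) auto
 also have "\<dots> = card (D i) * F (t \<otimes> inv m)" by (rule sum_coset) (use m t F in auto)
 finally show ?thesis .
qed

text \<open>
 The functions \<open>h\<close> of \<open>k\<close> and \<open>y\<close> obtained by summing a signed weight on pairs of units \<open>(a, b)\<close>
 along the line \<open>a + b k = y\<close>.
\<close>

definition rep :: "'a set \<Rightarrow> ('a \<Rightarrow> 'a \<Rightarrow> real) \<Rightarrow> bool"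
 where "rep Y h \<longleftrightarrow> (\<exists>\<alpha>. (\<forall>a b. \<alpha> a b \<noteq> 0 \<longrightarrow> a \<in> Units R \<and> b \<in> Units R) \<and>
  (\<forall>k\<in>Units R. \<forall>y\<in>Y. (\<Sum>b\<in>carrier R. \<alpha> (line y b k) b) = h k y))"

lemma repI:
 "(\<And>a b. \<alpha> a b \<noteq> 0 ==> a \<in> Units R \<and> b \<in> Units R) ==>
  (\<And>k y. k \<in> Units R ==> y \<in> Y ==> (\<Sum>b\<in>carrier R. \<alpha> (line y b k) b) = h k y) ==> rep Y h"
 unfolding rep_def by blast

lemma rep_cong: "rep Y h ==> (\<And>k y. k \<in> Units R ==> y \<in> Y ==> h k y = h' k y) ==> rep Y h'"
 unfolding rep_def by auto

lemma rep_sum: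
 assumes "finite I" "\<And>i. i \<in> I ==> rep Y (h i)"
 shows "rep Y (\<lambda>k y. \<Sum>i\<in>I. c i * h i k y)"
proof -
 have "\<forall>i\<in>I. \<exists>\<alpha>. (\<forall>a b. \<alpha> a b \<noteq> 0 \<longrightarrow> a \<in> Units R \<and> b \<in> Units R) \<and>
   (\<forall>k\<in>Units R. \<forall>y\<in>Y. (\<Sum>b\<in>carrier R. \<alpha> (line y b k) b) = h i k y)"
  using assms(2) by (simp add: rep_def)
 from bchoice[OF this] obtain \<alpha> where "\<forall>i\<in>I. (\<forall>a b. \<alpha> i a b \<noteq> 0 \<longrightarrow> a \<in> Units R \<and> b \<in> Units R) \<and>
   (\<forall>k\<in>Units R. \<forall>y\<in>Y. (\<Sum>b\<in>carrier R. \<alpha> i (line y b k) b) = h i k y)" by blast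
 then have \<alpha>: "\<And>i a b. i \<in> I ==> \<alpha> i a b \<noteq> 0 ==> a \<in> Units R \<and> b \<in> Units R"
  "\<And>i k y. i \<in> I ==> k \<in> Units R ==> y \<in> Y ==> (\<Sum>b\<in>carrier R. \<alpha> i (line y b k) b) = h i k y" by blast+
 show ?thesis
 proof (rule repI[of "\<lambda>a b. \<Sum>i\<in>I. c i * \<alpha> i a b"])
  fix a b assume "(\<Sum>i\<in>I. c i * \<alpha> i a b) \<noteq> 0"
  then obtain i where "i \<in> I" "c i * \<alpha> i a b \<noteq> 0" by (meson sum.neutral)
  then show "a \<in> Units R \<and> b \<in> Units R" using \<alpha>(1)[of i a b] by auto
 next
  fix k y assume k: "k \<in> Units R" "y \<in> Y"
  have "(\<Sum>b\<in>carrier R. \<Sum>i\<in>I. c i * \<alpha> i (line y b k) b) =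
    (\<Sum>i\<in>I. c i * (\<Sum>b\<in>carrier R. \<alpha> i (line y b k) b))"
   by (subst sum.swap) (simp add: sum_distrib_left)
  then show "(\<Sum>b\<in>carrier R. \<Sum>i\<in>I. c i * \<alpha> i (line y b k) b) = (\<Sum>i\<in>I. c i * h i k y)"
   using \<alpha>(2) k by simp
 qed
qed

lemma rep_lin: "rep Y h ==> rep Y h' ==> rep Y (\<lambda>k y. c * h k y + d * h' k y)"
 using rep_sum[of "{True, False}" Y "\<lambda>i. if i then h else h'" "\<lambda>i. if i then c else d"] by auto

lemma rep_scale: "rep Y h ==> rep Y (\<lambda>k y. c * h k y)" using rep_lin[of Y h h c 0] by simp

text \<open>Substituting k0 b for b in the weight moves what happens at slope 1 to slope k0.\<close>

lemma rep_twist: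
 assumes h: "rep Y h" and k0: "k0 \<in> Units R"
 shows "rep Y (\<lambda>k y. h (inv k0 \<otimes> k) y)"
proof -
 obtain \<alpha> where \<alpha>: "\<And>a b. \<alpha> a b \<noteq> 0 ==> a \<in> Units R \<and> b \<in> Units R"
  "\<And>k y. k \<in> Units R ==> y \<in> Y ==> (\<Sum>b\<in>carrier R. \<alpha> (line y b k) b) = h k y"
  using h unfolding rep_def by blast
 show ?thesis
 proof (rule repI[of "\<lambda>a b. if b \<in> carrier R then \<alpha> a (k0 \<otimes> b) else 0"])
  fix a b assume "(if b \<in> carrier R then \<alpha> a (k0 \<otimes> b) else 0) \<noteq> 0"
  then have b: "b \<in> carrier R" "a \<in> Units R" "k0 \<otimes> b \<in> Units R" using \<alpha>(1) by (auto split: if_splits)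
  have "inv k0 \<otimes> (k0 \<otimes> b) \<in> Units R" using b k0 by blast
  then show "a \<in> Units R \<and> b \<in> Units R" using b k0 by simp
 next
  fix k y assume k: "k \<in> Units R" "y \<in> Y"
  have "(\<Sum>b\<in>carrier R. if b \<in> carrier R then \<alpha> (line y b k) (k0 \<otimes> b) else 0) =
    (\<Sum>b\<in>carrier R. \<alpha> (y \<ominus> b \<otimes> (inv k0 \<otimes> k)) b)"
  proof (rule sum.reindex_bij_witness[of _ "\<lambda>b. inv k0 \<otimes> b" "\<lambda>b. k0 \<otimes> b"])
   fix b assume b: "b \<in> carrier R"
   have "k0 \<otimes> b \<otimes> (inv k0 \<otimes> k) = (k0 \<otimes> inv k0) \<otimes> (b \<otimes> k)"
    using b k0 k by (simp only: m_ac Units_closed Units_inv_closed m_closed)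
   then have "k0 \<otimes> b \<otimes> (inv k0 \<otimes> k) = b \<otimes> k" using b k0 k by (simp add: Units_closed)
   then show "\<alpha> (y \<ominus> k0 \<otimes> b \<otimes> (inv k0 \<otimes> k)) (k0 \<otimes> b) =
    (if b \<in> carrier R then \<alpha> (line y b k) (k0 \<otimes> b) else 0)" using b by simp
  qed (use k0 Units_closed in auto)
  then show "(\<Sum>b\<in>carrier R. if b \<in> carrier R then \<alpha> (line y b k) (k0 \<otimes> b) else 0) = h (inv k0 \<otimes> k) y"
   using \<alpha>(2) k k0 by simp
 qed
qed

lemma twist_iff: "k \<in> Units R ==> k0 \<in> Units R ==> inv k0 \<otimes> k \<ominus> \<one> \<in> D i \<longleftrightarrow> k \<ominus> k0 \<in> D i"
using D_unit_mult[of k0 "inv k0 \<otimes> k \<ominus> \<one>" i] by (simp add: a_minus_def r_distr r_minus Units_closed)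

lemma unit_neg: "u \<in> Units R ==> \<ominus> u \<in> Units R"
 using unit_D[of u] unit_D[of "\<ominus> u"] ideal_neg[OF D_ideal, of "\<ominus> u" 1] Units_closed[of u] by auto

text \<open>For y in p R the line a + b k = y passes through the origin modulo p. Away from the
  origin it meets the line a + b = 0 only if the two coincide modulo p, that is for k congruent to
  1; then every unit b contributes one point.\<close>

lemma rep_point_D: "rep (D 1) (\<lambda>k y. of_bool (k \<ominus> \<one> \<in> D 1))"
proof -
 have "rep (D 1) (\<lambda>k y. real (card (Units R)) * of_bool (k \<ominus> \<one> \<in> D 1))"
 proof (rule repI[of "\<lambda>a b. of_bool (a \<in> Units R \<and> b \<in> Units R \<and> a \<oplus> b \<in> D 1)"])
  fix k y assume k: "k \<in> Units R" and y: "y \<in> D 1"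
  note yc = D_in[OF y]
  have "of_bool (line y b k \<in> Units R \<and> b \<in> Units R \<and> line y b k \<oplus> b \<in> D 1) =
    of_bool (b \<in> Units R) * (of_bool (k \<ominus> \<one> \<in> D 1) :: real)" if b: "b \<in> carrier R" for b
  proof (cases "b \<in> Units R")
   case True
   have "\<ominus> (b \<otimes> k) \<in> Units R" using True k by (simp add: unit_neg)
   from unit_add[OF this y] have u: "line y b k \<in> Units R"
    using b k yc by (simp add: a_minus_def a_comm Units_closed)
   have "y \<ominus> (line y b k \<oplus> b) = b \<otimes> (k \<ominus> \<one>)" using b Units_closed[OF k] yc by algebra
   then have "line y b k \<oplus> b \<in> D 1 \<longleftrightarrow> k \<ominus> \<one> \<in> D 1"
    using D_unit_mult[OF True, of "k \<ominus> \<one>" 1] ideal_minus[OF D_ideal y, of "line y b k \<oplus> b"]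
     D_shift[of y "line y b k \<oplus> b" 1] y yc b k by (auto simp: Units_closed)
   then show ?thesis using u by simp
  qed simp
  then have "(\<Sum>b\<in>carrier R. of_bool (line y b k \<in> Units R \<and> b \<in> Units R \<and> line y b k \<oplus> b \<in> D 1)) =
    (\<Sum>b\<in>carrier R. of_bool (b \<in> Units R) * (of_bool (k \<ominus> \<one> \<in> D 1) :: real))"
   by (intro sum.cong) auto
  also have "\<dots> = (\<Sum>b\<in>carrier R. of_bool (b \<in> Units R)) * of_bool (k \<ominus> \<one> \<in> D 1)" by simp
  also have "(\<Sum>b\<in>carrier R. of_bool (b \<in> Units R)) = real (card (Units R))"
   by (subst card_Ex_sum) (auto intro!: arg_cong[of _ _ card])
  finally show "(\<Sum>b\<in>carrier R. of_bool (line y b k \<in> Units R \<and> b \<in> Units R \<and> line y b k \<oplus> b \<in> D 1)) =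
    real (card (Units R)) * (of_bool (k \<ominus> \<one> \<in> D 1) :: real)" .
 qed auto
 moreover have "card (Units R) \<noteq> 0" by (auto simp: card_eq_0_iff)
 ultimately show ?thesis using rep_cong[OF rep_scale[of "D 1" _ "1 / card (Units R)"]] by simp
qed

text \<open>
 A point of the plane over the residue field is isolated among the lines meeting both axes outside
 the origin by an explicit signed combination of points off the axes.
\<close>

lemma rep_point_U:
 assumes z: "z \<in> Units R"
 shows "rep (Units R) (\<lambda>k y. of_bool (k \<ominus> \<one> \<in> D 1 \<and> y \<ominus> z \<in> D 1))"
proof -
 note zc = Units_closed[OF z]
 let ?d = "real (card (D 1))" and ?N = "real (order R)"
 have "D 1 \<subset> carrier R" using unit_D[of \<one>] D_in by auto
 then have "3 * card (D 1) \<le> order R"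
  using ideal_index3[OF D_ideal oneideal] by (simp add: order_def)
 then have N: "?N - 2 * ?d > 0" using card_D_pos[of 1] by linarith
 \<comment> \<open>For units k and y the line has \<open>?N - 2 * ?d\<close> points off the axes, so
   the constant \<open>?c\<close> contributes \<open>2 * ?d\<close> in total. Modulo p the
   indicators in the weight belong to the line a + b = z that is to be isolated, to the parallels of
   the axes through its two intercepts, and to its parallel through the origin.\<close>
 let ?c = "2 * ?d / (?N - 2 * ?d)"
 let ?\<beta> = "\<lambda>a b. of_bool (a \<oplus> b \<ominus> z \<in> D 1) - of_bool (a \<ominus> z \<in> D 1) - of_bool (b \<ominus> z \<in> D 1)
  - of_bool (a \<oplus> b \<in> D 1) + ?c"
 have "rep (Units R) (\<lambda>k y. ?N * of_bool (k \<ominus> \<one> \<in> D 1 \<and> y \<ominus> z \<in> D 1))"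
 proof (rule repI[of "\<lambda>a b. of_bool (a \<in> Units R \<and> b \<in> Units R) * ?\<beta> a b"])
  fix k y assume k: "k \<in> Units R" and y: "y \<in> Units R"
  note kc = Units_closed[OF k] and yc = Units_closed[OF y]
  let ?F = "\<lambda>b. of_bool (line y b k \<in> Units R \<and> b \<in> Units R) :: real"
  have F: "?F b = ?F c" if bc: "b \<in> carrier R" "c \<in> carrier R" "b \<ominus> c \<in> D 1" for b c
  proof -
   have "line y c k \<ominus> line y b k = k \<otimes> (b \<ominus> c)" using bc kc yc by algebra
   then have "line y c k \<ominus> line y b k \<in> D 1" using ideal_mult[OF D_ideal bc(3) kc] by simp
   then show ?thesis
    using unit_cong[of "line y c k" "line y b k"] unit_cong[of b c] bc kc yc by simp
  qed
  let ?A = "y \<ominus> z \<in> D 1" and ?B = "line y z k \<in> D 1"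
  have s0: "(\<Sum>b\<in>carrier R. ?F b) = ?N - 2 * ?d"
  proof -
   have "?F b = 1 - of_bool (b \<ominus> \<zero> \<in> D 1) - of_bool (line y b k \<in> D 1)" if b: "b \<in> carrier R" for b
   proof -
    have "\<not> (b \<in> D 1 \<and> line y b k \<in> D 1)"
    proof
     assume a: "b \<in> D 1 \<and> line y b k \<in> D 1"
     then have "b \<otimes> k \<oplus> line y b k \<in> D 1" using ideal_add[OF D_ideal] ideal_mult'[OF D_ideal _ kc] by blast
     then show False using y unit_D add_minus b kc yc by simp
    qed
    moreover have "b \<ominus> \<zero> = b" using b by (simp add: a_minus_def)
    ultimately show ?thesis using unit_D[of b] unit_D[of "line y b k"] b kc yc by auto
   qed
   then have "(\<Sum>b\<in>carrier R. ?F b) =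
     (\<Sum>b\<in>carrier R. 1 - of_bool (b \<ominus> \<zero> \<in> D 1) * 1 - of_bool (line y b k \<in> D 1) * 1)"
    by (intro sum.cong) auto
   also have "\<dots> = ?N - 2 * ?d"
    using sum_coset[of \<zero> 1 "\<lambda>_. 1"] sum_lin[OF k yc, of 1 "\<lambda>_. 1"] by (simp add: sum_subtractf order_def)
   finally show ?thesis .
  qed
  have s2: "(\<Sum>b\<in>carrier R. of_bool (line y b k \<ominus> z \<in> D 1) * ?F b) = ?d * of_bool (\<not> ?A)"
  proof -
   have "(\<Sum>b\<in>carrier R. of_bool (line y b k \<ominus> z \<in> D 1) * ?F b) =
     (\<Sum>b\<in>carrier R. of_bool (line (y \<ominus> z) b k \<in> D 1) * ?F b)"
   proof (rule sum.cong[OF refl])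
    fix b assume "b \<in> carrier R"
    then have "line y b k \<ominus> z = line (y \<ominus> z) b k" using kc yc zc by algebra
    then show "of_bool (line y b k \<ominus> z \<in> D 1) * ?F b = of_bool (line (y \<ominus> z) b k \<in> D 1) * ?F b" by simp
   qed
   also have "\<dots> = ?d * ?F ((y \<ominus> z) \<otimes> inv k)" by (rule sum_lin[OF k _ F]) (use yc zc in auto)
   also have "?F ((y \<ominus> z) \<otimes> inv k) = of_bool (\<not> ?A)"
   proof -
    have "(y \<ominus> z) \<otimes> inv k \<otimes> k = y \<ominus> z" using k kc yc zc by (simp add: m_assoc)
    moreover have "y \<ominus> (y \<ominus> z) = z" using yc zc by algebra
    moreover have "(y \<ominus> z) \<otimes> inv k \<in> Units R \<longleftrightarrow> y \<ominus> z \<notin> D 1"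
     using unit_D[of "(y \<ominus> z) \<otimes> inv k"] D_unit_mult[of "inv k" "y \<ominus> z" 1] m_comm[of "inv k" "y \<ominus> z"] k yc zc by simp
    ultimately show ?thesis using z by simp
   qed
   finally show ?thesis .
  qed
  have Fz: "?F z = of_bool (\<not> ?B)" using unit_D[of "line y z k"] z zc kc yc by simp
  have s3: "(\<Sum>b\<in>carrier R. of_bool (b \<ominus> z \<in> D 1) * ?F b) = ?d * of_bool (\<not> ?B)"
   unfolding Fz[symmetric] by (rule sum_coset) (use zc F in auto)
  have e1: "line y b k \<oplus> b \<ominus> z = line (y \<ominus> z) b (k \<ominus> \<one>)"
   and e4: "line y b k \<oplus> b = line y b (k \<ominus> \<one>)" if "b \<in> carrier R" for b
   using that kc yc zc by algebra+
  let ?s1 = "\<Sum>b\<in>carrier R. of_bool (line y b k \<oplus> b \<ominus> z \<in> D 1) * ?F b"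
  let ?s4 = "\<Sum>b\<in>carrier R. of_bool (line y b k \<oplus> b \<in> D 1) * ?F b"
  have T: "(\<Sum>b\<in>carrier R. of_bool (line y b k \<in> Units R \<and> b \<in> Units R) * ?\<beta> (line y b k) b) =
    ?s1 - ?d * of_bool (\<not> ?A) - ?d * of_bool (\<not> ?B) - ?s4 + 2 * ?d"
  proof -
   have "(\<Sum>b\<in>carrier R. of_bool (line y b k \<in> Units R \<and> b \<in> Units R) * ?\<beta> (line y b k) b) =
    (\<Sum>b\<in>carrier R. of_bool (line y b k \<oplus> b \<ominus> z \<in> D 1) * ?F b - of_bool (line y b k \<ominus> z \<in> D 1) * ?F b
     - of_bool (b \<ominus> z \<in> D 1) * ?F b - of_bool (line y b k \<oplus> b \<in> D 1) * ?F b + ?c * ?F b)"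
    by (intro sum.cong refl) simp
   also have "\<dots> = ?s1 - ?d * of_bool (\<not> ?A) - ?d * of_bool (\<not> ?B) - ?s4 + ?c * (?N - 2 * ?d)"
    unfolding sum.distrib sum_subtractf s2 s3 sum_distrib_left[symmetric] s0 ..
   finally show ?thesis using N by simp
  qed
  have "?s1 - ?d * of_bool (\<not> ?A) - ?d * of_bool (\<not> ?B) - ?s4 + 2 * ?d =
    ?N * of_bool (k \<ominus> \<one> \<in> D 1 \<and> ?A)"
  proof (cases "k \<ominus> \<one> \<in> D 1")
   case True
   have i: "line x b (k \<ominus> \<one>) \<in> D 1 \<longleftrightarrow> x \<in> D 1" if "x \<in> carrier R" "b \<in> carrier R" for x b
   proof -
    have "x \<ominus> line x b (k \<ominus> \<one>) = b \<otimes> (k \<ominus> \<one>)" using that kc by algebra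
    then show ?thesis
     using D_shift[of x "line x b (k \<ominus> \<one>)" 1] ideal_mult[OF D_ideal True that(2)] that kc by simp
   qed
   have "?s1 = (\<Sum>b\<in>carrier R. of_bool ?A * ?F b)"
    by (intro sum.cong refl) (simp add: e1 i yc zc del: One_nat_def)
   also have "\<dots> = of_bool ?A * (?N - 2 * ?d)" by (simp only: sum_distrib_left[symmetric] s0)
   finally have s1: "?s1 = of_bool ?A * (?N - 2 * ?d)" .
   have s4: "?s4 = 0" by (rule sum.neutral) (use y yc unit_D in \<open>simp add: e4 i del: One_nat_def\<close>)
   have "?B \<longleftrightarrow> ?A"
   proof -
    have "line y z k = line (y \<ominus> z) z (k \<ominus> \<one>)" using kc yc zc by algebra
    then show ?thesis using i[of "y \<ominus> z" z] yc zc by simp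
   qed
   then show ?thesis unfolding s1 s4 using True by simp
  next
   case False
   have m: "k \<ominus> \<one> \<in> Units R" using False unit_D kc by simp
   note mc = Units_closed[OF m] and mi = Units_inv_closed[OF m]
   have mm: "x \<otimes> inv (k \<ominus> \<one>) \<otimes> (k \<ominus> \<one>) = x" if "x \<in> carrier R" for x
    using that m mc by (simp add: m_assoc)
   have u: "x \<otimes> inv (k \<ominus> \<one>) \<in> D 1 \<longleftrightarrow> x \<in> D 1" if "x \<in> carrier R" for x
    using D_unit_mult[OF Units_inv_Units[OF m] that, of 1] m_comm[OF that mi] by simp
   have cross: "y \<ominus> x \<otimes> inv (k \<ominus> \<one>) \<otimes> k = (y \<otimes> (k \<ominus> \<one>) \<ominus> x \<otimes> k) \<otimes> inv (k \<ominus> \<one>)" if x: "x \<in> carrier R" for x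
   proof -
    have "y = y \<otimes> inv (k \<ominus> \<one>) \<otimes> (k \<ominus> \<one>)" using mm[OF yc] by simp
    then have "y \<ominus> x \<otimes> inv (k \<ominus> \<one>) \<otimes> k = y \<otimes> inv (k \<ominus> \<one>) \<otimes> (k \<ominus> \<one>) \<ominus> x \<otimes> inv (k \<ominus> \<one>) \<otimes> k" by simp
    also have "\<dots> = (y \<otimes> (k \<ominus> \<one>) \<ominus> x \<otimes> k) \<otimes> inv (k \<ominus> \<one>)" using x yc kc mi by algebra
    finally show ?thesis .
   qed
   have "?s1 = (\<Sum>b\<in>carrier R. of_bool (line (y \<ominus> z) b (k \<ominus> \<one>) \<in> D 1) * ?F b)"
    by (intro sum.cong refl) (simp add: e1)
   also have "\<dots> = ?d * ?F ((y \<ominus> z) \<otimes> inv (k \<ominus> \<one>))" by (rule sum_lin[OF m _ F]) (use yc zc in auto)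
   also have "?F ((y \<ominus> z) \<otimes> inv (k \<ominus> \<one>)) = of_bool (\<not> ?B) * of_bool (\<not> ?A)"
   proof -
    have "y \<otimes> (k \<ominus> \<one>) \<ominus> (y \<ominus> z) \<otimes> k = \<ominus> line y z k" using yc zc kc by algebra
    then have "y \<ominus> (y \<ominus> z) \<otimes> inv (k \<ominus> \<one>) \<otimes> k \<in> D 1 \<longleftrightarrow> \<ominus> line y z k \<in> D 1"
     using cross[of "y \<ominus> z"] u[of "\<ominus> line y z k"] yc zc kc by simp
    moreover have "\<ominus> line y z k \<in> D 1 \<longleftrightarrow> ?B"
     using ideal_neg[OF D_ideal, of "line y z k" 1] ideal_neg[OF D_ideal, of "\<ominus> line y z k" 1] yc zc kc by auto
    ultimately show ?thesis
     using unit_D[of "y \<ominus> (y \<ominus> z) \<otimes> inv (k \<ominus> \<one>) \<otimes> k"] unit_D[of "(y \<ominus> z) \<otimes> inv (k \<ominus> \<one>)"]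
      u[of "y \<ominus> z"] yc zc kc mi by simp
   qed
   finally have s1: "?s1 = ?d * (of_bool (\<not> ?B) * of_bool (\<not> ?A))" .
   have "?s4 = (\<Sum>b\<in>carrier R. of_bool (line y b (k \<ominus> \<one>) \<in> D 1) * ?F b)"
    by (intro sum.cong refl) (simp add: e4)
   also have "\<dots> = ?d * ?F (y \<otimes> inv (k \<ominus> \<one>))" by (rule sum_lin[OF m yc F]) auto
   also have "?F (y \<otimes> inv (k \<ominus> \<one>)) = 1"
   proof -
    have "y \<otimes> (k \<ominus> \<one>) \<ominus> y \<otimes> k = \<ominus> y" using yc kc by algebra
    then have "y \<ominus> y \<otimes> inv (k \<ominus> \<one>) \<otimes> k = \<ominus> y \<otimes> inv (k \<ominus> \<one>)" using cross[OF yc] by simp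
    moreover have "\<ominus> y \<otimes> inv (k \<ominus> \<one>) \<in> Units R" "y \<otimes> inv (k \<ominus> \<one>) \<in> Units R" using y m by (simp_all add: unit_neg)
    ultimately show ?thesis by simp
   qed
   finally have s4: "?s4 = ?d" by simp
   \<comment> \<open>\<open>?A\<close> and \<open>?B\<close> say that the line passes through (z, 0)
     and (0, z) modulo p; through both of them only the line with k congruent to 1 passes.\<close>
   have "\<not> (?A \<and> ?B)"
   proof
    assume AB: "?A \<and> ?B"
    have "(y \<ominus> z) \<ominus> line y z k = z \<otimes> (k \<ominus> \<one>)" using yc zc kc by algebra
    then have "z \<otimes> (k \<ominus> \<one>) \<in> D 1" using ideal_minus[OF D_ideal, of "y \<ominus> z" 1 "line y z k"] AB by simp
    then show False using D_unit_mult[OF z mc] False by simp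
   qed
   then show ?thesis unfolding s1 s4 using False by auto
  qed
  then show "(\<Sum>b\<in>carrier R. of_bool (line y b k \<in> Units R \<and> b \<in> Units R) * ?\<beta> (line y b k) b) =
    ?N * of_bool (k \<ominus> \<one> \<in> D 1 \<and> ?A)" using T by simp
 qed auto
 from rep_cong[OF rep_scale[OF this, of "1 / ?N"]] show ?thesis using order_pos by simp
qed

text \<open>A function of the residues is a combination of indicators of residue pairs. Summing over
  all representatives counts each residue of k and each residue of y \<open>card (D 1)\<close>
  times, hence the division by the square.\<close>

lemma rep_coarse:
 assumes Y: "Y = D 1 \<or> Y = Units R"
  and inv: "\<And>k k' y y'. k \<in> Units R ==> k' \<in> Units R ==> y \<in> Y ==> y' \<in> Y ==>
   k \<ominus> k' \<in> D 1 ==> y \<ominus> y' \<in> D 1 ==> \<phi> k y = \<phi> k' y'"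
 shows "rep Y \<phi>"
proof -
 let ?d = "real (card (D 1))"
 have Yc: "Y \<subseteq> carrier R" using Y D_in by auto
 have Ys: "y' \<in> Y" if "y \<in> Y" "y' \<in> carrier R" "y \<ominus> y' \<in> D 1" for y y'
  using Y that unit_cong[of y y'] D_shift[of y y' 1] Yc by auto
 have finU: "finite (Units R)" "finite Y" using finite_subset[OF _ fin] Yc by blast+
 have pt: "rep Y (\<lambda>k y. of_bool (k \<ominus> k0 \<in> D 1 \<and> y \<ominus> y0 \<in> D 1))" if k0: "k0 \<in> Units R" and y0: "y0 \<in> Y" for k0 y0
 proof -
  have "rep Y (\<lambda>k y. of_bool (k \<ominus> \<one> \<in> D 1 \<and> y \<ominus> y0 \<in> D 1))" using Y
  proof
   assume "Y = D 1"
   then show ?thesis using rep_cong[OF rep_point_D] y0 ideal_minus[OF D_ideal] by simp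
  qed (use rep_point_U y0 in simp)
  from rep_cong[OF rep_twist[OF this k0]] show ?thesis using twist_iff k0 by simp
 qed
 have "rep Y (\<lambda>k y. \<Sum>i\<in>Units R \<times> Y. (\<phi> (fst i) (snd i) / (?d * ?d)) * of_bool (k \<ominus> fst i \<in> D 1 \<and> y \<ominus> snd i \<in> D 1))"
  by (rule rep_sum) (use finU pt in auto)
 then show ?thesis
 proof (rule rep_cong)
  fix k y assume k: "k \<in> Units R" and y: "y \<in> Y"
  have c: "(\<Sum>x\<in>A. of_bool (w \<ominus> x \<in> D 1)) = ?d" if w: "w \<in> carrier R" and A: "A \<subseteq> carrier R"
   "\<And>x. x \<in> carrier R ==> w \<ominus> x \<in> D 1 ==> x \<in> A" for w A
  proof -
   have "{x \<in> A. w \<ominus> x \<in> D 1} = {x \<in> carrier R. x \<ominus> w \<in> D 1}" using A D_sym[OF w] by blast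
   moreover have "(\<Sum>x\<in>A. of_bool (w \<ominus> x \<in> D 1)) = real (card {x \<in> A. w \<ominus> x \<in> D 1})"
    by (rule card_Ex_sum) (rule finite_subset[OF A(1) fin])
   ultimately show ?thesis using card_coset[OF w, of 1] by presburger
  qed
  have "(\<Sum>i\<in>Units R \<times> Y. (\<phi> (fst i) (snd i) / (?d * ?d)) * of_bool (k \<ominus> fst i \<in> D 1 \<and> y \<ominus> snd i \<in> D 1)) =
    (\<Sum>(k0, y0)\<in>Units R \<times> Y. (\<phi> k y / (?d * ?d)) * (of_bool (k \<ominus> k0 \<in> D 1) * of_bool (y \<ominus> y0 \<in> D 1)))"
   using inv[OF k _ y] by (intro sum.cong) auto
  also have "\<dots> = (\<phi> k y / (?d * ?d)) * ((\<Sum>k0\<in>Units R. of_bool (k \<ominus> k0 \<in> D 1)) * (\<Sum>y0\<in>Y. of_bool (y \<ominus> y0 \<in> D 1)))"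
   by (subst sum_product) (simp add: sum.cartesian_product sum_distrib_left case_prod_unfold)
  also have "(\<Sum>k0\<in>Units R. of_bool (k \<ominus> k0 \<in> D 1)) = ?d"
   by (rule c) (use k Units_closed unit_cong[of k] in auto)
  also have "(\<Sum>y0\<in>Y. of_bool (y \<ominus> y0 \<in> D 1)) = ?d" by (rule c) (use y Yc Ys in auto)
  finally show "(\<Sum>i\<in>Units R \<times> Y. (\<phi> (fst i) (snd i) / (?d * ?d)) * of_bool (k \<ominus> fst i \<in> D 1 \<and> y \<ominus> snd i \<in> D 1)) = \<phi> k y"
   using card_D_pos[of 1] by simp
 qed
qed

end

section \<open>Powers of principal units\<close>

context local_cg_ring
begin

lemma one_plus_pow:
 assumes s: "s \<in> carrier R"
 shows "\<exists>r\<in>carrier R. (\<one> \<oplus> s) [^] m = \<one> \<oplus> num m \<otimes> s \<oplus> num (m choose 2) \<otimes> (s \<otimes> s) \<oplus> s \<otimes> s \<otimes> s \<otimes> r"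
proof (induction m)
 case 0
 then show ?case using s by (intro bexI[of _ \<zero>]) (auto simp: numeral_2_eq_2)
next
 case (Suc m)
 then obtain r where r: "r \<in> carrier R"
  "(\<one> \<oplus> s) [^] m = \<one> \<oplus> num m \<otimes> s \<oplus> num (m choose 2) \<otimes> (s \<otimes> s) \<oplus> s \<otimes> s \<otimes> s \<otimes> r" by blast
 have n: "num (Suc m) = num m \<oplus> \<one>" "num (Suc m choose 2) = num m \<oplus> num (m choose 2)"
  using num_add[of m 1] num_add[of m "m choose 2"] by (simp_all add: numeral_2_eq_2)
 have *: "(\<one> \<oplus> a \<otimes> s \<oplus> c \<otimes> (s \<otimes> s) \<oplus> s \<otimes> s \<otimes> s \<otimes> r) \<otimes> (\<one> \<oplus> s) =
   \<one> \<oplus> (a \<oplus> \<one>) \<otimes> s \<oplus> (a \<oplus> c) \<otimes> (s \<otimes> s) \<oplus> s \<otimes> s \<otimes> s \<otimes> (c \<oplus> r \<oplus> s \<otimes> r)"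
  if "a \<in> carrier R" "c \<in> carrier R" for a c using that s r(1) by algebra
 show ?case unfolding nat_pow_Suc r(2) n
  by (rule bexI[of _ "num (m choose 2) \<oplus> r \<oplus> s \<otimes> r"], rule *) (use s r(1) in auto)
qed

text \<open>For odd p the binomial coefficient p choose 2 is divisible by p, so the quadratic term
  gains a factor p; the remaining terms contain the cube of s.\<close>

lemma pow_near:
 assumes s: "s \<in> D j" and j: "j \<ge> 1"
 shows "(\<one> \<oplus> s) [^] p \<ominus> \<one> \<ominus> num p \<otimes> s \<in> D (Suc (Suc j))"
proof -
 note sc = D_in[OF s]
 obtain r where r: "r \<in> carrier R"
  "(\<one> \<oplus> s) [^] p = \<one> \<oplus> num p \<otimes> s \<oplus> num (p choose 2) \<otimes> (s \<otimes> s) \<oplus> s \<otimes> s \<otimes> s \<otimes> r"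
  using one_plus_pow[OF sc] by blast
 have "even (p - 1)" using prime_odd_nat[OF pp] p3 by simp
 then have c: "p choose 2 = (p - 1) div 2 * p ^ 1" by (simp add: choose_two div_mult_swap mult.commute)
 have ss: "s \<otimes> s \<in> D (j + j)" using D_mult[OF s s] .
 have "num (p ^ 1) \<otimes> (s \<otimes> s) \<in> D (j + j + 1)" using num_D[OF ss] .
 then have "num (p choose 2) \<otimes> (s \<otimes> s) \<in> D (j + j + 1)"
  unfolding c num_mult using ideal_mult[OF D_ideal, of "num (p ^ 1) \<otimes> (s \<otimes> s)" _ "num ((p - 1) div 2)"] sc by (simp add: m_assoc)
 then have 1: "num (p choose 2) \<otimes> (s \<otimes> s) \<in> D (Suc (Suc j))" using D_mono[of "Suc (Suc j)" "j + j + 1"] j by auto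
 have "s \<otimes> s \<otimes> s \<in> D (j + j + j)" using D_mult[OF ss s] .
 then have "s \<otimes> s \<otimes> s \<otimes> r \<in> D (j + j + j)" using ideal_mult'[OF D_ideal _ r(1)] by blast
 then have 2: "s \<otimes> s \<otimes> s \<otimes> r \<in> D (Suc (Suc j))" using D_mono[of "Suc (Suc j)" "j + j + j"] j by auto
 have "(\<one> \<oplus> a \<oplus> b \<oplus> c) \<ominus> \<one> \<ominus> a = b \<oplus> c" if "a \<in> carrier R" "b \<in> carrier R" "c \<in> carrier R" for a b c
  using that by algebra
 then have "(\<one> \<oplus> s) [^] p \<ominus> \<one> \<ominus> num p \<otimes> s = num (p choose 2) \<otimes> (s \<otimes> s) \<oplus> s \<otimes> s \<otimes> s \<otimes> r"
  unfolding r(2) using sc r(1) by simp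
 then show ?thesis using ideal_add[OF D_ideal 1 2] by simp
qed

lemma pow_ppower_near: "k \<in> carrier R ==> k \<ominus> \<one> \<in> D 1 ==> k [^] (p ^ n) \<ominus> \<one> \<in> D (Suc n)"
proof (induction n)
 case (Suc n)
 let ?l = "k [^] (p ^ n)"
 have l: "?l \<in> carrier R" "?l \<ominus> \<one> \<in> D (Suc n)" using Suc by simp_all
 have "num (p ^ 1) \<otimes> (?l \<ominus> \<one>) \<in> D (Suc n + 1)" by (rule num_D[OF l(2)])
 then have 1: "num p \<otimes> (?l \<ominus> \<one>) \<in> D (Suc (Suc n))" by simp
 have "\<one> \<oplus> (?l \<ominus> \<one>) = ?l" using l add_minus by simp
 then have "?l [^] p \<ominus> \<one> \<ominus> num p \<otimes> (?l \<ominus> \<one>) \<in> D (Suc (Suc (Suc n)))" using pow_near[OF l(2)] by simp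
 then have "?l [^] p \<ominus> \<one> \<ominus> num p \<otimes> (?l \<ominus> \<one>) \<in> D (Suc (Suc n))" by (rule D_Suc)
 then have "?l [^] p \<ominus> \<one> \<in> D (Suc (Suc n))"
  using D_shift[of "?l [^] p \<ominus> \<one>" "num p \<otimes> (?l \<ominus> \<one>)"] 1 l by simp
 then show ?case using Suc.prems(1) by (simp add: nat_pow_pow mult.commute)
qed simp

lemma pow_ppart: "k \<in> carrier R ==> k \<ominus> \<one> \<in> D 1 ==> ppart p dvd m ==> k [^] m = \<one>"
proof -
 assume k: "k \<in> carrier R" "k \<ominus> \<one> \<in> D 1" and m: "ppart p dvd m"
 have "num (ppart p) = \<zero>" using ppart_kill[OF pP] by (simp add: \<epsilon>_one)
 then have "D (multiplicity p (order R)) = {\<zero>}" by (auto simp: D_def image_iff)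
 then have "k [^] ppart p \<ominus> \<one> = \<zero>" using D_Suc[OF pow_ppower_near[OF k]] by blast
 then have "k [^] ppart p = \<one>" using k(1) by simp
 moreover obtain c where "m = ppart p * c" using m by (auto elim: dvdE)
 ultimately show "k [^] m = \<one>" using k(1) by (simp flip: nat_pow_pow)
qed

end

section \<open>Groups of principal units and their layers\<close>

locale local_L = local_cg_ring +
 fixes L
 assumes L_subgroup: "subgroup L (units_of R)"
  and L_near: "k \<in> L ==> k \<ominus> \<one> \<in> D 1"
begin

lemma L_unit: "k \<in> L ==> k \<in> Units R"
 using subgroup.subset[OF L_subgroup] by (auto simp: units_of_def)

lemma L_carrier: "k \<in> L ==> k \<in> carrier R" using L_unit by blast

lemma L_one: "\<one> \<in> L" using subgroup.one_closed[OF L_subgroup] by (simp add: units_of_def)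

lemma L_mult: "k \<in> L ==> l \<in> L ==> k \<otimes> l \<in> L"
 using subgroup.m_closed[OF L_subgroup, of k l] by (simp add: units_of_def)

lemma L_inv: "k \<in> L ==> inv k \<in> L"
 using subgroup.m_inv_closed[OF L_subgroup, of k] units_of_inv L_unit by simp

lemma L_pow: "k \<in> L ==> k [^] (n::nat) \<in> L" by (induction n) (auto simp: L_one L_mult)

lemma L_finite: "finite L" using finite_subset[OF _ fin] L_carrier by blast

lemma L_card: "card L > 0" using L_one L_finite by (auto simp: card_gt_0_iff)

abbreviation L' :: "nat \<Rightarrow> 'a set"
 where "L' i \<equiv> {k \<in> L. k \<ominus> \<one> \<in> D i}"

text \<open>The function h must vanish unless k is 1 modulo p. When the primes are put together,
  this removes the elements of K that fail to be principal units at some prime.\<close>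

definition rep' :: "'a set \<Rightarrow> ('a \<Rightarrow> real) \<Rightarrow> bool"
 where "rep' Y g \<longleftrightarrow> (\<exists>h. rep Y h \<and> (\<forall>k\<in>Units R. \<forall>y\<in>Y. k \<ominus> \<one> \<notin> D 1 \<longrightarrow> h k y = 0) \<and>
  (\<forall>y\<in>Y. (\<Sum>k\<in>L. h k y) = g y))"

lemma rep'I:
 "rep Y h ==> (\<And>k y. k \<in> Units R ==> y \<in> Y ==> k \<ominus> \<one> \<notin> D 1 ==> h k y = 0) ==>
  (\<And>y. y \<in> Y ==> (\<Sum>k\<in>L. h k y) = g y) ==> rep' Y g" unfolding rep'_def by blast

lemma rep'_cong: "rep' Y g ==> (\<And>y. y \<in> Y ==> g y = g' y) ==> rep' Y g'" unfolding rep'_def by auto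

lemma rep'_sum:
 assumes "finite I" "\<And>i. i \<in> I ==> rep' Y (g i)"
 shows "rep' Y (\<lambda>y. \<Sum>i\<in>I. c i * g i y)"
proof -
 have "\<forall>i\<in>I. \<exists>h. rep Y h \<and> (\<forall>k\<in>Units R. \<forall>y\<in>Y. k \<ominus> \<one> \<notin> D 1 \<longrightarrow> h k y = 0) \<and>
   (\<forall>y\<in>Y. (\<Sum>k\<in>L. h k y) = g i y)" using assms(2) by (simp add: rep'_def)
 from bchoice[OF this] obtain h where h: "\<forall>i\<in>I. rep Y (h i) \<and>
   (\<forall>k\<in>Units R. \<forall>y\<in>Y. k \<ominus> \<one> \<notin> D 1 \<longrightarrow> h i k y = 0) \<and> (\<forall>y\<in>Y. (\<Sum>k\<in>L. h i k y) = g i y)" by blast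
 show ?thesis
 proof (rule rep'I[of _ "\<lambda>k y. \<Sum>i\<in>I. c i * h i k y"])
  show "rep Y (\<lambda>k y. \<Sum>i\<in>I. c i * h i k y)" by (rule rep_sum) (use assms h in auto)
  fix y assume y: "y \<in> Y"
  have "(\<Sum>k\<in>L. \<Sum>i\<in>I. c i * h i k y) = (\<Sum>i\<in>I. c i * (\<Sum>k\<in>L. h i k y))"
   by (subst sum.swap) (simp add: sum_distrib_left)
  then show "(\<Sum>k\<in>L. \<Sum>i\<in>I. c i * h i k y) = (\<Sum>i\<in>I. c i * g i y)" using h y by simp
 qed (use h in auto)
qed

lemma rep'_lin: "rep' Y g ==> rep' Y g' ==> rep' Y (\<lambda>y. c * g y + d * g' y)"
 using rep'_sum[of "{True, False}" Y "\<lambda>i. if i then g else g'" "\<lambda>i. if i then c else d"] by auto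

abbreviation ucount :: "nat \<Rightarrow> 'a \<Rightarrow> 'a \<Rightarrow> real"
 where "ucount i t k \<equiv> \<Sum>b\<in>carrier R. of_bool (b \<in> Units R) * of_bool (line t b (k \<ominus> \<one>) \<in> D i)"

text \<open>The number of pairs of k in L and a unit b with b (k - 1) congruent to t modulo p^i. By
  \<open>f_unit\<close> and \<open>f_cong\<close> it depends only on the exact power of p in t,
  capped at i.\<close>

definition f :: "nat \<Rightarrow> 'a \<Rightarrow> real"
 where "f i t = (\<Sum>k\<in>L. \<Sum>b\<in>carrier R. of_bool (b \<in> Units R) * of_bool (line t b (k \<ominus> \<one>) \<in> D i))"

lemma f_cong: "t \<in> carrier R ==> s \<in> carrier R ==> t \<ominus> s \<in> D i ==> f i t = f i s" unfolding f_def
proof (intro sum.cong refl)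
 fix k b assume c: "t \<in> carrier R" "s \<in> carrier R" "t \<ominus> s \<in> D i" "k \<in> L" "b \<in> carrier R"
 note kc = L_carrier[OF c(4)]
 have "line t b (k \<ominus> \<one>) \<ominus> line s b (k \<ominus> \<one>) = t \<ominus> s" using c kc by algebra
 then show "of_bool (b \<in> Units R) * of_bool (line t b (k \<ominus> \<one>) \<in> D i) =
   of_bool (b \<in> Units R) * (of_bool (line s b (k \<ominus> \<one>) \<in> D i) :: real)"
  using D_shift[of "line t b (k \<ominus> \<one>)" "line s b (k \<ominus> \<one>)" i] c kc by simp
qed

lemma f_unit:
 assumes u: "u \<in> Units R" and t: "t \<in> carrier R"
 shows "f i (u \<otimes> t) = f i t" unfolding f_def
proof (rule sum.cong[OF refl])
 fix k assume k: "k \<in> L"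
 note kc = L_carrier[OF k] and uc = Units_closed[OF u]
 have uu: "u \<otimes> b \<in> Units R \<longleftrightarrow> b \<in> Units R" if "b \<in> carrier R" for b
  using unit_D[of "u \<otimes> b"] unit_D[of b] D_unit_mult[OF u that, of 1] that uc by simp
 show "(\<Sum>b\<in>carrier R. of_bool (b \<in> Units R) * of_bool (u \<otimes> t \<ominus> b \<otimes> (k \<ominus> \<one>) \<in> D i)) =
   ucount i t k"
 proof (rule sum.reindex_bij_witness[of _ "\<lambda>b. inv u \<otimes> b" "\<lambda>b. u \<otimes> b", symmetric])
  fix b assume b: "b \<in> carrier R"
  have "u \<otimes> t \<ominus> u \<otimes> b \<otimes> (k \<ominus> \<one>) = u \<otimes> line t b (k \<ominus> \<one>)" using b t uc kc by algebra
  then show "of_bool (u \<otimes> b \<in> Units R) * of_bool (u \<otimes> t \<ominus> u \<otimes> b \<otimes> (k \<ominus> \<one>) \<in> D i) =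
    of_bool (b \<in> Units R) * (of_bool (line t b (k \<ominus> \<one>) \<in> D i) :: real)"
   using D_unit_mult[OF u, of "line t b (k \<ominus> \<one>)" i] uu[OF b] t b kc by simp
 qed (use u uc in auto)
qed

text \<open>t is p^m times a unit with m < i, so s = (1 + w) t with w in p R, a unit multiple of
  t.\<close>

lemma f_near:
 assumes t: "t \<in> carrier R" "t \<notin> D i" and s: "s \<in> carrier R" "s \<ominus> t \<in> D i"
 shows "f j s = f j t"
proof -
 obtain m u where u: "u \<in> Units R" "t = num (p ^ m) \<otimes> u" "m < i" using D_form'[OF t] by blast
 obtain e where e: "e \<in> carrier R" "s \<ominus> t = num (p ^ i) \<otimes> e" using s(2) by (auto simp: D_def)
 let ?w = "num (p ^ (i - m)) \<otimes> (e \<otimes> inv u)"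
 have "num (p ^ i) = num (p ^ m) \<otimes> num (p ^ (i - m))" using u(3) by (simp flip: num_mult power_add)
 then have "s \<ominus> t = num (p ^ m) \<otimes> (num (p ^ (i - m)) \<otimes> e)" using e by (simp add: m_assoc)
 also have "\<dots> = num (p ^ m) \<otimes> (num (p ^ (i - m)) \<otimes> (e \<otimes> (inv u \<otimes> u)))" using u e by simp
 also have "\<dots> = ?w \<otimes> t"
  unfolding u(2) using u(1) e(1) by (simp only: m_ac num_closed Units_closed Units_inv_closed m_closed)
 finally have "s \<ominus> t = ?w \<otimes> t" .
 then have st: "s = (\<one> \<oplus> ?w) \<otimes> t"
  using add_minus[OF t(1) s(1)] t(1) u(1) e(1) by (simp add: l_distr)
 have "num (p ^ (i - m)) \<otimes> (e \<otimes> inv u) \<in> D (i - m)" using e u by (auto simp: D_def)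
 then have "?w \<in> D 1" by (rule D_le1[rotated]) (use u in simp)
 then have "\<one> \<oplus> ?w \<in> Units R" using unit_add[OF Units_one_closed] by blast
 then show ?thesis unfolding st using f_unit t(1) by simp
qed

lemma L_quot:
 assumes k: "k \<in> L" and l: "l \<in> L" and d: "k \<ominus> l \<in> D i"
 shows "k \<otimes> inv l \<in> L' i"
using L_unit[OF k] L_unit[OF l] ideal_mult[OF D_ideal d, of "inv l"] L_mult[OF k L_inv[OF l]]
 by (simp add: a_minus_def r_distr r_minus m_comm[of k "inv l"] Units_closed)

text \<open>Taking p-th powers multiplies the leading term of k - 1 by p, by
  \<open>pow_near\<close>, so representatives of one layer yield representatives of the
  next.\<close>

lemma full_layer_up:
 assumes j: "j \<ge> 1" and full: "\<And>x. x \<in> D j ==> \<exists>k\<in>L. k \<ominus> \<one> \<ominus> x \<in> D (Suc j)" and x: "x \<in> D (Suc j)"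
 shows "\<exists>k\<in>L. k \<ominus> \<one> \<ominus> x \<in> D (Suc (Suc j))"
proof -
 obtain y where y: "y \<in> carrier R" "x = num (p ^ Suc j) \<otimes> y" using x by (auto simp: D_def)
 let ?x = "num (p ^ j) \<otimes> y"
 have x': "?x \<in> D j" using y by (auto simp: D_def)
 then obtain k where k: "k \<in> L" "k \<ominus> \<one> \<ominus> ?x \<in> D (Suc j)" using full by blast
 note kc = L_carrier[OF k(1)] and xc = D_in[OF x']
 have xe: "x = num p \<otimes> ?x" using y by (simp add: num_mult m_assoc)
 have s: "k \<ominus> \<one> \<in> D j" using D_shift[of "k \<ominus> \<one>" ?x j] D_Suc[OF k(2)] x' kc xc by simp
 have "num (p ^ 1) \<otimes> (k \<ominus> \<one> \<ominus> ?x) \<in> D (Suc j + 1)" using num_D[OF k(2)] .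
 then have 1: "num p \<otimes> (k \<ominus> \<one> \<ominus> ?x) \<in> D (Suc (Suc j))" by simp
 have "\<one> \<oplus> (k \<ominus> \<one>) = k" using kc add_minus by simp
 then have 2: "k [^] p \<ominus> \<one> \<ominus> num p \<otimes> (k \<ominus> \<one>) \<in> D (Suc (Suc j))" using pow_near[OF s j] by simp
 have "k [^] p \<ominus> \<one> \<ominus> x = (k [^] p \<ominus> \<one> \<ominus> num p \<otimes> (k \<ominus> \<one>)) \<oplus> num p \<otimes> (k \<ominus> \<one> \<ominus> ?x)"
  unfolding xe using kc xc num_closed[of p] nat_pow_closed[OF kc, of p] by algebra
 then have "k [^] p \<ominus> \<one> \<ominus> x \<in> D (Suc (Suc j))" using ideal_add[OF D_ideal 2 1] by simp
 then show ?thesis using L_pow[OF k(1)] by blast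
qed


text \<open>A full layer makes all later ones full. In the last non-zero layer congruence is
  equality, and this layer contains \<open>tor p\<close>, which lies in every non-zero
  ideal.\<close>

lemma full_layer_tor:
 assumes i: "i \<ge> 1" and full: "\<And>x. x \<in> D i ==> \<exists>k\<in>L. k \<ominus> \<one> \<ominus> x \<in> D (Suc i)" and ne: "D i \<noteq> {\<zero>}"
  and h: "h \<in> tor p"
 shows "\<one> \<oplus> h \<in> L"
proof -
 have all: "\<forall>x\<in>D (i + j). \<exists>k\<in>L. k \<ominus> \<one> \<ominus> x \<in> D (Suc (i + j))" for j
 proof (induction j)
  case (Suc j)
  then show ?case using full_layer_up[of "i + j"] i by simp
 qed (use full in simp)
 define n where "n = (LEAST n. D n = {\<zero>})"
 have n: "D n = {\<zero>}" unfolding n_def by (rule LeastI_ex[OF D_vanish])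
 have least: "D m \<noteq> {\<zero>}" if "m < n" for m using not_less_Least[of m "\<lambda>n. D n = {\<zero>}"] that unfolding n_def by blast
 have "i < n" using D_mono[of n i] n ne ideal_zero[OF D_ideal] by auto
 then obtain j where j: "n = Suc (i + j)" using less_imp_Suc_add by blast
 have "h \<in> D (i + j)"
 proof (cases "h = \<zero>")
  case True
  then show ?thesis using ideal_zero[OF D_ideal] by simp
 next
  case False
  obtain x where x: "x \<in> D (i + j)" "x \<noteq> \<zero>"
   using least[of "i + j"] j ideal_zero[OF D_ideal] by blast
  have "tor p \<subseteq> D (i + j)" by (rule tor_sub_ideal[OF D_ideal x(1) _ pP]) (use x D_in in \<open>simp add: \<epsilon>_one\<close>)
  then show ?thesis using h by blast
 qed
 then obtain k where k: "k \<in> L" "k \<ominus> \<one> \<ominus> h \<in> D (Suc (i + j))" using all by blast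
 note kc = L_carrier[OF k(1)] and hc = tor_carrier[OF h]
 have "k \<ominus> \<one> \<ominus> h = \<zero>" using k(2) n j by simp
 moreover have "k = \<one> \<oplus> h \<oplus> (k \<ominus> \<one> \<ominus> h)" using kc hc by algebra
 ultimately have "k = \<one> \<oplus> h" using hc by simp
 then show ?thesis using k(1) by simp
qed

end

locale pure_L = local_L +
 assumes L_pure: "D 1 \<noteq> {\<zero>} ==> \<exists>h\<in>tor p. \<one> \<oplus> h \<notin> L"
begin

text \<open>The fibres of (k, d) \<mapsto> k - 1 + d have at most \<open>card (L' (Suc i))\<close>
  elements. If the map were onto \<open>D i\<close>, the layer would be full and L would contain all
  1 + h with h in \<open>tor p\<close>, against \<open>L_pure\<close>.\<close>

lemma layer_card:
 assumes i: "i \<ge> 1" and ne: "D i \<noteq> {\<zero>}"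
 shows "card (L' i) * card (D (Suc i)) < card (L' (Suc i)) * card (D i)"
proof -
 let ?g = "\<lambda>(k, d). k \<ominus> \<one> \<oplus> d" and ?A = "L' i \<times> D (Suc i)"
 have finD: "finite (D j)" for j using finite_subset[OF ideal_sub[OF D_ideal] fin] .
 have sub: "?g ` ?A \<subseteq> D i" using ideal_add[OF D_ideal _ D_Suc] by auto
 have "card ?A \<le> card (?g ` ?A) * card (L' (Suc i))"
 proof (rule card_le_fibres)
  show "finite ?A" using L_finite finD by simp
  fix y assume "y \<in> ?g ` ?A"
  then obtain k0 d0 where kd: "k0 \<in> L' i" "d0 \<in> D (Suc i)" "y = k0 \<ominus> \<one> \<oplus> d0" by auto
  have inj: "inj_on (\<lambda>(k, d). k \<otimes> inv k0) {x \<in> ?A. ?g x = y}"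
  proof (rule inj_onI)
   fix x x' assume a: "x \<in> {x \<in> ?A. ?g x = y}" "x' \<in> {x \<in> ?A. ?g x = y}"
    "(case x of (k, d) \<Rightarrow> k \<otimes> inv k0) = (case x' of (k, d) \<Rightarrow> k \<otimes> inv k0)"
   obtain k d k' d' where x: "x = (k, d)" "x' = (k', d')" by (cases x, cases x') blast
   have m: "k \<in> L" "d \<in> D (Suc i)" "k' \<in> L" "d' \<in> D (Suc i)" "k \<otimes> inv k0 = k' \<otimes> inv k0"
    "k \<ominus> \<one> \<oplus> d = k' \<ominus> \<one> \<oplus> d'" using a x by auto
   have r: "l \<otimes> inv k0 \<otimes> k0 = l" if "l \<in> L" for l
    using that kd(1) L_unit[of k0] L_carrier by (simp add: m_assoc)
   have "k = k \<otimes> inv k0 \<otimes> k0" by (rule r[OF m(1), symmetric])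
   also have "\<dots> = k'" unfolding m(5) by (rule r[OF m(3)])
   finally have kk: "k = k'" .
   have c: "e = (l \<ominus> \<one> \<oplus> e) \<ominus> (l \<ominus> \<one>)" if "l \<in> carrier R" "e \<in> carrier R" for l e using that by algebra
   have "d = d'" using c[OF L_carrier[OF m(1)] D_in[OF m(2)]] c[OF L_carrier[OF m(3)] D_in[OF m(4)]] m(6) kk by simp
   then show "x = x'" using kk x by simp
  qed
  have "(\<lambda>(k, d). k \<otimes> inv k0) ` {x \<in> ?A. ?g x = y} \<subseteq> L' (Suc i)"
  proof (rule image_subsetI)
   fix x assume x: "x \<in> {x \<in> ?A. ?g x = y}"
   then obtain k d where a: "x = (k, d)" "k \<in> L" "d \<in> D (Suc i)" "k \<ominus> \<one> \<oplus> d = y" by auto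
   have kc: "k \<in> carrier R" "k0 \<in> carrier R" "d \<in> carrier R" "d0 \<in> carrier R"
    using a kd L_carrier D_in by auto
   have "k \<ominus> k0 = (k \<ominus> \<one> \<oplus> d) \<ominus> (k0 \<ominus> \<one> \<oplus> d0) \<oplus> (d0 \<ominus> d)" using kc by algebra
   also have "\<dots> = d0 \<ominus> d" using a kd kc by simp
   finally have "k \<ominus> k0 \<in> D (Suc i)" using ideal_minus[OF D_ideal kd(2) a(3)] by simp
   then show "(case x of (k, d) \<Rightarrow> k \<otimes> inv k0) \<in> L' (Suc i)" using L_quot[of k k0] a kd by simp
  qed
  then have "card ((\<lambda>(k, d). k \<otimes> inv k0) ` {x \<in> ?A. ?g x = y}) \<le> card (L' (Suc i))"
   using L_finite by (intro card_mono) auto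
  then show "card {x \<in> ?A. ?g x = y} \<le> card (L' (Suc i))" using card_image[OF inj] by simp
 qed
 then have le: "card (L' i) * card (D (Suc i)) \<le> card (?g ` ?A) * card (L' (Suc i))"
  by (simp add: card_cartesian_product)
 have "?g ` ?A \<noteq> D i"
 proof
  assume e: "?g ` ?A = D i"
  have "\<exists>k\<in>L. k \<ominus> \<one> \<ominus> x \<in> D (Suc i)" if x: "x \<in> D i" for x
  proof -
   have "x \<in> ?g ` ?A" using x by (simp only: e)
   then obtain k d where k: "k \<in> L" "d \<in> D (Suc i)" "x = k \<ominus> \<one> \<oplus> d" by auto
   have "k \<ominus> \<one> \<ominus> x = \<ominus> d" unfolding k(3) using L_carrier[OF k(1)] D_in[OF k(2)] by algebra
   then show ?thesis using k ideal_neg[OF D_ideal k(2)] by (intro bexI[of _ k]) simp_all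
  qed
  then have "\<one> \<oplus> h \<in> L" if "h \<in> tor p" for h using full_layer_tor[OF i _ ne that] by blast
  moreover have "D 1 \<noteq> {\<zero>}" using ne D_mono[OF i] ideal_zero[OF D_ideal, of i] by blast
  ultimately show False using L_pure by blast
 qed
 then have "card (?g ` ?A) < card (D i)" using sub finD by (intro psubset_card_mono) auto
 moreover have "card (L' (Suc i)) > 0" using L_one L_finite ideal_zero[OF D_ideal]
  by (auto simp: card_gt_0_iff a_minus_def r_neg)
 ultimately have "card (?g ` ?A) * card (L' (Suc i)) < card (D i) * card (L' (Suc i))" by simp
 from le_less_trans[OF le this] show ?thesis by (simp only: mult.commute)
qed

lemma f_zero: "f i \<zero> = real (card (Units R)) * card (L' i)"
proof -
 have "ucount i \<zero> k =
   real (card (Units R)) * of_bool (k \<ominus> \<one> \<in> D i)" if k: "k \<in> L" for k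
 proof -
  note kc = L_carrier[OF k]
  have "ucount i \<zero> k =
    (\<Sum>b\<in>carrier R. of_bool (b \<in> Units R) * (of_bool (k \<ominus> \<one> \<in> D i) :: real))"
  proof (rule sum.cong[OF refl])
   fix b assume b: "b \<in> carrier R"
   have "line \<zero> b (k \<ominus> \<one>) = \<ominus> (b \<otimes> (k \<ominus> \<one>))" using b kc by (simp add: a_minus_def)
   moreover have "\<ominus> (b \<otimes> (k \<ominus> \<one>)) \<in> D i \<longleftrightarrow> b \<otimes> (k \<ominus> \<one>) \<in> D i"
    using ideal_neg[OF D_ideal, of "b \<otimes> (k \<ominus> \<one>)" i] ideal_neg[OF D_ideal, of "\<ominus> (b \<otimes> (k \<ominus> \<one>))" i] b kc by auto
   ultimately show "of_bool (b \<in> Units R) * of_bool (line \<zero> b (k \<ominus> \<one>) \<in> D i) =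
     of_bool (b \<in> Units R) * (of_bool (k \<ominus> \<one> \<in> D i) :: real)"
    using D_unit_mult[of b "k \<ominus> \<one>" i] kc by simp
  qed
  also have "\<dots> = (\<Sum>b\<in>carrier R. of_bool (b \<in> Units R)) * of_bool (k \<ominus> \<one> \<in> D i)" by simp
  also have "(\<Sum>b\<in>carrier R. of_bool (b \<in> Units R)) = real (card {b \<in> carrier R. b \<in> Units R})"
   by (rule card_Ex_sum) (rule fin)
  also have "{b \<in> carrier R. b \<in> Units R} = Units R" by blast
  finally show ?thesis .
 qed
 then have "f i \<zero> = real (card (Units R)) * (\<Sum>k\<in>L. of_bool (k \<ominus> \<one> \<in> D i))"
  unfolding f_def sum_distrib_left by (intro sum.cong) auto
 also have "(\<Sum>k\<in>L. of_bool (k \<ominus> \<one> \<in> D i)) = real (card (L' i))" by (rule card_Ex_sum) (rule L_finite)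
 finally show ?thesis .
qed

text \<open>Only those k contribute that lie in layer i but not in the next one, and for them b is
  determined modulo p R.\<close>

lemma f_top:
 assumes ne: "D i \<noteq> {\<zero>}"
 shows "f (Suc i) (num (p ^ i)) = real (card (D 1)) * (real (card (L' i)) - card (L' (Suc i)))"
proof -
 let ?q = "num (p ^ i)"
 have qD: "?q \<in> D i" using num_D[of \<one> 0 i] by (simp add: D_0)
 have "ucount (Suc i) ?q k =
   real (card (D 1)) * (of_bool (k \<ominus> \<one> \<in> D i) - of_bool (k \<ominus> \<one> \<in> D (Suc i)))" if k: "k \<in> L" for k
 proof (cases "k \<ominus> \<one> \<in> D i \<and> k \<ominus> \<one> \<notin> D (Suc i)")
  case True
  note kc = L_carrier[OF k]
  obtain w where w: "w \<in> Units R" "k \<ominus> \<one> = ?q \<otimes> w" using D_form True by blast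
  note wc = Units_closed[OF w(1)]
  have "ucount (Suc i) ?q k =
    (\<Sum>b\<in>carrier R. of_bool (\<one> \<ominus> b \<otimes> w \<in> D 1) * (1::real))"
  proof (rule sum.cong[OF refl])
   fix b assume b: "b \<in> carrier R"
   have "line ?q b (k \<ominus> \<one>) = ?q \<otimes> (\<one> \<ominus> b \<otimes> w)" unfolding w(2) using b wc num_closed[of "p ^ i"] by algebra
   then have 1: "line ?q b (k \<ominus> \<one>) \<in> D (Suc i) \<longleftrightarrow> \<one> \<ominus> b \<otimes> w \<in> D 1"
    using D_cancel[OF ne, of "\<one> \<ominus> b \<otimes> w"] b wc by simp
   have "b \<in> Units R" if a: "\<one> \<ominus> b \<otimes> w \<in> D 1"
   using unit_D b ideal_add[OF D_ideal _ a] ideal_mult'[OF D_ideal _ wc] add_minus[of "b \<otimes> w" \<one>] wc unit_D[of \<one>]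
    by fastforce
   then show "of_bool (b \<in> Units R) * of_bool (line ?q b (k \<ominus> \<one>) \<in> D (Suc i)) =
     of_bool (\<one> \<ominus> b \<otimes> w \<in> D 1) * (1::real)" unfolding 1 by auto
  qed
  also have "\<dots> = real (card (D 1)) * 1" by (rule sum_lin[OF w(1)]) auto
  finally show ?thesis using True by simp
 next
  case False
  note kc = L_carrier[OF k]
  have "of_bool (b \<in> Units R) * of_bool (line ?q b (k \<ominus> \<one>) \<in> D (Suc i)) = (0::real)" if b: "b \<in> carrier R" for b
  proof -
   have "\<not> (b \<in> Units R \<and> line ?q b (k \<ominus> \<one>) \<in> D (Suc i))"
   using D_shift[of ?q "b \<otimes> (k \<ominus> \<one>)" i] D_Suc[of "line ?q b (k \<ominus> \<one>)" i] qD kc D_unit_mult[of b "k \<ominus> \<one>" i] False ideal_mult[OF D_ideal _ b] D_shift[of ?q "b \<otimes> (k \<ominus> \<one>)" "Suc i"] D_psub[OF ne]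
    by auto
   then show ?thesis by auto
  qed
  then have "ucount (Suc i) ?q k = (0::real)" by (intro sum.neutral) blast
  moreover have "k \<ominus> \<one> \<in> D (Suc i) \<longleftrightarrow> k \<ominus> \<one> \<in> D i" using False D_Suc by blast
  ultimately show ?thesis by simp
 qed
 then have "f (Suc i) ?q = real (card (D 1)) * (\<Sum>k\<in>L. of_bool (k \<ominus> \<one> \<in> D i) - of_bool (k \<ominus> \<one> \<in> D (Suc i)))"
  unfolding f_def sum_distrib_left by (intro sum.cong) auto
 also have "(\<Sum>k\<in>L. of_bool (k \<ominus> \<one> \<in> D i) - of_bool (k \<ominus> \<one> \<in> D (Suc i))) = real (card (L' i)) - card (L' (Suc i))"
  using card_Ex_sum[OF L_finite, of "\<lambda>k. k \<ominus> \<one> \<in> D i", where ?'c = real]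
   card_Ex_sum[OF L_finite, of "\<lambda>k. k \<ominus> \<one> \<in> D (Suc i)", where ?'c = real] by (simp only: sum_subtractf)
 finally show ?thesis .
qed

text \<open>Equality of the two values would make the index of \<open>L' (Suc i)\<close> in
  \<open>L' i\<close> equal to the size of the residue field, by \<open>card_units\<close> and
  \<open>card_index\<close>; \<open>layer_card\<close> says that it is smaller.\<close>

lemma f_gap:
 assumes i: "i \<ge> 1" and ne: "D i \<noteq> {\<zero>}"
 shows "f (Suc i) \<zero> \<noteq> f (Suc i) (num (p ^ i))"
proof
 assume "f (Suc i) \<zero> = f (Suc i) (num (p ^ i))"
 then have "real (card (Units R)) * card (L' (Suc i)) + real (card (D 1)) * card (L' (Suc i)) = real (card (D 1)) * card (L' i)"
  unfolding f_zero f_top[OF ne] by (simp add: algebra_simps)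
 then have "real ((card (Units R) + card (D 1)) * card (L' (Suc i))) = real (card (D 1) * card (L' i))"
  by (simp add: algebra_simps)
 then have 1: "order R * card (L' (Suc i)) = card (D 1) * card (L' i)" unfolding card_units of_nat_eq_iff .
 have "card (D 1) * (card (L' i) * card (D (Suc i))) = order R * card (L' (Suc i)) * card (D (Suc i))" using 1 by simp
 also have "\<dots> = order R * card (D (Suc i)) * card (L' (Suc i))" by simp
 also have "\<dots> = card (D 1) * (card (L' (Suc i)) * card (D i))" using card_index[OF ne] by simp
 finally show False using layer_card[OF i ne] card_D_pos[of 1] by simp
qed


text \<open>
 If \<open>Y\<close> consists of units, \<open>b\<close> must avoid the residue class of \<open>z\<close>. Its contribution is replaced by
 that of the class of \<open>2 z\<close>: both have the same sum over \<open>L\<close>, as \<open>k \<mapsto> k\<^sup>2\<close> permutes \<open>L\<close> and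
 \<open>k\<^sup>2 - 1 = (k + 1) (k - 1)\<close> with \<open>k + 1\<close> congruent to 2.
\<close>

lemma weight_exists:
 assumes Y: "Y = D 1 \<or> Y = Units R" and z: "z \<in> Y" and i: "i \<ge> 1"
 obtains w :: "'a \<Rightarrow> real" where
  "\<And>b. b \<in> carrier R ==> w b \<noteq> 0 ==> b \<in> Units R \<and> z \<ominus> b \<in> Units R"
  "\<And>b c. b \<in> carrier R ==> c \<in> carrier R ==> b \<ominus> c \<in> D 1 ==> w b = w c"
  "\<And>t. t \<in> carrier R ==> (\<Sum>k\<in>L. \<Sum>b\<in>carrier R. w b * of_bool (line t b (k \<ominus> \<one>) \<in> D i)) = f i t"
 using Y
proof (cases "Y = Units R")
 case False
 then have zD: "z \<in> D 1" using Y z by simp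
 show ?thesis
 proof (rule that[of "\<lambda>b. of_bool (b \<in> Units R)"])
  fix b assume b: "b \<in> carrier R" "of_bool (b \<in> Units R) \<noteq> (0::real)"
  then have "\<ominus> b \<oplus> z \<in> Units R" using unit_add[OF unit_neg zD, of b] by simp
  then show "b \<in> Units R \<and> z \<ominus> b \<in> Units R" using b D_in[OF zD] by (simp add: a_minus_def a_comm)
 qed (use unit_cong in \<open>auto simp: f_def\<close>)
next
 case True
 then have zU: "z \<in> Units R" using z by simp
 note zc = Units_closed[OF zU]
 have zz: "z \<oplus> z \<notin> D 1"
 proof
  assume a: "z \<oplus> z \<in> D 1"
  have "num 2 \<otimes> z \<in> mul p" using a zc num_add[of 1 1] by (simp add: numeral_2_eq_2 l_distr D_1)
  then have "num 2 \<in> mul p" using D_unit_mult[OF zU, of "num 2" 1] m_comm[of z "num 2"] zc by (simp add: D_1)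
  moreover have "coprime 2 p" using prime_odd_nat[OF pp] p3 by simp
  ultimately show False using num_notin_mul[OF pP] by blast
 qed
 let ?w = "\<lambda>b. of_bool (b \<in> Units R) - of_bool (b \<ominus> z \<in> D 1) + of_bool (b \<ominus> (z \<oplus> z) \<in> D 1) :: real"
 show ?thesis
 proof (rule that[of ?w])
  fix b assume b: "b \<in> carrier R" "?w b \<noteq> 0"
  have n: "\<not> (b \<in> D 1 \<and> b \<ominus> z \<in> D 1)" using D_shift[of b z 1] b unit_D[of z] zU by blast
  have n2: "\<not> (b \<in> D 1 \<and> b \<ominus> (z \<oplus> z) \<in> D 1)" using D_shift[of b "z \<oplus> z" 1] b zc zz by blast
  have n3: "\<not> (b \<ominus> z \<in> D 1 \<and> b \<ominus> (z \<oplus> z) \<in> D 1)"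
  proof
   assume a: "b \<ominus> z \<in> D 1 \<and> b \<ominus> (z \<oplus> z) \<in> D 1"
   have "(b \<ominus> z) \<ominus> (b \<ominus> (z \<oplus> z)) = z" using b zc by algebra
   then have "z \<in> D 1" using ideal_minus[OF D_ideal, of "b \<ominus> z" 1 "b \<ominus> (z \<oplus> z)"] a by simp
   then show False using zU unit_D by blast
  qed
  have "b \<in> Units R" "b \<ominus> z \<notin> D 1" using b n n2 n3 unit_D[of b] by (auto split: if_splits simp: of_bool_def)
  then show "b \<in> Units R \<and> z \<ominus> b \<in> Units R" using D_sym[of b z 1] unit_D[of "z \<ominus> b"] b zc by simp
 next
  fix b c assume bc: "b \<in> carrier R" "c \<in> carrier R" "b \<ominus> c \<in> D 1"
  have "b \<ominus> x \<in> D 1 \<longleftrightarrow> c \<ominus> x \<in> D 1" if "x \<in> carrier R" for x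
   using D_trans[of b c x 1] D_trans[of c b x 1] D_sym[of b c 1] bc that by blast
  from this[OF zc] this[OF a_closed[OF zc zc]] unit_cong[OF bc] show "?w b = ?w c" by (simp only:)
 next
  fix t assume t: "t \<in> carrier R"
  let ?S = "\<lambda>v k. \<Sum>b\<in>carrier R. of_bool (b \<ominus> v \<in> D 1) * of_bool (line t b (k \<ominus> \<one>) \<in> D i) :: real"
  have plus: "k \<oplus> l \<in> Units R" if "k \<in> L" "l \<in> L" for k l
  proof -
   have "(\<one> \<oplus> \<one>) \<oplus> ((k \<ominus> \<one>) \<oplus> (l \<ominus> \<one>)) = k \<oplus> l" using L_carrier that by algebra
   moreover have "\<one> \<oplus> \<one> \<in> Units R"
   using zz zc unit_D[of "\<one> \<oplus> \<one>"] ideal_mult'[OF D_ideal _ zc, of "\<one> \<oplus> \<one>" 1]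
    by (auto simp: l_distr)
   ultimately show ?thesis using unit_add[of "\<one> \<oplus> \<one>"] ideal_add[OF D_ideal L_near L_near] that by metis
  qed
  have sq_inj: "inj_on (\<lambda>k. k \<otimes> k) L"
  proof (rule inj_onI)
   fix k l assume a: "k \<in> L" "l \<in> L" "k \<otimes> k = l \<otimes> l"
   note c = L_carrier[OF a(1)] L_carrier[OF a(2)]
   have "(k \<oplus> l) \<otimes> (k \<ominus> l) = k \<otimes> k \<ominus> l \<otimes> l" using c by algebra
   also have "\<dots> = (k \<oplus> l) \<otimes> \<zero>" using a(3) c by simp
   finally have "k \<ominus> l = \<zero>" using Units_l_cancel[OF plus[OF a(1,2)], of "k \<ominus> l" \<zero>] c by simp
   then show "k = l" using c by simp
  qed
  have sq: "bij_betw (\<lambda>k. k \<otimes> k) L L"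
   using sq_inj L_mult endo_inj_surj[OF L_finite _ sq_inj] by (auto simp: bij_betw_def)
  have "?S z (k \<otimes> k) = ?S (z \<oplus> z) k" if k: "k \<in> L" for k
  proof (rule sum.reindex_bij_witness[of _ "\<lambda>b. inv (k \<oplus> \<one>) \<otimes> b" "\<lambda>b. (k \<oplus> \<one>) \<otimes> b"])
   note kc = L_carrier[OF k] and u = plus[OF k L_one]
   fix b assume b: "b \<in> carrier R"
   show "inv (k \<oplus> \<one>) \<otimes> ((k \<oplus> \<one>) \<otimes> b) = b" "(k \<oplus> \<one>) \<otimes> (inv (k \<oplus> \<one>) \<otimes> b) = b"
    "(k \<oplus> \<one>) \<otimes> b \<in> carrier R" "inv (k \<oplus> \<one>) \<otimes> b \<in> carrier R" using u b kc by simp_all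
   have 1: "(k \<oplus> \<one>) \<otimes> b \<otimes> (k \<ominus> \<one>) = b \<otimes> (k \<otimes> k \<ominus> \<one>)" using b kc by algebra
   have "(k \<oplus> \<one>) \<otimes> b \<ominus> (z \<oplus> z) = (k \<oplus> \<one>) \<otimes> (b \<ominus> z) \<oplus> z \<otimes> (k \<ominus> \<one>)" using b kc zc by algebra
   moreover have "z \<otimes> (k \<ominus> \<one>) \<in> D 1" using ideal_mult[OF D_ideal L_near[OF k] zc] .
   ultimately have "(k \<oplus> \<one>) \<otimes> b \<ominus> (z \<oplus> z) \<in> D 1 \<longleftrightarrow> (k \<oplus> \<one>) \<otimes> (b \<ominus> z) \<in> D 1"
    using ideal_add_cancel[OF D_ideal, of "z \<otimes> (k \<ominus> \<one>)" 1 "(k \<oplus> \<one>) \<otimes> (b \<ominus> z)"]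
     ideal_add[OF D_ideal, of "(k \<oplus> \<one>) \<otimes> (b \<ominus> z)" 1 "z \<otimes> (k \<ominus> \<one>)"] b kc zc by auto
   then have 2: "(k \<oplus> \<one>) \<otimes> b \<ominus> (z \<oplus> z) \<in> D 1 \<longleftrightarrow> b \<ominus> z \<in> D 1" using D_unit_mult[OF u, of "b \<ominus> z" 1] b zc by simp
   show "of_bool ((k \<oplus> \<one>) \<otimes> b \<ominus> (z \<oplus> z) \<in> D 1) * of_bool (t \<ominus> (k \<oplus> \<one>) \<otimes> b \<otimes> (k \<ominus> \<one>) \<in> D i) =
     of_bool (b \<ominus> z \<in> D 1) * (of_bool (t \<ominus> b \<otimes> (k \<otimes> k \<ominus> \<one>) \<in> D i) :: real)" unfolding 1 2 ..
  qed
  then have "(\<Sum>k\<in>L. ?S (z \<oplus> z) k) = (\<Sum>k\<in>L. ?S z (k \<otimes> k))" by simp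
  also have "\<dots> = (\<Sum>k\<in>L. ?S z k)" by (rule sum.reindex_bij_betw[OF sq])
  finally have e: "(\<Sum>k\<in>L. ?S (z \<oplus> z) k) = (\<Sum>k\<in>L. ?S z k)" .
  have "(\<Sum>k\<in>L. \<Sum>b\<in>carrier R. ?w b * of_bool (line t b (k \<ominus> \<one>) \<in> D i)) =
    f i t - (\<Sum>k\<in>L. ?S z k) + (\<Sum>k\<in>L. ?S (z \<oplus> z) k)"
   unfolding f_def by (simp only: sum.distrib sum_subtractf ring_distribs left_diff_distrib)
  then show "(\<Sum>k\<in>L. \<Sum>b\<in>carrier R. ?w b * of_bool (line t b (k \<ominus> \<one>) \<in> D i)) = f i t" using e by simp
 qed
qed

text \<open>Weighting the points with a + b congruent to z modulo p^i by w b gives T, which has the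
  right sum over L but need not vanish for k not congruent to 1 modulo p. For such k the difference
  k - 1 is a unit, so T depends on residues only, and \<open>rep_coarse\<close> allows this part to
  be subtracted.\<close>

lemma rep'_f:
 assumes Y: "Y = D 1 \<or> Y = Units R" and z: "z \<in> Y" and i: "i \<ge> 1"
 shows "rep' Y (\<lambda>y. f i (y \<ominus> z))"
proof -
 have Yc: "y \<in> carrier R" if "y \<in> Y" for y using Y that D_in by auto
 note zc = Yc[OF z]
 obtain w :: "'a \<Rightarrow> real" where w: "\<And>b. b \<in> carrier R ==> w b \<noteq> 0 ==> b \<in> Units R \<and> z \<ominus> b \<in> Units R"
  "\<And>b c. b \<in> carrier R ==> c \<in> carrier R ==> b \<ominus> c \<in> D 1 ==> w b = w c"
  "\<And>t. t \<in> carrier R ==> (\<Sum>k\<in>L. \<Sum>b\<in>carrier R. w b * of_bool (line t b (k \<ominus> \<one>) \<in> D i)) = f i t"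
  using weight_exists[OF Y z i] by blast
 define T where "T k y = (\<Sum>b\<in>carrier R. w b * of_bool (line (y \<ominus> z) b (k \<ominus> \<one>) \<in> D i))" for k y
 have T: "rep Y T"
 proof (rule repI[of "\<lambda>a b. if a \<in> carrier R \<and> b \<in> carrier R then w b * of_bool (a \<oplus> b \<ominus> z \<in> D i) else 0"])
  fix a b assume "(if a \<in> carrier R \<and> b \<in> carrier R then w b * of_bool (a \<oplus> b \<ominus> z \<in> D i) else 0) \<noteq> 0"
  then have ab: "a \<in> carrier R" "b \<in> carrier R" "w b \<noteq> 0" "a \<oplus> b \<ominus> z \<in> D i" by (auto split: if_splits)
  then have u: "b \<in> Units R" "z \<ominus> b \<in> Units R" using w(1) by auto
  have "a \<ominus> (z \<ominus> b) = a \<oplus> b \<ominus> z" using ab zc by algebra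
  then show "a \<in> Units R \<and> b \<in> Units R"
   using D_le1[OF i ab(4)] unit_cong[of a "z \<ominus> b"] u ab zc by simp
 next
  fix k y assume k: "k \<in> Units R" "y \<in> Y"
  show "(\<Sum>b\<in>carrier R. if y \<ominus> b \<otimes> k \<in> carrier R \<and> b \<in> carrier R
    then w b * of_bool (line y b k \<oplus> b \<ominus> z \<in> D i) else 0) = T k y" unfolding T_def
  proof (rule sum.cong[OF refl])
   fix b assume b: "b \<in> carrier R"
   have "line y b k \<oplus> b \<ominus> z = line (y \<ominus> z) b (k \<ominus> \<one>)"
    using b Units_closed[OF k(1)] Yc[OF k(2)] zc by algebra
   then show "(if y \<ominus> b \<otimes> k \<in> carrier R \<and> b \<in> carrier R then w b * of_bool (line y b k \<oplus> b \<ominus> z \<in> D i) else 0) =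
    w b * of_bool (line (y \<ominus> z) b (k \<ominus> \<one>) \<in> D i)"
    using b Units_closed[OF k(1)] Yc[OF k(2)] by simp
  qed
 qed
 define \<phi> where "\<phi> k y = (if k \<ominus> \<one> \<in> D 1 then 0 else T k y)" for k y
 have \<phi>: "rep Y \<phi>"
 proof (rule rep_coarse[OF Y])
  fix k k' y y' assume a: "k \<in> Units R" "k' \<in> Units R" "y \<in> Y" "y' \<in> Y" "k \<ominus> k' \<in> D 1" "y \<ominus> y' \<in> D 1"
  note c = Units_closed[OF a(1)] Units_closed[OF a(2)] Yc[OF a(3)] Yc[OF a(4)]
  have kk: "k \<ominus> \<one> \<in> D 1 \<longleftrightarrow> k' \<ominus> \<one> \<in> D 1"
   using D_trans[of k k' \<one> 1] D_trans[of k' k \<one> 1] D_sym[of k k' 1] a(5) c by blast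
  show "\<phi> k y = \<phi> k' y'"
  proof (cases "k \<ominus> \<one> \<in> D 1")
   case False
   have m: "k \<ominus> \<one> \<in> Units R" "k' \<ominus> \<one> \<in> Units R" using False kk unit_D c by simp_all
   have *: "T l x = card (D i) * w ((x \<ominus> z) \<otimes> inv (l \<ominus> \<one>))" if "l \<ominus> \<one> \<in> Units R" "x \<in> carrier R" for l x
    unfolding T_def using sum_lin[OF that(1), of "x \<ominus> z" i w] w(2) D_le1[OF i] that zc by simp
   let ?m = "k \<ominus> \<one>" and ?m' = "k' \<ominus> \<one>"
   note ic = Units_inv_closed[OF m(1)] Units_inv_closed[OF m(2)]
   have "((y \<ominus> z) \<otimes> inv ?m \<ominus> (y' \<ominus> z) \<otimes> inv ?m') = (y \<ominus> y') \<otimes> inv ?m \<ominus> (y' \<ominus> z) \<otimes> inv ?m \<otimes> inv ?m' \<otimes> (k \<ominus> k')"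
   proof -
    have 1: "inv ?m \<otimes> ?m = \<one>" "?m' \<otimes> inv ?m' = \<one>" using m by simp_all
    have "inv ?m \<otimes> inv ?m' \<otimes> (k \<ominus> k') = inv ?m \<otimes> ?m \<otimes> inv ?m' \<ominus> inv ?m \<otimes> (?m' \<otimes> inv ?m')"
     using c ic by algebra
    then have 2: "inv ?m \<otimes> inv ?m' \<otimes> (k \<ominus> k') = inv ?m' \<ominus> inv ?m" unfolding 1 using ic by simp
    have "(y' \<ominus> z) \<otimes> inv ?m \<otimes> inv ?m' \<otimes> (k \<ominus> k') = (y' \<ominus> z) \<otimes> (inv ?m' \<ominus> inv ?m)"
     unfolding 2[symmetric] using c ic zc by (simp add: m_assoc)
    moreover have "(y \<ominus> z) \<otimes> inv ?m \<ominus> (y' \<ominus> z) \<otimes> inv ?m' = (y \<ominus> y') \<otimes> inv ?m \<ominus> (y' \<ominus> z) \<otimes> (inv ?m' \<ominus> inv ?m)"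
     using c ic zc by algebra
    ultimately show ?thesis by simp
   qed
   moreover have "(y \<ominus> y') \<otimes> inv ?m \<ominus> (y' \<ominus> z) \<otimes> inv ?m \<otimes> inv ?m' \<otimes> (k \<ominus> k') \<in> D 1"
    using ideal_minus[OF D_ideal ideal_mult'[OF D_ideal a(6) ic(1)] ideal_mult[OF D_ideal a(5)]] c ic zc by simp
   ultimately have "w ((y \<ominus> z) \<otimes> inv ?m) = w ((y' \<ominus> z) \<otimes> inv ?m')" using w(2) c ic zc by simp
   then show ?thesis using kk *[OF m(1) c(3)] *[OF m(2) c(4)] by (simp add: \<phi>_def)
  qed (use kk in \<open>simp add: \<phi>_def\<close>)
 qed
 show ?thesis
 proof (rule rep'I[of _ "\<lambda>k y. 1 * T k y + (- 1) * \<phi> k y"])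
  show "rep Y (\<lambda>k y. 1 * T k y + (- 1) * \<phi> k y)" by (rule rep_lin[OF T \<phi>])
  fix y assume y: "y \<in> Y"
  have "(\<Sum>k\<in>L. 1 * T k y + (- 1) * \<phi> k y) = (\<Sum>k\<in>L. T k y)"
   using L_near by (intro sum.cong) (auto simp: \<phi>_def)
  also have "\<dots> = f i (y \<ominus> z)" unfolding T_def using w(3) Yc[OF y] zc by simp
  finally show "(\<Sum>k\<in>L. 1 * T k y + (- 1) * \<phi> k y) = f i (y \<ominus> z)" .
 qed (simp add: \<phi>_def)
qed

text \<open>Induction on i. As a function of y, \<open>f (Suc i) (y \<ominus> z)\<close> is A times
  the indicator of y congruent to z modulo p^(i+1), plus a function g that is constant modulo p^i.
  By induction g is representable, and A is non-zero by \<open>f_gap\<close>. If p^i R is already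
  zero, the two indicators agree.\<close>

lemma rep'_D:
 assumes Y: "Y = D 1 \<or> Y = Units R" and i: "i \<ge> 1"
 shows "\<forall>z\<in>Y. rep' Y (\<lambda>y. of_bool (y \<ominus> z \<in> D i))" using i
proof (induction i rule: nat_induct_at_least)
 have Yc: "y \<in> carrier R" if "y \<in> Y" for y using Y that D_in by auto
 case base
 show ?case
 proof
  fix z assume z: "z \<in> Y"
  have "rep Y (\<lambda>k y. of_bool (k \<ominus> \<one> \<in> D 1 \<and> y \<ominus> z \<in> D 1) / card L)"
  proof (rule rep_coarse[OF Y])
   fix k k' y y' assume a: "k \<in> Units R" "k' \<in> Units R" "y \<in> Y" "y' \<in> Y" "k \<ominus> k' \<in> D 1" "y \<ominus> y' \<in> D 1"
   note c = Units_closed[OF a(1)] Units_closed[OF a(2)] Yc[OF a(3)] Yc[OF a(4)]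
   have "k \<ominus> \<one> \<in> D 1 \<longleftrightarrow> k' \<ominus> \<one> \<in> D 1"
    using D_trans[of k k' \<one> 1] D_trans[of k' k \<one> 1] D_sym[of k k' 1] a(5) c by blast
   moreover have "y \<ominus> z \<in> D 1 \<longleftrightarrow> y' \<ominus> z \<in> D 1"
    using D_trans[of y y' z 1] D_trans[of y' y z 1] D_sym[of y y' 1] a(6) c Yc[OF z] by blast
   ultimately show "of_bool (k \<ominus> \<one> \<in> D 1 \<and> y \<ominus> z \<in> D 1) / real (card L) =
    of_bool (k' \<ominus> \<one> \<in> D 1 \<and> y' \<ominus> z \<in> D 1) / card L" by simp
  qed
  then show "rep' Y (\<lambda>y. of_bool (y \<ominus> z \<in> D 1))" by (rule rep'I) (use L_near L_card in auto)
 qed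
next
 case (Suc i)
 have Yc: "y \<in> carrier R" if "y \<in> Y" for y using Y that D_in by auto
 have finY: "finite Y" using finite_subset[OF _ fin] Yc by blast
 show ?case
 proof (cases "D i = {\<zero>}")
  case True
  then have "D (Suc i) = D i" using D_mono[of i "Suc i"] ideal_zero[OF D_ideal, of "Suc i"] by auto
  then show ?thesis using Suc.IH by simp
 next
  case False
  let ?q = "num (p ^ i)"
  define A where "A = f (Suc i) \<zero> - f (Suc i) ?q"
  have A: "A \<noteq> 0" using f_gap[OF Suc.hyps False] by (simp add: A_def)
  show ?thesis
  proof
   fix z assume z: "z \<in> Y"
   note zc = Yc[OF z]
   define g where "g y = f (Suc i) (y \<ominus> z) - A * of_bool (y \<ominus> z \<in> D (Suc i))" for y
   have g_in: "g y = f (Suc i) ?q" if y: "y \<in> Y" "y \<ominus> z \<in> D i" for y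
   proof (cases "y \<ominus> z \<in> D (Suc i)")
    case True
    then have "f (Suc i) (y \<ominus> z) = f (Suc i) \<zero>" using f_cong[of "y \<ominus> z" \<zero> "Suc i"] Yc[OF y(1)] zc by (simp add: a_minus_def)
    then show ?thesis using True by (simp add: g_def A_def)
   next
    case nD: False
    obtain u where "u \<in> Units R" "y \<ominus> z = ?q \<otimes> u" using D_form[OF y(2) nD] by blast
    then have "f (Suc i) (y \<ominus> z) = f (Suc i) ?q" using f_unit[of u ?q "Suc i"] m_comm[of u ?q] Units_closed by simp
    then show ?thesis using nD by (simp add: g_def)
   qed
   have g_inv: "g y = g y'" if y: "y \<in> Y" "y' \<in> Y" "y \<ominus> y' \<in> D i" for y y'
   proof -
    note c = Yc[OF y(1)] Yc[OF y(2)]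
    have d: "(y \<ominus> z) \<ominus> (y' \<ominus> z) = y \<ominus> y'" using c zc by algebra
    show ?thesis
    proof (cases "y \<ominus> z \<in> D i")
     case True
     then have "y' \<ominus> z \<in> D i" using D_shift[of "y \<ominus> z" "y' \<ominus> z" i] d y c zc by simp
     then show ?thesis using g_in True y by simp
    next
     case nD: False
     then have nD': "y' \<ominus> z \<notin> D i" using D_shift[of "y \<ominus> z" "y' \<ominus> z" i] d y c zc by simp
     have "f (Suc i) (y \<ominus> z) = f (Suc i) (y' \<ominus> z)"
      by (rule f_near[OF _ nD']) (use d y c zc in auto)
     then show ?thesis using nD nD' D_Suc by (auto simp: g_def)
    qed
   qed
   have "rep' Y (\<lambda>y. \<Sum>x\<in>Y. g x / card (D i) * of_bool (y \<ominus> x \<in> D i))"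
    by (rule rep'_sum) (use Suc.IH finY in auto)
   then have "rep' Y g"
   proof (rule rep'_cong)
    fix y assume y: "y \<in> Y"
    have "(\<Sum>x\<in>Y. g x / card (D i) * of_bool (y \<ominus> x \<in> D i)) = (\<Sum>x\<in>Y. g y / card (D i) * of_bool (y \<ominus> x \<in> D i))"
     using g_inv[OF y] by (intro sum.cong) auto
    also have "\<dots> = g y / card (D i) * (\<Sum>x\<in>Y. of_bool (y \<ominus> x \<in> D i))" by (simp only: sum_distrib_left)
    also have "(\<Sum>x\<in>Y. of_bool (y \<ominus> x \<in> D i)) = real (card {x \<in> Y. y \<ominus> x \<in> D i})"
     by (rule card_Ex_sum) (rule finY)
    also have "{x \<in> Y. y \<ominus> x \<in> D i} = {x \<in> carrier R. x \<ominus> y \<in> D i}"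
    proof (intro Set.set_eqI iffI; clarify)
     fix x assume "x \<in> carrier R" "x \<ominus> y \<in> D i"
     then have x: "x \<in> carrier R" "x \<ominus> y \<in> D 1" "y \<ominus> x \<in> D i" using D_le1[OF Suc.hyps] D_sym[OF _ Yc[OF y]] by auto
     have "x \<in> Y" using Y y unit_cong[OF x(1) Yc[OF y] x(2)] D_shift[OF x(1) Yc[OF y] x(2)] by auto
     then show "x \<in> Y \<and> y \<ominus> x \<in> D i" using x(3) by simp
    qed (use Yc D_sym y in simp)
    also have "card \<dots> = card (D i)" by (rule card_coset) (rule Yc[OF y])
    finally show "(\<Sum>x\<in>Y. g x / card (D i) * of_bool (y \<ominus> x \<in> D i)) = g y" using card_D_pos[of i] by simp
   qed
   from rep'_lin[OF rep'_f[OF Y z, of "Suc i"] this, of "1 / A" "- 1 / A"]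
   show "rep' Y (\<lambda>y. of_bool (y \<ominus> z \<in> D (Suc i)))" using A by (simp add: g_def field_simps)
  qed
 qed
qed

theorem separation:
 assumes Y: "Y = D 1 \<or> Y = Units R" and z: "z \<in> Y"
 obtains \<alpha> :: "'a \<Rightarrow> 'a \<Rightarrow> real" where "\<And>a b. \<alpha> a b \<noteq> 0 ==> a \<in> Units R \<and> b \<in> Units R"
  "\<And>k y. k \<in> Units R ==> y \<in> Y ==> k \<ominus> \<one> \<notin> D 1 ==> (\<Sum>b\<in>carrier R. \<alpha> (line y b k) b) = 0"
  "\<And>y. y \<in> Y ==> (\<Sum>k\<in>L. \<Sum>b\<in>carrier R. \<alpha> (line y b k) b) = of_bool (y = z)"
proof -
 have Yc: "y \<in> carrier R" if "y \<in> Y" for y using Y that D_in by auto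
 obtain n where n: "D n = {\<zero>}" using D_vanish by blast
 have "D (Suc n) = {\<zero>}" using D_mono[of n "Suc n"] n ideal_zero[OF D_ideal, of "Suc n"] by auto
 then have "rep' Y (\<lambda>y. of_bool (y \<ominus> z \<in> {\<zero>}))" using rep'_D[OF Y, of "Suc n"] z by simp
 then obtain h where h: "rep Y h" "\<And>k y. k \<in> Units R ==> y \<in> Y ==> k \<ominus> \<one> \<notin> D 1 ==> h k y = 0"
  "\<And>y. y \<in> Y ==> (\<Sum>k\<in>L. h k y) = of_bool (y \<ominus> z \<in> {\<zero>})" unfolding rep'_def by blast
 obtain \<alpha> where \<alpha>: "\<And>a b. \<alpha> a b \<noteq> 0 ==> a \<in> Units R \<and> b \<in> Units R"
  "\<And>k y. k \<in> Units R ==> y \<in> Y ==> (\<Sum>b\<in>carrier R. \<alpha> (line y b k) b) = h k y"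
  using h(1) unfolding rep_def by blast
 show ?thesis
 proof (rule that[OF \<alpha>(1)])
  fix y assume y: "y \<in> Y"
  have "(\<Sum>k\<in>L. \<Sum>b\<in>carrier R. \<alpha> (line y b k) b) = (\<Sum>k\<in>L. h k y)" using \<alpha>(2) y L_unit by simp
  also have "\<dots> = of_bool (y = z)" using h(3)[OF y] Yc[OF y] Yc[OF z] by simp
  finally show "(\<Sum>k\<in>L. \<Sum>b\<in>carrier R. \<alpha> (line y b k) b) = of_bool (y = z)" .
 qed (use \<alpha>(2) h(2) in auto)
qed

end

section \<open>Cyclotomic S-rings\<close>

lemma (in cg_ring) corner_local: "p \<in> P ==> local_cg_ring (corner {p}) p"
 using local_cg_ring.intro[OF corner_cg_ring, of "{p}" p] local_cg_ring_axioms.intro[of "corner {p}" p]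
  corner_primes[of "{p}"] by simp

lemma (in cg_ring) unit_component:
 "p \<in> P ==> x \<in> carrier R ==> \<pi> {p} x \<in> Units (corner {p}) \<longleftrightarrow> x \<notin> mul p"
proof -
 assume p: "p \<in> P" and x: "x \<in> carrier R"
 interpret C: local_cg_ring "corner {p}" p by (rule corner_local[OF p])
 have "\<pi> {p} x \<in> Units (corner {p}) \<longleftrightarrow> \<pi> {p} x \<notin> C.mul p"
  using C.unit_D[of "\<pi> {p} x"] comp_proj[OF x, of "{p}"] by (simp add: C.D_1)
 also have "\<dots> \<longleftrightarrow> x \<notin> mul p"
  using corner_mul[OF P_prime[OF p] comp_proj[OF x]] mul_iff[OF P_prime[OF p] x] by simp
 finally show ?thesis .
qed

lemma (in fin_cring) sum_components:
 fixes F :: "nat \<Rightarrow> 'a \<Rightarrow> real"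
 shows "(\<Sum>x\<in>carrier R. \<Prod>p\<in>P. F p (\<pi> {p} x)) = (\<Prod>p\<in>P. \<Sum>b\<in>comp {p}. F p b)"
proof -
 have finC: "finite (comp Q)" for Q using finite_subset[OF ideal_sub[OF comp_ideal] fin] .
 have bij: "bij_betw (\<lambda>x. \<lambda>p\<in>P. \<pi> {p} x) (carrier R) (\<Pi>\<^sub>E p\<in>P. comp {p})"
 proof (rule bij_betw_imageI)
  show "inj_on (\<lambda>x. \<lambda>p\<in>P. \<pi> {p} x) (carrier R)"
  proof (rule inj_onI)
   fix x y assume a: "x \<in> carrier R" "y \<in> carrier R" "(\<lambda>p\<in>P. \<pi> {p} x) = (\<lambda>p\<in>P. \<pi> {p} y)"
   show "x = y"
   proof (rule eqI_primes[OF a(1,2)])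
    fix p assume "p \<in> P"
    then show "\<pi> {p} x = \<pi> {p} y" using fun_cong[OF a(3), of p] by simp
   qed
  qed
  show "(\<lambda>x. \<lambda>p\<in>P. \<pi> {p} x) ` carrier R = (\<Pi>\<^sub>E p\<in>P. comp {p})"
  proof (intro equalityI subsetI)
   fix l assume l: "l \<in> (\<Pi>\<^sub>E p\<in>P. comp {p})"
   note l' = finsum_family[where Q = "\<lambda>p. {p}", OF P_finite _ PiE_mem[OF l], unfolded disjoint_family_on_def]
   have "l = (\<lambda>p\<in>P. \<pi> {p} (finsum R l P))"
    using l l'(2) by (auto simp: PiE_def extensional_def fun_eq_iff)
   moreover have "finsum R l P \<in> carrier R" using l'(1) by auto
   ultimately show "l \<in> (\<lambda>x. \<lambda>p\<in>P. \<pi> {p} x) ` carrier R" by blast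
  qed (use comp_proj in auto)
 qed
 have "(\<Prod>p\<in>P. \<Sum>b\<in>comp {p}. F p b) = (\<Sum>l\<in>(\<Pi>\<^sub>E p\<in>P. comp {p}). \<Prod>p\<in>P. F p (l p))"
  by (rule prod_sum_PiE) (use finC in auto)
 also have "\<dots> = (\<Sum>x\<in>carrier R. \<Prod>p\<in>P. F p ((\<lambda>p\<in>P. \<pi> {p} x) p))"
  by (rule sum.reindex_bij_betw[OF bij, symmetric])
 finally show ?thesis by simp
qed

section \<open>K as a group of units and its principal units at each prime\<close>

locale mul_sring = pure_sring +
 assumes mul_aideal: "p \<in> P ==> aideal (mul p)"
begin

lemma K_Units: "k \<in> K ==> k \<in> Units R"
proof -
 assume k: "k \<in> K"
 have "k \<notin> mul p" if "p \<in> P" for p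
  using aset_cong[OF aideal_aset[OF mul_aideal[OF that]] one_closed k] one_notin_mul[OF that] by blast
 then show "k \<in> Units R" using unit_iff cls_in[OF one_closed k] by blast
qed

lemma K_carrier: "k \<in> K ==> k \<in> carrier R" using K_Units by blast

lemma K_sub: "subgroup K (units_of R)"
proof -
 have "{u \<in> Units R. u \<in> K} = K" using K_Units by blast
 then show ?thesis using K_subgroup by simp
qed

lemma K_one: "\<one> \<in> K" using cls_self[of \<one>] by simp

lemma K_mult: "k \<in> K ==> l \<in> K ==> k \<otimes> l \<in> K"
 using subgroup.m_closed[OF K_sub, of k l] by (simp add: units_of_def)

lemma K_inv: "k \<in> K ==> inv k \<in> K"
 using subgroup.m_inv_closed[OF K_sub, of k] units_of_inv K_Units by simp

lemma K_pow: "k \<in> K ==> k [^] (n::nat) \<in> K" by (induction n) (auto simp: K_one K_mult)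

lemma K_finite: "finite K" using finite_subset[OF _ fin] K_carrier by blast

lemma cls_unit: "u \<in> Units R ==> cls u = (\<lambda>k. u \<otimes> k) ` K"
 using cls_mult[of u \<one>] by (simp add: Units_closed)

lemma cls_pattern: "x \<in> carrier R ==> y \<in> cls x ==> p \<in> P ==> y \<in> mul p \<longleftrightarrow> x \<in> mul p"
 using aset_cong aideal_aset mul_aideal by blast

text \<open>Only elements of K that are already 1 at the other primes are projected to R_p. Thus an
  element of \<open>Lp p\<close>, completed by 1, lies in K again, which the projection of an
  arbitrary element of K need not satisfy.\<close>

definition Lp :: "nat \<Rightarrow> 'a set"
 where "Lp p = (\<lambda>k. \<pi> {p} k) ` {k \<in> K. k \<in> \<Gamma> p \<and> k \<ominus> \<one> \<in> mul p}"

lemma \<Gamma>_decomp: "k \<in> \<Gamma> p ==> k = \<pi> {p} k \<oplus> \<epsilon> (- {p})" using \<epsilon>_split[of k "{p}"] by (auto simp: \<Gamma>_def)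

lemma near_mult: "prime p ==> k \<in> carrier R ==> l \<in> carrier R ==> k \<ominus> \<one> \<in> mul p ==> l \<ominus> \<one> \<in> mul p ==> k \<otimes> l \<ominus> \<one> \<in> mul p"
proof -
 assume a: "prime p" "k \<in> carrier R" "l \<in> carrier R" "k \<ominus> \<one> \<in> mul p" "l \<ominus> \<one> \<in> mul p"
 have "k \<otimes> l \<ominus> \<one> = k \<otimes> (l \<ominus> \<one>) \<oplus> (k \<ominus> \<one>)" using a(2,3) by algebra
 then show ?thesis using ideal_add[OF mul_ideal ideal_mult[OF mul_ideal a(5,2)] a(4)] by simp
qed

lemma near_pow: "prime p ==> k \<in> carrier R ==> k \<ominus> \<one> \<in> mul p ==> k [^] (n::nat) \<ominus> \<one> \<in> mul p"
proof (induction n)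
 case 0
 then show ?case using ideal_zero[OF mul_ideal, of p] by (simp add: a_minus_def r_neg)
next
 case (Suc n)
 then show ?case using near_mult[of p "k [^] n" k] by simp
qed

lemma \<Gamma>_mult: "k \<in> \<Gamma> p ==> l \<in> \<Gamma> p ==> k \<otimes> l \<in> \<Gamma> p"
proof -
 assume a: "k \<in> \<Gamma> p" "l \<in> \<Gamma> p"
 then have c: "k \<in> Units R" "l \<in> Units R" by (auto simp: \<Gamma>_def)
 have "\<pi> (- {p}) (k \<otimes> l) = \<pi> (- {p}) k \<otimes> l" using c by (simp add: m_assoc Units_closed)
 also have "\<dots> = \<epsilon> (- {p})" using a by (simp add: \<Gamma>_def)
 finally show ?thesis using c by (simp add: \<Gamma>_def)
qed

lemma \<epsilon>_mult_dist: "x \<in> carrier R ==> y \<in> carrier R ==> \<pi> Q x \<otimes> \<pi> Q y = \<pi> Q (x \<otimes> y)"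
proof -
 assume c: "x \<in> carrier R" "y \<in> carrier R"
 have "\<pi> Q x \<otimes> \<pi> Q y = (\<epsilon> Q \<otimes> \<epsilon> Q) \<otimes> (x \<otimes> y)" using c by (simp only: m_ac \<epsilon>_closed m_closed)
 then show ?thesis by simp
qed

lemma \<epsilon>_minus_dist: "x \<in> carrier R ==> y \<in> carrier R ==> \<pi> Q (x \<ominus> y) = \<pi> Q x \<ominus> \<pi> Q y"
 by (simp add: a_minus_def r_distr r_minus)

text \<open>If \<open>Lp p\<close> contained 1 + h for all h in the annihilator of p, so would K;
  since x + h = x (1 + h / x) for a unit x, K would be stable under translation by
  \<open>tor p\<close>, against purity.\<close>

lemma Lp_pure_L:
 assumes p: "p \<in> P"
 shows "pure_L (corner {p}) p (Lp p)"
proof -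
 interpret C: local_cg_ring "corner {p}" p by (rule corner_local[OF p])
 note pp = P_prime[OF p]
 have LU: "Lp p \<subseteq> Units (corner {p})" using K_Units unfolding Lp_def corner_Units by blast
 have near1: "\<pi> {p} k \<ominus>\<^bsub>corner {p}\<^esub> \<epsilon> {p} \<in> C.D 1" if k: "k \<in> carrier R" "k \<ominus> \<one> \<in> mul p" for k
 proof -
  have e: "\<pi> {p} k \<ominus>\<^bsub>corner {p}\<^esub> \<epsilon> {p} = \<pi> {p} (k \<ominus> \<one>)"
   using corner_minus[OF comp_proj[OF k(1)] \<epsilon>_in_comp] \<epsilon>_minus_dist[OF k(1) one_closed] by simp
  have "\<pi> {p} (k \<ominus> \<one>) \<in> mul p" using ideal_mult[OF mul_ideal k(2)] by simp
  then show ?thesis unfolding e using corner_mul[OF pp comp_proj[of "k \<ominus> \<one>" "{p}"]] k(1) by (simp add: C.D_1)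
 qed
 show ?thesis
 proof (intro pure_L.intro local_L.intro local_L_axioms.intro pure_L_axioms.intro corner_local[OF p])
  show "subgroup (Lp p) (units_of (corner {p}))"
  proof (rule group.subgroupI[OF C.units_group])
   have "\<one> \<in> {k \<in> K. k \<in> \<Gamma> p \<and> k \<ominus> \<one> \<in> mul p}"
    using K_one ideal_zero[OF mul_ideal, of p] by (simp add: \<Gamma>_def a_minus_def r_neg)
   then show "Lp p \<noteq> {}" unfolding Lp_def by blast
   show "Lp p \<subseteq> carrier (units_of (corner {p}))" using LU by (simp add: units_of_def)
  next
   fix x assume "x \<in> Lp p"
   then obtain k where k: "k \<in> K" "k \<in> \<Gamma> p" "k \<ominus> \<one> \<in> mul p" "x = \<pi> {p} k" by (auto simp: Lp_def)
   note kU = K_Units[OF k(1)] and kc = K_carrier[OF k(1)]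
   have "inv k \<ominus> \<one> = (\<ominus> (inv k)) \<otimes> (k \<ominus> \<one>)"
    using kU kc by (simp add: a_minus_def r_distr r_minus l_minus a_comm)
   then have n: "inv k \<ominus> \<one> \<in> mul p" using ideal_mult[OF mul_ideal k(3), of "\<ominus> (inv k)"] kU by simp
   have "\<epsilon> (- {p}) \<otimes> inv k = \<pi> (- {p}) k \<otimes> inv k" using k(2) by (simp add: \<Gamma>_def)
   also have "\<dots> = \<epsilon> (- {p})" using kU kc by (simp add: m_assoc)
   finally have g: "inv k \<in> \<Gamma> p" using kU by (simp add: \<Gamma>_def)
   have i: "\<epsilon> {p} \<otimes> inv k \<in> Lp p" using n g K_inv[OF k(1)] by (auto simp: Lp_def)
   have "inv\<^bsub>corner {p}\<^esub> x = \<epsilon> {p} \<otimes> inv k" by (rule C.inv_char)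
     (use k(4) kU kc comp_proj \<epsilon>_mult_dist[of k "inv k" "{p}"] \<epsilon>_mult_dist[of "inv k" k "{p}"] in simp_all)
   moreover have "x \<in> Units (corner {p})" using k(4) kU by (simp add: corner_Units)
   ultimately show "inv\<^bsub>units_of (corner {p})\<^esub> x \<in> Lp p" using i C.units_of_inv by simp
  next
   fix x y assume "x \<in> Lp p" "y \<in> Lp p"
   then obtain k l where kl: "k \<in> K" "k \<in> \<Gamma> p" "k \<ominus> \<one> \<in> mul p" "x = \<pi> {p} k"
    "l \<in> K" "l \<in> \<Gamma> p" "l \<ominus> \<one> \<in> mul p" "y = \<pi> {p} l" by (auto simp: Lp_def)
   have "x \<otimes> y = \<pi> {p} (k \<otimes> l)" using kl \<epsilon>_mult_dist K_carrier by simp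
   moreover have "k \<otimes> l \<in> K" "k \<otimes> l \<in> \<Gamma> p" "k \<otimes> l \<ominus> \<one> \<in> mul p"
    using kl K_mult \<Gamma>_mult near_mult[OF pp] K_carrier by auto
   ultimately show "x \<otimes>\<^bsub>units_of (corner {p})\<^esub> y \<in> Lp p" by (auto simp: Lp_def units_of_def)
  qed
  fix k assume "k \<in> Lp p"
  then show "k \<ominus>\<^bsub>corner {p}\<^esub> \<one>\<^bsub>corner {p}\<^esub> \<in> C.D 1" using near1 K_carrier by (auto simp: Lp_def)
 next
  show "\<exists>h\<in>C.tor p. \<one>\<^bsub>corner {p}\<^esub> \<oplus>\<^bsub>corner {p}\<^esub> h \<notin> Lp p"
  proof (rule ccontr)
   assume "\<not> ?thesis"
   then have all: "\<And>h. h \<in> C.tor p ==> \<epsilon> {p} \<oplus> h \<in> Lp p" by auto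
   have in_K: "\<one> \<oplus> h \<in> K" if h: "h \<in> tor p" for h
   proof -
    have hc: "h \<in> comp {p}" using tor_\<epsilon>[OF pp h] tor_carrier[OF h] by (simp add: comp_def)
    then obtain k where k: "k \<in> K" "k \<in> \<Gamma> p" "\<epsilon> {p} \<oplus> h = \<pi> {p} k"
     using all[of h] corner_tor[OF hc] h by (auto simp: Lp_def)
    have "k = \<epsilon> {p} \<oplus> h \<oplus> \<epsilon> (- {p})" using \<Gamma>_decomp[OF k(2)] k(3) by simp
    also have "\<dots> = \<epsilon> {p} \<oplus> \<epsilon> (- {p}) \<oplus> h" using tor_carrier[OF h] by (simp add: a_ac)
    also have "\<dots> = \<one> \<oplus> h" using \<epsilon>_add[of "{p}" "- {p}"] by simp
    finally show ?thesis using k(1) by simp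
   qed
   have "tor p = {\<zero>}"
   proof (rule pure[OF tor_ideal])
    fix x h assume x: "x \<in> K" and h: "h \<in> tor p"
    have "x \<oplus> h = x \<otimes> (\<one> \<oplus> inv x \<otimes> h)"
     using K_Units[OF x] tor_carrier[OF h] by (simp add: r_distr Units_closed)
    moreover have "inv x \<otimes> h \<in> tor p" using ideal_mult[OF tor_ideal h, of "inv x"] K_Units[OF x] by simp
    ultimately show "x \<oplus> h \<in> K" using K_mult[OF x in_K] by simp
   qed
   then show False using tor_nontrivial[OF p] by blast
  qed
 qed
qed


definition K1 :: "'a set"
 where "K1 = {k \<in> K. \<forall>p\<in>P. k \<ominus> \<one> \<in> mul p}"

lemma corner_pow:
 assumes k: "k \<in> carrier R"
 shows "\<pi> {p} k [^]\<^bsub>corner {p}\<^esub> (n::nat) = \<epsilon> {p} \<otimes> k [^] n"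
proof -
 interpret C: cring "corner {p}" by (rule corner_cring)
 show ?thesis
 proof (induction n)
  case (Suc n)
  have "\<pi> {p} k [^]\<^bsub>corner {p}\<^esub> Suc n = (\<epsilon> {p} \<otimes> k [^] n) \<otimes> \<pi> {p} k" using Suc by simp
  then show ?case using \<epsilon>_mult_dist[of "k [^] n" k "{p}"] k by simp
 qed simp
qed

lemma corner_multiplicity:
 assumes p: "p \<in> P"
 shows "p ^ multiplicity p (order (corner {p})) dvd ppart p"
proof -
 have "multiplicity p (order (corner {p})) \<le> multiplicity p (order R)"
  using corner_order[of "{p}"] order_pos by (intro dvd_imp_multiplicity_le) auto
 then show ?thesis by (rule le_imp_power_dvd)
qed

lemma local_pow:
 assumes p: "p \<in> P" and k: "k \<in> carrier R" "k \<ominus> \<one> \<in> mul p" and m: "ppart p dvd m"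
 shows "\<epsilon> {p} \<otimes> k [^] m = \<epsilon> {p}"
proof -
 interpret C: local_cg_ring "corner {p}" p by (rule corner_local[OF p])
 have c: "\<pi> {p} k \<in> comp {p}" using comp_proj[OF k(1)] .
 have "\<pi> {p} k \<ominus>\<^bsub>corner {p}\<^esub> \<epsilon> {p} = \<pi> {p} (k \<ominus> \<one>)"
  using corner_minus[OF c \<epsilon>_in_comp] \<epsilon>_minus_dist[OF k(1) one_closed] by simp
 moreover have "\<pi> {p} (k \<ominus> \<one>) \<in> C.mul p"
  using corner_mul[OF P_prime[OF p] comp_proj[of "k \<ominus> \<one>" "{p}"]] ideal_mult[OF mul_ideal k(2), of "\<epsilon> {p}"] k(1) by simp
 ultimately have "\<pi> {p} k [^]\<^bsub>corner {p}\<^esub> m = \<epsilon> {p}"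
  using C.pow_ppart[of "\<pi> {p} k" m] c dvd_trans[OF corner_multiplicity[OF p] m] by (simp add: C.D_1)
 then show ?thesis using corner_pow[OF k(1)] by simp
qed

text \<open>A power of k isolates its p-component: the exponent \<open>idx {p}\<close> is 0 modulo
  the q-part of the order for q \<noteq> p, which turns those components into 1, and it is 1 modulo
  the p-part. So the p-component of k, completed by 1, belongs to K.\<close>

lemma K1_Lp:
 assumes k: "k \<in> K1" and p: "p \<in> P"
 shows "\<pi> {p} k \<in> Lp p"
proof -
 have kK: "k \<in> K" and near: "\<And>q. q \<in> P ==> k \<ominus> \<one> \<in> mul q" using k by (auto simp: K1_def)
 note kc = K_carrier[OF kK]
 let ?m = "idx {p}"
 have off: "\<epsilon> (- {p}) \<otimes> k [^] ?m = \<pi> (- {p}) \<one>"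
 proof (rule \<epsilon>_eqI)
  fix q assume q: "q \<in> P" "q \<in> - {p}"
  have "ppart q dvd ?m" using idx[OF q(1), of "{p}"] q(2) by (simp add: cong_0_iff)
  then show "\<epsilon> {q} \<otimes> k [^] ?m = \<pi> {q} \<one>" using local_pow[OF q(1) kc near[OF q(1)]] by simp
 qed (use kc in auto)
 have on: "\<epsilon> {p} \<otimes> k [^] ?m = \<pi> {p} k"
 proof -
  have c: "[?m = 1] (mod ppart p)" using idx[OF p, of "{p}"] by simp
  have "multiplicity p (order R) > 0"
   using p order_pos by (intro multiplicity_gt_zero_iff[THEN iffD2]) (auto simp: ring_primes_def prime_gt_1_nat)
  then have "ppart p > 1" using P_odd[OF p] one_less_power[of p "multiplicity p (order R)"] by simp
  \<comment> \<open>Natural number subtraction: the exponent is split as \<open>?m - 1\<close> and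
    one further factor k.\<close>
  then have "?m \<noteq> 0" using c by (metis cong_def mod_0 mod_less zero_neq_one)
  then have "ppart p dvd ?m - 1" using c cong_to_1_nat by blast
  then have "\<epsilon> {p} \<otimes> k [^] (?m - 1) = \<epsilon> {p}" using local_pow[OF p kc near[OF p]] by blast
  moreover have "k [^] ?m = k [^] (?m - 1) \<otimes> k" using \<open>?m \<noteq> 0\<close> nat_pow_Suc[of k "?m - 1"] by simp
  ultimately show ?thesis using kc by (simp flip: m_assoc)
 qed
 have "k [^] ?m \<in> K" "k [^] ?m \<in> \<Gamma> p" "k [^] ?m \<ominus> \<one> \<in> mul p"
  using K_pow[OF kK, of ?m] K_Units off near_pow[OF P_prime[OF p] kc near[OF p]] by (auto simp: \<Gamma>_def)
 then show ?thesis unfolding Lp_def using on by (intro image_eqI[of _ _ "k [^] ?m"]) auto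
qed

lemma K1_bij: "bij_betw (\<lambda>k. \<lambda>p\<in>P. \<pi> {p} k) K1 (\<Pi>\<^sub>E p\<in>P. Lp p)"
proof (rule bij_betw_imageI)
 show "inj_on (\<lambda>k. \<lambda>p\<in>P. \<pi> {p} k) K1"
 proof (rule inj_onI)
  fix x y assume a: "x \<in> K1" "y \<in> K1" "(\<lambda>p\<in>P. \<pi> {p} x) = (\<lambda>p\<in>P. \<pi> {p} y)"
  show "x = y"
  proof (rule eqI_primes)
   fix p assume "p \<in> P"
   then show "\<pi> {p} x = \<pi> {p} y" using fun_cong[OF a(3), of p] by simp
  qed (use a K_carrier in \<open>auto simp: K1_def\<close>)
 qed
 show "(\<lambda>k. \<lambda>p\<in>P. \<pi> {p} k) ` K1 = (\<Pi>\<^sub>E p\<in>P. Lp p)"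
 proof (intro equalityI subsetI)
  fix l assume l: "l \<in> (\<Pi>\<^sub>E p\<in>P. Lp p)"
  have *: "\<exists>k\<in>K. (\<forall>p\<in>P. k \<ominus> \<one> \<in> mul p) \<and> (\<forall>p\<in>F. \<pi> {p} k = l p) \<and> (\<forall>p. p \<notin> F \<longrightarrow> \<pi> {p} k = \<epsilon> {p})"
   if "finite F" "F \<subseteq> P" for F using that
  proof (induction F rule: finite_induct)
   case empty
   then show ?case using K_one ideal_zero[OF mul_ideal] by (intro bexI[of _ \<one>]) (auto simp: a_minus_def r_neg)
  next
   case (insert q F)
   then obtain x where x: "x \<in> K" "\<And>p. p \<in> P ==> x \<ominus> \<one> \<in> mul p" "\<And>p. p \<in> F ==> \<pi> {p} x = l p"
    "\<And>p. p \<notin> F ==> \<pi> {p} x = \<epsilon> {p}" by blast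
   have qP: "q \<in> P" using insert.prems by simp
   obtain k where k: "k \<in> K" "k \<in> \<Gamma> q" "k \<ominus> \<one> \<in> mul q" "l q = \<pi> {q} k"
    using PiE_mem[OF l qP] by (auto simp: Lp_def)
   note c = K_carrier[OF x(1)] K_carrier[OF k(1)]
   have off: "\<pi> {p} k = \<epsilon> {p}" if "p \<noteq> q" for p
   proof -
    have "\<pi> {p} k = \<pi> {p} (\<pi> (- {q}) k)" using that c by (simp add: \<epsilon>_idem)
    also have "\<dots> = \<epsilon> {p}" using k(2) that by (simp add: \<Gamma>_def)
    finally show ?thesis .
   qed
   have split: "\<pi> {p} (x \<otimes> k) = \<pi> {p} x \<otimes> \<pi> {p} k" for p using \<epsilon>_mult_dist[OF c] by simp
   show ?case
   proof (rule bexI[of _ "x \<otimes> k"], intro conjI ballI allI impI)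
    fix p assume p: "p \<in> P"
    have "k \<ominus> \<one> \<in> mul p"
    proof (cases "p = q")
     case False
     have "\<pi> {p} (k \<ominus> \<one>) = \<zero>" using off[OF False] c \<epsilon>_minus_dist[of k \<one> "{p}"] by simp
     then show ?thesis using mul_iff[OF P_prime[OF p], of "k \<ominus> \<one>"] ideal_zero[OF mul_ideal] c by simp
    qed (use k in simp)
    then show "x \<otimes> k \<ominus> \<one> \<in> mul p" using near_mult[OF P_prime[OF p] c x(2)[OF p]] by simp
   next
    fix p assume p: "p \<in> insert q F"
    show "\<pi> {p} (x \<otimes> k) = l p"
    proof (cases "p = q")
     case True
     then have "\<pi> {p} (x \<otimes> k) = \<pi> {p} (\<pi> {p} k)" unfolding split using x(4) insert.hyps(2) by simp
     then show ?thesis using True k(4) c by (simp add: \<epsilon>_idem)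
    next
     case False
     then have "\<pi> {p} (x \<otimes> k) = \<pi> {p} x \<otimes> \<epsilon> {p}" unfolding split using off by simp
     also have "\<dots> = \<pi> {p} x" using c by (simp add: m_comm[of "\<pi> {p} x"] \<epsilon>_idem)
     finally show ?thesis using p False x(3) by simp
    qed
   next
    fix p assume p: "p \<notin> insert q F"
    then show "\<pi> {p} (x \<otimes> k) = \<epsilon> {p}" unfolding split using off x(4) by simp
   qed (rule K_mult[OF x(1) k(1)])
  qed
  obtain k where k: "k \<in> K" "\<forall>p\<in>P. k \<ominus> \<one> \<in> mul p" "\<forall>p\<in>P. \<pi> {p} k = l p" using *[OF P_finite order_refl] by blast
  then have "l = (\<lambda>p\<in>P. \<pi> {p} k)" using l by (auto simp: PiE_def extensional_def fun_eq_iff)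
  then show "l \<in> (\<lambda>k. \<lambda>p\<in>P. \<pi> {p} k) ` K1" using k by (auto simp: K1_def)
 qed (use K1_Lp in auto)
qed

text \<open>A is the product over the primes of the weights from \<open>separation\<close>, and sums
  over R factor by \<open>sum_components\<close>. For k in K outside K1 the factor at some prime
  vanishes; K1 is the direct product of the groups \<open>Lp p\<close>, so the sum over k factors as
  well.\<close>

lemma separate:
 assumes z: "z \<in> carrier R"
 obtains A :: "'a \<Rightarrow> 'a \<Rightarrow> real" where
  "\<And>v w. v \<in> carrier R ==> w \<in> carrier R ==> A v w \<noteq> 0 ==> v \<in> Units R \<and> w \<in> Units R"
  "\<And>y. y \<in> carrier R ==> (\<And>p. p \<in> P ==> y \<in> mul p \<longleftrightarrow> z \<in> mul p) ==>
   (\<Sum>k\<in>K. \<Sum>w\<in>carrier R. A (y \<ominus> w \<otimes> k) w) = of_bool (y = z)"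
proof -
 \<comment> \<open>At each prime z decides which of the two cases of \<open>separation\<close> is
   used, multiples of p or units.\<close>
 define Y where "Y p = (if z \<in> mul p then local_cg_ring.D (corner {p}) p 1 else Units (corner {p}))" for p
 have Y_iff: "\<pi> {p} y \<in> Y p \<longleftrightarrow> (y \<in> mul p \<longleftrightarrow> z \<in> mul p)" if p: "p \<in> P" and y: "y \<in> carrier R" for p y
 proof -
  interpret C: local_cg_ring "corner {p}" p by (rule corner_local[OF p])
  have "\<pi> {p} y \<in> C.D 1 \<longleftrightarrow> y \<in> mul p"
   using corner_mul[OF P_prime[OF p] comp_proj[OF y]] mul_iff[OF P_prime[OF p] y] by (simp add: C.D_1)
  then show ?thesis using unit_component[OF p y] by (simp add: Y_def)
 qed
 let ?good = "\<lambda>p \<alpha>. (\<forall>a b. \<alpha> a b \<noteq> 0 \<longrightarrow> a \<in> Units (corner {p}) \<and> b \<in> Units (corner {p})) \<and>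
   (\<forall>k y. k \<in> Units (corner {p}) \<longrightarrow> y \<in> Y p \<longrightarrow> k \<ominus>\<^bsub>corner {p}\<^esub> \<epsilon> {p} \<notin> mul p \<longrightarrow>
    (\<Sum>b\<in>comp {p}. \<alpha> (y \<ominus>\<^bsub>corner {p}\<^esub> b \<otimes> k) b) = (0::real)) \<and>
   (\<forall>y\<in>Y p. (\<Sum>k\<in>Lp p. \<Sum>b\<in>comp {p}. \<alpha> (y \<ominus>\<^bsub>corner {p}\<^esub> b \<otimes> k) b) = of_bool (y = \<pi> {p} z))"
 have "\<forall>p\<in>P. \<exists>\<alpha>. ?good p \<alpha>"
 proof
  fix p assume p: "p \<in> P"
  interpret C: pure_L "corner {p}" p "Lp p" by (rule Lp_pure_L[OF p])
  have Y: "Y p = C.D 1 \<or> Y p = Units (corner {p})" by (simp add: Y_def)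
  have zY: "\<pi> {p} z \<in> Y p" using Y_iff[OF p z] by simp
  obtain \<alpha> :: "'a \<Rightarrow> 'a \<Rightarrow> real" where \<alpha>: "\<And>a b. \<alpha> a b \<noteq> 0 ==> a \<in> Units (corner {p}) \<and> b \<in> Units (corner {p})"
   "\<And>k y. k \<in> Units (corner {p}) ==> y \<in> Y p ==> k \<ominus>\<^bsub>corner {p}\<^esub> \<one>\<^bsub>corner {p}\<^esub> \<notin> C.D 1 ==>
    (\<Sum>b\<in>carrier (corner {p}). \<alpha> (y \<ominus>\<^bsub>corner {p}\<^esub> b \<otimes>\<^bsub>corner {p}\<^esub> k) b) = 0"
   "\<And>y. y \<in> Y p ==> (\<Sum>k\<in>Lp p. \<Sum>b\<in>carrier (corner {p}). \<alpha> (y \<ominus>\<^bsub>corner {p}\<^esub> b \<otimes>\<^bsub>corner {p}\<^esub> k) b) = of_bool (y = \<pi> {p} z)"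
   using C.separation[OF Y zY] by blast
  have d: "k \<ominus>\<^bsub>corner {p}\<^esub> \<epsilon> {p} \<notin> C.D 1" if "k \<in> Units (corner {p})" "k \<ominus>\<^bsub>corner {p}\<^esub> \<epsilon> {p} \<notin> mul p" for k
  proof -
   have "k \<ominus>\<^bsub>corner {p}\<^esub> \<epsilon> {p} \<in> comp {p}"
    using C.minus_closed[OF C.Units_closed[OF that(1)] C.one_closed] by simp
   then show ?thesis using corner_mul[OF P_prime[OF p]] that(2) by (simp add: C.D_1)
  qed
  show "\<exists>\<alpha>. ?good p \<alpha>" using \<alpha> d by (intro exI[of _ \<alpha>]) auto
 qed
 from bchoice[OF this] obtain \<alpha> where \<alpha>: "\<And>p. p \<in> P ==> ?good p (\<alpha> p)" by blast
 define A where "A v w = (\<Prod>p\<in>P. \<alpha> p (\<pi> {p} v) (\<pi> {p} w))" for v w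
 define N where "N p k y = (\<Sum>b\<in>comp {p}. \<alpha> p (y \<ominus>\<^bsub>corner {p}\<^esub> b \<otimes> k) b)" for p k y
 show ?thesis
 proof (rule that[of A])
  fix v w assume c: "v \<in> carrier R" "w \<in> carrier R" and A: "A v w \<noteq> 0"
  have "v \<notin> mul p \<and> w \<notin> mul p" if p: "p \<in> P" for p
  proof -
   have "\<alpha> p (\<pi> {p} v) (\<pi> {p} w) \<noteq> 0" using A p by (auto simp: A_def)
   then show ?thesis using \<alpha>[OF p] unit_component[OF p] c by blast
  qed
  then show "v \<in> Units R \<and> w \<in> Units R" using unit_iff c by blast
 next
  fix y assume y: "y \<in> carrier R" "\<And>p. p \<in> P ==> y \<in> mul p \<longleftrightarrow> z \<in> mul p"
  have yY: "\<pi> {p} y \<in> Y p" if "p \<in> P" for p using Y_iff[OF that y(1)] y(2)[OF that] by simp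
  have step: "(\<Sum>w\<in>carrier R. A (y \<ominus> w \<otimes> k) w) = (\<Prod>p\<in>P. N p (\<pi> {p} k) (\<pi> {p} y))" if k: "k \<in> carrier R" for k
  proof -
   have e: "\<pi> {p} (y \<ominus> w \<otimes> k) = \<pi> {p} y \<ominus>\<^bsub>corner {p}\<^esub> \<pi> {p} w \<otimes> \<pi> {p} k" if w: "w \<in> carrier R" for p w
    using corner_minus[OF comp_proj[OF y(1)] comp_mult_closed[OF comp_proj[OF w] comp_proj[OF k]]]
     \<epsilon>_mult_dist[OF w k] \<epsilon>_minus_dist[OF y(1), of "w \<otimes> k"] w k by simp
   have "(\<Sum>w\<in>carrier R. A (y \<ominus> w \<otimes> k) w) = (\<Sum>w\<in>carrier R. \<Prod>p\<in>P.
     (\<lambda>p b. \<alpha> p (\<pi> {p} y \<ominus>\<^bsub>corner {p}\<^esub> b \<otimes> \<pi> {p} k) b) p (\<pi> {p} w))"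
    unfolding A_def using e by simp
   also have "\<dots> = (\<Prod>p\<in>P. N p (\<pi> {p} k) (\<pi> {p} y))" unfolding N_def by (rule sum_components)
   finally show ?thesis .
  qed
  have off: "(\<Prod>p\<in>P. N p (\<pi> {p} k) (\<pi> {p} y)) = 0" if k: "k \<in> K" "k \<notin> K1" for k
  proof -
   obtain p where p: "p \<in> P" "k \<ominus> \<one> \<notin> mul p" using k by (auto simp: K1_def)
   note kc = K_carrier[OF k(1)]
   have "\<pi> {p} k \<ominus>\<^bsub>corner {p}\<^esub> \<epsilon> {p} = \<pi> {p} (k \<ominus> \<one>)"
    using corner_minus[OF comp_proj[OF kc] \<epsilon>_in_comp] \<epsilon>_minus_dist[OF kc one_closed] by simp
   then have "\<pi> {p} k \<ominus>\<^bsub>corner {p}\<^esub> \<epsilon> {p} \<notin> mul p" using mul_iff[OF P_prime[OF p(1)], of "k \<ominus> \<one>"] p(2) kc by simp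
   moreover have "\<pi> {p} k \<in> Units (corner {p})" using K_Units[OF k(1)] by (simp add: corner_Units)
   ultimately have "N p (\<pi> {p} k) (\<pi> {p} y) = 0" unfolding N_def using \<alpha>[OF p(1)] yY[OF p(1)] by blast
   then show ?thesis using p(1) by (intro prod_zero) auto
  qed
  have K1: "K1 \<subseteq> K" by (auto simp: K1_def)
  have finLp: "finite (Lp p)" for p using K_finite by (simp add: Lp_def)
  have "(\<Sum>k\<in>K. \<Sum>w\<in>carrier R. A (y \<ominus> w \<otimes> k) w) = (\<Sum>k\<in>K. \<Prod>p\<in>P. N p (\<pi> {p} k) (\<pi> {p} y))"
   using step K_carrier by (intro sum.cong) auto
  also have "\<dots> = (\<Sum>k\<in>K1. \<Prod>p\<in>P. N p (\<pi> {p} k) (\<pi> {p} y))"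
   by (rule sum.mono_neutral_right) (use K1 K_finite off in auto)
  also have "\<dots> = (\<Sum>k\<in>K1. \<Prod>p\<in>P. N p ((\<lambda>p\<in>P. \<pi> {p} k) p) (\<pi> {p} y))" by simp
  also have "\<dots> = (\<Sum>l\<in>(\<Pi>\<^sub>E p\<in>P. Lp p). \<Prod>p\<in>P. N p (l p) (\<pi> {p} y))"
   by (rule sum.reindex_bij_betw[OF K1_bij])
  also have "\<dots> = (\<Prod>p\<in>P. \<Sum>l\<in>Lp p. N p l (\<pi> {p} y))"
   by (rule prod_sum_PiE[symmetric]) (use finLp in auto)
  also have "\<dots> = (\<Prod>p\<in>P. of_bool (\<pi> {p} y = \<pi> {p} z))"
   unfolding N_def using \<alpha> yY by (intro prod.cong) auto
  also have "\<dots> = of_bool (y = z)" using eqI_primes[OF y(1) z] by auto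
  finally show "(\<Sum>k\<in>K. \<Sum>w\<in>carrier R. A (y \<ominus> w \<otimes> k) w) = of_bool (y = z)" .
 qed
qed

text \<open>The dual of \<open>separate\<close>: g z is a combination of the sums of g over the sets
  v + w K with units v and w. The support condition confines g to the elements among which the
  weights isolate z.\<close>

lemma vanishing:
 fixes g :: "'a \<Rightarrow> real"
 assumes z: "z \<in> carrier R"
  and supp: "\<And>y p. y \<in> carrier R ==> g y \<noteq> 0 ==> p \<in> P ==> y \<in> mul p \<longleftrightarrow> z \<in> mul p"
  and null: "\<And>v w. v \<in> Units R ==> w \<in> Units R ==> (\<Sum>k\<in>K. g (v \<oplus> w \<otimes> k)) = 0"
 shows "g z = 0"
proof -
 obtain A :: "'a \<Rightarrow> 'a \<Rightarrow> real" where A: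
  "\<And>v w. v \<in> carrier R ==> w \<in> carrier R ==> A v w \<noteq> 0 ==> v \<in> Units R \<and> w \<in> Units R"
  "\<And>y. y \<in> carrier R ==> (\<And>p. p \<in> P ==> y \<in> mul p \<longleftrightarrow> z \<in> mul p) ==>
   (\<Sum>k\<in>K. \<Sum>w\<in>carrier R. A (y \<ominus> w \<otimes> k) w) = of_bool (y = z)" using separate[OF z] by blast
 have "g z = (\<Sum>y\<in>carrier R. g y * of_bool (y = z))" using z by (simp add: of_bool_def if_distrib cong: if_cong)
 also have "\<dots> = (\<Sum>y\<in>carrier R. g y * (\<Sum>k\<in>K. \<Sum>w\<in>carrier R. A (y \<ominus> w \<otimes> k) w))"
 proof (rule sum.cong[OF refl])
  fix y assume y: "y \<in> carrier R"
  show "g y * of_bool (y = z) = g y * (\<Sum>k\<in>K. \<Sum>w\<in>carrier R. A (y \<ominus> w \<otimes> k) w)"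
   using A(2)[OF y] supp[OF y] by (cases "g y = 0") auto
 qed
 also have "\<dots> = (\<Sum>k\<in>K. \<Sum>w\<in>carrier R. \<Sum>y\<in>carrier R. g y * A (y \<ominus> w \<otimes> k) w)"
  unfolding sum_distrib_left by (subst sum.swap) (intro sum.cong refl sum.swap)
 also have "\<dots> = (\<Sum>k\<in>K. \<Sum>w\<in>carrier R. \<Sum>v\<in>carrier R. g (v \<oplus> w \<otimes> k) * A v w)"
 proof (rule sum.cong[OF refl], rule sum.cong[OF refl])
  fix k w assume "k \<in> K" and w: "w \<in> carrier R"
  then have k: "k \<in> carrier R" using K_carrier by blast
  show "(\<Sum>y\<in>carrier R. g y * A (y \<ominus> w \<otimes> k) w) = (\<Sum>v\<in>carrier R. g (v \<oplus> w \<otimes> k) * A v w)"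
   by (rule sum.reindex_bij_witness[of _ "\<lambda>v. v \<oplus> w \<otimes> k" "\<lambda>y. y \<ominus> w \<otimes> k"])
    (use w k in \<open>auto simp: a_minus_def a_assoc l_neg r_neg\<close>)
 qed
 also have "\<dots> = (\<Sum>w\<in>carrier R. \<Sum>k\<in>K. \<Sum>v\<in>carrier R. g (v \<oplus> w \<otimes> k) * A v w)" by (rule sum.swap)
 also have "\<dots> = (\<Sum>w\<in>carrier R. \<Sum>v\<in>carrier R. \<Sum>k\<in>K. g (v \<oplus> w \<otimes> k) * A v w)"
  by (rule sum.cong[OF refl]) (rule sum.swap)
 also have "\<dots> = (\<Sum>w\<in>carrier R. \<Sum>v\<in>carrier R. A v w * (\<Sum>k\<in>K. g (v \<oplus> w \<otimes> k)))"
  by (simp only: sum_distrib_left mult.commute)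
 also have "\<dots> = 0"
 proof (intro sum.neutral ballI)
  fix w v assume "w \<in> carrier R" "v \<in> carrier R"
  then show "A v w * (\<Sum>k\<in>K. g (v \<oplus> w \<otimes> k)) = 0" using A(1)[of v w] null[of v w] by (cases "A v w = 0") auto
 qed
 finally show ?thesis .
qed

lemma orbit_sum: "w \<in> Units R ==> (\<Sum>k\<in>K. f (w \<otimes> k)) = (\<Sum>a\<in>cls w. f a)"
proof -
 assume w: "w \<in> Units R"
 have "inj_on (\<lambda>k. w \<otimes> k) K" by (rule inj_onI) (use w K_carrier in simp)
 then show ?thesis unfolding cls_unit[OF w] by (simp add: sum.reindex)
qed

lemma shift_count:
 assumes X: "aset X" and Z: "aset Z" and v: "v \<in> carrier R" "v' \<in> cls v"
 shows "hits X v' Z = hits X v Z"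
proof -
 have *: "hits X x Z = card {a \<in> (\<lambda>x. \<ominus> x) ` X. x \<ominus> a \<in> Z}" if x: "x \<in> carrier R" for x
 proof -
  have "bij_betw (\<lambda>a. \<ominus> a) {a \<in> X. x \<oplus> a \<in> Z} {a \<in> (\<lambda>x. \<ominus> x) ` X. x \<ominus> a \<in> Z}"
   by (rule bij_betw_byWitness[of _ "\<lambda>a. \<ominus> a"]) (use aset_in[OF X] in \<open>auto simp: a_minus_def\<close>)
  then show ?thesis by (rule bij_betw_same_card)
 qed
 show ?thesis using *[OF v(1)] *[OF cls_in[OF v]] card_conv[OF aset_neg[OF X] Z v] by simp
qed

text \<open>\<open>vanishing\<close> is applied to the difference of the indicators of Z =
  \<open>cls z\<close> and of l Z. The count for l Z at v equals the count for Z at v divided by l,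
  since \<open>cls w\<close> is stable under K; and v divided by l lies in the basic set of the unit
  v.\<close>

lemma K_invariant:
 assumes z: "z \<in> carrier R" and l: "l \<in> K"
 shows "l \<otimes> z \<in> cls z"
proof -
 note lU = K_Units[OF l]
 let ?Z = "cls z" and ?Z' = "cls (l \<otimes> z)"
 have lz: "l \<otimes> z \<in> carrier R" using z lU by (simp add: Units_closed)
 have mul_l: "l \<otimes> x \<in> ?Z' \<longleftrightarrow> x \<in> ?Z" if "x \<in> carrier R" for x
  unfolding cls_mult[OF lU z] using that lU cls_in[OF z] by (auto simp: image_iff)
 have "of_bool (z \<in> ?Z) - of_bool (z \<in> ?Z') = (0::real)"
 proof (rule vanishing[where g = "\<lambda>y. of_bool (y \<in> ?Z) - of_bool (y \<in> ?Z')", OF z])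
  fix y p assume y: "y \<in> carrier R" "of_bool (y \<in> ?Z) - of_bool (y \<in> ?Z') \<noteq> (0::real)" and p: "p \<in> P"
  have "l \<otimes> z \<in> mul p \<longleftrightarrow> z \<in> mul p"
  proof
   assume "l \<otimes> z \<in> mul p"
   then have "inv l \<otimes> (l \<otimes> z) \<in> mul p" using ideal_mult[OF mul_ideal] lU by blast
   then show "z \<in> mul p" using lU z by simp
  qed (use ideal_mult[OF mul_ideal] lU Units_closed in blast)
  moreover have "y \<in> ?Z \<or> y \<in> ?Z'" using y(2) by (auto split: if_splits simp: of_bool_def)
  ultimately show "y \<in> mul p \<longleftrightarrow> z \<in> mul p" using cls_pattern[OF z _ p] cls_pattern[OF lz _ p] by blast
 next
  fix v w assume v: "v \<in> Units R" and w: "w \<in> Units R"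
  note vc = Units_closed[OF v] and wc = Units_closed[OF w]
  have fX: "finite (cls w)" using aset_finite[OF aset_cls[OF wc]] .
  have "hits (cls w) v ?Z' = hits (cls w) (inv l \<otimes> v) ?Z"
  proof (rule bij_betw_same_card[OF bij_betw_byWitness[of _ "\<lambda>a. l \<otimes> a" "\<lambda>a. inv l \<otimes> a"]])
   have cw: "k \<otimes> a \<in> cls w" if ka: "k \<in> K" "a \<in> cls w" for k a
   proof -
    obtain m where m: "m \<in> K" "a = w \<otimes> m" using ka(2) cls_unit[OF w] by blast
    have "k \<otimes> a = w \<otimes> (k \<otimes> m)" using m ka K_carrier wc by (simp add: m_lcomm)
    then show ?thesis using cls_unit[OF w] K_mult ka m by blast
   qed
   have tr: "inv l \<otimes> v \<oplus> inv l \<otimes> a \<in> ?Z \<longleftrightarrow> v \<oplus> a \<in> ?Z'" if "a \<in> carrier R" for a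
    using mul_l[of "inv l \<otimes> (v \<oplus> a)"] lU vc that by (simp add: r_distr[symmetric])
   show "(\<lambda>a. inv l \<otimes> a) ` {a \<in> cls w. v \<oplus> a \<in> ?Z'} \<subseteq> {a \<in> cls w. inv l \<otimes> v \<oplus> a \<in> ?Z}"
    using tr cls_in[OF wc] cw[OF K_inv[OF l]] by auto
   show "(\<lambda>a. l \<otimes> a) ` {a \<in> cls w. inv l \<otimes> v \<oplus> a \<in> ?Z} \<subseteq> {a \<in> cls w. v \<oplus> a \<in> ?Z'}"
   proof (rule image_subsetI)
    fix a assume a: "a \<in> {a \<in> cls w. inv l \<otimes> v \<oplus> a \<in> ?Z}"
    then have ac: "a \<in> carrier R" using cls_in[OF wc] by blast
    have "v \<oplus> l \<otimes> a \<in> ?Z'" using tr[of "l \<otimes> a"] a ac lU by (simp add: Units_closed)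
    then show "l \<otimes> a \<in> {a \<in> cls w. v \<oplus> a \<in> ?Z'}" using cw[OF l] a by simp
   qed
  qed (use lU cls_in[OF wc] in auto)
  also have "\<dots> = hits (cls w) v ?Z"
  proof (rule shift_count[OF aset_cls[OF wc] aset_cls[OF z] vc])
   show "inv l \<otimes> v \<in> cls v" unfolding cls_unit[OF v] using K_inv[OF l] vc lU by (intro image_eqI[of _ _ "inv l"]) (simp_all add: m_comm)
  qed
  finally have e: "hits (cls w) v ?Z' = hits (cls w) v ?Z" .
  have "(\<Sum>k\<in>K. of_bool (v \<oplus> w \<otimes> k \<in> ?Z) - of_bool (v \<oplus> w \<otimes> k \<in> ?Z')) =
    (\<Sum>a\<in>cls w. of_bool (v \<oplus> a \<in> ?Z) - (of_bool (v \<oplus> a \<in> ?Z') :: real))"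
   by (rule orbit_sum[OF w, of "\<lambda>a. of_bool (v \<oplus> a \<in> ?Z) - of_bool (v \<oplus> a \<in> ?Z')"])
  also have "\<dots> = real (hits (cls w) v ?Z) - real (hits (cls w) v ?Z')"
   using fX by (simp add: sum_subtractf Int_def)
  finally show "(\<Sum>k\<in>K. of_bool (v \<oplus> w \<otimes> k \<in> ?Z) - of_bool (v \<oplus> w \<otimes> k \<in> ?Z')) = (0::real)" using e by simp
 qed
 then have "z \<in> ?Z'" using cls_self[OF z] by (auto split: if_splits simp: of_bool_def)
 then show ?thesis using cls_eq[OF lz] cls_self[OF lz] by blast
qed

text \<open>\<open>vanishing\<close> is applied to the number of k with k x = z minus the number of
  k with k x = y. Its sum over v + w K is a difference of coefficients, at z and at y, of the
  product belonging to \<open>cls v\<close> and \<open>cls w\<close>, hence zero. At x = z the first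
  number is positive, so the second is too.\<close>

lemma K_transitive:
 assumes z: "z \<in> carrier R" and y: "y \<in> cls z"
 shows "\<exists>k\<in>K. y = k \<otimes> z"
proof -
 note yc = cls_in[OF z y]
 let ?g = "\<lambda>x. \<Sum>k\<in>K. of_bool (k \<otimes> x = z) - (of_bool (k \<otimes> x = y) :: real)"
 have "?g z = 0"
 proof (rule vanishing[where g = ?g, OF z])
  fix x p assume x: "x \<in> carrier R" "?g x \<noteq> 0" and p: "p \<in> P"
  obtain k where k: "k \<in> K" "of_bool (k \<otimes> x = z) - (of_bool (k \<otimes> x = y) :: real) \<noteq> 0"
   using x(2) by (meson sum.neutral)
  then have "k \<otimes> x = z \<or> k \<otimes> x = y" by (auto split: if_splits simp: of_bool_def)
  moreover have "k \<otimes> x \<in> mul p \<longleftrightarrow> x \<in> mul p" using cls_pattern[OF x(1) K_invariant[OF x(1) k(1)] p] .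
  ultimately show "x \<in> mul p \<longleftrightarrow> z \<in> mul p" using cls_pattern[OF z y p] by auto
 next
  fix v w assume v: "v \<in> Units R" and w: "w \<in> Units R"
  note vc = Units_closed[OF v] and wc = Units_closed[OF w]
  have fin': "finite (cls v)" "finite (cls w)" using aset_finite aset_cls vc wc by blast+
  have count: "(\<Sum>l\<in>K. \<Sum>k\<in>K. of_bool (k \<otimes> (v \<oplus> w \<otimes> l) = s)) = real (card {a \<in> cls v. s \<ominus> a \<in> cls w})"
   if s: "s \<in> carrier R" for s
  proof -
   have "(\<Sum>l\<in>K. \<Sum>k\<in>K. of_bool (k \<otimes> (v \<oplus> w \<otimes> l) = s)) = (\<Sum>k\<in>K. \<Sum>l\<in>K. of_bool (k \<otimes> (v \<oplus> w \<otimes> l) = s) :: real)"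
    by (rule sum.swap)
   also have "\<dots> = (\<Sum>k\<in>K. \<Sum>l\<in>K. of_bool (v \<otimes> k \<oplus> w \<otimes> l = s))"
   proof (rule sum.cong[OF refl])
    fix k assume k: "k \<in> K"
    show "(\<Sum>l\<in>K. of_bool (k \<otimes> (v \<oplus> w \<otimes> l) = s)) = (\<Sum>l\<in>K. of_bool (v \<otimes> k \<oplus> w \<otimes> l = s) :: real)"
    proof (rule sum.reindex_bij_witness[of _ "\<lambda>l. inv k \<otimes> l" "\<lambda>l. k \<otimes> l"])
     fix l assume l: "l \<in> K"
     show "inv k \<otimes> (k \<otimes> l) = l" "k \<otimes> (inv k \<otimes> l) = l" "k \<otimes> l \<in> K" "inv k \<otimes> l \<in> K"
      using K_Units[OF k] K_carrier[OF l] K_mult K_inv k l by simp_all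
     have "k \<otimes> (v \<oplus> w \<otimes> l) = v \<otimes> k \<oplus> w \<otimes> (k \<otimes> l)"
      using K_carrier[OF k] K_carrier[OF l] vc wc by algebra
     then show "of_bool (v \<otimes> k \<oplus> w \<otimes> (k \<otimes> l) = s) = (of_bool (k \<otimes> (v \<oplus> w \<otimes> l) = s) :: real)" by simp
    qed
   qed
   also have "\<dots> = (\<Sum>k\<in>K. \<Sum>b\<in>cls w. of_bool (v \<otimes> k \<oplus> b = s))"
    by (rule sum.cong[OF refl]) (rule orbit_sum[OF w])
   also have "\<dots> = (\<Sum>a\<in>cls v. \<Sum>b\<in>cls w. of_bool (a \<oplus> b = s))"
    by (rule orbit_sum[OF v, of "\<lambda>a. \<Sum>b\<in>cls w. of_bool (a \<oplus> b = s)"])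
   also have "\<dots> = (\<Sum>a\<in>cls v. of_bool (s \<ominus> a \<in> cls w))"
   proof (rule sum.cong[OF refl])
    fix a assume "a \<in> cls v"
    then have a: "a \<in> carrier R" using cls_in[OF vc] by blast
    have "a \<oplus> b = s \<longleftrightarrow> b = s \<ominus> a" if "b \<in> carrier R" for b
     using add_minus[OF a s] add_minus_cancel[OF a that] by auto
    then have "(\<Sum>b\<in>cls w. of_bool (a \<oplus> b = s)) = (\<Sum>b\<in>cls w. of_bool (b = s \<ominus> a) :: real)"
     using cls_in[OF wc] by (intro sum.cong) auto
    also have "\<dots> = of_bool (s \<ominus> a \<in> cls w)" using fin'(2) by simp
    finally show "(\<Sum>b\<in>cls w. of_bool (a \<oplus> b = s)) = (of_bool (s \<ominus> a \<in> cls w) :: real)" .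
   qed
   also have "\<dots> = real (card {a \<in> cls v. s \<ominus> a \<in> cls w})" using fin'(1) by (simp add: Int_def)
   finally show ?thesis .
  qed
  have "(\<Sum>l\<in>K. ?g (v \<oplus> w \<otimes> l)) = real (card {a \<in> cls v. z \<ominus> a \<in> cls w}) - real (card {a \<in> cls v. y \<ominus> a \<in> cls w})"
   unfolding count[OF z, symmetric] count[OF yc, symmetric] by (simp add: sum_subtractf)
  also have "\<dots> = 0" using card_conv[OF aset_cls[OF vc] aset_cls[OF wc] z y] by simp
  finally show "(\<Sum>l\<in>K. ?g (v \<oplus> w \<otimes> l)) = 0" .
 qed
 then have "(\<Sum>k\<in>K. of_bool (k \<otimes> z = z)) = (\<Sum>k\<in>K. of_bool (k \<otimes> z = y) :: real)" by (simp add: sum_subtractf)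
 moreover have "(\<Sum>k\<in>K. of_bool (k \<otimes> z = z) :: real) \<ge> of_bool (\<one> \<otimes> z = z)"
  by (rule member_le_sum[OF K_one]) (use K_finite in auto)
 ultimately have "(\<Sum>k\<in>K. of_bool (k \<otimes> z = y) :: real) \<noteq> 0" using z by simp
 then obtain k where "k \<in> K" "of_bool (k \<otimes> z = y) \<noteq> (0::real)" by (meson sum.neutral)
 then show ?thesis by (auto split: if_splits simp: of_bool_def)
qed

theorem cls_orbit: "x \<in> carrier R ==> cls x = (\<lambda>k. k \<otimes> x) ` K" using K_invariant K_transitive by blast

end

section \<open>S-rings and their class functions\<close>

lemma int_span_iff:
 assumes fin: "finite \<X>" and dis: "disjoint \<X>" and ne: "{} \<notin> \<X>"
 shows "a \<in> int_span (simple_quantity ` \<X>) \<longleftrightarrow>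
  (\<forall>x. x \<notin> \<Union>\<X> \<longrightarrow> a x = 0) \<and> (\<forall>X\<in>\<X>. \<forall>x\<in>X. \<forall>y\<in>X. a x = a y)"
proof
 assume "a \<in> int_span (simple_quantity ` \<X>)"
 then obtain c where c: "a = int_comb (simple_quantity ` \<X>) c" by (auto simp: int_span_def)
 have const: "simple_quantity Y x = (simple_quantity Y y :: int)" if "X \<in> \<X>" "x \<in> X" "y \<in> X" "Y \<in> \<X>" for X Y x y
  using that dis by (cases "X = Y") (auto simp: disjoint_def indicator_def)
 show "(\<forall>x. x \<notin> \<Union>\<X> \<longrightarrow> a x = 0) \<and> (\<forall>X\<in>\<X>. \<forall>x\<in>X. \<forall>y\<in>X. a x = a y)" unfolding c int_comb_def
 proof (intro conjI allI impI ballI)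
  fix x assume "x \<notin> \<Union>\<X>"
  then show "(\<Sum>b\<in>simple_quantity ` \<X>. c b * b x) = 0" by (intro sum.neutral) auto
 next
  fix X x y assume X: "X \<in> \<X>" "x \<in> X" "y \<in> X"
  show "(\<Sum>b\<in>simple_quantity ` \<X>. c b * b x) = (\<Sum>b\<in>simple_quantity ` \<X>. c b * b y)"
  proof (rule sum.cong[OF refl])
   fix b :: "'a \<Rightarrow> int" assume "b \<in> simple_quantity ` \<X>"
   then obtain Y where "Y \<in> \<X>" "b = simple_quantity Y" by blast
   then show "c b * b x = c b * b y" using const[OF X, of Y] by simp
  qed
 qed
next
 assume a: "(\<forall>x. x \<notin> \<Union>\<X> \<longrightarrow> a x = 0) \<and> (\<forall>X\<in>\<X>. \<forall>x\<in>X. \<forall>y\<in>X. a x = a y)"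
 have inj: "inj_on (simple_quantity :: 'a set \<Rightarrow> 'a \<Rightarrow> int) \<X>"
  by (rule inj_onI) (metis indicator_eq_1_iff subsetI subset_antisym)
 define r where "r X = (SOME x. x \<in> X)" for X :: "'a set"
 have r: "r X \<in> X" if "X \<in> \<X>" for X using that ne some_in_eq[of X] by (auto simp: r_def)
 define c where "c b = a (r (the_inv_into \<X> simple_quantity b))" for b :: "'a \<Rightarrow> int"
 have "a = int_comb (simple_quantity ` \<X>) c"
 proof
  fix x
  have "int_comb (simple_quantity ` \<X>) c x = (\<Sum>X\<in>\<X>. a (r X) * simple_quantity X x)"
   unfolding int_comb_def by (subst sum.reindex[OF inj]) (simp add: c_def the_inv_into_f_f[OF inj])
  also have "\<dots> = a x"
  proof (cases "x \<in> \<Union>\<X>")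
   case True
   then obtain X where X: "X \<in> \<X>" "x \<in> X" by blast
   have "(\<Sum>Y\<in>\<X>. a (r Y) * simple_quantity Y x) = (\<Sum>Y\<in>\<X>. if Y = X then a (r X) else 0)"
    using X dis by (intro sum.cong) (auto simp: disjoint_def indicator_def)
   also have "\<dots> = a (r X)" using X fin by simp
   also have "\<dots> = a x" using a X r by blast
   finally show ?thesis .
  next
   case False
   then show ?thesis using a by (auto intro!: sum.neutral)
  qed
  finally show "a x = int_comb (simple_quantity ` \<X>) c x" ..
 qed
 then show "a \<in> int_span (simple_quantity ` \<X>)" by (simp only: int_span_def rangeI)
qed

lemma int_span_extensional: "int_span B = int_comb B ` (B \<rightarrow>\<^sub>E UNIV)"
proof -
 have e: "int_comb B c = int_comb B (restrict c B)" for c :: "('a \<Rightarrow> int) \<Rightarrow> int"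
  by (simp add: int_comb_def)
 have "int_comb B c \<in> int_comb B ` (B \<rightarrow>\<^sub>E UNIV)" for c
  by (subst e) (intro imageI restrict_extensional PiE_I, auto)
 then show ?thesis unfolding int_span_def by auto
qed

lemma int_basis_span: "int_basis B A ==> A = int_span B"
 by (simp add: int_basis_def bij_betw_def int_span_extensional)

lemma int_basis_disjoint:
 assumes fin: "finite \<X>" and dis: "disjoint \<X>" and ne: "{} \<notin> \<X>"
 shows "int_basis (simple_quantity ` \<X>) (int_span (simple_quantity ` \<X>))"
proof -
 let ?B = "(simple_quantity :: 'a set \<Rightarrow> 'a \<Rightarrow> int) ` \<X>"
 have val: "int_comb ?B c x = c (simple_quantity X)" if X: "X \<in> \<X>" "x \<in> X" for c X x
 proof -
  have "int_comb ?B c x = (\<Sum>b\<in>?B. if b = simple_quantity X then c (simple_quantity X) else 0)"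
   unfolding int_comb_def
  proof (rule sum.cong[OF refl])
   fix b assume "b \<in> ?B"
   then obtain Y where Y: "Y \<in> \<X>" "b = simple_quantity Y" by blast
   show "c b * b x = (if b = simple_quantity X then c (simple_quantity X) else 0)"
   proof (cases "Y = X")
    case True
    then show ?thesis using X Y by simp
   next
    case False
    then have "simple_quantity Y x = (0 :: int)" using X Y dis by (auto simp: disjoint_def indicator_def)
    then show ?thesis using X Y by (auto dest: fun_cong[of _ _ x])
   qed
  qed
  then show ?thesis using X fin by simp
 qed
 have "inj_on (int_comb ?B) (?B \<rightarrow>\<^sub>E UNIV)"
 proof (rule inj_onI)
  fix c d assume c: "c \<in> ?B \<rightarrow>\<^sub>E UNIV" "d \<in> ?B \<rightarrow>\<^sub>E UNIV" "int_comb ?B c = int_comb ?B d"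
  show "c = d"
  proof (rule PiE_ext[OF c(1,2)])
   fix b assume "b \<in> ?B"
   then obtain X where X: "X \<in> \<X>" "b = simple_quantity X" by blast
   obtain x where "x \<in> X" using X(1) ne by (metis ex_in_conv)
   then show "c b = d b" using val[OF X(1)] X(2) c(3) by metis
  qed
 qed
 then show ?thesis using fin by (simp add: int_basis_def bij_betw_def int_span_extensional)
qed

text \<open>The factor r builds closure under multiplication into the right-hand side, so that it is
  an ideal and the greatest element in the definition is attained.\<close>

lemma (in cring) I_L_eq:
 assumes X: "X \<subseteq> carrier R"
 shows "I_L R X = {t \<in> carrier R. \<forall>r\<in>carrier R. \<forall>x\<in>X. x \<oplus> r \<otimes> t \<in> X}" (is "_ = ?I")
 unfolding I_L_def
proof (rule Greatest_equality)
 have "ideal ?I R"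
 proof (rule idealI')
  fix t s assume ts: "t \<in> ?I" "s \<in> ?I"
  have "x \<oplus> r \<otimes> (t \<oplus> s) \<in> X" if "r \<in> carrier R" "x \<in> X" for r x
  proof -
   have "x \<oplus> r \<otimes> (t \<oplus> s) = (x \<oplus> r \<otimes> t) \<oplus> r \<otimes> s" using that ts X by (auto simp: r_distr a_assoc)
   then show ?thesis using ts that by simp
  qed
  then show "t \<oplus> s \<in> ?I" using ts by simp
 next
  fix r t assume r: "r \<in> carrier R" and t: "t \<in> ?I"
  then show "r \<otimes> t \<in> ?I" by (auto simp flip: m_assoc)
 qed (use X in auto)
 moreover have "X <+>\<^bsub>R\<^esub> ?I = X"
 proof (intro equalityI subsetI)
  fix y assume "y \<in> X <+>\<^bsub>R\<^esub> ?I"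
  then obtain x t where "x \<in> X" "t \<in> ?I" "y = x \<oplus> t" by (auto simp: set_add_def')
  then have t: "t \<in> carrier R" "\<forall>r\<in>carrier R. \<forall>x\<in>X. x \<oplus> r \<otimes> t \<in> X" "x \<in> X" "y = x \<oplus> t" by auto
  show "y \<in> X" using bspec[OF bspec[OF t(2) one_closed] t(3)] t(1,4) by simp
 next
  fix x assume x: "x \<in> X"
  have "\<zero> \<in> ?I" using X by auto
  then have "x \<oplus> \<zero> \<in> X <+>\<^bsub>R\<^esub> ?I" by (rule set_addI[OF x])
  then show "x \<in> X <+>\<^bsub>R\<^esub> ?I" using x X by auto
 qed
 ultimately show "ideal ?I R \<and> X <+>\<^bsub>R\<^esub> ?I = X" ..
next
 fix J assume J: "ideal J R \<and> X <+>\<^bsub>R\<^esub> J = X"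
 show "J \<subseteq> ?I"
 proof
  fix t assume t: "t \<in> J"
  have "x \<oplus> r \<otimes> t \<in> X" if "r \<in> carrier R" "x \<in> X" for r x
   using set_addI[OF that(2) ideal_mult[OF _ t that(1)], of R] J by simp
  then show "t \<in> ?I" using ideal_in[of J t] J t by blast
 qed
qed

context cg_sring
begin

definition class_fun :: "('a \<Rightarrow> int) set"
 where "class_fun = {a. (\<forall>x. x \<notin> carrier R \<longrightarrow> a x = 0) \<and> (\<forall>x\<in>carrier R. \<forall>y\<in>cls x. a y = a x)}"

lemma classes_partition: "partition_on (carrier R) (cls ` carrier R)"
proof (rule partition_onI)
 show "\<Union>(cls ` carrier R) = carrier R" using cls_self cls_in by blast
 show "{} \<notin> cls ` carrier R" using cls_self by fastforce
 fix X Y assume a: "X \<in> cls ` carrier R" "Y \<in> cls ` carrier R" "X \<noteq> Y"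
 obtain x y where xy: "x \<in> carrier R" "X = cls x" "y \<in> carrier R" "Y = cls y" using a by blast
 have "X = Y" if "z \<in> X" "z \<in> Y" for z using cls_eq[OF xy(1), of z] cls_eq[OF xy(3), of z] xy that by simp
 then show "disjnt X Y" using a(3) by (auto simp: disjnt_def)
qed

lemma class_fun_span: "class_fun = int_span (simple_quantity ` cls ` carrier R)"
proof -
 have u: "\<Union>(cls ` carrier R) = carrier R" using classes_partition by (simp add: partition_on_def)
 have d: "disjoint (cls ` carrier R)" "{} \<notin> cls ` carrier R"
  using classes_partition by (auto simp: partition_on_def)
 have "a \<in> class_fun \<longleftrightarrow> a \<in> int_span (simple_quantity ` cls ` carrier R)" for a
 proof -
  have "(\<forall>X\<in>cls ` carrier R. \<forall>x\<in>X. \<forall>y\<in>X. a x = a y) \<longleftrightarrow> (\<forall>x\<in>carrier R. \<forall>y\<in>cls x. a y = a x)"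
  proof (intro iffI ballI)
   fix X x y assume h: "\<forall>x\<in>carrier R. \<forall>y\<in>cls x. a y = a x" "X \<in> cls ` carrier R" "x \<in> X" "y \<in> X"
   then obtain z where "z \<in> carrier R" "X = cls z" by blast
   then show "a x = a y" using h by metis
  next
   fix x y assume "\<forall>X\<in>cls ` carrier R. \<forall>x\<in>X. \<forall>y\<in>X. a x = a y" "x \<in> carrier R" "y \<in> cls x"
   then show "a y = a x" using cls_self by blast
  qed
  then show ?thesis using int_span_iff[OF _ d, of a] fin unfolding class_fun_def u by auto
 qed
 then show ?thesis by blast
qed

lemma class_fun_S_partition: "S_ring_partition (add_monoid R) class_fun (cls ` carrier R)"
 unfolding S_ring_partition_def
proof (intro conjI ballI)
 show "partition_on (carrier (add_monoid R)) (cls ` carrier R)" using classes_partition by simp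
 show "int_basis (simple_quantity ` cls ` carrier R) class_fun"
  unfolding class_fun_span by (rule int_basis_disjoint)
   (use classes_partition fin in \<open>auto simp: partition_on_def\<close>)
 show "{\<one>\<^bsub>add_monoid R\<^esub>} \<in> cls ` carrier R" using cls_zero by (auto intro!: image_eqI[of _ _ \<zero>])
 fix X assume "X \<in> cls ` carrier R"
 then obtain x where x: "x \<in> carrier R" "X = cls x" by blast
 have "set_inv\<^bsub>add_monoid R\<^esub> X = (\<lambda>y. \<ominus> y) ` X" by (auto simp: SET_INV_def a_inv_def)
 then show "set_inv\<^bsub>add_monoid R\<^esub> X \<in> cls ` carrier R" using cls_neg[OF x(1)] x
  by (metis a_inv_closed imageI)
qed

lemma class_fun_basic: "basic_sets (add_monoid R) class_fun = cls ` carrier R"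
 by (rule basic_sets_eq[OF class_fun_S_partition])

lemma group_ring_mult:
 "x \<in> carrier R ==> (a \<otimes>\<^bsub>group_ring (add_monoid R)\<^esub> b) x = (\<Sum>y\<in>carrier R. a y * b (x \<ominus> y))"
proof -
 assume x: "x \<in> carrier R"
 have "inv\<^bsub>add_monoid R\<^esub> y \<oplus> x = x \<ominus> y" if "y \<in> carrier R" for y
  using that x by (simp add: a_minus_def a_comm flip: a_inv_def)
 then show ?thesis using x by (simp add: group_ring_def)
qed

lemma class_fun_subring: "subring class_fun (group_ring (add_monoid R))" (is "subring _ ?G")
proof -
 have sub: "class_fun \<subseteq> carrier ?G" by (auto simp: class_fun_def group_ring_def)
 have add: "a \<oplus>\<^bsub>?G\<^esub> b \<in> class_fun" if "a \<in> class_fun" "b \<in> class_fun" for a b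
  using that by (auto simp: class_fun_def group_ring_def)
 have zero: "\<zero>\<^bsub>?G\<^esub> \<in> class_fun" by (auto simp: class_fun_def group_ring_def)
 have neg: "inv\<^bsub>add_monoid ?G\<^esub> a \<in> class_fun" if a: "a \<in> class_fun" for a
 proof -
  have "inv\<^bsub>add_monoid ?G\<^esub> a = (\<lambda>x. - a x)" unfolding m_inv_def
   by (rule the_equality) (use a in \<open>auto simp: class_fun_def group_ring_def fun_eq_iff eq_neg_iff_add_eq_0\<close>)
  then show ?thesis using a by (auto simp: class_fun_def)
 qed
 have mult: "a \<otimes>\<^bsub>?G\<^esub> b \<in> class_fun" if ab: "a \<in> class_fun" "b \<in> class_fun" for a b
 proof -
  have "(a \<otimes>\<^bsub>?G\<^esub> b) y = (a \<otimes>\<^bsub>?G\<^esub> b) x" if x: "x \<in> carrier R" "y \<in> cls x" for x y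
   unfolding group_ring_mult[OF x(1)] group_ring_mult[OF cls_in[OF x]]
   by (rule cls_conv[OF _ _ x]) (use ab in \<open>auto simp: class_fun_def\<close>)
  then show ?thesis by (auto simp: class_fun_def) (simp add: group_ring_def)
 qed
 have "y = \<zero> \<longleftrightarrow> x = \<zero>" if "x \<in> carrier R" "y \<in> cls x" for x y
  using that cls_zero cls_eq[of x y] cls_self by (metis cls_in singletonD)
 then have one: "\<one>\<^bsub>?G\<^esub> \<in> class_fun" by (auto simp: class_fun_def group_ring_def indicator_def)
 show ?thesis
  by (intro subring.intro subgroup.intro submonoid.intro) (use sub add zero neg mult one in auto)
qed

lemma class_fun_S_ring: "S_ring_over_ring R class_fun"
 unfolding S_ring_over_ring_def S_ring_def class_fun_basic
proof (intro conjI ballI)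
 show "group (add_monoid R)" by (rule add.is_group)
 show "\<exists>S. S_ring_partition (add_monoid R) class_fun S" using class_fun_S_partition by blast
 show "subring class_fun (group_ring (add_monoid R))" by (rule class_fun_subring)
 fix X u assume "X \<in> cls ` carrier R" and u: "u \<in> Units R"
 then obtain x where "x \<in> carrier R" "X = cls x" by blast
 then have "(\<lambda>x. u \<otimes> x) ` X = cls (u \<otimes> x)" "u \<otimes> x \<in> carrier R"
  using cls_mult[OF u] u by (auto simp: Units_closed)
 then show "(\<lambda>x. u \<otimes> x) ` X \<in> cls ` carrier R" by blast
qed simp

end

definition basic_set_of :: "'g set set \<Rightarrow> 'g \<Rightarrow> 'g set"
 where "basic_set_of S x = (THE X. X \<in> S \<and> x \<in> X)"

lemma basic_set_of_eq: "partition_on C S ==> X \<in> S ==> x \<in> X ==> basic_set_of S x = X"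
 unfolding basic_set_of_def by (rule the_equality) (auto simp: partition_on_def disjoint_def)

lemma S_ring_cg_sring:
 fixes R :: "('a, 'b) ring_scheme" (structure) and \<A> :: "('a \<Rightarrow> int) set" and cls
 defines "cls \<equiv> basic_set_of (basic_sets (add_monoid R) \<A>)"
 assumes R: "cg_ring R" and A: "S_ring_over_ring R \<A>"
 shows "cg_sring R cls" and "\<A> = cg_sring.class_fun R cls" and "basic_sets (add_monoid R) \<A> = cls ` carrier R"
proof -
 interpret cg_ring R by (rule R)
 let ?S = "basic_sets (add_monoid R) \<A>"
 obtain S where S: "S_ring_partition (add_monoid R) \<A> S"
  using A by (auto simp: S_ring_over_ring_def S_ring_def)
 have Se: "?S = S" by (rule basic_sets_eq[OF S])
 have part: "partition_on (carrier R) ?S" and basis: "int_basis (simple_quantity ` ?S) \<A>"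
  and zero: "{\<zero>} \<in> ?S" using S unfolding Se S_ring_partition_def by auto
 have mult: "(\<lambda>x. u \<otimes> x) ` X \<in> ?S" if "X \<in> ?S" "u \<in> Units R" for X u
  using A that by (simp add: S_ring_over_ring_def)
 have sub: "subring \<A> (group_ring (add_monoid R))" using A by (simp add: S_ring_over_ring_def S_ring_def)
 have cls_eq: "cls x = X" if "X \<in> ?S" "x \<in> X" for x X
  unfolding cls_def by (rule basic_set_of_eq[OF part that])
 have ex: "\<exists>X\<in>?S. x \<in> X \<and> cls x = X" if "x \<in> carrier R" for x
  using that part cls_eq unfolding partition_on_def by blast
 have in_cls: "x \<in> cls x" "cls x \<in> ?S" if "x \<in> carrier R" for x using ex[OF that] by auto
 have Sc: "X \<subseteq> carrier R" if "X \<in> ?S" for X using that part by (auto simp: partition_on_def)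
 have finS: "finite ?S" using finite_elements[OF fin part] .
 have A_iff: "a \<in> \<A> \<longleftrightarrow> (\<forall>x. x \<notin> carrier R \<longrightarrow> a x = 0) \<and> (\<forall>x\<in>carrier R. \<forall>y\<in>cls x. a y = a x)" for a
 proof -
  have "(\<forall>X\<in>?S. \<forall>x\<in>X. \<forall>y\<in>X. a x = a y) \<longleftrightarrow> (\<forall>x\<in>carrier R. \<forall>y\<in>cls x. a y = a x)"
  proof (intro iffI ballI)
   fix x y assume h: "\<forall>X\<in>?S. \<forall>x\<in>X. \<forall>y\<in>X. a x = a y" "x \<in> carrier R" "y \<in> cls x"
   show "a y = a x" using h(1) h(3) in_cls[OF h(2)] by blast
  next
   fix X x y assume h: "\<forall>x\<in>carrier R. \<forall>y\<in>cls x. a y = a x" "X \<in> ?S" "x \<in> X" "y \<in> X"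
   then have "cls x = X" "x \<in> carrier R" using cls_eq Sc by blast+
   then show "a x = a y" using h by metis
  qed
  moreover have "a \<in> \<A> \<longleftrightarrow> a \<in> int_span (simple_quantity ` ?S)"
   by (rule arg_cong[OF int_basis_span[OF basis]])
  moreover have "disjoint ?S" "{} \<notin> ?S" "\<Union>?S = carrier R" using part by (auto simp: partition_on_def)
  ultimately show ?thesis using int_span_iff[OF finS, of a] by simp
 qed
 show cg: "cg_sring R cls"
 proof
  fix x y assume x: "x \<in> carrier R" and y: "y \<in> cls x"
  show "cls y = cls x" by (rule cls_eq[OF in_cls(2)[OF x] y])
 next
  show "cls \<zero> = {\<zero>}" by (rule cls_eq[OF zero]) simp
 next
  fix u x assume u: "u \<in> Units R" and x: "x \<in> carrier R"
  show "cls (u \<otimes> x) = (\<lambda>y. u \<otimes> y) ` cls x"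
   by (rule cls_eq[OF mult[OF in_cls(2)[OF x] u]]) (use in_cls(1)[OF x] in blast)
 next
  fix f g :: "'a \<Rightarrow> int" and x y
  assume f: "\<And>x y. x \<in> carrier R ==> y \<in> cls x ==> f y = f x"
   and g: "\<And>x y. x \<in> carrier R ==> y \<in> cls x ==> g y = g x" and x: "x \<in> carrier R" and y: "y \<in> cls x"
  have yc: "y \<in> carrier R" using y Sc in_cls(2)[OF x] by blast
  \<comment> \<open>Cut off outside the carrier, class functions become elements of \<A>, and their
    product in the group ring is the convolution.\<close>
  let ?f = "\<lambda>x. if x \<in> carrier R then f x else 0" and ?g = "\<lambda>x. if x \<in> carrier R then g x else 0"
  have cc: "y \<in> carrier R" if "x \<in> carrier R" "y \<in> cls x" for x y using that Sc in_cls(2) by blast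
  have "?f \<in> \<A>" "?g \<in> \<A>" unfolding A_iff using f g cc by auto
  then have "?f \<otimes>\<^bsub>group_ring (add_monoid R)\<^esub> ?g \<in> \<A>" by (rule subringE(6)[OF sub])
  then have "(?f \<otimes>\<^bsub>group_ring (add_monoid R)\<^esub> ?g) y = (?f \<otimes>\<^bsub>group_ring (add_monoid R)\<^esub> ?g) x"
   unfolding A_iff using x y by blast
  moreover have "(?f \<otimes>\<^bsub>group_ring (add_monoid R)\<^esub> ?g) z = (\<Sum>a\<in>carrier R. f a * g (z \<ominus> a))" if z: "z \<in> carrier R" for z
  proof -
   have "inv\<^bsub>add_monoid R\<^esub> a \<oplus> z = z \<ominus> a" if "a \<in> carrier R" for a
    using that z by (simp add: a_minus_def a_comm flip: a_inv_def)
   then show ?thesis using z by (simp add: group_ring_def)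
  qed
  ultimately show "(\<Sum>a\<in>carrier R. f a * g (y \<ominus> a)) = (\<Sum>a\<in>carrier R. f a * g (x \<ominus> a))" using x yc by simp
 qed (use in_cls Sc in auto)
 show "\<A> = cg_sring.class_fun R cls" unfolding cg_sring.class_fun_def[OF cg] using A_iff by blast
 show "?S = cls ` carrier R"
 proof (intro equalityI subsetI)
  fix X assume X: "X \<in> ?S"
  then obtain x where "x \<in> X" using part by (metis all_not_in_conv partition_on_def)
  then show "X \<in> cls ` carrier R" using cls_eq[OF X] Sc[OF X] by blast
 qed (use in_cls in auto)
qed

section \<open>Agreement with the components used in the statement\<close>

context fin_cring
begin

lemma ring_on_comp: "ring_on R (comp Q) = corner Q"
proof -
 have "(THE e. e \<in> comp Q \<and> (\<forall>x\<in>comp Q. e \<otimes> x = x \<and> x \<otimes> e = x)) = \<epsilon> Q"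
 proof (rule the_equality)
  show "\<epsilon> Q \<in> comp Q \<and> (\<forall>x\<in>comp Q. \<pi> Q x = x \<and> x \<otimes> \<epsilon> Q = x)"
   using \<epsilon>_in_comp comp_mult comp_in by (auto simp: m_comm[of _ "\<epsilon> Q"])
  fix e assume e: "e \<in> comp Q \<and> (\<forall>x\<in>comp Q. e \<otimes> x = x \<and> x \<otimes> e = x)"
  then have "e \<otimes> \<epsilon> Q = \<epsilon> Q" using \<epsilon>_in_comp by blast
  moreover have "e \<otimes> \<epsilon> Q = e" using e comp_mult[of e Q] comp_in[of e Q] by (simp add: m_comm)
  ultimately show "e = \<epsilon> Q" by simp
 qed
 then show ?thesis by (simp add: ring_on_def)
qed

lemma sylow_comp:
 assumes p: "p \<in> P"
 shows "sylow_carrier R p = comp {p}"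
proof -
 have s: "sylow_carrier R p = {x \<in> carrier R. num (ppart p) \<otimes> x = \<zero>}"
  using sylow_carrier_props(3)[OF cring_axioms fin P_prime[OF p]] by (simp add: add_pow_num cong: conj_cong)
 show ?thesis unfolding s
 proof (intro equalityI subsetI)
  fix x assume "x \<in> {x \<in> carrier R. num (ppart p) \<otimes> x = \<zero>}"
  then have x: "x \<in> carrier R" "num (ppart p) \<otimes> x = \<zero>" by auto
  obtain b where b: "num (ppart p) \<otimes> num b \<otimes> \<epsilon> (- {p}) = \<epsilon> (- {p})"
   using num_inverse[of "- {p}" "ppart p"] P_prime p by (metis ComplD coprime_power_left_iff insertI1 primes_coprime)
  have "\<pi> (- {p}) x = (num (ppart p) \<otimes> num b \<otimes> \<epsilon> (- {p})) \<otimes> x" using b by simp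
  also have "\<dots> = num b \<otimes> \<epsilon> (- {p}) \<otimes> (num (ppart p) \<otimes> x)" using x(1) by (simp only: m_ac num_closed \<epsilon>_closed m_closed)
  also have "\<dots> = \<zero>" using x(2) by simp
  finally show "x \<in> comp {p}" using \<epsilon>_split[OF x(1), of "{p}"] x(1) by (simp add: comp_def)
 next
  fix x assume x: "x \<in> comp {p}"
  have "num (ppart p) \<otimes> x = num (ppart p) \<otimes> \<epsilon> {p} \<otimes> x" using comp_mult[OF x] comp_in[OF x] by (simp add: m_assoc)
  then show "x \<in> {x \<in> carrier R. num (ppart p) \<otimes> x = \<zero>}" using ppart_kill[OF p] comp_in[OF x] by simp
 qed
qed

lemma p_component_corner: "p \<in> P ==> p_component R p = corner {p}"
 by (simp add: p_component_def sylow_comp ring_on_comp)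

lemma \<epsilon>_Int: "\<epsilon> (P \<inter> Q) = \<epsilon> Q"
proof -
 have "\<pi> Q \<one> = \<epsilon> Q \<otimes> \<epsilon> P" by (rule \<epsilon>_eqI) (auto simp: Int_absorb2)
 then show ?thesis by (simp add: Int_commute)
qed

lemma Q_component_corner:
 assumes Q: "Q \<subseteq> P"
 shows "Q_component R Q = corner Q"
proof -
 have finQ: "finite Q" using finite_subset[OF Q P_finite] .
 have dis: "disjoint_family_on (\<lambda>p. {p}) Q" by (auto simp: disjoint_family_on_def)
 have c: "carrier (p_component R p) = comp {p}" if "p \<in> Q" for p using p_component_corner[of p] that Q by auto
 have "{finsum R f Q | f. f \<in> (\<Pi> p\<in>Q. carrier (p_component R p))} = comp Q"
 proof (intro equalityI subsetI)
  fix y assume "y \<in> {finsum R f Q | f. f \<in> (\<Pi> p\<in>Q. carrier (p_component R p))}"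
  then obtain f where f: "y = finsum R f Q" "\<And>p. p \<in> Q ==> f p \<in> comp {p}" using c by fastforce
  note ff = finsum_family[OF finQ dis, of f, OF f(2)]
  have "\<pi> (- Q) y = \<zero>" unfolding f(1) by (rule ff(3)) auto
  then show "y \<in> comp Q" using \<epsilon>_split[of y Q] ff(1) f(1) by (simp add: comp_def)
 next
  fix y assume y: "y \<in> comp Q"
  note yc = comp_in[OF y]
  note ff = finsum_family[OF finQ dis, of "\<lambda>p. \<pi> {p} y", OF comp_proj[OF yc]]
  have "y = finsum R (\<lambda>p. \<pi> {p} y) Q"
  proof (rule eqI_primes[OF yc ff(1)])
   fix p assume p: "p \<in> P"
   show "\<pi> {p} y = \<epsilon> {p} \<otimes> finsum R (\<lambda>p. \<pi> {p} y) Q"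
   proof (cases "p \<in> Q")
    case False
    then have "\<pi> {p} (\<pi> Q y) = \<zero>" by (intro \<epsilon>_disj[OF yc]) simp
    then show ?thesis using False ff(3)[of "{p}"] comp_mult[OF y] by simp
   qed (use ff(2) in simp)
  qed
  moreover have "(\<lambda>p. \<pi> {p} y) \<in> (\<Pi> p\<in>Q. carrier (p_component R p))" using c comp_proj[OF yc] by auto
  ultimately show "y \<in> {finsum R f Q | f. f \<in> (\<Pi> p\<in>Q. carrier (p_component R p))}" by blast
 qed
 then show ?thesis by (simp add: Q_component_def ring_on_comp)
qed

end

lemma (in fin_cring) maximalideal_exists:
 assumes "ideal I R" "I \<noteq> carrier R"
 obtains M where "maximalideal M R" "I \<subseteq> M"
proof -
 let ?P = "\<lambda>M. ideal M R \<and> M \<noteq> carrier R \<and> I \<subseteq> M"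
 have "\<exists>M. ?P M \<and> (\<forall>J. ?P J \<longrightarrow> card J \<le> card M)"
  by (rule ex_has_greatest_nat[of ?P I card "Suc (card (carrier R))"])
   (use assms ideal_sub card_mono[OF fin] in \<open>auto simp: less_Suc_eq_le\<close>)
 then obtain M where M: "?P M" "\<And>J. ?P J ==> card J \<le> card M" by blast
 have "maximalideal M R"
 proof (rule maximalidealI)
  fix J assume J: "ideal J R" "M \<subseteq> J" "J \<subseteq> carrier R"
  show "J = M \<or> J = carrier R"
  using M(2)[of J] J M(1) card_seteq[OF finite_subset[OF J(3) fin] J(2)] by auto
 qed (use M in auto)
 then show ?thesis using that M by blast
qed

text \<open>A non-unit lies in some maximal ideal, and in a local ring this ideal is the
  radical.\<close>

lemma (in fin_cring) local_nonunit:
 assumes M: "\<exists>!M. maximalideal M R" and rad: "ring_radical R = {[p] \<cdot> x | x. x \<in> carrier R}"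
  and x: "x \<in> carrier R" "x \<notin> Units R"
 shows "x \<in> (\<lambda>x. num p \<otimes> x) ` carrier R"
proof -
 have ideal: "ideal (PIdl x) R" using cgenideal_ideal[OF x(1)] .
 have "PIdl x \<noteq> carrier R"
 proof
  assume "PIdl x = carrier R"
  then have "\<one> \<in> PIdl x" by simp
  then obtain y where "y \<in> carrier R" "\<one> = y \<otimes> x" by (auto simp: cgenideal_def)
  then show False using unit_rightI[of x y] x m_comm by auto
 qed
 then obtain N where N: "maximalideal N R" "PIdl x \<subseteq> N" using maximalideal_exists[OF ideal] by blast
 have "x \<in> N" using N(2) cgenideal_self[OF x(1)] by blast
 then have "x \<in> ring_radical R" unfolding ring_radical_def using M N(1) x(1) by blast
 then show ?thesis unfolding rad by (auto simp: add_pow_num)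
qed

text \<open>In R_p every non-unit is divisible by p. Repeated division reaches a unit, or after as
  many steps as the exponent of the p-part it shows that the element is 0. The prime powers and
  units found at the primes are combined to one integer and one unit. The order is odd because an
  element annihilated by 2 and by the odd characteristic is 0.\<close>

theorem CG_ring_cg_ring:
 fixes R :: "('a, 'b) ring_scheme" (structure)
 assumes CG: "CG_ring R" and odd: "odd (ring_characteristic R)"
 shows "cg_ring R"
proof -
 interpret cring R using CG by (simp add: CG_ring_def)
 interpret fin_cring R by unfold_locales (use CG in \<open>simp add: CG_ring_def\<close>)
 show ?thesis
 proof
  show "odd (order R)"
  proof
   assume "even (order R)"
   then have "2 \<in> P" by (simp add: ring_primes_def)
   then obtain h where h: "h \<in> tor 2" "h \<noteq> \<zero>" using tor_nontrivial by blast
   have "num (ring_characteristic R) = \<zero>"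
    using add.pow_ord_eq_1[of \<one>] by (simp add: num_def ring_characteristic_def)
   moreover obtain m where "ring_characteristic R = 2 * m + 1" using odd by (auto elim: oddE)
   ultimately have n: "num m \<otimes> num 2 \<oplus> \<one> = \<zero>"
    using num_add[of "2 * m" 1] num_mult[of 2 m] by (simp add: m_comm)
   have hc: "h \<in> carrier R" "num 2 \<otimes> h = \<zero>" using h by (auto simp: tor_def)
   have "(num m \<otimes> num 2 \<oplus> \<one>) \<otimes> h = num m \<otimes> (num 2 \<otimes> h) \<oplus> h" using hc(1) by (simp add: l_distr m_assoc)
   then show False using n hc h(2) by simp
  qed
  fix x assume x: "x \<in> carrier R"
  have loc: "\<exists>i. \<exists>u\<in>Units R. \<pi> {p} x = \<pi> {p} (num (p ^ i) \<otimes> u)" if p: "p \<in> P" for p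
  proof -
   let ?C = "corner {p}"
   interpret C: fin_cring ?C by (rule corner_fin)
   have M: "\<exists>!M. maximalideal M ?C" and rad: "ring_radical ?C = {[p] \<cdot>\<^bsub>?C\<^esub> x | x. x \<in> carrier ?C}"
    using CG p unfolding CG_ring_def local_ring_def by (auto simp flip: p_component_corner[OF p])
   have st: "\<exists>z\<in>comp {p}. y = num p \<otimes> z" if "y \<in> comp {p}" "y \<notin> Units ?C" for y
    using C.local_nonunit[OF M rad, of y] that corner_num_mult by auto
   have step: "(\<exists>i. \<exists>u\<in>Units ?C. y = num (p ^ i) \<otimes> u) \<or> (\<exists>z\<in>comp {p}. y = num (p ^ n) \<otimes> z)" if y: "y \<in> comp {p}" for y n
   proof (induction n)
    case 0
    have "y = num (p ^ 0) \<otimes> y" using comp_in[OF y] by simp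
    then show ?case using y by blast
   next
    case (Suc n)
    then show ?case
    proof
     assume "\<exists>z\<in>comp {p}. y = num (p ^ n) \<otimes> z"
     then obtain z where z: "z \<in> comp {p}" "y = num (p ^ n) \<otimes> z" by blast
     show ?thesis
     proof (cases "z \<in> Units ?C")
      case False
      then obtain w where w: "w \<in> comp {p}" "z = num p \<otimes> w" using st[OF z(1)] by blast
      have "y = num (p ^ Suc n) \<otimes> w" unfolding z(2) w(2)
       using comp_in[OF w(1)] num_mult[of p "p ^ n"] by (simp add: m_assoc m_lcomm)
      then show ?thesis using w(1) by blast
     qed (use z in blast)
    qed blast
   qed
   have c: "\<pi> {p} x \<in> comp {p}" using comp_proj[OF x] .
   have fin: "\<exists>i. \<exists>u\<in>Units ?C. \<pi> {p} x = num (p ^ i) \<otimes> u"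
   proof (rule disjE[OF step[OF c, of "multiplicity p (order R)"]])
    assume "\<exists>z\<in>comp {p}. \<pi> {p} x = num (ppart p) \<otimes> z"
    then obtain z where z: "z \<in> comp {p}" "\<pi> {p} x = num (ppart p) \<otimes> z" by blast
    have "num (ppart p) \<otimes> z = num (ppart p) \<otimes> \<epsilon> {p} \<otimes> z" using comp_mult[OF z(1)] comp_in[OF z(1)] by (simp add: m_assoc)
    then have "\<pi> {p} x = \<zero>" unfolding z(2) using ppart_kill[OF p] comp_in[OF z(1)] by simp
    then have "\<pi> {p} x = num (ppart p) \<otimes> \<epsilon> {p}" using ppart_kill[OF p] by simp
    moreover have "\<epsilon> {p} \<in> Units ?C" using C.Units_one_closed by simp
    ultimately show ?thesis by blast
   qed
   then obtain i u where u: "u \<in> Units R" "\<pi> {p} x = num (p ^ i) \<otimes> \<pi> {p} u" unfolding corner_Units by blast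
   then have "\<pi> {p} x = \<pi> {p} (num (p ^ i) \<otimes> u)" by (simp add: m_lcomm Units_closed)
   then show ?thesis using u(1) by blast
  qed
  have "\<exists>d. \<exists>u\<in>Units R. \<forall>p\<in>F. \<pi> {p} x = \<pi> {p} (num d \<otimes> u)" if "finite F" "F \<subseteq> P" for F using that
  proof (induction F rule: finite_induct)
   case (insert q F)
   then obtain d u where du: "u \<in> Units R" "\<And>p. p \<in> F ==> \<pi> {p} x = \<pi> {p} (num d \<otimes> u)" by auto
   obtain i w where w: "w \<in> Units R" "\<pi> {q} x = \<pi> {q} (num (q ^ i) \<otimes> w)" using loc insert.prems by blast
   \<comment> \<open>Chinese remaindering: q^i at q and d at the other primes, matched by the unit
     that is w at q and u elsewhere.\<close>
   let ?d = "q ^ i * idx {q} + d * idx (- {q})" and ?u = "patch {q} w u"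
   have nd: "num ?d = num (q ^ i) \<otimes> \<epsilon> {q} \<oplus> num d \<otimes> \<epsilon> (- {q})" by (simp add: num_add num_mult \<epsilon>_def)
   have ndp: "num ?d = patch {q} (num (q ^ i)) (num d)" unfolding nd patch_def by (simp add: m_comm)
   have m: "\<pi> {p} (a \<otimes> b) = \<pi> {p} a \<otimes> b" if "a \<in> carrier R" "b \<in> carrier R" for a b p using that by (simp add: m_assoc)
   have m2: "\<pi> {p} (a \<otimes> b) = a \<otimes> \<pi> {p} b" if "a \<in> carrier R" "b \<in> carrier R" for a b p using that by (simp add: m_lcomm)
   note c = Units_closed[OF w(1)] Units_closed[OF du(1)]
   have "\<pi> {p} x = \<pi> {p} (num ?d \<otimes> ?u)" if p: "p \<in> insert q F" for p
   proof (cases "p = q")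
    case True
    have "\<pi> {q} (num ?d \<otimes> ?u) = (\<epsilon> {q} \<otimes> num ?d) \<otimes> ?u" by (rule m) (use c in auto)
    also have "\<dots> = (\<epsilon> {q} \<otimes> num (q ^ i)) \<otimes> ?u" unfolding ndp by (subst patch_in) auto
    also have "\<dots> = \<pi> {q} (num (q ^ i) \<otimes> ?u)" by (rule m[symmetric]) (use c in auto)
    also have "\<dots> = num (q ^ i) \<otimes> \<pi> {q} ?u" by (rule m2) (use c in auto)
    also have "\<dots> = num (q ^ i) \<otimes> \<pi> {q} w" by (subst patch_in) (use c in auto)
    also have "\<dots> = \<pi> {q} x" unfolding w(2) by (rule m2[symmetric]) (use c in auto)
    finally show ?thesis using True by simp
   next
    case False
    have "\<pi> {p} (num ?d \<otimes> ?u) = (\<epsilon> {p} \<otimes> num ?d) \<otimes> ?u" by (rule m) (use c in auto)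
    also have "\<dots> = (\<epsilon> {p} \<otimes> num d) \<otimes> ?u" unfolding ndp by (subst patch_out) (use False in auto)
    also have "\<dots> = \<pi> {p} (num d \<otimes> ?u)" by (rule m[symmetric]) (use c in auto)
    also have "\<dots> = num d \<otimes> \<pi> {p} ?u" by (rule m2) (use c in auto)
    also have "\<dots> = num d \<otimes> \<pi> {p} u" by (subst patch_out) (use c False in auto)
    also have "\<dots> = \<pi> {p} x" using du(2)[of p] False p m2[of "num d" u p] c by simp
    finally show ?thesis by simp
   qed
   moreover have "?u \<in> Units R" using patch_Units[OF w(1) du(1)] .
   ultimately show ?case by blast
  qed (use Units_one_closed in blast)
  from this[OF P_finite order_refl] obtain d u where u: "u \<in> Units R" "\<And>p. p \<in> P ==> \<pi> {p} x = \<pi> {p} (num d \<otimes> u)" by blast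
  have "x = num d \<otimes> u" by (rule eqI_primes[OF x _ u(2)]) (use Units_closed[OF u(1)] in auto)
  then show "\<exists>d. \<exists>u\<in>Units R. x = num d \<otimes> u" using u(1) by blast
 qed
qed

section \<open>The decomposition\<close>

lemma product_group_cong:
 assumes "\<And>i. i \<in> I ==> G i = H i"
 shows "product_group I G = product_group I H"
proof -
 have "(\<Pi>\<^sub>E i\<in>I. carrier (G i)) = (\<Pi>\<^sub>E i\<in>I. carrier (H i))" by (rule PiE_cong) (simp add: assms)
 then show ?thesis unfolding product_group_def using assms by (simp cong: restrict_cong)
qed

text \<open>As \<open>comp Q\<close> is a union of basic sets, class functions on it extend by 0 to
  class functions on R; units of R_Q are projections of units of R.\<close>

lemma (in cg_sring) corner_cg_sring:
 assumes a: "aset (comp Q)"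
 shows "cg_sring (corner Q) cls"
proof (intro cg_sring.intro cg_sring_axioms.intro corner_cg_ring)
 fix u x assume "u \<in> Units (corner Q)" and x: "x \<in> carrier (corner Q)"
 then obtain v where v: "v \<in> Units R" "u = \<pi> Q v" by (auto simp: corner_Units)
 have m: "u \<otimes> y = v \<otimes> y" if "y \<in> comp Q" for y
  using comp_mult[OF that] comp_in[OF that] v by (simp add: m_assoc m_lcomm[of "\<epsilon> Q" v] Units_closed)
 have xc: "x \<in> comp Q" using x by simp
 have "cls (v \<otimes> x) = (\<lambda>y. v \<otimes> y) ` cls x" by (rule cls_mult[OF v(1) comp_in[OF xc]])
 also have "\<dots> = (\<lambda>y. u \<otimes> y) ` cls x" using m asetD[OF a xc] by (intro image_cong) auto
 finally show "cls (u \<otimes>\<^bsub>corner Q\<^esub> x) = (\<lambda>y. u \<otimes>\<^bsub>corner Q\<^esub> y) ` cls x" using m[OF xc] by simp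
next
 fix f g :: "'a \<Rightarrow> int" and x y
 assume f: "\<And>x y. x \<in> carrier (corner Q) ==> y \<in> cls x ==> f y = f x"
  and g: "\<And>x y. x \<in> carrier (corner Q) ==> y \<in> cls x ==> g y = g x"
  and x: "x \<in> carrier (corner Q)" and y: "y \<in> cls x"
 have xc: "x \<in> comp Q" and yc: "y \<in> comp Q" using x y asetD[OF a] by auto
 let ?F = "\<lambda>a. if a \<in> comp Q then f a else 0" and ?G = "\<lambda>a. if a \<in> comp Q then g a else 0"
 have e: "(\<Sum>a\<in>carrier R. ?F a * ?G (w \<ominus> a)) = (\<Sum>a\<in>comp Q. f a * g (w \<ominus>\<^bsub>corner Q\<^esub> a))" if w: "w \<in> comp Q" for w
 proof (rule sum.mono_neutral_cong_right)
  show "comp Q \<subseteq> carrier R" using comp_in by blast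
 qed (use w corner_minus comp_minus_closed in auto)
 have "(\<Sum>a\<in>carrier R. ?F a * ?G (y \<ominus> a)) = (\<Sum>a\<in>carrier R. ?F a * ?G (x \<ominus> a))"
 proof (rule cls_conv)
  fix x y assume xy: "x \<in> carrier R" "y \<in> cls x"
  show "?F y = ?F x" "?G y = ?G x" using aset_cong[OF a xy] f[of x y] g[of x y] xy by auto
 qed (use comp_in[OF xc] y in auto)
 then show "(\<Sum>a\<in>carrier (corner Q). f a * g (y \<ominus>\<^bsub>corner Q\<^esub> a)) = (\<Sum>a\<in>carrier (corner Q). f a * g (x \<ominus>\<^bsub>corner Q\<^esub> a))"
  using e[OF xc] e[OF yc] by simp
qed (use comp_in cls_self cls_eq cls_zero asetD[OF a] in auto)

context pure_sring
begin

lemma I_L_one: "I_L R (cls \<one>) = {\<zero>}"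
proof -
 have sub: "cls \<one> \<subseteq> carrier R" using cls_carrier by simp
 have "t = \<zero>" if t: "t \<in> carrier R" "\<And>r x. r \<in> carrier R ==> x \<in> cls \<one> ==> x \<oplus> r \<otimes> t \<in> cls \<one>" for t
 proof -
  have "PIdl t = {\<zero>}" by (rule pure[OF cgenideal_ideal[OF t(1)]]) (use t(2) in \<open>auto simp: cgenideal_def\<close>)
  then show ?thesis using cgenideal_self[OF t(1)] by simp
 qed
 then show ?thesis unfolding I_L_eq[OF sub] using sub by auto
qed

lemma class_fun_pure: "pure_S_ring R class_fun" unfolding pure_S_ring_def class_fun_basic
 using class_fun_S_ring I_L_one cls_self[OF one_closed] by blast

end

lemma (in mul_sring) class_fun_cyclotomic: "cyclotomic_S_ring R class_fun"
proof -
 have "cls ` carrier R = orbits ((units_of R)\<lparr>carrier := K\<rparr>) (carrier R) (\<lambda>u x. u \<otimes> x)"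
 proof -
  have o: "orbit ((units_of R)\<lparr>carrier := K\<rparr>) (\<lambda>u x. u \<otimes> x) x = (\<lambda>k. k \<otimes> x) ` K" for x
   by (simp add: orbit_def image_def) blast
  have "orbits ((units_of R)\<lparr>carrier := K\<rparr>) (carrier R) (\<lambda>u x. u \<otimes> x) = (\<lambda>x. (\<lambda>k. k \<otimes> x) ` K) ` carrier R"
   unfolding orbits_def o by blast
  also have "\<dots> = cls ` carrier R" by (rule image_cong[OF refl]) (simp only: cls_orbit)
  finally show ?thesis by (rule sym)
 qed
 then show ?thesis unfolding cyclotomic_S_ring_def class_fun_basic using class_fun_S_ring K_sub by blast
qed

text \<open>The basic set in the definition of purity contains a unit u, so it is u times the basic
  set of 1.\<close>

lemma (in cg_sring) pure_sringI:
 assumes A: "\<A> = class_fun" and pure: "pure_S_ring R \<A>"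
 shows "pure_sring R cls"
proof unfold_locales
 fix J assume J: "ideal J R" and st: "\<And>x j. x \<in> cls \<one> ==> j \<in> J ==> x \<oplus> j \<in> cls \<one>"
 obtain X u where X: "X \<in> cls ` carrier R" "u \<in> X" "u \<in> Units R" "I_L R X = {\<zero>}"
  using pure unfolding pure_S_ring_def A class_fun_basic by blast
 then have "X = cls u" using cls_eq by blast
 then have Xe: "X = (\<lambda>y. u \<otimes> y) ` cls \<one>" using cls_mult[OF X(3) one_closed] X(3) by (simp add: Units_closed)
 have uc: "u \<in> carrier R" using X(3) by (simp add: Units_closed)
 have "j \<in> I_L R X" if j: "j \<in> J" for j
 proof -
  have Xc: "X \<subseteq> carrier R" using X(1) cls_carrier by blast
  have "x \<oplus> r \<otimes> j \<in> X" if r: "r \<in> carrier R" and x: "x \<in> X" for r x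
  proof -
   obtain w where w: "w \<in> cls \<one>" "x = u \<otimes> w" using x Xe by blast
   have wc: "w \<in> carrier R" using cls_in[OF one_closed w(1)] .
   have "x \<oplus> r \<otimes> j = u \<otimes> (w \<oplus> inv u \<otimes> (r \<otimes> j))"
    unfolding w(2) using X(3) uc wc r ideal_in[OF J j] by (simp add: r_distr)
   moreover have "w \<oplus> inv u \<otimes> (r \<otimes> j) \<in> cls \<one>"
    using st[OF w(1)] ideal_mult[OF J] j r X(3) by blast
   ultimately show ?thesis using Xe by blast
  qed
  then show ?thesis unfolding I_L_eq[OF Xc] using ideal_in[OF J j] by blast
 qed
 then show "J = {\<zero>}" using X(4) ideal_zero[OF J] by blast
qed

context pure_sring
begin

definition Q0 :: "nat set"
 where "Q0 = P - \<Union>{S. block S}"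

lemma block_disjoint: "block S ==> block S' ==> S \<noteq> S' ==> S \<inter> S' = {}" using block_unique by blast

text \<open>\<open>block_split\<close> is applied to one block after another; the blocks are
  disjoint, so the projection off one block leaves the components at the others untouched.\<close>

lemma split_blocks:
 assumes "finite F" "\<And>S. S \<in> F ==> block S" and x: "x \<in> carrier R" and y: "y \<in> carrier R"
 shows "y \<in> cls x \<longleftrightarrow> (\<forall>S\<in>F. \<pi> S y = \<zero> \<longleftrightarrow> \<pi> S x = \<zero>) \<and> \<pi> (- \<Union>F) y \<in> cls (\<pi> (- \<Union>F) x)" using assms(1,2)
proof (induction F rule: finite_induct)
 case empty
 then show ?case using x y by simp
next
 case (insert S F)
 have S: "block S" using insert.prems by simp
 have "S \<inter> S' = {}" if "S' \<in> F" for S' using block_disjoint[OF S insert.prems[of S']] that insert.hyps(2) by blast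
 then have d: "S \<inter> - \<Union>F = S" by blast
 have u: "- S \<inter> - \<Union>F = - \<Union>(insert S F)" by blast
 have "y \<in> cls x \<longleftrightarrow> (\<forall>S\<in>F. \<pi> S y = \<zero> \<longleftrightarrow> \<pi> S x = \<zero>) \<and> \<pi> (- \<Union>F) y \<in> cls (\<pi> (- \<Union>F) x)"
  using insert by simp
 also have "\<pi> (- \<Union>F) y \<in> cls (\<pi> (- \<Union>F) x) \<longleftrightarrow> (\<pi> S y = \<zero> \<longleftrightarrow> \<pi> S x = \<zero>) \<and>
   \<pi> (- \<Union>(insert S F)) y \<in> cls (\<pi> (- \<Union>(insert S F)) x)"
  using block_split[OF S, of "\<pi> (- \<Union>F) x" "\<pi> (- \<Union>F) y"] x y unfolding \<epsilon>_idem[OF x] \<epsilon>_idem[OF y] d u by simp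
 finally show ?case by blast
qed

lemma split_all:
 assumes x: "x \<in> carrier R" and y: "y \<in> carrier R"
 shows "y \<in> cls x \<longleftrightarrow> (\<forall>S. block S \<longrightarrow> (\<pi> S y = \<zero> \<longleftrightarrow> \<pi> S x = \<zero>)) \<and> \<pi> Q0 y \<in> cls (\<pi> Q0 x)"
using \<epsilon>_Int[of "- \<Union>{S. block S}"] split_blocks[OF block_finite _ x y] by (simp add: Q0_def Diff_eq)

lemma Q0_off: "block S ==> x \<in> comp Q0 ==> \<pi> S x = \<zero>"
proof -
 assume S: "block S" and x: "x \<in> comp Q0"
 have "\<pi> S (\<pi> Q0 x) = \<zero>" by (rule \<epsilon>_disj[OF comp_in[OF x]]) (use S in \<open>auto simp: Q0_def\<close>)
 then show ?thesis using comp_mult[OF x] by simp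
qed

lemma Q0_aset: "aset (comp Q0)"
proof (rule asetI)
 fix x y assume x: "x \<in> comp Q0" and y: "y \<in> cls x"
 note xc = comp_in[OF x] and yc = cls_in[OF comp_in[OF x] y]
 have S0: "\<pi> S y = \<zero>" if "block S" for S using split_all[OF xc yc] y Q0_off[OF that x] that by blast
 have "\<pi> Q0 y = y"
 proof (rule eqI_primes)
  fix p assume p: "p \<in> P"
  show "\<pi> {p} (\<pi> Q0 y) = \<pi> {p} y"
  proof (cases "p \<in> Q0")
   case True
   then show ?thesis using yc by (simp add: \<epsilon>_idem)
  next
   case False
   then obtain S where S: "block S" "p \<in> S" using p by (auto simp: Q0_def)
   have "\<pi> {p} y = \<pi> {p} (\<pi> S y)" using S(2) yc by (simp add: \<epsilon>_idem)
   then show ?thesis using S0[OF S(1)] False yc by (simp add: \<epsilon>_disj)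
  qed
 qed (use yc in auto)
 then show "y \<in> comp Q0" using yc by (simp add: comp_def)
qed (use comp_in in blast)

text \<open>Purity passes to R_Q0: by \<open>split_all\<close>, a translation inside R_Q0 that
  preserves the class of its identity also preserves K, since it changes nothing at the blocks. The
  primes in \<open>Q0\<close> lie in no block, so for them p R is an \<A>-ideal by
  \<open>block_exists\<close>.\<close>

lemma Q0_mul_sring: "mul_sring (corner Q0) cls"
proof -
 interpret C: cg_sring "corner Q0" cls by (rule corner_cg_sring[OF Q0_aset])
 show ?thesis
 proof (intro mul_sring.intro pure_sring.intro mul_sring_axioms.intro pure_sring_axioms.intro C.cg_sring_axioms)
  fix J assume J: "ideal J (corner Q0)"
   and st: "\<And>x j. x \<in> cls \<one>\<^bsub>corner Q0\<^esub> ==> j \<in> J ==> x \<oplus>\<^bsub>corner Q0\<^esub> j \<in> cls \<one>\<^bsub>corner Q0\<^esub>"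
  have Jc: "j \<in> comp Q0" if "j \<in> J" for j using C.ideal_in[OF J that] by simp
  have "ideal J R"
  proof (rule idealI')
   fix r j assume r: "r \<in> carrier R" and j: "j \<in> J"
   have "r \<otimes> j = \<pi> Q0 r \<otimes> j" using comp_mult[OF Jc[OF j]] comp_in[OF Jc[OF j]] r by (simp add: m_assoc m_lcomm[of "\<epsilon> Q0" r])
   then show "r \<otimes> j \<in> J" using C.ideal_mult[OF J j, of "\<pi> Q0 r"] comp_proj[OF r] by simp
  qed (use Jc comp_in C.ideal_zero[OF J] C.ideal_add[OF J] in auto)
  then show "J = {\<zero>\<^bsub>corner Q0\<^esub>}"
  proof (subst pure)
   fix x j assume x: "x \<in> cls \<one>" and j: "j \<in> J"
   note xc = cls_in[OF one_closed x] and jc = comp_in[OF Jc[OF j]]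
   have sx: "\<And>S. block S ==> \<pi> S x = \<zero> \<longleftrightarrow> \<pi> S \<one> = \<zero>" "\<pi> Q0 x \<in> cls (\<pi> Q0 \<one>)"
    using split_all[OF one_closed xc] x by blast+
   have "\<pi> S (x \<oplus> j) = \<pi> S x" if "block S" for S using Q0_off[OF that Jc[OF j]] xc jc by (simp add: r_distr)
   moreover have "\<pi> Q0 (x \<oplus> j) = \<pi> Q0 x \<oplus> j" using comp_mult[OF Jc[OF j]] xc jc by (simp add: r_distr)
   ultimately show "x \<oplus> j \<in> cls \<one>"
    using split_all[OF one_closed, of "x \<oplus> j"] sx st[of "\<pi> Q0 x" j] j xc jc by simp
  qed simp_all
 next
  fix p assume "p \<in> C.P"
  then have p: "p \<in> P" "p \<in> Q0" by (auto simp: corner_primes)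
  have am: "aideal (mul p)"
  proof (rule ccontr)
   assume "\<not> aideal (mul p)"
   then obtain S where "block S" "p \<in> S" using block_exists[OF p(1)] by blast
   then show False using p(2) by (auto simp: Q0_def)
  qed
  have "C.aset (C.mul p)"
  proof (rule C.asetI)
   fix x y assume x: "x \<in> C.mul p" and y: "y \<in> cls x"
   have xc: "x \<in> comp Q0" using C.mul_sub x by auto
   then have "y \<in> comp Q0" using asetD[OF Q0_aset] y by blast
   moreover have "y \<in> mul p" using asetD[OF aideal_aset[OF am] _ y] corner_mul[OF P_prime[OF p(1)] xc] x by blast
   ultimately show "y \<in> C.mul p" using corner_mul[OF P_prime[OF p(1)]] by blast
  qed (rule C.mul_sub)
  then show "C.aideal (C.mul p)" using C.mul_ideal by (simp add: C.aideal_def)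
 qed
qed

text \<open>In a field R_S a non-zero element annihilated by p would be invertible, so p would
  annihilate R_S. Then S = {p} and p R is \<open>cocomp S\<close>, an \<A>-ideal, contrary to the
  definition of a block.\<close>

lemma block_not_field:
 assumes S: "block S"
 shows "\<not> field (corner S)"
proof
 assume "field (corner S)"
 then interpret F: field "corner S" .
 obtain p h where h: "p \<in> S" "h \<in> tor p" "h \<noteq> \<zero>" "h \<in> comp S" using block_tor[OF S] by blast
 have pP: "p \<in> P" and na: "\<not> aideal (mul p)" using S h(1) by (auto simp: block_def)
 note pp = P_prime[OF pP] and hc = tor_carrier[OF h(2)]
 have "h \<in> Units (corner S)" using F.field_Units h by simp
 then obtain g where g: "g \<in> comp S" "h \<otimes> g = \<epsilon> S" by (auto simp: Units_def)
 note gc = comp_in[OF g(1)]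
 have 1: "num p \<otimes> \<epsilon> S = \<zero>" using h(2) gc by (simp add: g(2)[symmetric] tor_def flip: m_assoc)
 have Sp: "S = {p}"
 proof (rule ccontr)
  assume "S \<noteq> {p}"
  then obtain l where l: "l \<in> S" "l \<noteq> p" using h(1) by blast
  have "\<epsilon> {l} = \<epsilon> {l} \<otimes> \<epsilon> S" using l by simp
  also have "\<dots> = \<pi> {l} h \<otimes> g" using g gc hc by (simp add: m_assoc)
  also have "\<dots> = \<zero>" using tor_\<epsilon>_off[OF pp h(2), of "{l}"] l gc by simp
  finally show False using \<epsilon>_nonzero[of l] S l by (auto simp: block_def)
 qed
 have "mul p = cocomp S"
 proof (intro equalityI subsetI)
  fix x assume "x \<in> mul p"
  then obtain y where y: "y \<in> carrier R" "x = num p \<otimes> y" by (auto simp: mul_def)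
  have "\<pi> S x = (num p \<otimes> \<epsilon> S) \<otimes> y" using y by (simp add: m_ac)
  then show "x \<in> cocomp S" using 1 y by (simp add: cocomp_def)
 next
  fix x assume "x \<in> cocomp S"
  then show "x \<in> mul p" using cocomp_out[of x S] mul_off[OF pp cocomp_in[of x S]] Sp by simp
 qed
 then show False using na block_cocomp_aideal[OF S] by simp
qed

lemma block_rank:
 assumes S: "block S"
 shows "S_ring_rank (add_monoid (corner S)) (cg_sring.class_fun (corner S) cls) = 2"
proof -
 interpret C: cg_sring "corner S" cls by (rule corner_cg_sring[OF aideal_aset[OF block_comp_aideal[OF S]]])
 have c: "cls x = comp S - {\<zero>}" if x: "x \<in> comp S" "x \<noteq> \<zero>" for x
 proof -
  note xc = comp_in[OF x(1)]
  have "y \<in> cls x \<longleftrightarrow> y \<in> comp S - {\<zero>}" if y: "y \<in> carrier R" for y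
  proof -
   have "y \<in> cls x \<longleftrightarrow> \<pi> S y \<noteq> \<zero> \<and> \<pi> (- S) y = \<zero>"
    using block_split[OF S xc y] comp_mult[OF x(1)] comp_out[OF x(1)] x(2) cls_zero by simp
   also have "\<dots> \<longleftrightarrow> y \<in> comp S - {\<zero>}" using \<epsilon>_split[OF y, of S] y by (auto simp: comp_def)
   finally show ?thesis .
  qed
  then show ?thesis using cls_in[OF xc] comp_in by blast
 qed
 obtain h where h: "h \<in> comp S" "h \<noteq> \<zero>" using block_tor[OF S] by blast
 have "cls ` comp S = {{\<zero>}, comp S - {\<zero>}}" using c h cls_zero comp_zero by (auto simp: image_iff)
 moreover have "{\<zero>} \<noteq> comp S - {\<zero>}" by blast
 ultimately show ?thesis unfolding S_ring_rank_def C.class_fun_basic by simp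
qed

lemma block_component:
 assumes S: "block S" and x: "x \<in> carrier R" and y: "y \<in> carrier R"
 shows "\<pi> S y \<in> cls (\<pi> S x) \<longleftrightarrow> (\<pi> S y = \<zero> \<longleftrightarrow> \<pi> S x = \<zero>)"
 using block_split[OF S, of "\<pi> S x" "\<pi> S y"] x y cls_zero by (simp add: \<epsilon>_idem)

text \<open>Summation identifies families of components with elements of R, the inverse being the
  family of projections. By \<open>int_span_iff\<close> the tensor product consists of the functions
  constant on products of basic sets, and by the hypothesis \<open>split\<close> these products
  correspond to the basic sets of R.\<close>

lemma tensor_decomposition:
 fixes Q :: "nat \<Rightarrow> nat set" and k :: nat
 assumes dis: "disjoint_family_on Q {0..k}" and P: "(\<Union>i\<in>{0..k}. Q i) = P"
  and as: "\<And>i. i \<in> {0..k} ==> aset (comp (Q i))"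
  and split: "\<And>x y. x \<in> carrier R ==> y \<in> carrier R ==>
   y \<in> cls x \<longleftrightarrow> (\<forall>i\<in>{0..k}. \<pi> (Q i) y \<in> cls (\<pi> (Q i) x))"
 shows "class_fun = group_ring_map (product_group {0..k} (\<lambda>i. add_monoid (corner (Q i))))
   (\<lambda>x. finsum R x {0..k}) `
  tensor_S_ring {0..k} (\<lambda>i. add_monoid (corner (Q i))) (\<lambda>i. cg_sring.class_fun (corner (Q i)) cls)"
proof -
 let ?I = "{0..k}"
 let ?\<Omega> = "\<Pi>\<^sub>E i\<in>?I. comp (Q i)" and ?\<phi> = "\<lambda>x. finsum R x ?I" and ?\<psi> = "\<lambda>y. \<lambda>i\<in>?I. \<pi> (Q i) y"
 let ?X = "{Pi\<^sub>E ?I X | X. \<forall>i\<in>?I. X i \<in> cls ` comp (Q i)}"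
 have sub: "X \<subseteq> comp (Q i)" if "i \<in> ?I" "X \<in> cls ` comp (Q i)" for i X using that asetD[OF as] by blast
 have eqX: "X = cls x" if "i \<in> ?I" "X \<in> cls ` comp (Q i)" "x \<in> X" for i X x using that cls_eq comp_in by blast
 note fs = finsum_family[OF finite_atLeastAtMost dis]
 have \<phi>: "?\<phi> x \<in> carrier R" "i \<in> ?I ==> \<epsilon> (Q i) \<otimes> ?\<phi> x = x i" if "x \<in> ?\<Omega>" for x i
  using fs(1,2)[of x] PiE_mem[OF that] by blast+
 have \<psi>: "?\<psi> y \<in> ?\<Omega>" if "y \<in> carrier R" for y using comp_proj[OF that] by auto
 have \<psi>\<phi>: "?\<psi> (?\<phi> x) = x" if "x \<in> ?\<Omega>" for x
  using \<phi>(2)[OF that] that by (auto simp: PiE_def extensional_def fun_eq_iff)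
 have \<phi>\<psi>: "?\<phi> (?\<psi> y) = y" if y: "y \<in> carrier R" for y
 proof (rule eqI_primes[OF \<phi>(1)[OF \<psi>[OF y]] y])
  fix p assume "p \<in> P"
  then obtain i where i: "i \<in> ?I" "p \<in> Q i" using P by blast
  have "\<pi> {p} z = \<pi> {p} (\<pi> (Q i) z)" if "z \<in> carrier R" for z using i(2) that by (simp add: \<epsilon>_idem)
  from this[OF \<phi>(1)[OF \<psi>[OF y]]] this[OF y] show "\<epsilon> {p} \<otimes> ?\<phi> (?\<psi> y) = \<pi> {p} y"
   unfolding \<phi>(2)[OF \<psi>[OF y] i(1)] restrict_apply'[OF i(1)] by (rule trans[OF _ sym])
 qed
 have basic: "basic_sets (add_monoid (corner (Q i))) (cg_sring.class_fun (corner (Q i)) cls) = cls ` comp (Q i)"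
  if "i \<in> ?I" for i using cg_sring.class_fun_basic[OF corner_cg_sring[OF as[OF that]]] by simp
 have T: "tensor_S_ring ?I (\<lambda>i. add_monoid (corner (Q i))) (\<lambda>i. cg_sring.class_fun (corner (Q i)) cls) =
   int_span (simple_quantity ` ?X)"
  unfolding tensor_S_ring_def using basic by (simp cong: conj_cong)
 have UX: "\<Union>?X = ?\<Omega>"
 proof (intro equalityI subsetI)
  fix x assume "x \<in> \<Union>?X"
  then obtain X where X: "\<forall>i\<in>?I. X i \<in> cls ` comp (Q i)" "x \<in> Pi\<^sub>E ?I X" by blast
  then have "Pi\<^sub>E ?I X \<subseteq> ?\<Omega>" using sub by (intro PiE_mono) blast
  then show "x \<in> ?\<Omega>" using X(2) by blast
 next
  fix x assume x: "x \<in> ?\<Omega>"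
  have "x \<in> Pi\<^sub>E ?I (\<lambda>i. cls (x i))"
  proof (rule PiE_I)
   fix i assume i: "i \<in> ?I"
   show "x i \<in> cls (x i)" by (rule cls_self[OF comp_in[OF PiE_mem[OF x i]]])
  qed (rule PiE_arb[OF x])
  moreover have "Pi\<^sub>E ?I (\<lambda>i. cls (x i)) \<in> ?X" using PiE_mem[OF x] by blast
  ultimately show "x \<in> \<Union>?X" by blast
 qed
 have fX: "finite ?X"
 proof (rule finite_subset)
  show "?X \<subseteq> Pow ?\<Omega>" using UX by blast
  show "finite (Pow ?\<Omega>)"
   using finite_PiE[of ?I "\<lambda>i. comp (Q i)"] finite_subset[OF ideal_sub[OF comp_ideal] fin] by simp
 qed
 have dX: "disjoint ?X" unfolding disjoint_def
 proof (intro ballI impI, rule ccontr)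
  fix A B assume "A \<in> ?X" "B \<in> ?X" and ne: "A \<noteq> B" "A \<inter> B \<noteq> {}"
  then obtain X Y where XY: "A = Pi\<^sub>E ?I X" "B = Pi\<^sub>E ?I Y" "\<forall>i\<in>?I. X i \<in> cls ` comp (Q i)" "\<forall>i\<in>?I. Y i \<in> cls ` comp (Q i)" by blast
  obtain x where x: "x \<in> Pi\<^sub>E ?I X" "x \<in> Pi\<^sub>E ?I Y" using ne XY by blast
  have "X i = Y i" if i: "i \<in> ?I" for i
   using eqX[OF i _ PiE_mem[OF x(1) i]] eqX[OF i _ PiE_mem[OF x(2) i]] XY(3,4) i by metis
  then have "Pi\<^sub>E ?I X = Pi\<^sub>E ?I Y" by (rule PiE_cong)
  then show False using ne XY by simp
 qed
 have eX: "{} \<notin> ?X"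
 proof
  assume "{} \<in> ?X"
  then obtain X where X: "Pi\<^sub>E ?I X = {}" "\<forall>i\<in>?I. X i \<in> cls ` comp (Q i)" by blast
  then obtain i where i: "i \<in> ?I" "X i = {}" unfolding PiE_eq_empty_iff by blast
  then obtain x where "x \<in> comp (Q i)" "cls x = {}" using X(2) by blast
  then show False using cls_self[OF comp_in] by blast
 qed
 have span: "a \<in> int_span (simple_quantity ` ?X) \<longleftrightarrow>
   (\<forall>x. x \<notin> ?\<Omega> \<longrightarrow> a x = 0) \<and> (\<forall>X\<in>?X. \<forall>x\<in>X. \<forall>y\<in>X. a x = a y)" for a :: "(nat \<Rightarrow> 'a) \<Rightarrow> int"
  using int_span_iff[OF fX dX eX, of a] unfolding UX .
 have map: "group_ring_map (product_group ?I (\<lambda>i. add_monoid (corner (Q i)))) ?\<phi> a =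
   (\<lambda>y. if y \<in> carrier R then a (?\<psi> y) else 0)" for a
 proof
  fix y
  have "{x \<in> ?\<Omega>. ?\<phi> x = y} = (if y \<in> carrier R then {?\<psi> y} else {})"
  proof (cases "y \<in> carrier R")
   case True
   have "x \<in> ?\<Omega> \<and> ?\<phi> x = y \<longleftrightarrow> x = ?\<psi> y" for x using \<psi>[OF True] \<psi>\<phi>[of x] \<phi>\<psi>[OF True] by metis
   then show ?thesis using True by simp
  qed (use \<phi>(1) in auto)
  then show "group_ring_map (product_group ?I (\<lambda>i. add_monoid (corner (Q i)))) ?\<phi> a y =
    (if y \<in> carrier R then a (?\<psi> y) else 0)" by (simp add: group_ring_map_def)
 qed
 show ?thesis unfolding T
 proof (intro equalityI subsetI)
  fix b assume b: "b \<in> class_fun"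
  \<comment> \<open>The preimage of b; elements of the span are 0 outside the product of the
    carriers.\<close>
  let ?a = "\<lambda>x. if x \<in> ?\<Omega> then b (?\<phi> x) else 0"
  have const: "?a x = ?a y" if X: "X \<in> ?X" "x \<in> X" "y \<in> X" for X x y
  proof -
   obtain Y where Y: "X = Pi\<^sub>E ?I Y" "\<forall>i\<in>?I. Y i \<in> cls ` comp (Q i)" using X(1) by blast
   have xy: "x \<in> ?\<Omega>" "y \<in> ?\<Omega>" using X UX by blast+
   have "y i \<in> cls (x i)" if i: "i \<in> ?I" for i by (metis X(2,3) Y(1) PiE_mem i eqX[OF i] Y(2))
   then have "?\<phi> y \<in> cls (?\<phi> x)" using split[OF \<phi>(1)[OF xy(1)] \<phi>(1)[OF xy(2)]] \<phi>(2)[OF xy(1)] \<phi>(2)[OF xy(2)] by simp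
   then have "b (?\<phi> y) = b (?\<phi> x)" using b \<phi>(1)[OF xy(1)] by (auto simp: class_fun_def)
   then show ?thesis using xy by simp
  qed
  have "\<forall>X\<in>?X. \<forall>x\<in>X. \<forall>y\<in>X. ?a x = ?a y"
  proof (intro ballI)
   fix X x y assume "X \<in> ?X" "x \<in> X" "y \<in> X"
   then show "?a x = ?a y" by (rule const)
  qed
  moreover have "\<forall>x. x \<notin> ?\<Omega> \<longrightarrow> ?a x = 0" by simp
  ultimately have "?a \<in> int_span (simple_quantity ` ?X)" by (intro iffD2[OF span] conjI)
  moreover have "b = group_ring_map (product_group ?I (\<lambda>i. add_monoid (corner (Q i)))) ?\<phi> ?a"
  proof
   fix y
   show "b y = group_ring_map (product_group ?I (\<lambda>i. add_monoid (corner (Q i)))) ?\<phi> ?a y"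
    unfolding map using b \<phi>\<psi>[of y] \<psi>[of y] by (auto simp: class_fun_def)
  qed
  ultimately show "b \<in> group_ring_map (product_group ?I (\<lambda>i. add_monoid (corner (Q i)))) ?\<phi> ` int_span (simple_quantity ` ?X)"
   by blast
 next
  fix b assume "b \<in> group_ring_map (product_group ?I (\<lambda>i. add_monoid (corner (Q i)))) ?\<phi> ` int_span (simple_quantity ` ?X)"
  then obtain a where a: "a \<in> int_span (simple_quantity ` ?X)" "b = (\<lambda>y. if y \<in> carrier R then a (?\<psi> y) else 0)"
   unfolding map by blast
  have c: "a (?\<psi> y) = a (?\<psi> x)" if x: "x \<in> carrier R" and y: "y \<in> cls x" for x y
  proof -
   let ?Y = "\<lambda>i. cls (\<pi> (Q i) x)"
   have "Pi\<^sub>E ?I ?Y \<in> ?X" using comp_proj[OF x] by blast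
   moreover have "?\<psi> x \<in> Pi\<^sub>E ?I ?Y" using cls_self x by simp
   moreover have "?\<psi> y \<in> Pi\<^sub>E ?I ?Y" using split[OF x cls_in[OF x y]] y by simp
   ultimately show ?thesis using a(1) unfolding span by blast
  qed
  have "b y = b x" if "x \<in> carrier R" "y \<in> cls x" for x y
   unfolding a(2) using c[OF that] cls_in[OF that] that(1) by (simp only: if_True)
  moreover have "b x = 0" if "x \<notin> carrier R" for x unfolding a(2) using that by (simp only: if_False)
  ultimately show "b \<in> class_fun" unfolding class_fun_def by blast
 qed
qed

theorem decomposition: "\<exists>(k::nat) (Q :: nat \<Rightarrow> nat set) (\<B> :: nat \<Rightarrow> ('a \<Rightarrow> int) set).
  disjoint_family_on Q {0..k} \<and>
  (\<Union>i\<in>{0..k}. Q i) = ring_primes R \<and>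
  (\<forall>i\<in>{1..k}. Q i \<noteq> {}) \<and>
  pure_S_ring (Q_component R (Q 0)) (\<B> 0) \<and>
  cyclotomic_S_ring (Q_component R (Q 0)) (\<B> 0) \<and>
  (\<forall>i\<in>{1..k}.
    \<not> field (Q_component R (Q i)) \<and>
    S_ring_over_ring (Q_component R (Q i)) (\<B> i) \<and>
    S_ring_rank (add_monoid (Q_component R (Q i))) (\<B> i) = 2) \<and>
  class_fun = group_ring_map
     (product_group {0..k} (\<lambda>i. add_monoid (Q_component R (Q i))))
     (\<lambda>x. finsum R x {0..k}) `
    tensor_S_ring {0..k} (\<lambda>i. add_monoid (Q_component R (Q i))) \<B>"
proof -
 define k where "k = card {S. block S}"
 obtain e where e: "bij_betw e {1..k} {S. block S}" unfolding k_def using ex_bij_betw_nat_finite_1[OF block_finite] by blast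
 \<comment> \<open>Index 0 is kept for the cyclotomic factor and the blocks are numbered from 1, so
   that there may be no block at all.\<close>
 define Q where "Q i = (if i = 0 then Q0 else e i)" for i :: nat
 define \<B> where "\<B> i = cg_sring.class_fun (corner (Q i)) cls" for i
 have eb: "block (e i)" if "i \<in> {1..k}" for i using bij_betwE[OF e] that by blast
 have Qi: "Q i = e i" if "i \<in> {1..k}" for i using that by (simp add: Q_def)
 have Q_0: "Q 0 = Q0" by (simp add: Q_def)
 have cases: "i = 0 \<or> i \<in> {1..k}" if "i \<in> {0..k}" for i using that by auto
 have blocks: "{S. block S} = e ` {1..k}" using e by (simp add: bij_betw_def)
 have dis: "disjoint_family_on Q {0..k}" unfolding disjoint_family_on_def
 proof (intro ballI impI)
  fix i j assume ij: "i \<in> {0..k}" "j \<in> {0..k}" "i \<noteq> j"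
  have z: "Q 0 \<inter> Q l = {}" if l: "l \<in> {1..k}" for l using eb[OF l] Qi[OF l] Q_0 Q0_def by auto
  have "e i \<noteq> e j" if "i \<in> {1..k}" "j \<in> {1..k}"
   using inj_onD[OF bij_betw_imp_inj_on[OF e] _ that] ij(3) by blast
  then have ne: "Q i \<inter> Q j = {}" if "i \<in> {1..k}" "j \<in> {1..k}"
   using block_disjoint[OF eb eb] that Qi by simp
  show "Q i \<inter> Q j = {}"
  proof (cases "i = 0")
   case True
   then show ?thesis using z[of j] cases[OF ij(2)] ij(3) by auto
  next
   case i: False
   show ?thesis
   proof (cases "j = 0")
    case True
    then show ?thesis using z[of i] cases[OF ij(1)] i by (simp add: Int_commute)
   qed (use ne cases[OF ij(1)] cases[OF ij(2)] i in blast)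
  qed
 qed
 have I: "{0..k} = insert 0 {1..k}" by auto
 have U: "(\<Union>i\<in>{0..k}. Q i) = P"
 proof -
  have "(\<Union>i\<in>{1..k}. Q i) = \<Union>{S. block S}" unfolding blocks using Qi by auto
  then have "(\<Union>i\<in>{0..k}. Q i) = Q0 \<union> \<Union>{S. block S}" unfolding I using Q_0 by simp
  also have "\<dots> = P" by (auto simp: Q0_def block_def)
  finally show ?thesis .
 qed
 have comp: "Q_component R (Q i) = corner (Q i)" if "i \<in> {0..k}" for i
  by (rule Q_component_corner) (use U that in blast)
 have as: "aset (comp (Q i))" if "i \<in> {0..k}" for i
  using cases[OF that] Q0_aset Q_0 Qi block_comp_aideal[OF eb] aideal_aset by metis
 have split: "y \<in> cls x \<longleftrightarrow> (\<forall>i\<in>{0..k}. \<pi> (Q i) y \<in> cls (\<pi> (Q i) x))"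
  if x: "x \<in> carrier R" and y: "y \<in> carrier R" for x y
 proof -
  have "(\<forall>i\<in>{0..k}. \<pi> (Q i) y \<in> cls (\<pi> (Q i) x)) \<longleftrightarrow>
    (\<forall>S\<in>e ` {1..k}. \<pi> S y \<in> cls (\<pi> S x)) \<and> \<pi> Q0 y \<in> cls (\<pi> Q0 x)"
   unfolding I using Qi Q_0 by auto
  also have "(\<forall>S\<in>e ` {1..k}. \<pi> S y \<in> cls (\<pi> S x)) \<longleftrightarrow>
    (\<forall>S. block S \<longrightarrow> (\<pi> S y = \<zero> \<longleftrightarrow> \<pi> S x = \<zero>))"
   unfolding blocks[symmetric] using block_component[OF _ x y] by blast
  finally show ?thesis using split_all[OF x y] by (rule trans[OF _ sym, rotated])
 qed
 interpret M: mul_sring "corner Q0" cls by (rule Q0_mul_sring)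
 have "product_group {0..k} (\<lambda>i. add_monoid (Q_component R (Q i))) = product_group {0..k} (\<lambda>i. add_monoid (corner (Q i)))"
  by (rule product_group_cong) (simp add: comp)
 moreover have "tensor_S_ring {0..k} (\<lambda>i. add_monoid (Q_component R (Q i))) \<B> =
   tensor_S_ring {0..k} (\<lambda>i. add_monoid (corner (Q i))) \<B>"
  unfolding tensor_S_ring_def using comp by (simp cong: conj_cong)
 ultimately have "class_fun = group_ring_map (product_group {0..k} (\<lambda>i. add_monoid (Q_component R (Q i))))
   (\<lambda>x. finsum R x {0..k}) ` tensor_S_ring {0..k} (\<lambda>i. add_monoid (Q_component R (Q i))) \<B>"
  using tensor_decomposition[OF dis U as split] unfolding \<B>_def by simp
 moreover have "pure_S_ring (Q_component R (Q 0)) (\<B> 0)" "cyclotomic_S_ring (Q_component R (Q 0)) (\<B> 0)"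
  using M.class_fun_pure M.class_fun_cyclotomic comp[of 0] by (simp_all add: \<B>_def Q_0)
 moreover have "\<not> field (Q_component R (Q i)) \<and> S_ring_over_ring (Q_component R (Q i)) (\<B> i) \<and>
   S_ring_rank (add_monoid (Q_component R (Q i))) (\<B> i) = 2 \<and> Q i \<noteq> {}" if i: "i \<in> {1..k}" for i
 proof -
  have i0: "i \<in> {0..k}" using i by simp
  show ?thesis using block_not_field[OF eb[OF i]] block_rank[OF eb[OF i]] eb[OF i]
    cg_sring.class_fun_S_ring[OF corner_cg_sring[OF as[OF i0]]] comp[OF i0] Qi[OF i]
   by (simp add: \<B>_def block_def)
 qed
 ultimately show ?thesis using dis U by (intro exI[of _ k] exI[of _ Q] exI[of _ \<B>]) simp
qed

end

theorem theorem1p3: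
 fixes R :: "('a, 'm) ring_scheme" and \<A> :: "('a \<Rightarrow> int) set"
 assumes "CG_ring R"
  and "odd (ring_characteristic R)"
  and "pure_S_ring R \<A>"
 shows "\<exists>(k::nat) (Q :: nat \<Rightarrow> nat set) (\<B> :: nat \<Rightarrow> ('a \<Rightarrow> int) set).
  disjoint_family_on Q {0..k} \<and>
  (\<Union>i\<in>{0..k}. Q i) = ring_primes R \<and>
  (\<forall>i\<in>{1..k}. Q i \<noteq> {}) \<and>
  pure_S_ring (Q_component R (Q 0)) (\<B> 0) \<and>
  cyclotomic_S_ring (Q_component R (Q 0)) (\<B> 0) \<and>
  (\<forall>i\<in>{1..k}.
    \<not> field (Q_component R (Q i)) \<and>
    S_ring_over_ring (Q_component R (Q i)) (\<B> i) \<and>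
    S_ring_rank (add_monoid (Q_component R (Q i))) (\<B> i) = 2) \<and>
  \<A> = group_ring_map
     (product_group {0..k} (\<lambda>i. add_monoid (Q_component R (Q i))))
     (\<lambda>x. finsum R x {0..k}) `
    tensor_S_ring {0..k} (\<lambda>i. add_monoid (Q_component R (Q i))) \<B>"
proof -
 define cls where "cls = basic_set_of (basic_sets (add_monoid R) \<A>)"
 have S: "S_ring_over_ring R \<A>" using assms(3) by (simp add: pure_S_ring_def)
 note cg = CG_ring_cg_ring[OF assms(1,2)]
 interpret C: cg_sring R cls unfolding cls_def by (rule S_ring_cg_sring(1)[OF cg S])
 have A: "\<A> = C.class_fun" unfolding cls_def by (rule S_ring_cg_sring(2)[OF cg S])
 have "pure_sring R cls" by (rule C.pure_sringI[OF A assms(3)])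
 from pure_sring.decomposition[OF this] show ?thesis unfolding A .
qed

end
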